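(* Let $\mathbf E$, $b$, $\chi$ satisfy the assumptions listed in the context, and let $\alpha,\beta,\eta,\gamma$ be the constants given there. Consider a time step $\Delta t>0$, a final time $T>0$, $N_T=[T/\Delta t]$ (integer part), $t^n=n\Delta t$, $t^{n+1/2}=t^n+\Delta t/2$, and for each $\varepsilon>0$ the sequence $(\mathbf x^n_\varepsilon,\mathbf v^n_\varepsilon,e^n_{\perp,\varepsilon})_{0\le n\le N_T}$ given by the four-stage semi-implicit scheme (S) written in the context, where the initial data $(\mathbf x^0_\varepsilon,\mathbf v^0_\varepsilon,e^0_{\perp,\varepsilon})$ is uniformly bounded with respect to $\varepsilon>0$. Then: 1. For all $0\le n\le N_T$, $(\mathbf x^n_\varepsilon,\mathbf v^n_\varepsilon,e^n_{\perp,\varepsilon})_{\varepsilon>0}$ is uniformly bounded with respect to $\varepsilon>0$ and $\Delta t>0$. 2. For a fixed $\Delta t>0$, the sequence $(\mathbf x^n_\varepsilon,e^n_{\perp,\varepsilon},v^n_{\parallel,\varepsilon})_{1\le n\le N_T}$ is a second order consistent approximation with respect to $\varepsilon$ to the drift-kinetic equation provided by the following scheme (L). Write $g(t,\mathbf x)=\mathrm{div}_{\mathbf x_\perp}\mathbf F_\perp^\perp(t,\mathbf x)$. Set $v_\parallel^{(2)}=v_\parallel^n$ and $$\frac{\hat{\mathbf x}^{(2)}-\mathbf x^n}{\Delta t}=\mathbf U^{\rm gc}(t^n,\mathbf x^n,e_\perp^n,v_\parallel^{(2)}),\qquad \frac{\hat e_\perp^{(2)}-e_\perp^n}{\Delta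 t}=\varepsilon\,e_\perp^n\,g(t^n,\mathbf x^n).$$ The next stage is $$\frac{v_\parallel^{(3)}-v_\parallel^n}{\Delta t}=(1-\alpha)E_\parallel(t^n,\mathbf x^n)+\alpha E_\parallel(t^{n+1},\hat{\mathbf x}^{(2)}),$$ $$\frac{\hat{\mathbf x}^{(3)}-\mathbf x^n}{\Delta t}=\frac14\left[\mathbf U^{\rm gc}(t^n,\mathbf x^n,e_\perp^n,v_\parallel^{(2)})+\mathbf U^{\rm gc}(t^{n+1},\hat{\mathbf x}^{(2)},\hat e_\perp^{(2)},v_\parallel^{(3)})\right],$$ $$\frac{\hat e_\perp^{(3)}-e_\perp^n}{\Delta t}=\frac{\varepsilon}{4}\left[e_\perp^n\,g(t^n,\mathbf x^n)+\hat e_\perp^{(2)}\,g(t^{n+1},\hat{\mathbf x}^{(2)})\right].$$ The fourth stage is $$\frac{v_\parallel^{(4)}-v_\parallel^n}{\Delta t}=(\beta+\eta)E_\parallel(t^n,\mathbf x^n)+\gamma E_\parallel(t^{n+1},\hat{\mathbf x}^{(2)})+\alpha E_\parallel(t^{n+1/2},\hat{\mathbf x}^{(3)}),$$ and finally $$\begin{aligned} \frac{\mathbf x^{n+1}-\mathbf x^n}{\Delta t}&=\frac16\left[\mathbf U^{\rm gc}(t^n,\mathbf x^n,e_\perp^n,v_\parallel^{(2)})+\mathbf U^{\rm gc}(t^{n+1},\hat{\mathbf x}^{(2)},\hat e_\perp^{(2)},v_\parallel^{(3)})+4\,\mathbf U^{\rm gc}(t^{n+1/2},\hat{\mathbf x}^{(3)},\hat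 e_\perp^{(3)},v_\parallel^{(4)})\right],\\ \frac{e_\perp^{n+1}-e_\perp^n}{\Delta t}&=\frac{\varepsilon}{6}\left[e_\perp^n\,g(t^n,\mathbf x^n)+\hat e_\perp^{(2)}\,g(t^{n+1},\hat{\mathbf x}^{(2)})+4\,\hat e_\perp^{(3)}\,g(t^{n+1/2},\hat{\mathbf x}^{(3)})\right],\\ \frac{v_\parallel^{n+1}-v_\parallel^n}{\Delta t}&=\frac16\left[E_\parallel(t^n,\mathbf x^n)+E_\parallel(t^{n+1},\hat{\mathbf x}^{(2)})+4\,E_\parallel(t^{n+1/2},\hat{\mathbf x}^{(3)})\right]. \end{aligned}$$ 3. The scheme (L) is a third order approximation in $\Delta t$ of the characteristic curves of the drift-kinetic equation, $$\frac{d\mathbf x}{dt}=\mathbf U^{\rm gc}(t,\mathbf x,e_\perp,v_\parallel),\qquad \frac{de_\perp}{dt}=\varepsilon\,\mathrm{div}_{\mathbf x_\perp}\mathbf F_\perp^\perp(t,\mathbf x)\,e_\perp,\qquad \frac{dv_\parallel}{dt}=E_\parallel(t,\mathbf x).$$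
   Context: Notation. For $\mathbf w=(w_x,w_y,w_z)\in\mathbb R^3$: $w_\parallel=w_z$, $\mathbf w_\perp=(w_x,w_y,0)$, $\mathbf w_\perp^\perp=(-w_y,w_x,0)$, and $\mathbf w^\perp$ also denotes $(-w_y,w_x,0)$; $\mathbf e_z=(0,0,1)$; $\langle\cdot,\cdot\rangle$ is the Euclidean scalar product; $\nabla_{\mathbf x_\perp}=(\partial_x,\partial_y,0)$ and $\mathrm{div}_{\mathbf x_\perp}$ is the divergence in $(x,y)$. Constants. $\alpha=0.24169426078821$, $\beta=\alpha/4$, $\eta=0.12915286960590$, $\gamma=1/2-\alpha-\beta-\eta$. Assumptions. The given electric field satisfies $\mathbf E=-\nabla_{\mathbf x}\phi\in W^{1,\infty}((0,T)\times\mathbb R^3)$. The given magnetic intensity $b=b(t,\mathbf x_\perp)$ satisfies $b(t,\mathbf x_\perp)>b_0>0$ and $b\in W^{2,\infty}((0,T)\times\mathbb R^3)$ (the external magnetic field is $\varepsilon^{-1}b\,\mathbf e_z$). The function $\chi\in W^{1,\infty}_{loc}(\mathbb R^4)$ is such that, for any $e_\perp\in\mathbb R$ and $\mathbf v_\perp=(v_x,v_y,0)\in\mathbb R^3$: $\chi(\|\mathbf v_\perp\|^2/2,\mathbf v_\perp)=0$; $\chi(e_\perp,0)=e_\perp$; $0\le\chi(e_\perp,\mathbf v_\perp)\le e_\perp$. (The concrete choice made in the paper is $\chi(e_\perp,\mathbf v_\perp)=\frac{e_\perp}{e_\perp+\|\mathbf v_\perp\|^2/2}\left(e_\perp-\|\mathbf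 v_\perp\|^2/2\right)^+$, with $s^+=\max(0,s)$.) Definitions. $\mathbf H(t,\mathbf x,\mathbf v_\perp,e_\perp)=\mathbf E(t,\mathbf x)-\chi(e_\perp,\mathbf v_\perp)\nabla_{\mathbf x_\perp}\ln b(t,\mathbf x_\perp)$; $\mathbf F(t,\mathbf x)=\mathbf E(t,\mathbf x)/b(t,\mathbf x_\perp)$ (not to be confused with the stage forces $\mathbf F^{(i)}$ below); $$\mathbf U^{\rm gc}(t,\mathbf x,e_\perp,v_\parallel)=v_\parallel\mathbf e_z-\varepsilon\left(\mathbf F_\perp(t,\mathbf x)-\frac{e_\perp}{b^2(t,\mathbf x_\perp)}\nabla_{\mathbf x_\perp}b(t,\mathbf x_\perp)\right)^\perp .$$ The drift-kinetic equation, for an unknown density $f(t,\mathbf x,e_\perp,v_\parallel)$, is $$\partial_t f+\mathbf U^{\rm gc}\cdot\nabla_{\mathbf x}f+\varepsilon\,\mathrm{div}_{\mathbf x_\perp}\mathbf F_\perp^\perp(t,\mathbf x)\,e_\perp\,\partial_{e_\perp}f+E_\parallel\,\partial_{v_\parallel}f=0.$$ Scheme (S) (index $\varepsilon$ dropped). $$\frac{\mathbf v^{(1)}-\mathbf v^n}{\Delta t}=\alpha\mathbf F^{(1)},\qquad \mathbf F^{(1)}:=\mathbf H(t^n,\mathbf x^n,\mathbf v_\perp^n,e_\perp^n)-b(t^n,\mathbf x_\perp^n)\frac{(\mathbf v^{(1)})^\perp}{\varepsilon};$$ $$\frac{\mathbf v^{(2)}-\mathbf v^n}{\Delta t}=-\alpha\mathbf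 F^{(1)}+\alpha\mathbf F^{(2)},\qquad \mathbf F^{(2)}:=\mathbf H(t^n,\mathbf x^n,\mathbf v_\perp^n,e_\perp^n)-b(t^n,\mathbf x_\perp^n)\frac{(\mathbf v^{(2)})^\perp}{\varepsilon};$$ $$\frac{\hat{\mathbf x}^{(2)}-\mathbf x^n}{\Delta t}=\mathbf v^{(2)},\quad \frac{\hat e_\perp^{(2)}-e_\perp^n}{\Delta t}=\langle\mathbf E_\perp(t^n,\mathbf x^n),\mathbf v_\perp^{(2)}\rangle,\quad \frac{\hat{\mathbf v}^{(2)}-\mathbf v^n}{\Delta t}=\mathbf F^{(2)};$$ $$\frac{\mathbf v^{(3)}-\mathbf v^n}{\Delta t}=(1-\alpha)\mathbf F^{(2)}+\alpha\mathbf F^{(3)},\qquad \mathbf F^{(3)}:=\mathbf H(t^{n+1},\hat{\mathbf x}^{(2)},\hat{\mathbf v}_\perp^{(2)},\hat e_\perp^{(2)})-b(t^{n+1},\hat{\mathbf x}_\perp^{(2)})\frac{(\mathbf v^{(3)})^\perp}{\varepsilon};$$ $$\frac{\hat{\mathbf x}^{(3)}-\mathbf x^n}{\Delta t}=\tfrac14(\mathbf v^{(2)}+\mathbf v^{(3)}),\quad \frac{\hat e_\perp^{(3)}-e_\perp^n}{\Delta t}=\tfrac14\left(\langle\mathbf E_\perp(t^n,\mathbf x^n),\mathbf v_\perp^{(2)}\rangle+\langle\mathbf E_\perp(t^{n+1},\hat{\mathbf x}^{(2)}),\mathbf v_\perp^{(3)}\rangle\right),\quad \frac{\hat{\mathbf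 v}^{(3)}-\mathbf v^n}{\Delta t}=\tfrac14(\mathbf F^{(2)}+\mathbf F^{(3)});$$ $$\frac{\mathbf v^{(4)}-\mathbf v^n}{\Delta t}=\beta\mathbf F^{(1)}+\eta\mathbf F^{(2)}+\gamma\mathbf F^{(3)}+\alpha\mathbf F^{(4)},\qquad \mathbf F^{(4)}:=\mathbf H(t^{n+1/2},\hat{\mathbf x}^{(3)},\hat{\mathbf v}_\perp^{(3)},\hat e_\perp^{(3)})-b(t^{n+1/2},\hat{\mathbf x}_\perp^{(3)})\frac{(\mathbf v^{(4)})^\perp}{\varepsilon};$$ $$\frac{\mathbf x^{n+1}-\mathbf x^n}{\Delta t}=\tfrac16(\mathbf v^{(2)}+\mathbf v^{(3)}+4\mathbf v^{(4)}),\qquad \frac{\mathbf v^{n+1}-\mathbf v^n}{\Delta t}=\tfrac16(\mathbf F^{(2)}+\mathbf F^{(3)}+4\mathbf F^{(4)}),$$ $$\frac{e_\perp^{n+1}-e_\perp^n}{\Delta t}=\tfrac16\left(\langle\mathbf E_\perp(t^n,\mathbf x^n),\mathbf v_\perp^{(2)}\rangle+\langle\mathbf E_\perp(t^{n+1},\hat{\mathbf x}^{(2)}),\mathbf v_\perp^{(3)}\rangle+4\langle\mathbf E_\perp(t^{n+1/2},\hat{\mathbf x}^{(3)}),\mathbf v_\perp^{(4)}\rangle\right).$$ "Second order consistent with respect to $\varepsilon$" means that, from $n\ge1$ on, the values produced by (S) satisfy the equations of (L) up to additive residuals of norm at most $C(\Delta t)\,\varepsilon^2$, with $C(\Delta t)$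 independent of $\varepsilon$.
   Formalization: α, η are the exact values, not the 14-digit roundings; the conditions on χ are taken for e_⊥≥0, with |χ|≤|e_⊥| for e_⊥<0; part 2 assumes initial energies ≥0 or χ(e_⊥,0)=e_⊥ for all real e_⊥; part 3 assumes E is C³ and b is C⁴ on [0,T]×R³. *)

theory Defs
  imports "HOL-Analysis.Analysis"
begin

type_synonym vec3 = "real^3"
type_synonym spacetime = "real \<times> vec3"

section \<open>Regularity classes\<close>

text \<open>Functions of class \<open>C\<^sup>k\<close> on a set \<open>S\<close>, up to its boundary. It is used on the whole space and on
  closed convex sets with nonempty interior, where the derivative within \<open>S\<close> is unique.\<close>

primrec C_k_on :: "nat \<Rightarrow> 'a::euclidean_space set \<Rightarrow> ('a \<Rightarrow> 'b::real_normed_vector) \<Rightarrow> bool" where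
  "C_k_on 0 S f = continuous_on S f"
| "C_k_on (Suc k) S f =
     (\<exists>D. (\<forall>x\<in>S. (f has_derivative D x) (at x within S)) \<and> (\<forall>v. C_k_on k S (\<lambda>x. D x v)))"

definition test_function :: "'a::euclidean_space set \<Rightarrow> ('a \<Rightarrow> real) \<Rightarrow> bool" where
  "test_function \<Omega> \<psi> \<longleftrightarrow> (\<forall>k. C_k_on k UNIV \<psi>) \<and>
     compact (closure {x. \<psi> x \<noteq> 0}) \<and> closure {x. \<psi> x \<noteq> 0} \<subseteq> \<Omega>"

definition locally_integrable :: "'a::euclidean_space set \<Rightarrow> ('a \<Rightarrow> real) \<Rightarrow> bool" where
  "locally_integrable \<Omega> f \<longleftrightarrow> (\<forall>K. compact K \<and> K \<subseteq> \<Omega> \<longrightarrow> integrable (lebesgue_on K) f)"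

definition weak_partial ::
  "'a::euclidean_space set \<Rightarrow> 'a \<Rightarrow> ('a \<Rightarrow> real) \<Rightarrow> ('a \<Rightarrow> real) \<Rightarrow> bool" where
  "weak_partial \<Omega> i f g \<longleftrightarrow> locally_integrable \<Omega> f \<and> locally_integrable \<Omega> g \<and>
     (\<forall>\<psi>. test_function \<Omega> \<psi> \<longrightarrow>
        (LINT x|lebesgue_on \<Omega>. f x * frechet_derivative \<psi> (at x) i)
          = - (LINT x|lebesgue_on \<Omega>. g x * \<psi> x))"

definition L_inf :: "'a::euclidean_space set \<Rightarrow> ('a \<Rightarrow> real) \<Rightarrow> bool" where
  "L_inf \<Omega> f \<longleftrightarrow> f \<in> borel_measurable (lebesgue_on \<Omega>) \<and> (\<exists>M. AE x in lebesgue_on \<Omega>. \<bar>f x\<bar> \<le> M)"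

text \<open>The Sobolev spaces \<open>W\<^sup>k\<^sup>,\<^sup>\<infinity>(\<Omega>)\<close>, for open \<open>\<Omega>\<close>, and their local versions.\<close>

primrec W_inf :: "nat \<Rightarrow> 'a::euclidean_space set \<Rightarrow> ('a \<Rightarrow> real) \<Rightarrow> bool" where
  "W_inf 0 \<Omega> f = L_inf \<Omega> f"
| "W_inf (Suc k) \<Omega> f = (L_inf \<Omega> f \<and> (\<forall>i\<in>Basis. \<exists>g. weak_partial \<Omega> i f g \<and> W_inf k \<Omega> g))"

definition W_inf_loc :: "nat \<Rightarrow> 'a::euclidean_space set \<Rightarrow> ('a \<Rightarrow> real) \<Rightarrow> bool" where
  "W_inf_loc k U f \<longleftrightarrow>
     (\<forall>\<Omega>. open \<Omega> \<and> compact (closure \<Omega>) \<and> closure \<Omega> \<subseteq> U \<longrightarrow> W_inf k \<Omega> f)"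

definition open_slab :: "real \<Rightarrow> spacetime set" where
  "open_slab T = {0<..<T} \<times> UNIV"

definition closed_slab :: "real \<Rightarrow> spacetime set" where
  "closed_slab T = {0..T} \<times> UNIV"

section \<open>Vectors and differential operators\<close>

definition perp :: "vec3 \<Rightarrow> vec3" where
  "perp w = vector [w $ 1, w $ 2, 0]"

definition rot :: "vec3 \<Rightarrow> vec3" where
  "rot w = vector [- (w $ 2), w $ 1, 0]"

definition e_z :: vec3 where
  "e_z = vector [0, 0, 1]"

definition grad_perp :: "(spacetime \<Rightarrow> real) \<Rightarrow> spacetime \<Rightarrow> vec3" where
  "grad_perp f p = vector
     [deriv (\<lambda>s. f (fst p, snd p + s *\<^sub>R axis 1 1)) 0,
      deriv (\<lambda>s. f (fst p, snd p + s *\<^sub>R axis 2 1)) 0, 0]"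

definition weak_div_perp ::
  "spacetime set \<Rightarrow> (spacetime \<Rightarrow> vec3) \<Rightarrow> (spacetime \<Rightarrow> real) \<Rightarrow> bool" where
  "weak_div_perp \<Omega> G h \<longleftrightarrow> (\<forall>i. locally_integrable \<Omega> (\<lambda>p. G p $ i)) \<and> locally_integrable \<Omega> h \<and>
     (\<forall>\<psi>. test_function \<Omega> \<psi> \<longrightarrow>
        (LINT p|lebesgue_on \<Omega>. G p \<bullet> grad_perp \<psi> p) = - (LINT p|lebesgue_on \<Omega>. h p * \<psi> p))"

text \<open>The field \<open>F\<^sub>\<perp>\<^sup>\<perp>\<close> is only Lipschitz, so that its divergence is a priori a distribution. It has
  a (unique) continuous representative because \<open>E\<close> is a gradient, and the numerical scheme
  evaluates that representative pointwise.\<close>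

definition div_perp :: "real \<Rightarrow> (spacetime \<Rightarrow> vec3) \<Rightarrow> spacetime \<Rightarrow> real" where
  "div_perp T G = (SOME h. continuous_on (closed_slab T) h \<and> weak_div_perp (open_slab T) G h)"

section \<open>Assumptions on the data\<close>

text \<open>Elements of Sobolev spaces are evaluated pointwise through their continuous representatives,
  extended continuously to the times \<open>0\<close> and \<open>T\<close>.\<close>

definition electric_field :: "real \<Rightarrow> (spacetime \<Rightarrow> real) \<Rightarrow> (spacetime \<Rightarrow> vec3) \<Rightarrow> bool" where
  "electric_field T \<phi> E \<longleftrightarrow>
     (\<forall>i. W_inf 1 (open_slab T) (\<lambda>p. E p $ i)) \<and> continuous_on (closed_slab T) E \<and>
     (\<forall>i. weak_partial (open_slab T) (0, axis i 1) \<phi> (\<lambda>p. - (E p $ i)))"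

definition magnetic_intensity :: "real \<Rightarrow> real \<Rightarrow> (spacetime \<Rightarrow> real) \<Rightarrow> bool" where
  "magnetic_intensity T b0 b \<longleftrightarrow>
     W_inf 2 (open_slab T) b \<and> continuous_on (closed_slab T) b \<and>
     (\<forall>t\<in>{0..T}. \<forall>x. b (t, x) = b (t, perp x)) \<and>
     0 < b0 \<and> (\<forall>t\<in>{0..T}. \<forall>x. b0 < b (t, x))"

text \<open>The conditions \<open>0 \<le> \<chi> \<le> e\<close> and \<open>\<chi> (e, 0) = e\<close> are consistent for \<open>e \<ge> 0\<close> only. Since the
  scheme may produce negative values of \<open>e\<close>, the bound is kept there as \<open>\<bar>\<chi>\<bar> \<le> \<bar>e\<bar>\<close>; the
  concrete choice of \<open>\<chi>\<close> below vanishes for \<open>e < 0\<close>.\<close>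

definition admissible_chi :: "(real \<times> vec3 \<Rightarrow> real) \<Rightarrow> bool" where
  "admissible_chi chi \<longleftrightarrow>
     W_inf_loc 1 UNIV chi \<and> continuous_on UNIV chi \<and>
     (\<forall>v. v $ 3 = 0 \<longrightarrow> chi ((norm v)\<^sup>2 / 2, v) = 0) \<and>
     (\<forall>e\<ge>0. chi (e, 0) = e) \<and>
     (\<forall>e\<ge>0. \<forall>v. v $ 3 = 0 \<longrightarrow> 0 \<le> chi (e, v) \<and> chi (e, v) \<le> e) \<and>
     (\<forall>e<0. \<forall>v. v $ 3 = 0 \<longrightarrow> \<bar>chi (e, v)\<bar> \<le> \<bar>e\<bar>)"

definition chi_concrete :: "real \<times> vec3 \<Rightarrow> real" where
  "chi_concrete = (\<lambda>(e, v). e / (e + (norm v)\<^sup>2 / 2) * max 0 (e - (norm v)\<^sup>2 / 2))"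

lemma chi_concrete_properties:
  "chi_concrete ((norm v)\<^sup>2 / 2, v) = 0"
  "0 \<le> e \<Longrightarrow> chi_concrete (e, 0) = e"
  "0 \<le> e \<Longrightarrow> 0 \<le> chi_concrete (e, v)"
  "0 \<le> e \<Longrightarrow> chi_concrete (e, v) \<le> e"
  "e < 0 \<Longrightarrow> chi_concrete (e, v) = 0"
proof -
  show "chi_concrete ((norm v)\<^sup>2 / 2, v) = 0"
    by (simp add: chi_concrete_def)
  show "0 \<le> e \<Longrightarrow> chi_concrete (e, 0) = e"
    by (simp add: chi_concrete_def)
  show "0 \<le> e \<Longrightarrow> 0 \<le> chi_concrete (e, v)"
    by (simp add: chi_concrete_def)
  show "chi_concrete (e, v) \<le> e" if "0 \<le> e"
  proof -
    define k where "k = (norm v)\<^sup>2 / 2"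
    have k: "0 \<le> k" by (simp add: k_def)
    have "max 0 (e - k) \<le> e + k" using that k by simp
    then have "max 0 (e - k) / (e + k) \<le> 1"
      using that k by (cases "e + k = 0") (auto simp: divide_le_eq)
    then have "e * (max 0 (e - k) / (e + k)) \<le> e * 1"
      using that by (rule mult_left_mono)
    then show ?thesis by (simp add: chi_concrete_def k_def)
  qed
  show "chi_concrete (e, v) = 0" if "e < 0"
  proof -
    have "e - (norm v)\<^sup>2 / 2 \<le> 0" using that zero_le_power2[of "norm v"] by linarith
    then show ?thesis by (simp add: chi_concrete_def max_def)
  qed
qed

section \<open>The constants of the scheme\<close>

text \<open>The decimal values \<open>0.24169426078821\<close> and \<open>0.12915286960590\<close> usually quoted for \<open>\<alpha>\<close> and \<open>\<eta>\<close>
  are roundings to 14 digits of the numbers below, which solve the third order condition and the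
  L-stability condition (stability function vanishing at infinity). With the rounded values neither
  of the two conditions holds exactly.\<close>

definition \<alpha> :: real where "\<alpha> = (9 - sqrt 57) / 6"
definition \<beta> :: real where "\<beta> = \<alpha> / 4"
definition \<eta> :: real where "\<eta> = 1 / 4 - \<alpha> / 2"
definition \<gamma> :: real where "\<gamma> = 1 / 2 - \<alpha> - \<beta> - \<eta>"

lemma scheme_constants:
  "\<bar>\<alpha> - 0.24169426078821\<bar> < 5 / 10 ^ 15"
  "\<bar>\<eta> - 0.12915286960590\<bar> \<le> 5 / 10 ^ 15"
  and third_order_condition: "\<alpha> / 6 + 4 / 6 * (\<gamma> + \<alpha> / 2) = 1 / 6"
  and L_stability_condition:
    "1 + (- 2 / \<alpha> + (2 - 3 * \<alpha>) / \<alpha>\<^sup>2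
        - 4 / \<alpha> * (1 - \<beta> / \<alpha> - 2 * \<eta> / \<alpha> + \<gamma> * (2 - 3 * \<alpha>) / \<alpha>\<^sup>2)) / 6 = 0"
proof -
  have l: "7.549834435270749 < sqrt 57" by (rule real_less_rsqrt) (simp add: power2_eq_square)
  have u: "sqrt 57 < 7.549834435270751" by (rule real_less_lsqrt) (simp_all add: power2_eq_square)
  show "\<bar>\<alpha> - 0.24169426078821\<bar> < 5 / 10 ^ 15"
    using l u by (simp add: \<alpha>_def abs_less_iff field_simps)
  show "\<bar>\<eta> - 0.12915286960590\<bar> \<le> 5 / 10 ^ 15"
    using l u by (simp add: \<alpha>_def \<eta>_def abs_le_iff field_simps)
  have g: "\<gamma> = (1 - 3 * \<alpha>) / 4"
    by (simp add: \<gamma>_def \<eta>_def \<beta>_def)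
  show "\<alpha> / 6 + 4 / 6 * (\<gamma> + \<alpha> / 2) = 1 / 6"
    by (simp add: g field_simps)
  have q: "3 * \<alpha>\<^sup>2 = 9 * \<alpha> - 2"
    by (simp add: \<alpha>_def power2_eq_square field_simps)
  have a: "\<alpha> \<noteq> 0" using u by (simp add: \<alpha>_def)
  have "1 + (- 2 / \<alpha> + (2 - 3 * \<alpha>) / \<alpha>\<^sup>2
        - 4 / \<alpha> * (1 - \<beta> / \<alpha> - 2 * \<eta> / \<alpha> + \<gamma> * (2 - 3 * \<alpha>) / \<alpha>\<^sup>2)) / 6
      = (2 * \<alpha> - 1) * (3 * \<alpha>\<^sup>2 - 9 * \<alpha> + 2) / (6 * \<alpha> ^ 3)"
    using a by (simp add: g \<beta>_def \<eta>_def field_simps power2_eq_square power3_eq_cube)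
  also have "\<dots> = 0" using q by simp
  finally show "1 + (- 2 / \<alpha> + (2 - 3 * \<alpha>) / \<alpha>\<^sup>2
        - 4 / \<alpha> * (1 - \<beta> / \<alpha> - 2 * \<eta> / \<alpha> + \<gamma> * (2 - 3 * \<alpha>) / \<alpha>\<^sup>2)) / 6 = 0" .
qed

definition N_steps :: "real \<Rightarrow> real \<Rightarrow> nat" where
  "N_steps T dt = nat \<lfloor>T / dt\<rfloor>"

section \<open>The four-stage semi-implicit scheme\<close>

definition H_field :: "(spacetime \<Rightarrow> vec3) \<Rightarrow> (spacetime \<Rightarrow> real) \<Rightarrow> (real \<times> vec3 \<Rightarrow> real) \<Rightarrow>
    real \<Rightarrow> vec3 \<Rightarrow> vec3 \<Rightarrow> real \<Rightarrow> vec3" where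
  "H_field E b chi t x w e =
     E (t, x) - chi (e, perp w) *\<^sub>R grad_perp (\<lambda>p. ln (b p)) (t, x)"

text \<open>Stage values within one step: \<open>vel\<^sub>k\<close> is \<open>v\<^sup>(\<^sup>k\<^sup>)\<close>, and \<open>pos\<^sub>k\<close>, \<open>hvel\<^sub>k\<close>, \<open>en\<^sub>k\<close> are the explicit
  values \<open>x\<^sup>(\<^sup>k\<^sup>)\<close>, \<open>v\<^sup>(\<^sup>k\<^sup>)\<close>, \<open>e\<^sup>(\<^sup>k\<^sup>)\<close> carrying a hat.\<close>

record S_stages =
  vel1 :: vec3
  vel2 :: vec3
  vel3 :: vec3
  vel4 :: vec3
  pos2 :: vec3
  pos3 :: vec3
  hvel2 :: vec3
  hvel3 :: vec3
  en2 :: real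
  en3 :: real

definition S_step :: "(spacetime \<Rightarrow> vec3) \<Rightarrow> (spacetime \<Rightarrow> real) \<Rightarrow> (real \<times> vec3 \<Rightarrow> real) \<Rightarrow>
    real \<Rightarrow> real \<Rightarrow> real \<Rightarrow> vec3 \<times> vec3 \<times> real \<Rightarrow> S_stages \<Rightarrow> vec3 \<times> vec3 \<times> real \<Rightarrow> bool" where
  "S_step E b chi \<epsilon> dt t = (\<lambda>(x, v, e) s (x', v', e').
     let F1 = H_field E b chi t x v e - (b (t, x) / \<epsilon>) *\<^sub>R rot (vel1 s);
         F2 = H_field E b chi t x v e - (b (t, x) / \<epsilon>) *\<^sub>R rot (vel2 s);
         F3 = H_field E b chi (t + dt) (pos2 s) (hvel2 s) (en2 s)
                - (b (t + dt, pos2 s) / \<epsilon>) *\<^sub>R rot (vel3 s);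
         F4 = H_field E b chi (t + dt / 2) (pos3 s) (hvel3 s) (en3 s)
                - (b (t + dt / 2, pos3 s) / \<epsilon>) *\<^sub>R rot (vel4 s);
         P2 = perp (E (t, x)) \<bullet> perp (vel2 s);
         P3 = perp (E (t + dt, pos2 s)) \<bullet> perp (vel3 s);
         P4 = perp (E (t + dt / 2, pos3 s)) \<bullet> perp (vel4 s)
     in (vel1 s - v) /\<^sub>R dt = \<alpha> *\<^sub>R F1 \<and>
        (vel2 s - v) /\<^sub>R dt = - (\<alpha> *\<^sub>R F1) + \<alpha> *\<^sub>R F2 \<and>
        (pos2 s - x) /\<^sub>R dt = vel2 s \<and>
        (en2 s - e) / dt = P2 \<and>
        (hvel2 s - v) /\<^sub>R dt = F2 \<and>
        (vel3 s - v) /\<^sub>R dt = (1 - \<alpha>) *\<^sub>R F2 + \<alpha> *\<^sub>R F3 \<and>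
        (pos3 s - x) /\<^sub>R dt = (1 / 4) *\<^sub>R (vel2 s + vel3 s) \<and>
        (en3 s - e) / dt = 1 / 4 * (P2 + P3) \<and>
        (hvel3 s - v) /\<^sub>R dt = (1 / 4) *\<^sub>R (F2 + F3) \<and>
        (vel4 s - v) /\<^sub>R dt = \<beta> *\<^sub>R F1 + \<eta> *\<^sub>R F2 + \<gamma> *\<^sub>R F3 + \<alpha> *\<^sub>R F4 \<and>
        (x' - x) /\<^sub>R dt = (1 / 6) *\<^sub>R (vel2 s + vel3 s + 4 *\<^sub>R vel4 s) \<and>
        (v' - v) /\<^sub>R dt = (1 / 6) *\<^sub>R (F2 + F3 + 4 *\<^sub>R F4) \<and>
        (e' - e) / dt = 1 / 6 * (P2 + P3 + 4 * P4))"

section \<open>The limiting scheme for the drift-kinetic equation\<close>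

definition F_field :: "(spacetime \<Rightarrow> vec3) \<Rightarrow> (spacetime \<Rightarrow> real) \<Rightarrow> spacetime \<Rightarrow> vec3" where
  "F_field E b p = E p /\<^sub>R b p"

definition U_gc :: "(spacetime \<Rightarrow> vec3) \<Rightarrow> (spacetime \<Rightarrow> real) \<Rightarrow> real \<Rightarrow>
    real \<Rightarrow> vec3 \<Rightarrow> real \<Rightarrow> real \<Rightarrow> vec3" where
  "U_gc E b \<epsilon> t x e vpar = vpar *\<^sub>R e_z
     - \<epsilon> *\<^sub>R rot (perp (F_field E b (t, x)) - (e / (b (t, x))\<^sup>2) *\<^sub>R grad_perp b (t, x))"

definition g_field :: "real \<Rightarrow> (spacetime \<Rightarrow> vec3) \<Rightarrow> (spacetime \<Rightarrow> real) \<Rightarrow> real \<Rightarrow> vec3 \<Rightarrow> real" where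
  "g_field T E b t x = div_perp T (\<lambda>p. rot (perp (F_field E b p))) (t, x)"

record L_stages =
  vpar2 :: real
  vpar3 :: real
  vpar4 :: real
  lpos2 :: vec3
  lpos3 :: vec3
  len2 :: real
  len3 :: real

text \<open>One step of the scheme, where each equation holds up to an additive residual of norm at most
  \<open>\<delta>\<close>; the scheme itself is the case \<open>\<delta> = 0\<close>.\<close>

definition L_step_upto :: "real \<Rightarrow> real \<Rightarrow> (spacetime \<Rightarrow> vec3) \<Rightarrow> (spacetime \<Rightarrow> real) \<Rightarrow>
    real \<Rightarrow> real \<Rightarrow> real \<Rightarrow> vec3 \<times> real \<times> real \<Rightarrow> L_stages \<Rightarrow> vec3 \<times> real \<times> real \<Rightarrow> bool" where
  "L_step_upto \<delta> T E b \<epsilon> dt t = (\<lambda>(x, e, v) s (x', e', v').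
     let U2 = U_gc E b \<epsilon> t x e (vpar2 s);
         U3 = U_gc E b \<epsilon> (t + dt) (lpos2 s) (len2 s) (vpar3 s);
         U4 = U_gc E b \<epsilon> (t + dt / 2) (lpos3 s) (len3 s) (vpar4 s);
         G2 = e * g_field T E b t x;
         G3 = len2 s * g_field T E b (t + dt) (lpos2 s);
         G4 = len3 s * g_field T E b (t + dt / 2) (lpos3 s);
         E2 = E (t, x) $ 3;
         E3 = E (t + dt, lpos2 s) $ 3;
         E4 = E (t + dt / 2, lpos3 s) $ 3
     in \<bar>vpar2 s - v\<bar> \<le> \<delta> \<and>
        norm ((lpos2 s - x) /\<^sub>R dt - U2) \<le> \<delta> \<and>
        \<bar>(len2 s - e) / dt - \<epsilon> * G2\<bar> \<le> \<delta> \<and>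
        \<bar>(vpar3 s - v) / dt - ((1 - \<alpha>) * E2 + \<alpha> * E3)\<bar> \<le> \<delta> \<and>
        norm ((lpos3 s - x) /\<^sub>R dt - (1 / 4) *\<^sub>R (U2 + U3)) \<le> \<delta> \<and>
        \<bar>(len3 s - e) / dt - \<epsilon> / 4 * (G2 + G3)\<bar> \<le> \<delta> \<and>
        \<bar>(vpar4 s - v) / dt - ((\<beta> + \<eta>) * E2 + \<gamma> * E3 + \<alpha> * E4)\<bar> \<le> \<delta> \<and>
        norm ((x' - x) /\<^sub>R dt - (1 / 6) *\<^sub>R (U2 + U3 + 4 *\<^sub>R U4)) \<le> \<delta> \<and>
        \<bar>(e' - e) / dt - \<epsilon> / 6 * (G2 + G3 + 4 * G4)\<bar> \<le> \<delta> \<and>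
        \<bar>(v' - v) / dt - 1 / 6 * (E2 + E3 + 4 * E4)\<bar> \<le> \<delta>)"

definition L_part :: "S_stages \<Rightarrow> L_stages" where
  "L_part s = \<lparr> vpar2 = vel2 s $ 3, vpar3 = vel3 s $ 3, vpar4 = vel4 s $ 3,
     lpos2 = pos2 s, lpos3 = pos3 s, len2 = en2 s, len3 = en3 s \<rparr>"

definition characteristic_curve :: "real \<Rightarrow> (spacetime \<Rightarrow> vec3) \<Rightarrow> (spacetime \<Rightarrow> real) \<Rightarrow> real \<Rightarrow>
    (real \<Rightarrow> vec3) \<Rightarrow> (real \<Rightarrow> real) \<Rightarrow> (real \<Rightarrow> real) \<Rightarrow> bool" where
  "characteristic_curve T E b \<epsilon> X Y V \<longleftrightarrow> (\<forall>t\<in>{0..T}.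
     (X has_vector_derivative U_gc E b \<epsilon> t (X t) (Y t) (V t)) (at t within {0..T}) \<and>
     (Y has_real_derivative \<epsilon> * g_field T E b t (X t) * Y t) (at t within {0..T}) \<and>
     (V has_real_derivative E (t, X t) $ 3) (at t within {0..T}))"

end

theory Submission
  imports Defs
begin

text \<open>The three claims rest on a pointwise understanding of the data and on three properties of the
  tableau: modulus of the stability function at most one on the imaginary axis, L-stability, and the
  third order condition.

  \<^emph>\<open>The data.\<close> Mollification turns the Sobolev hypotheses into pointwise ones. The electric field is
  bounded, the intensity \<open>b\<close> is Lipschitz with genuine, bounded and continuous derivatives in \<open>x\<close> and
  \<open>y\<close> (\<open>magnetic_facts\<close>), and \<open>\<chi>\<close> is locally Lipschitz. Since \<open>E\<close> is a gradient, the divergence of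
  \<open>(E / b)\<^sup>\<perp>\<close> is the function \<open>E \<bullet> (\<nabla>\<^sub>\<perp> b)\<^sup>\<perp> / b\<^sup>2\<close> (\<open>drift_divergence\<close>).

  \<^emph>\<open>Boundedness.\<close> In the plane orthogonal to the field, identified with the complex numbers, each
  implicit stage is a multiplication by \<open>1 / (1 + i \<alpha> \<Delta>t b / \<epsilon>)\<close>. With \<open>b\<close> frozen along the step, the
  velocity is multiplied by a number of modulus at most \<open>1\<close>, and less than \<open>1\<close> uniformly if \<open>\<Delta>t / \<epsilon>\<close> is
  bounded below (\<open>norm_amplification_diagonal\<close>). The variation of \<open>b\<close> along the step adds a term which
  is quadratic in the size of the solution. It is harmless when \<open>\<Delta>t / \<epsilon>\<close> is small, absorbed by the
  damping when \<open>\<Delta>t\<close> is small but \<open>\<Delta>t / \<epsilon>\<close> is not, and irrelevant for large \<open>\<Delta>t\<close>, when there are few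
  steps and L-stability bounds the new velocity without it (\<open>growth_bound\<close>, \<open>uniform_bounds\<close>).

  \<^emph>\<open>Consistency.\<close> For fixed \<open>\<Delta>t\<close> the factor \<open>1 / (1 + i \<alpha> \<Delta>t b / \<epsilon>)\<close> is \<open>O(\<epsilon>)\<close>, so all perpendicular stage
  velocities are \<open>O(\<epsilon>)\<close>, and by L-stability so is the new velocity. From the second step on, the
  velocity at the beginning of the step is therefore \<open>O(\<epsilon>)\<close> too. Then the forces, which are
  combinations of these velocities divided by \<open>\<Delta>t\<close>, are \<open>O(\<epsilon>)\<close>; and inverting the rotation in the
  definition of a force expresses the stage velocity as the guiding centre velocity up to
  \<open>O(\<epsilon>\<^sup>2)\<close> (\<open>drift_velocity\<close>). The work of \<open>E\<close> along that velocity is exactly the energy source of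
  the drift-kinetic equation (\<open>drift_work\<close>), so that the position and energy equations follow together
  (\<open>consistency\<close>).

  \<^emph>\<open>Third order.\<close> The limiting scheme is a Runge-Kutta method for the characteristics in which the
  parallel velocity follows the implicit tableau and the other components the explicit one. The
  stages have defects of second order, whose contributions to the result cancel (\<open>local_error\<close>). The
  constants are uniform because exact and numerical solutions remain in a ball that does not depend
  on \<open>\<Delta>t\<close> (\<open>third_order\<close>).\<close>

section \<open>Calculus of functions of class C^k\<close>

lemma C_k_on_Suc_imp:
  "C_k_on (Suc k) S f \<Longrightarrow> C_k_on k S f"
proof (induction k arbitrary: f)
  case 0
  then obtain D where "\<forall>x\<in>S. (f has_derivative D x) (at x within S)" by auto
  then show ?case
    by (auto simp: continuous_on_eq_continuous_within intro: has_derivative_continuous)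
next
  case (Suc k)
  then obtain D where D: "\<forall>x\<in>S. (f has_derivative D x) (at x within S)"
    and c: "\<forall>v. C_k_on (Suc k) S (\<lambda>x. D x v)" by auto
  then show ?case using Suc.IH by auto
qed

lemma C_k_on_mono: "C_k_on n S f \<Longrightarrow> k \<le> n \<Longrightarrow> C_k_on k S f"
  by (induction n) (auto simp: le_Suc_eq intro: C_k_on_Suc_imp simp del: C_k_on.simps)

lemma C_k_on_continuous: "C_k_on k S f \<Longrightarrow> continuous_on S f"
  using C_k_on_mono[of k S f 0] by simp

lemma C_k_on_cong:
  assumes "C_k_on k S f" "\<And>x. x \<in> S \<Longrightarrow> f x = g x"
  shows "C_k_on k S g"
proof (cases k)
  case 0
  then show ?thesis using assms by (simp cong: continuous_on_cong)
next
  case (Suc m)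
  then obtain D where D: "\<forall>x\<in>S. (f has_derivative D x) (at x within S)"
    and c: "\<forall>v. C_k_on m S (\<lambda>x. D x v)" using assms by auto
  have "\<forall>x\<in>S. (g has_derivative D x) (at x within S)"
    using D assms(2) by (metis has_derivative_transform)
  then show ?thesis using c Suc by auto
qed

lemma C_k_on_const: "C_k_on k S (\<lambda>x. c)"
proof (induction k arbitrary: c)
  case (Suc k)
  then show ?case by (auto intro!: exI[of _ "\<lambda>_ _. 0"])
qed simp

lemma C_k_on_add:
  "C_k_on k S f \<Longrightarrow> C_k_on k S g \<Longrightarrow> C_k_on k S (\<lambda>x. f x + g x)"
proof (induction k arbitrary: f g)
  case 0
  then show ?case by (simp add: continuous_on_add)
next
  case (Suc k)
  then obtain D1 D2 where "\<forall>x\<in>S. (f has_derivative D1 x) (at x within S)" "\<forall>v. C_k_on k S (\<lambda>x. D1 x v)"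
    "\<forall>x\<in>S. (g has_derivative D2 x) (at x within S)" "\<forall>v. C_k_on k S (\<lambda>x. D2 x v)" by auto
  then show ?case using Suc.IH
    by (auto intro!: exI[of _ "\<lambda>x v. D1 x v + D2 x v"] derivative_intros)
qed

lemma C_k_on_scaleR:
  fixes f :: "'a::euclidean_space \<Rightarrow> real" and g :: "'a \<Rightarrow> 'b::real_normed_vector"
  shows "C_k_on k S f \<Longrightarrow> C_k_on k S g \<Longrightarrow> C_k_on k S (\<lambda>x. f x *\<^sub>R g x)"
proof (induction k arbitrary: f g)
  case 0
  then show ?case by (simp add: continuous_on_scaleR)
next
  case (Suc k)
  then have fg: "C_k_on k S f" "C_k_on k S g" using C_k_on_Suc_imp by blast+
  from Suc.prems obtain D1 D2 where
    "\<forall>x\<in>S. (f has_derivative D1 x) (at x within S)" "\<forall>v. C_k_on k S (\<lambda>x. D1 x v)"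
    "\<forall>x\<in>S. (g has_derivative D2 x) (at x within S)" "\<forall>v. C_k_on k S (\<lambda>x. D2 x v)" by auto
  then show ?case using Suc.IH fg
    by (auto intro!: exI[of _ "\<lambda>x v. f x *\<^sub>R D2 x v + D1 x v *\<^sub>R g x"] derivative_eq_intros C_k_on_add)
qed

lemma C_k_on_mult:
  fixes f g :: "'a::euclidean_space \<Rightarrow> real"
  shows "C_k_on k S f \<Longrightarrow> C_k_on k S g \<Longrightarrow> C_k_on k S (\<lambda>x. f x * g x)"
  using C_k_on_scaleR[of k S f g] by simp

lemma C_k_on_uminus: "C_k_on k S f \<Longrightarrow> C_k_on k S (\<lambda>x. - f x)"
  using C_k_on_scaleR[OF C_k_on_const[of k S "-1"], of f] by simp

lemma C_k_on_diff:
  "C_k_on k S f \<Longrightarrow> C_k_on k S g \<Longrightarrow> C_k_on k S (\<lambda>x. f x - g x)"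
  using C_k_on_add[OF _ C_k_on_uminus] by fastforce

lemma C_k_on_sum:
  "(\<And>i. i \<in> I \<Longrightarrow> C_k_on k S (f i)) \<Longrightarrow> C_k_on k S (\<lambda>x. \<Sum>i\<in>I. f i x)"
proof (induction I rule: infinite_finite_induct)
  case (insert i I)
  then show ?case by (simp add: C_k_on_add del: C_k_on.simps)
qed (simp_all add: C_k_on_const del: C_k_on.simps)

lemma C_k_on_linear: "bounded_linear f \<Longrightarrow> C_k_on k S f"
proof (cases k)
  case 0
  assume "bounded_linear f" then show ?thesis using 0 by (simp add: linear_continuous_on)
next
  case (Suc m)
  assume "bounded_linear f"
  then show ?thesis using Suc C_k_on_const
    by (auto intro!: exI[of _ "\<lambda>_. f"] bounded_linear_imp_has_derivative)
qed

lemma C_k_on_compose_affine: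
  fixes P :: "'a::euclidean_space \<Rightarrow> 'b::euclidean_space"
  assumes P: "bounded_linear P" and sub: "(\<lambda>x. c + P x) ` S \<subseteq> R"
  shows "C_k_on k R f \<Longrightarrow> C_k_on k S (\<lambda>x. f (c + P x))"
proof (induction k arbitrary: f)
  case 0
  have "continuous_on S (\<lambda>x. c + P x)"
    by (intro continuous_intros linear_continuous_on P)
  then show ?case
    using continuous_on_compose2[OF _ _ sub] 0 by auto
next
  case (Suc k)
  then obtain D where D: "\<forall>x\<in>R. (f has_derivative D x) (at x within R)"
    and c: "\<forall>v. C_k_on k R (\<lambda>x. D x v)" by auto
  have "((\<lambda>x. f (c + P x)) has_derivative (\<lambda>v. D (c + P x) (P v))) (at x within S)" if "x \<in> S" for x
  proof -
    have "((\<lambda>x. c + P x) has_derivative P) (at x within S)"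
      using bounded_linear_imp_has_derivative[OF P] by (auto intro!: derivative_eq_intros)
    then show ?thesis
      using has_derivative_in_compose2[of R f D "\<lambda>x. c + P x" S x P] that D sub by auto
  qed
  then show ?case using Suc.IH c by (auto intro!: exI[of _ "\<lambda>x v. D (c + P x) (P v)"])
qed

lemma C_k_on_compose_linear:
  fixes P :: "'a::euclidean_space \<Rightarrow> 'b::euclidean_space"
  assumes "bounded_linear P" "P ` S \<subseteq> R" "C_k_on k R f"
  shows "C_k_on k S (\<lambda>x. f (P x))"
  using C_k_on_compose_affine[of P 0 S R k f] assms by simp

lemma C_k_on_inverse:
  fixes f :: "'a::euclidean_space \<Rightarrow> real"
  assumes nz: "\<And>x. x \<in> S \<Longrightarrow> f x \<noteq> 0"
  shows "C_k_on k S f \<Longrightarrow> C_k_on k S (\<lambda>x. inverse (f x))"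
proof (induction k)
  case 0
  then show ?case using nz by (simp add: continuous_on_inverse)
next
  case (Suc k)
  then have *: "C_k_on k S (\<lambda>x. inverse (f x))" using C_k_on_Suc_imp by blast
  from Suc.prems obtain D where D: "\<forall>x\<in>S. (f has_derivative D x) (at x within S)"
    and c: "\<forall>v. C_k_on k S (\<lambda>x. D x v)" by auto
  have "((\<lambda>x. inverse (f x)) has_derivative (\<lambda>v. - (inverse (f x) * D x v * inverse (f x)))) (at x within S)"
    if "x \<in> S" for x
    using Deriv.has_derivative_inverse[of f x "D x" S] D nz that by auto
  then show ?case using * c
    by (auto intro!: exI[of _ "\<lambda>x v. - (inverse (f x) * D x v * inverse (f x))"] C_k_on_uminus C_k_on_mult)
qed

lemma C_k_on_bounded_linear:
  fixes f :: "'a::euclidean_space \<Rightarrow> 'b::real_normed_vector"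
  assumes L: "bounded_linear L"
  shows "C_k_on k S f \<Longrightarrow> C_k_on k S (\<lambda>x. L (f x))"
proof (induction k arbitrary: f)
  case 0
  then show ?case using bounded_linear.continuous_on[OF L] by simp
next
  case (Suc k)
  then obtain D where D: "\<forall>x\<in>S. (f has_derivative D x) (at x within S)"
    and c: "\<forall>v. C_k_on k S (\<lambda>x. D x v)" by auto
  have "\<forall>x\<in>S. ((\<lambda>x. L (f x)) has_derivative (\<lambda>v. L (D x v))) (at x within S)"
    using D bounded_linear.has_derivative[OF L] by blast
  then show ?case using Suc.IH c by auto
qed

section \<open>Smooth bumps\<close>

text \<open>The functions \<open>exp (- 1 / t) / t\<^sup>k\<close>, extended by \<open>0\<close> to \<open>t \<le> 0\<close>. The
  index \<open>k\<close> makes the family closed under differentiation up to linear combinations, so that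
  smoothness of the bumps below is a plain induction.\<close>

definition flat_exp :: "nat \<Rightarrow> real \<Rightarrow> real" where
  "flat_exp k t = (if 0 < t then exp (- inverse t) * inverse t ^ k else 0)"

lemma flat_exp_nonneg: "0 \<le> flat_exp k t"
  by (simp add: flat_exp_def)

lemma flat_exp_pos: "0 < t \<Longrightarrow> 0 < flat_exp k t"
  by (simp add: flat_exp_def)

lemma flat_exp_has_derivative:
  "(flat_exp k has_real_derivative flat_exp (k + 2) t - real k * flat_exp (Suc k) t) (at t)"
proof -
  consider "t < 0" | "t = 0" | "0 < t" by linarith
  then show ?thesis
  proof cases
    case 1
    have ev: "\<forall>\<^sub>F s in nhds t. 0 = flat_exp k s"
      using eventually_nhds_in_open[of "{..<0}" t] 1 by (auto elim!: eventually_mono simp: flat_exp_def)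
    then have "(flat_exp k has_real_derivative 0) (at t)"
      using DERIV_cong_ev[OF refl ev refl, of 0] DERIV_const by blast
    then show ?thesis using 1 by (simp add: flat_exp_def)
  next
    case 2
    have lim: "((\<lambda>x. x ^ Suc k / exp x) \<longlongrightarrow> (0::real)) at_top"
      by (rule tendsto_power_div_exp_0)
    have "((\<lambda>h. inverse h ^ Suc k / exp (inverse h :: real)) \<longlongrightarrow> 0) (at_right 0)"
      by (rule filterlim_compose[OF lim filterlim_inverse_at_top_right])
    then have "((\<lambda>h. flat_exp k h / h) \<longlongrightarrow> 0) (at_right 0)"
      by (rule Lim_transform_eventually)
        (auto simp: eventually_at_right_less flat_exp_def exp_minus field_simps
          intro!: eventually_mono[OF eventually_at_right_less[of "0::real"]])
    moreover have "((\<lambda>h. flat_exp k h / h) \<longlongrightarrow> 0) (at_left 0)"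
      by (rule Lim_transform_eventually[OF tendsto_const])
        (auto simp: eventually_at_filter flat_exp_def)
    ultimately have "((\<lambda>h. flat_exp k h / h) \<longlongrightarrow> 0) (at 0)"
      by (simp add: filterlim_at_split)
    then show ?thesis using 2 by (simp add: DERIV_def flat_exp_def)
  next
    case 3
    have d: "((\<lambda>s. exp (- inverse s) * inverse s ^ k) has_real_derivative
       flat_exp (k + 2) t - real k * flat_exp (Suc k) t) (at t)"
    proof -
      have "((\<lambda>s. exp (- inverse s) * inverse s ^ k) has_real_derivative
         exp (- inverse t) * (inverse t * inverse t) * inverse t ^ k
         + exp (- inverse t) * (real k * inverse t ^ (k - 1) * (- (inverse t * inverse t)))) (at t)"
        using 3 by (auto intro!: derivative_eq_intros simp: algebra_simps)
      moreover have "exp (- inverse t) * (inverse t * inverse t) * inverse t ^ k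
         + exp (- inverse t) * (real k * inverse t ^ (k - 1) * (- (inverse t * inverse t)))
         = flat_exp (k + 2) t - real k * flat_exp (Suc k) t"
        using 3 by (cases k) (simp_all add: flat_exp_def algebra_simps)
      ultimately show ?thesis by simp
    qed
    have ev: "\<forall>\<^sub>F s in nhds t. exp (- inverse s) * inverse s ^ k = flat_exp k s"
      using eventually_nhds_in_open[of "{0<..}" t] 3 by (auto elim!: eventually_mono simp: flat_exp_def)
    show ?thesis using DERIV_cong_ev[OF refl ev refl] d by simp
  qed
qed

definition bump :: "nat \<Rightarrow> real \<Rightarrow> 'a::euclidean_space \<Rightarrow> real" where
  "bump k r z = flat_exp k (r\<^sup>2 - z \<bullet> z)"

text \<open>Directional derivative of \<open>bump 0 r\<close> in direction \<open>v\<close>, and its derivative in direction \<open>w\<close>.\<close>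

definition bump_d1 :: "real \<Rightarrow> 'a::euclidean_space \<Rightarrow> 'a \<Rightarrow> real" where
  "bump_d1 r v z = bump 2 r z * (- 2 * (z \<bullet> v))"

definition bump_d2 :: "real \<Rightarrow> 'a::euclidean_space \<Rightarrow> 'a \<Rightarrow> 'a \<Rightarrow> real" where
  "bump_d2 r v w z = (bump 4 r z - 2 * bump 3 r z) * (4 * (z \<bullet> v) * (z \<bullet> w)) - 2 * bump 2 r z * (v \<bullet> w)"

lemma bump_nonneg: "0 \<le> bump k r z"
  by (simp add: bump_def flat_exp_nonneg)

lemma bump_outside:
  assumes "0 < r" "z \<notin> cball 0 r" shows "bump k r z = 0"
proof -
  have "r\<^sup>2 \<le> z \<bullet> z"
    using assms power_mono[of r "norm z" 2] by (simp add: dot_square_norm)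
  then show ?thesis by (simp add: bump_def flat_exp_def)
qed

lemma bump_pos: "0 < r \<Longrightarrow> 0 < bump k r 0"
  by (simp add: bump_def flat_exp_pos)

lemma bump_has_derivative:
  "(bump k r has_derivative (\<lambda>v. (bump (k + 2) r z - real k * bump (Suc k) r z) * (- 2 * (z \<bullet> v)))) (at z)"
proof -
  have "((\<lambda>z. flat_exp k (r\<^sup>2 - z \<bullet> z)) has_derivative
     (\<lambda>v. (flat_exp (k + 2) (r\<^sup>2 - z \<bullet> z) - real k * flat_exp (Suc k) (r\<^sup>2 - z \<bullet> z)) * (- 2 * (z \<bullet> v)))) (at z)"
    by (rule has_derivative_eq_rhs[OF has_derivative_compose[OF _ flat_exp_has_derivative[unfolded has_field_derivative_def]]])
      (auto intro!: derivative_eq_intros simp: inner_commute algebra_simps)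
  then show ?thesis by (simp add: bump_def[abs_def])
qed

lemma bump_0_has_derivative: "(bump 0 r has_derivative (\<lambda>v. bump_d1 r v z)) (at z)"
  using bump_has_derivative[of 0 r z] by (simp add: bump_d1_def numeral_2_eq_2)

lemma bump_d1_has_derivative: "(bump_d1 r v has_derivative (\<lambda>w. bump_d2 r v w z)) (at z)"
  unfolding bump_d1_def[abs_def]
  by (rule has_derivative_eq_rhs[OF has_derivative_mult[OF bump_has_derivative]])
    (auto intro!: derivative_eq_intros
      simp: bump_d2_def fun_eq_iff eval_nat_numeral inner_commute algebra_simps)

lemma bump_d2_commute: "bump_d2 r v w z = bump_d2 r w v z"
  by (simp add: bump_d2_def inner_commute)

lemma C_k_on_bump: "C_k_on m UNIV (bump k r :: 'a::euclidean_space \<Rightarrow> real)"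
proof (induction m arbitrary: k)
  case 0
  show ?case using bump_has_derivative[of k r]
    by (auto simp: continuous_on_eq_continuous_within intro!: has_derivative_continuous)
next
  case (Suc m)
  have "C_k_on m UNIV (\<lambda>z. (bump (k + 2) r z - real k * bump (Suc k) r z) * (- 2 * (z \<bullet> v)))" for v :: 'a
    by (intro C_k_on_mult C_k_on_diff Suc C_k_on_const C_k_on_linear[OF bounded_linear_inner_left])
  then show ?case using bump_has_derivative[of k r]
    by (auto intro!: exI[of _ "\<lambda>z v. (bump (k + 2) r z - real k * bump (Suc k) r z) * (- 2 * (z \<bullet> v))"])
qed

lemma C_k_on_bump_d1: "C_k_on m UNIV (bump_d1 r v)"
  unfolding bump_d1_def[abs_def]
  by (intro C_k_on_mult C_k_on_bump C_k_on_const C_k_on_linear[OF bounded_linear_inner_left])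

lemma C_k_on_bump_d2: "C_k_on m UNIV (bump_d2 r v w)"
  unfolding bump_d2_def[abs_def]
  by (intro C_k_on_mult C_k_on_diff C_k_on_bump C_k_on_const C_k_on_linear[OF bounded_linear_inner_left])

section \<open>Mollification\<close>

text \<open>Weak derivatives are tested against functions supported in \<open>S\<close>, whereas convolutions are
  integrals over the whole space, and differentiation under the integral sign is done on a box. For
  an integrand supported in a ball the three integrals agree.\<close>

lemma compact_support_integral:
  fixes u :: "'a::euclidean_space \<Rightarrow> real"
  assumes u: "continuous_on UNIV u" and out: "\<And>x. x \<notin> cball c r \<Longrightarrow> u x = 0"
    and S: "S \<in> sets lebesgue" "cball c r \<subseteq> S"
  shows "integrable (lebesgue_on S) u" "(LINT x|lebesgue_on S. u x) = (LINT x|lebesgue. u x)"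
proof -
  obtain a b where ab: "cball c r \<subseteq> cbox a b"
    using bounded_subset_cbox_symmetric[OF bounded_cball] by blast
  have eq: "(\<lambda>x. if x \<in> A then u x else 0) = u" if "cball c r \<subseteq> A" for A
  proof
    show "(if x \<in> A then u x else 0) = u x" for x
      using out[of x] that by (cases "x \<in> cball c r") auto
  qed
  have "integrable (lebesgue_on (cbox a b)) u"
    using continuous_imp_integrable[OF continuous_on_subset[OF u]] by auto
  then have "integrable lebesgue u"
    using Lebesgue_Measure.integrable_restrict_UNIV[of "cbox a b" u] eq[OF ab] by simp
  then show "integrable (lebesgue_on S) u"
    using Lebesgue_Measure.integrable_restrict_UNIV[OF S(1), of u] eq[OF S(2)] by simp
  show "(LINT x|lebesgue_on S. u x) = (LINT x|lebesgue. u x)"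
    using Lebesgue_Measure.integral_restrict_UNIV[OF S(1), of u] eq[OF S(2)] by simp
qed

lemma compact_support_integral_cbox:
  fixes u :: "'a::euclidean_space \<Rightarrow> real"
  assumes u: "continuous_on UNIV u" and out: "\<And>x. x \<notin> cball c r \<Longrightarrow> u x = 0"
    and S: "cball c r \<subseteq> cbox a b"
  shows "(LINT x|lebesgue. u x) = integral (cbox a b) u"
  using compact_support_integral[OF u out _ S] lebesgue_integral_eq_integral[of "cbox a b" u] by auto

definition conv :: "('a::euclidean_space \<Rightarrow> real) \<Rightarrow> ('a \<Rightarrow> real) \<Rightarrow> 'a \<Rightarrow> real" where
  "conv f \<psi> y = (LINT x|lebesgue. f x * \<psi> (y - x))"

locale ball_kernel =
  fixes \<psi> :: "'a::euclidean_space \<Rightarrow> real" and r :: real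
  assumes cont: "continuous_on UNIV \<psi>" and outside: "z \<notin> cball 0 r \<Longrightarrow> \<psi> z = 0"
begin

lemma cont_reflected: "continuous_on A (\<lambda>x. \<psi> (y - x))"
  by (rule continuous_on_compose2[OF cont]) (auto intro!: continuous_intros)

lemma outside_reflected: "x \<notin> cball y r \<Longrightarrow> \<psi> (y - x) = 0"
  using outside[of "y - x"] by (simp add: dist_norm norm_minus_commute)

lemma conv_integrable:
  assumes "continuous_on UNIV f" "S \<in> sets lebesgue" "cball y r \<subseteq> S"
  shows "integrable (lebesgue_on S) (\<lambda>x. f x * \<psi> (y - x))"
  by (rule compact_support_integral(1)[where c=y and r=r])
    (use assms outside_reflected cont_reflected in \<open>auto intro!: continuous_intros\<close>)

lemma conv_eq_LINT:
  assumes "continuous_on UNIV f" "S \<in> sets lebesgue" "cball y r \<subseteq> S"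
  shows "conv f \<psi> y = (LINT x|lebesgue_on S. f x * \<psi> (y - x))"
  unfolding conv_def
  by (rule compact_support_integral(2)[where c=y and r=r, symmetric])
    (use assms outside_reflected cont_reflected in \<open>auto intro!: continuous_intros\<close>)

lemma conv_eq_cbox:
  assumes "continuous_on UNIV f" "cball y r \<subseteq> cbox a b"
  shows "conv f \<psi> y = integral (cbox a b) (\<lambda>x. f x * \<psi> (y - x))"
  unfolding conv_def
  by (rule compact_support_integral_cbox[where c=y and r=r])
    (use assms outside_reflected cont_reflected in \<open>auto intro!: continuous_intros\<close>)

end

lemma conv_has_derivative:
  fixes f :: "'a::euclidean_space \<Rightarrow> real"
  assumes f: "continuous_on UNIV f" and k: "ball_kernel \<psi> r" and k': "ball_kernel (\<lambda>z. \<psi>' z v) r"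
    and d: "\<And>z. (\<psi> has_derivative \<psi>' z) (at z)"
  shows "((\<lambda>s. conv f \<psi> (y + s *\<^sub>R v)) has_real_derivative conv f (\<lambda>z. \<psi>' z v) (y + s0 *\<^sub>R v)) (at s0)"
proof -
  interpret k: ball_kernel \<psi> r by fact
  interpret k': ball_kernel "\<lambda>z. \<psi>' z v" r by fact
  obtain a b where ab: "cball (y + s0 *\<^sub>R v) (r + norm v) \<subseteq> cbox a b"
    using bounded_subset_cbox_symmetric[OF bounded_cball] by blast
  have sub: "cball (y + s *\<^sub>R v) r \<subseteq> cbox a b" if "s \<in> ball s0 1" for s
  proof -
    have "dist (y + s *\<^sub>R v) (y + s0 *\<^sub>R v) \<le> norm v"
      using that mult_right_mono[of "\<bar>s - s0\<bar>" 1 "norm v"]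
      by (simp add: dist_norm abs_minus_commute flip: scaleR_left_diff_distrib)
    then have "cball (y + s *\<^sub>R v) r \<subseteq> cball (y + s0 *\<^sub>R v) (r + norm v)"
      by (simp add: cball_subset_cball_iff)
    then show ?thesis using ab by blast
  qed
  have "((\<lambda>s. integral (cbox a b) (\<lambda>x. f x * \<psi> (y + s *\<^sub>R v - x))) has_real_derivative
      integral (cbox a b) (\<lambda>x. f x * \<psi>' (y + s0 *\<^sub>R v - x) v)) (at s0 within ball s0 1)"
  proof (rule leibniz_rule_field_derivative)
    show "((\<lambda>s. f x * \<psi> (y + s *\<^sub>R v - x)) has_real_derivative f x * \<psi>' (y + s *\<^sub>R v - x) v) (at s within ball s0 1)"
      for s x
    proof -
      have "((\<lambda>s. \<psi> (y + s *\<^sub>R v - x)) has_derivative (\<lambda>t. \<psi>' (y + s *\<^sub>R v - x) (t *\<^sub>R v))) (at s)"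
        by (rule has_derivative_compose[OF _ d]) (auto intro!: derivative_eq_intros)
      moreover have "\<psi>' z (t *\<^sub>R v) = \<psi>' z v * t" for t z
        using linear_cmul[OF has_derivative_linear[OF d]] by (simp add: mult.commute)
      ultimately have "((\<lambda>s. \<psi> (y + s *\<^sub>R v - x)) has_real_derivative \<psi>' (y + s *\<^sub>R v - x) v) (at s)"
        by (simp add: has_field_derivative_def)
      then show ?thesis
        by (auto intro!: DERIV_cmult intro: has_field_derivative_at_within)
    qed
    show "(\<lambda>x. f x * \<psi> (y + s *\<^sub>R v - x)) integrable_on cbox a b" for s
      by (intro integrable_continuous continuous_intros k.cont_reflected continuous_on_subset[OF f]) auto
    show "continuous_on (ball s0 1 \<times> cbox a b) (\<lambda>(s, x). f x * \<psi>' (y + s *\<^sub>R v - x) v)"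
      unfolding split_beta
      by (intro continuous_intros continuous_on_compose2[OF f] continuous_on_compose2[OF k'.cont]) auto
  qed auto
  then have "((\<lambda>s. integral (cbox a b) (\<lambda>x. f x * \<psi> (y + s *\<^sub>R v - x))) has_real_derivative
      conv f (\<lambda>z. \<psi>' z v) (y + s0 *\<^sub>R v)) (at s0 within ball s0 1)"
    using k'.conv_eq_cbox[OF f sub[of s0]] by simp
  then have "((\<lambda>s. conv f \<psi> (y + s *\<^sub>R v)) has_real_derivative
      conv f (\<lambda>z. \<psi>' z v) (y + s0 *\<^sub>R v)) (at s0 within ball s0 1)"
    by (rule has_field_derivative_transform_within[where d=1])
      (use k.conv_eq_cbox[OF f sub] in auto)
  then show ?thesis by (simp add: at_within_open[of s0 "ball s0 1"])
qed

lemma kernel_bump: "0 < r \<Longrightarrow> ball_kernel (bump k r) r"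
  using C_k_on_continuous[OF C_k_on_bump] bump_outside[of r _ k]
  by unfold_locales auto

lemma kernel_bump_d1: "0 < r \<Longrightarrow> ball_kernel (bump_d1 r v) r"
  using C_k_on_continuous[OF C_k_on_bump_d1] bump_outside[of r]
  by unfold_locales (auto simp: bump_d1_def)

lemma kernel_bump_d2: "0 < r \<Longrightarrow> ball_kernel (bump_d2 r v w) r"
proof unfold_locales
  assume r: "0 < r"
  show "continuous_on UNIV (bump_d2 r v w)"
    by (rule C_k_on_continuous[OF C_k_on_bump_d2])
  show "bump_d2 r v w z = 0" if "z \<notin> cball 0 r" for z
    unfolding bump_d2_def bump_outside[OF r that] by simp
qed

lemma test_function_reflected:
  assumes "\<And>k. C_k_on k UNIV \<psi>" "ball_kernel \<psi> r" "cball y r \<subseteq> \<Omega>"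
  shows "test_function \<Omega> (\<lambda>x. \<psi> (y - x))"
proof -
  interpret ball_kernel \<psi> r by fact
  have "C_k_on k UNIV (\<lambda>x. \<psi> (y - x))" for k
    using C_k_on_compose_affine[of uminus y UNIV UNIV k \<psi>] assms(1)
    by (simp add: bounded_linear_minus bounded_linear_ident del: C_k_on.simps)
  moreover have "closure {x. \<psi> (y - x) \<noteq> 0} \<subseteq> cball y r"
    by (rule closure_minimal) (use outside_reflected in blast, rule closed_cball)
  ultimately show ?thesis using assms(3)
    by (auto simp: test_function_def compact_eq_bounded_closed intro: bounded_subset[OF bounded_cball])
qed

text \<open>Testing with \<open>x \<mapsto> \<psi> (y - x)\<close> turns a derivative of the mollified function at \<open>y\<close>
  into the mollified weak derivative: the sign of the reflection cancels the one in the definition of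
  weak derivatives.\<close>

lemma weak_partial_reflected:
  assumes w: "weak_partial \<Omega> i f g" and sub: "cball y r \<subseteq> \<Omega>"
    and C: "\<And>k. C_k_on k UNIV \<psi>" and k: "ball_kernel \<psi> r"
    and d: "\<And>z. (\<psi> has_derivative \<psi>' z) (at z)"
  shows "(LINT x|lebesgue_on \<Omega>. f x * \<psi>' (y - x) i) = (LINT x|lebesgue_on \<Omega>. g x * \<psi> (y - x))"
proof -
  have fd: "frechet_derivative (\<lambda>x. \<psi> (y - x)) (at x) i = - \<psi>' (y - x) i" for x
  proof -
    have "((\<lambda>x. \<psi> (y - x)) has_derivative (\<lambda>h. \<psi>' (y - x) (- h))) (at x)"
      by (rule has_derivative_compose[OF _ d]) (auto intro!: derivative_eq_intros)
    then show ?thesis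
      using linear_neg[OF has_derivative_linear[OF d]] by (simp flip: frechet_derivative_at)
  qed
  have "(LINT x|lebesgue_on \<Omega>. f x * \<psi>' (y - x) i) =
      - (LINT x|lebesgue_on \<Omega>. f x * frechet_derivative (\<lambda>x. \<psi> (y - x)) (at x) i)"
    by (simp add: fd)
  also have "\<dots> = (LINT x|lebesgue_on \<Omega>. g x * \<psi> (y - x))"
    using w test_function_reflected[OF C k sub] by (simp add: weak_partial_def)
  finally show ?thesis .
qed

definition mass :: "'a::euclidean_space itself \<Rightarrow> real \<Rightarrow> real" where
  "mass _ r = (LINT x|lebesgue. bump 0 r (x::'a))"

lemma conv_one:
  fixes y :: "'a::euclidean_space"
  assumes r: "0 < r" shows "conv (\<lambda>_. 1) (bump 0 r) y = mass TYPE('a) r"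
proof -
  interpret ball_kernel "bump 0 r :: 'a \<Rightarrow> real" r by (rule kernel_bump[OF r])
  obtain a b :: 'a where ab: "cball 0 r \<subseteq> cbox a b"
    using bounded_subset_cbox_symmetric[OF bounded_cball] by blast
  have "cbox (a + y) (b + y) = (+) y ` cbox a b"
    using cbox_translation[of y a b] by (simp add: add.commute)
  then have sub: "cball y r \<subseteq> cbox (a + y) (b + y)"
    using ab image_mono[OF ab, of "(+) y"] by (simp flip: cball_translation)
  have "conv (\<lambda>_. 1) (bump 0 r) y = integral (cbox (a + y) (b + y)) (\<lambda>x. bump 0 r (y - x))"
    using conv_eq_cbox[OF _ sub, of "\<lambda>_. 1"] by simp
  also have "\<dots> = integral (cbox a b) ((\<lambda>x. bump 0 r (y - x)) \<circ> (+) y)"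
    by (rule integral_shift_cbox_plus[symmetric])
  also have "(\<lambda>x. bump 0 r (y - x)) \<circ> (+) y = bump 0 r"
    by (simp add: fun_eq_iff bump_def)
  also have "integral (cbox a b) (bump 0 r) = mass TYPE('a) r"
    unfolding mass_def by (rule compact_support_integral_cbox[symmetric, OF cont outside ab])
  finally show ?thesis .
qed

lemma mass_pos: assumes r: "0 < r" shows "0 < mass TYPE('a::euclidean_space) r"
proof -
  interpret ball_kernel "bump 0 r :: 'a \<Rightarrow> real" r by (rule kernel_bump[OF r])
  have "integrable lebesgue (bump 0 r :: 'a \<Rightarrow> real)"
    using compact_support_integral(1)[OF cont, where c=0 and r=r and S=UNIV] outside by (simp add: lebesgue_on_UNIV_eq)
  moreover have "\<not> (AE x in lebesgue. bump 0 r (x::'a) = 0)"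
  proof
    assume "AE x in lebesgue. bump 0 r (x::'a) = 0"
    then have "negligible {x::'a. bump 0 r x \<noteq> 0}"
      unfolding eventually_ae_filter_negligible using negligible_subset by blast
    moreover have "open {x::'a. bump 0 r x \<noteq> 0}"
      using open_Collect_neq[OF cont continuous_on_const] by simp
    ultimately have "{x::'a. bump 0 r x \<noteq> 0} = {}"
      using open_not_negligible by blast
    then show False using bump_pos[OF r, of 0, where 'a='a] by auto
  qed
  moreover have "0 \<le> mass TYPE('a) r"
    unfolding mass_def by (rule integral_nonneg_AE) (simp add: bump_nonneg)
  ultimately show ?thesis
    using integral_nonneg_eq_0_iff_AE[of lebesgue "bump 0 r :: 'a \<Rightarrow> real"]
    by (auto simp: mass_def bump_nonneg less_le)
qed

lemma conv_bump_bound: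
  fixes y :: "'a::euclidean_space"
  assumes r: "0 < r" and \<Omega>: "open \<Omega>" "cball y r \<subseteq> \<Omega>"
    and g: "g \<in> borel_measurable (lebesgue_on \<Omega>)" "AE x in lebesgue_on \<Omega>. \<bar>g x\<bar> \<le> M"
  shows "\<bar>LINT x|lebesgue_on \<Omega>. g x * bump 0 r (y - x)\<bar> \<le> M * mass TYPE('a) r"
proof -
  interpret ball_kernel "bump 0 r :: 'a \<Rightarrow> real" r by (rule kernel_bump[OF r])
  have \<Omega>': "\<Omega> \<in> sets lebesgue" using \<Omega> by (auto intro: borel_open)
  have i: "integrable (lebesgue_on \<Omega>) (\<lambda>x. M * bump 0 r (y - x))"
    using conv_integrable[OF continuous_on_const \<Omega>' \<Omega>(2), of M] .
  have m: "(\<lambda>x. bump 0 r (y - x)) \<in> borel_measurable (lebesgue_on \<Omega>)"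
    by (rule continuous_imp_measurable_on_sets_lebesgue[OF cont_reflected \<Omega>'])
  have ae: "AE x in lebesgue_on \<Omega>. norm (g x * bump 0 r (y - x)) \<le> M * bump 0 r (y - x)"
    using g(2) by eventually_elim (simp add: abs_mult bump_nonneg mult_right_mono)
  have gi: "integrable (lebesgue_on \<Omega>) (\<lambda>x. g x * bump 0 r (y - x))"
    by (rule Bochner_Integration.integrable_bound[OF i]) (use g(1) m ae in \<open>auto elim!: eventually_mono\<close>)
  have "\<bar>LINT x|lebesgue_on \<Omega>. g x * bump 0 r (y - x)\<bar> \<le> (LINT x|lebesgue_on \<Omega>. norm (g x * bump 0 r (y - x)))"
    using integral_norm_bound[of "lebesgue_on \<Omega>" "\<lambda>x. g x * bump 0 r (y - x)"] by simp
  also have "\<dots> \<le> (LINT x|lebesgue_on \<Omega>. M * bump 0 r (y - x))"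
    by (rule integral_mono_AE[OF integrable_norm[OF gi] i ae])
  also have "\<dots> = M * mass TYPE('a) r"
    using conv_eq_LINT[OF continuous_on_const \<Omega>' \<Omega>(2), of 1] conv_one[OF r, of y] by simp
  finally show ?thesis .
qed

lemma conv_linear_combination:
  fixes f :: "'a::euclidean_space \<Rightarrow> real"
  assumes f: "continuous_on UNIV f" and k: "\<And>i. i \<in> I \<Longrightarrow> ball_kernel (\<psi> i) r"
  shows "conv f (\<lambda>z. \<Sum>i\<in>I. c i * \<psi> i z) y = (\<Sum>i\<in>I. c i * conv f (\<psi> i) y)"
proof -
  have int: "integrable lebesgue (\<lambda>x. f x * \<psi> i (y - x))" if "i \<in> I" for i
    using ball_kernel.conv_integrable[OF k[OF that] f, of UNIV y] by (simp add: lebesgue_on_UNIV_eq)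
  have "conv f (\<lambda>z. \<Sum>i\<in>I. c i * \<psi> i z) y = (LINT x|lebesgue. (\<Sum>i\<in>I. c i * (f x * \<psi> i (y - x))))"
    unfolding conv_def by (simp add: sum_distrib_left algebra_simps)
  also have "\<dots> = (\<Sum>i\<in>I. (LINT x|lebesgue. c i * (f x * \<psi> i (y - x))))"
    by (rule Bochner_Integration.integral_sum) (use int in auto)
  finally show ?thesis by (simp add: conv_def)
qed

definition moll :: "('a::euclidean_space \<Rightarrow> real) \<Rightarrow> real \<Rightarrow> 'a \<Rightarrow> real" where
  "moll f r y = conv f (bump 0 r) y / mass TYPE('a) r"

definition moll_d1 :: "('a::euclidean_space \<Rightarrow> real) \<Rightarrow> real \<Rightarrow> 'a \<Rightarrow> 'a \<Rightarrow> real" where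
  "moll_d1 f r v y = conv f (bump_d1 r v) y / mass TYPE('a) r"

definition moll_d2 :: "('a::euclidean_space \<Rightarrow> real) \<Rightarrow> real \<Rightarrow> 'a \<Rightarrow> 'a \<Rightarrow> 'a \<Rightarrow> real" where
  "moll_d2 f r v w y = conv f (bump_d2 r v w) y / mass TYPE('a) r"

lemma moll_has_derivative:
  assumes "continuous_on UNIV f" "0 < r"
  shows "((\<lambda>s. moll f r (y + s *\<^sub>R v)) has_real_derivative moll_d1 f r v (y + s *\<^sub>R v)) (at s)"
  unfolding moll_def moll_d1_def
  by (intro DERIV_cdivide conv_has_derivative[OF assms(1) kernel_bump kernel_bump_d1] bump_0_has_derivative assms(2))

lemma moll_d1_has_derivative:
  assumes "continuous_on UNIV f" "0 < r"
  shows "((\<lambda>s. moll_d1 f r u (y + s *\<^sub>R v)) has_real_derivative moll_d2 f r u v (y + s *\<^sub>R v)) (at s)"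
  unfolding moll_d2_def moll_d1_def
  by (intro DERIV_cdivide conv_has_derivative[OF assms(1) kernel_bump_d1 kernel_bump_d2] bump_d1_has_derivative assms(2))

lemma moll_d1_expand:
  fixes f :: "'a::euclidean_space \<Rightarrow> real"
  assumes "continuous_on UNIV f" "0 < r"
  shows "moll_d1 f r v y = (\<Sum>i\<in>Basis. (v \<bullet> i) * moll_d1 f r i y)"
proof -
  have "bump_d1 r v = (\<lambda>z. \<Sum>i\<in>Basis. (v \<bullet> i) * bump_d1 r i z)"
    unfolding bump_d1_def
    by (subst euclidean_inner) (simp add: fun_eq_iff sum_distrib_left algebra_simps)
  then show ?thesis
    using conv_linear_combination[OF assms(1) kernel_bump_d1[OF assms(2)], where I=Basis and c="\<lambda>i. v \<bullet> i"]
    by (simp add: moll_d1_def sum_divide_distrib)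
qed

lemma moll_d2_expand:
  fixes f :: "'a::euclidean_space \<Rightarrow> real"
  assumes "continuous_on UNIV f" "0 < r"
  shows "moll_d2 f r u v y = (\<Sum>i\<in>Basis. (v \<bullet> i) * moll_d2 f r u i y)"
proof -
  have "bump_d2 r u v = (\<lambda>z. \<Sum>i\<in>Basis. (v \<bullet> i) * bump_d2 r u i z)"
    unfolding bump_d2_def
    by (subst (1 2) euclidean_inner[of _ v])
      (simp add: fun_eq_iff sum_distrib_left algebra_simps sum_subtractf sum.distrib)
  then show ?thesis
    using conv_linear_combination[OF assms(1) kernel_bump_d2[OF assms(2)], where I=Basis and c="\<lambda>i. v \<bullet> i"]
    by (simp add: moll_d2_def sum_divide_distrib)
qed

lemma abs_linear_combination_le:
  fixes v :: "'a::euclidean_space"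
  assumes "\<And>i. i \<in> Basis \<Longrightarrow> \<bar>c i\<bar> \<le> M i"
  shows "\<bar>\<Sum>i\<in>Basis. (v \<bullet> i) * c i\<bar> \<le> (\<Sum>i\<in>Basis. M i) * norm v"
proof -
  have "\<bar>\<Sum>i\<in>Basis. (v \<bullet> i) * c i\<bar> \<le> (\<Sum>i\<in>Basis. \<bar>(v \<bullet> i) * c i\<bar>)"
    by (rule sum_abs)
  also have "\<dots> \<le> (\<Sum>i\<in>Basis. M i * norm v)"
  proof (rule sum_mono)
    fix i :: 'a assume i: "i \<in> Basis"
    have "\<bar>v \<bullet> i\<bar> * \<bar>c i\<bar> \<le> norm v * M i"
      by (rule mult_mono) (use assms[OF i] Basis_le_norm[OF i] in auto)
    then show "\<bar>(v \<bullet> i) * c i\<bar> \<le> M i * norm v" by (simp add: abs_mult mult.commute)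
  qed
  finally show ?thesis by (simp add: sum_distrib_right)
qed

text \<open>The bound does not depend on the radius of the mollifier, so that it survives the limit
  \<open>r \<rightarrow> 0\<close>: in the integral the derivative is moved from the bump to \<open>f\<close>, and the weak derivative
  is essentially bounded.\<close>

lemma moll_d1_bound:
  fixes f :: "'a::euclidean_space \<Rightarrow> real"
  assumes f: "continuous_on UNIV f" and \<Omega>: "open \<Omega>" and W: "W_inf 1 \<Omega> f"
  obtains L where "0 \<le> L"
    "\<And>r y v. 0 < r \<Longrightarrow> cball y r \<subseteq> \<Omega> \<Longrightarrow> \<bar>moll_d1 f r v y\<bar> \<le> L * norm v"
proof -
  have "\<forall>i\<in>Basis. \<exists>M g. weak_partial \<Omega> i f g \<and> g \<in> borel_measurable (lebesgue_on \<Omega>) \<and>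
      (AE x in lebesgue_on \<Omega>. \<bar>g x\<bar> \<le> M)"
    using W by (fastforce simp: L_inf_def)
  then obtain M g where g: "\<And>i. i \<in> Basis \<Longrightarrow> weak_partial \<Omega> i f (g i) \<and>
      g i \<in> borel_measurable (lebesgue_on \<Omega>) \<and> (AE x in lebesgue_on \<Omega>. \<bar>g i x\<bar> \<le> M i)"
    by metis
  have b: "\<bar>moll_d1 f r i y\<bar> \<le> \<bar>M i\<bar>" if i: "i \<in> Basis" and r: "0 < r" "cball y r \<subseteq> \<Omega>" for i y r
  proof -
    have "conv f (bump_d1 r i) y = (LINT x|lebesgue_on \<Omega>. f x * bump_d1 r i (y - x))"
      by (rule ball_kernel.conv_eq_LINT[OF kernel_bump_d1[OF r(1)] f _ r(2)]) (use \<Omega> in \<open>auto intro: borel_open\<close>)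
    also have "\<dots> = (LINT x|lebesgue_on \<Omega>. g i x * bump 0 r (y - x))"
      using g[OF i] r by (intro weak_partial_reflected[where r=r] C_k_on_bump kernel_bump bump_0_has_derivative) auto
    finally have "\<bar>conv f (bump_d1 r i) y\<bar> \<le> M i * mass TYPE('a) r"
      using conv_bump_bound[OF r(1) \<Omega> r(2)] g[OF i] by simp
    also have "\<dots> \<le> \<bar>M i\<bar> * mass TYPE('a) r"
      using mass_pos[OF r(1), where 'a='a] by (intro mult_right_mono) auto
    finally show ?thesis
      using mass_pos[OF r(1), where 'a='a] by (simp add: moll_d1_def divide_le_eq abs_divide)
  qed
  show ?thesis
  proof (rule that[of "\<Sum>i\<in>Basis. \<bar>M i\<bar>"])
    show "\<bar>moll_d1 f r v y\<bar> \<le> (\<Sum>i\<in>Basis. \<bar>M i\<bar>) * norm v" if "0 < r" "cball y r \<subseteq> \<Omega>" for r v y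
      unfolding moll_d1_expand[OF f that(1), of v] using b that by (intro abs_linear_combination_le) auto
  qed (simp add: sum_nonneg)
qed

lemma moll_d2_bound:
  fixes f :: "'a::euclidean_space \<Rightarrow> real"
  assumes f: "continuous_on UNIV f" and \<Omega>: "open \<Omega>" and W: "W_inf 2 \<Omega> f"
  obtains L where "0 \<le> L"
    "\<And>r y i v. 0 < r \<Longrightarrow> cball y r \<subseteq> \<Omega> \<Longrightarrow> i \<in> Basis \<Longrightarrow> \<bar>moll_d2 f r i v y\<bar> \<le> L * norm v"
proof -
  have "\<forall>j\<in>Basis. \<forall>i\<in>Basis. \<exists>M g h. weak_partial \<Omega> j f g \<and> weak_partial \<Omega> i g h \<and>
      h \<in> borel_measurable (lebesgue_on \<Omega>) \<and> (AE x in lebesgue_on \<Omega>. \<bar>h x\<bar> \<le> M)"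
    using W by (fastforce simp: L_inf_def numeral_2_eq_2)
  then obtain M g h where g: "\<And>i j. i \<in> Basis \<Longrightarrow> j \<in> Basis \<Longrightarrow> weak_partial \<Omega> j f (g j i) \<and>
      weak_partial \<Omega> i (g j i) (h j i) \<and>
      h j i \<in> borel_measurable (lebesgue_on \<Omega>) \<and> (AE x in lebesgue_on \<Omega>. \<bar>h j i x\<bar> \<le> M j i)"
    by metis
  have b: "\<bar>moll_d2 f r i j y\<bar> \<le> \<bar>M j i\<bar>"
    if i: "i \<in> Basis" "j \<in> Basis" and r: "0 < r" "cball y r \<subseteq> \<Omega>" for i j y r
  proof -
    have "conv f (bump_d2 r i j) y = (LINT x|lebesgue_on \<Omega>. f x * bump_d2 r i j (y - x))"
      by (rule ball_kernel.conv_eq_LINT[OF kernel_bump_d2[OF r(1)] f _ r(2)]) (use \<Omega> in \<open>auto intro: borel_open\<close>)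
    also have "\<dots> = (LINT x|lebesgue_on \<Omega>. g j i x * bump_d1 r i (y - x))"
      using g[OF i] r by (intro weak_partial_reflected[where r=r] C_k_on_bump_d1 kernel_bump_d1 bump_d1_has_derivative) auto
    also have "\<dots> = (LINT x|lebesgue_on \<Omega>. h j i x * bump 0 r (y - x))"
      using g[OF i] r by (intro weak_partial_reflected[where r=r] C_k_on_bump kernel_bump bump_0_has_derivative) auto
    finally have "\<bar>conv f (bump_d2 r i j) y\<bar> \<le> M j i * mass TYPE('a) r"
      using conv_bump_bound[OF r(1) \<Omega> r(2)] g[OF i] by simp
    also have "\<dots> \<le> \<bar>M j i\<bar> * mass TYPE('a) r"
      using mass_pos[OF r(1), where 'a='a] by (intro mult_right_mono) auto
    finally show ?thesis
      using mass_pos[OF r(1), where 'a='a] by (simp add: moll_d2_def divide_le_eq abs_divide)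
  qed
  show ?thesis
  proof (rule that[of "\<Sum>i\<in>Basis. \<Sum>j\<in>Basis. \<bar>M j i\<bar>"])
    show "\<bar>moll_d2 f r i v y\<bar> \<le> (\<Sum>i\<in>Basis. \<Sum>j\<in>Basis. \<bar>M j i\<bar>) * norm v"
      if "0 < r" "cball y r \<subseteq> \<Omega>" "i \<in> Basis" for r y i v
    proof -
      have "\<bar>moll_d2 f r i v y\<bar> \<le> (\<Sum>j\<in>Basis. \<bar>M j i\<bar>) * norm v"
        unfolding moll_d2_expand[OF f that(1), of i v] using b that by (intro abs_linear_combination_le) auto
      also have "\<dots> \<le> (\<Sum>i\<in>Basis. \<Sum>j\<in>Basis. \<bar>M j i\<bar>) * norm v"
        using member_le_sum[of i Basis "\<lambda>i. \<Sum>j\<in>Basis. \<bar>M j i\<bar>"] that(3)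
        by (intro mult_right_mono) (auto simp: sum_nonneg)
      finally show ?thesis .
    qed
  qed (simp add: sum_nonneg)
qed

lemma moll_close:
  fixes f :: "'a::euclidean_space \<Rightarrow> real"
  assumes f: "continuous_on UNIV f" and r: "0 < r" and e: "\<And>x. x \<in> cball y r \<Longrightarrow> \<bar>f x - f y\<bar> \<le> e"
  shows "\<bar>moll f r y - f y\<bar> \<le> e"
proof -
  interpret ball_kernel "bump 0 r :: 'a \<Rightarrow> real" r by (rule kernel_bump[OF r])
  have int: "integrable lebesgue (\<lambda>x. g x * bump 0 r (y - x))" if "continuous_on UNIV g" for g
    using conv_integrable[OF that, of UNIV] by (simp add: lebesgue_on_UNIV_eq)
  have "conv f (bump 0 r) y - f y * conv (\<lambda>_. 1) (bump 0 r) y = conv (\<lambda>x. f x - f y) (bump 0 r) y"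
    using int[OF f] int[of "\<lambda>_. 1"] by (simp add: conv_def algebra_simps)
  also have "\<bar>\<dots>\<bar> \<le> conv (\<lambda>_. e) (bump 0 r) y"
    unfolding conv_def
  proof (rule integral_abs_bound_integral)
    show "\<bar>(f x - f y) * bump 0 r (y - x)\<bar> \<le> e * bump 0 r (y - x)" for x
      using e[of x] outside_reflected[of x y]
      by (cases "x \<in> cball y r") (auto simp: abs_mult bump_nonneg intro!: mult_right_mono)
  qed (intro int continuous_intros f)+
  also have "\<dots> = e * conv (\<lambda>_. 1) (bump 0 r) y"
    by (simp add: conv_def)
  finally show ?thesis
    using mass_pos[OF r, where 'a='a] unfolding conv_one[OF r]
    by (simp add: moll_def field_simps abs_le_iff)
qed

lemma moll_tendsto:
  fixes f :: "'a::euclidean_space \<Rightarrow> real"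
  assumes f: "continuous_on UNIV f"
  shows "((\<lambda>r. moll f r y) \<longlongrightarrow> f y) (at_right 0)"
proof (rule tendstoI)
  fix e :: real assume e: "0 < e"
  then obtain d where d: "0 < d" "\<And>x. dist x y < d \<Longrightarrow> dist (f x) (f y) < e / 2"
    using f unfolding continuous_on_iff by (metis UNIV_I half_gt_zero)
  show "\<forall>\<^sub>F r in at_right 0. dist (moll f r y) (f y) < e"
    using eventually_at_right_less[of 0] eventually_at_right_real[OF d(1)]
  proof eventually_elim
    case (elim r)
    then have "\<bar>moll f r y - f y\<bar> \<le> e / 2"
      using d(2) by (intro moll_close[OF f]) (auto simp: dist_norm norm_minus_commute intro: less_imp_le)
    then show ?case using e by (simp add: dist_norm)
  qed
qed

lemma eventually_cball_subset:
  fixes K :: "'a::heine_borel set"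
  assumes "compact K" "open \<Omega>" "K \<subseteq> \<Omega>"
  shows "\<forall>\<^sub>F r in at_right 0. \<forall>y\<in>K. cball y r \<subseteq> \<Omega>"
proof -
  obtain e where e: "0 < e" "(\<Union>x\<in>K. ball x e) \<subseteq> \<Omega>"
    using compact_subset_open_imp_ball_epsilon_subset[OF assms] by blast
  show ?thesis
    using eventually_at_right_real[OF e(1)]
  proof eventually_elim
    case (elim r)
    then show ?case using e(2) by (fastforce simp: subset_iff)
  qed
qed

lemma difference_bound:
  fixes F :: "real \<Rightarrow> real"
  assumes d: "\<And>s. s \<in> {0..1} \<Longrightarrow> (F has_real_derivative F' s) (at s)"
    and B: "\<And>s. s \<in> {0..1} \<Longrightarrow> \<bar>F' s\<bar> \<le> B"
  shows "\<bar>F 1 - F 0\<bar> \<le> B"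
  using field_differentiable_bound[of "{0..1}" F F' B 1 0] d B
  by (auto intro: has_field_derivative_at_within)

lemma moll_diff_bound:
  assumes f: "continuous_on UNIV f" and r: "0 < r"
    and B: "\<And>z. z \<in> closed_segment p q \<Longrightarrow> \<bar>moll_d1 f r (q - p) z\<bar> \<le> B"
  shows "\<bar>moll f r q - moll f r p\<bar> \<le> B"
proof -
  have "\<bar>moll f r (p + 1 *\<^sub>R (q - p)) - moll f r (p + 0 *\<^sub>R (q - p))\<bar> \<le> B"
    by (rule difference_bound[OF moll_has_derivative[OF f r]])
      (rule B, auto simp: in_segment algebra_simps)
  then show ?thesis by simp
qed

lemma moll_d1_diff_bound:
  assumes f: "continuous_on UNIV f" and r: "0 < r"
    and B: "\<And>z. z \<in> closed_segment p q \<Longrightarrow> \<bar>moll_d2 f r u (q - p) z\<bar> \<le> B"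
  shows "\<bar>moll_d1 f r u q - moll_d1 f r u p\<bar> \<le> B"
proof -
  have "\<bar>moll_d1 f r u (p + 1 *\<^sub>R (q - p)) - moll_d1 f r u (p + 0 *\<^sub>R (q - p))\<bar> \<le> B"
    by (rule difference_bound[OF moll_d1_has_derivative[OF f r]])
      (rule B, auto simp: in_segment algebra_simps)
  then show ?thesis by simp
qed

text \<open>The mollified functions are Lipschitz on \<open>\<Omega>\<close> with a constant independent of the radius,
  and they converge pointwise to \<open>f\<close>.\<close>

theorem W1_Lipschitz:
  fixes f :: "'a::euclidean_space \<Rightarrow> real"
  assumes f: "continuous_on UNIV f" and \<Omega>: "open \<Omega>" "convex \<Omega>" and W: "W_inf 1 \<Omega> f"
  obtains L where "0 \<le> L" "\<And>p q. p \<in> \<Omega> \<Longrightarrow> q \<in> \<Omega> \<Longrightarrow> \<bar>f q - f p\<bar> \<le> L * norm (q - p)"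
proof -
  obtain L where L: "0 \<le> L"
    "\<And>r y v. 0 < r \<Longrightarrow> cball y r \<subseteq> \<Omega> \<Longrightarrow> \<bar>moll_d1 f r v y\<bar> \<le> L * norm v"
    using moll_d1_bound[OF f \<Omega>(1) W] by metis
  have "\<bar>f q - f p\<bar> \<le> L * norm (q - p)" if pq: "p \<in> \<Omega>" "q \<in> \<Omega>" for p q
  proof (rule tendsto_upperbound)
    show "((\<lambda>r. \<bar>moll f r q - moll f r p\<bar>) \<longlongrightarrow> \<bar>f q - f p\<bar>) (at_right 0)"
      by (intro tendsto_intros moll_tendsto f)
    have "\<forall>\<^sub>F r in at_right 0. \<forall>y\<in>closed_segment p q. cball y r \<subseteq> \<Omega>"
      using closed_segment_subset[OF pq \<Omega>(2)] \<Omega>(1) by (intro eventually_cball_subset) auto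
    with eventually_at_right_less[of 0]
    show "\<forall>\<^sub>F r in at_right 0. \<bar>moll f r q - moll f r p\<bar> \<le> L * norm (q - p)"
      by eventually_elim (auto intro!: moll_diff_bound[OF f] L)
  qed simp
  then show ?thesis using that L(1) by blast
qed

text \<open>A quantitative form of \<open>C\<^sup>1\<^sup>,\<^sup>1\<close> regularity which mentions no derivative of \<open>f\<close>: difference
  quotients in a coordinate direction are close to each other. For a mollified function the
  quotient over a step \<open>h\<close> is within \<open>L \<bar>h\<bar>\<close> of the derivative, which is Lipschitz, with \<open>L\<close>
  independent of the radius; the estimate passes to the limit.\<close>

theorem W2_difference_quotients:
  fixes f :: "'a::euclidean_space \<Rightarrow> real"
  assumes f: "continuous_on UNIV f" and \<Omega>: "open \<Omega>" "convex \<Omega>" and W: "W_inf 2 \<Omega> f"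
  obtains L where "0 \<le> L"
    "\<And>i p q h k. i \<in> Basis \<Longrightarrow> h \<noteq> 0 \<Longrightarrow> k \<noteq> 0 \<Longrightarrow> p \<in> \<Omega> \<Longrightarrow> p + h *\<^sub>R i \<in> \<Omega> \<Longrightarrow>
      q \<in> \<Omega> \<Longrightarrow> q + k *\<^sub>R i \<in> \<Omega> \<Longrightarrow>
      \<bar>(f (p + h *\<^sub>R i) - f p) / h - (f (q + k *\<^sub>R i) - f q) / k\<bar> \<le> L * (\<bar>h\<bar> + \<bar>k\<bar> + norm (q - p))"
proof -
  obtain L where L: "0 \<le> L"
    "\<And>r y i v. 0 < r \<Longrightarrow> cball y r \<subseteq> \<Omega> \<Longrightarrow> i \<in> Basis \<Longrightarrow> \<bar>moll_d2 f r i v y\<bar> \<le> L * norm v"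
    using moll_d2_bound[OF f \<Omega>(1) W] by metis
  have quot: "\<bar>(moll f r (p + h *\<^sub>R i) - moll f r p) / h - moll_d1 f r i p\<bar> \<le> L * \<bar>h\<bar>"
    if i: "i \<in> Basis" and h: "h \<noteq> 0" and r: "0 < r"
      and sub: "\<And>y. y \<in> closed_segment p (p + h *\<^sub>R i) \<Longrightarrow> cball y r \<subseteq> \<Omega>" for i p h r
  proof -
    define F where "F s = moll f r (p + (h * s) *\<^sub>R i) - (h * s) * moll_d1 f r i p" for s
    have "\<bar>F 1 - F 0\<bar> \<le> \<bar>h\<bar> * (L * \<bar>h\<bar>)"
    proof (rule difference_bound)
      show "(F has_real_derivative (moll_d1 f r i (p + (h * s) *\<^sub>R i) * h - h * moll_d1 f r i p)) (at s)" for s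
        unfolding F_def
        by (intro DERIV_diff DERIV_chain2[OF moll_has_derivative[OF f r, of p i]])
          (auto intro!: derivative_eq_intros)
      fix s :: real assume s: "s \<in> {0..1}"
      have "closed_segment p (p + (h * s) *\<^sub>R i) \<subseteq> closed_segment p (p + h *\<^sub>R i)"
        using s by (intro subset_closed_segment[THEN iffD2]) (auto simp: in_segment algebra_simps)
      then have "\<bar>moll_d1 f r i (p + (h * s) *\<^sub>R i) - moll_d1 f r i p\<bar> \<le> L * norm (p + (h * s) *\<^sub>R i - p)"
        using sub i r by (intro moll_d1_diff_bound[OF f r] L) auto
      also have "\<dots> \<le> L * \<bar>h\<bar>"
        using s i L(1) mult_left_le[of "\<bar>s\<bar>" "\<bar>h\<bar>"] by (intro mult_left_mono) (auto simp: abs_mult)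
      finally have "\<bar>h\<bar> * \<bar>moll_d1 f r i (p + (h * s) *\<^sub>R i) - moll_d1 f r i p\<bar> \<le> \<bar>h\<bar> * (L * \<bar>h\<bar>)"
        by (intro mult_left_mono) auto
      then show "\<bar>moll_d1 f r i (p + (h * s) *\<^sub>R i) * h - h * moll_d1 f r i p\<bar> \<le> \<bar>h\<bar> * (L * \<bar>h\<bar>)"
        by (simp flip: abs_mult) (simp add: algebra_simps)
    qed
    then have "\<bar>moll f r (p + h *\<^sub>R i) - moll f r p - h * moll_d1 f r i p\<bar> / \<bar>h\<bar> \<le> L * \<bar>h\<bar>"
      using h by (simp add: F_def divide_le_eq mult.commute algebra_simps)
    moreover have "\<bar>moll f r (p + h *\<^sub>R i) - moll f r p - h * moll_d1 f r i p\<bar> / \<bar>h\<bar>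
      = \<bar>(moll f r (p + h *\<^sub>R i) - moll f r p) / h - moll_d1 f r i p\<bar>"
      using h by (simp flip: abs_divide) (simp add: diff_divide_distrib)
    ultimately show ?thesis by simp
  qed
  have "\<bar>(f (p + h *\<^sub>R i) - f p) / h - (f (q + k *\<^sub>R i) - f q) / k\<bar> \<le> L * (\<bar>h\<bar> + \<bar>k\<bar> + norm (q - p))"
    if i: "i \<in> Basis" and hk: "h \<noteq> 0" "k \<noteq> 0"
      and p: "p \<in> \<Omega>" "p + h *\<^sub>R i \<in> \<Omega>" and q: "q \<in> \<Omega>" "q + k *\<^sub>R i \<in> \<Omega>" for i p q h k
  proof (rule tendsto_upperbound)
    let ?D = "\<lambda>r p h. (moll f r (p + h *\<^sub>R i) - moll f r p) / h"
    show "((\<lambda>r. \<bar>?D r p h - ?D r q k\<bar>) \<longlongrightarrow> \<bar>(f (p + h *\<^sub>R i) - f p) / h - (f (q + k *\<^sub>R i) - f q) / k\<bar>) (at_right 0)"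
      by (intro tendsto_intros moll_tendsto f hk)
    let ?K = "closed_segment p (p + h *\<^sub>R i) \<union> closed_segment q (q + k *\<^sub>R i) \<union> closed_segment p q"
    have "\<forall>\<^sub>F r in at_right 0. \<forall>y\<in>?K. cball y r \<subseteq> \<Omega>"
      using closed_segment_subset[OF p \<Omega>(2)] closed_segment_subset[OF q \<Omega>(2)]
        closed_segment_subset[OF p(1) q(1) \<Omega>(2)] \<Omega>(1)
      by (intro eventually_cball_subset compact_Un compact_segment) auto
    with eventually_at_right_less[of 0]
    show "\<forall>\<^sub>F r in at_right 0. \<bar>?D r p h - ?D r q k\<bar> \<le> L * (\<bar>h\<bar> + \<bar>k\<bar> + norm (q - p))"
    proof eventually_elim
      case (elim r)
      have "\<bar>?D r p h - moll_d1 f r i p\<bar> \<le> L * \<bar>h\<bar>" "\<bar>?D r q k - moll_d1 f r i q\<bar> \<le> L * \<bar>k\<bar>"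
        using elim i hk by (auto intro!: quot)
      moreover have "\<bar>moll_d1 f r i q - moll_d1 f r i p\<bar> \<le> L * norm (q - p)"
        using elim i by (intro moll_d1_diff_bound[OF f] L) auto
      ultimately show ?case by (simp add: distrib_left)
    qed
  qed simp
  then show ?thesis using that L(1) by blast
qed

section \<open>Continuous representatives on the slab\<close>

text \<open>Constant extension in time beyond \<open>0\<close> and \<open>T\<close>. It makes the data continuous on the
  whole space, as the mollification lemmas require, and changes nothing on the slab.\<close>

definition slab_ext :: "real \<Rightarrow> (spacetime \<Rightarrow> 'b) \<Rightarrow> spacetime \<Rightarrow> 'b" where
  "slab_ext T f p = f (max 0 (min T (fst p)), snd p)"

lemma slab_ext_eq: "p \<in> closed_slab T \<Longrightarrow> slab_ext T f p = f p"
  by (auto simp: slab_ext_def closed_slab_def max_def min_def)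

lemma open_slab_subset: "open_slab T \<subseteq> closed_slab T"
  by (auto simp: open_slab_def closed_slab_def)

lemma slab_ext_eq_open: "p \<in> open_slab T \<Longrightarrow> slab_ext T f p = f p"
  using open_slab_subset slab_ext_eq by blast

lemma continuous_slab_ext:
  assumes "0 < T" "continuous_on (closed_slab T) f"
  shows "continuous_on UNIV (slab_ext T f)"
  unfolding slab_ext_def[abs_def]
  by (rule continuous_on_compose2[OF assms(2)])
    (use assms(1) in \<open>auto simp: closed_slab_def intro!: continuous_intros\<close>)

lemma open_open_slab: "open (open_slab T)"
  by (simp add: open_slab_def open_Times)

lemma convex_open_slab: "convex (open_slab T)"
  by (simp add: open_slab_def convex_Times)

lemma closure_open_slab: "0 < T \<Longrightarrow> closure (open_slab T) = closed_slab T"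
  by (simp add: open_slab_def closed_slab_def closure_Times)

lemma locally_integrable_cong:
  assumes "locally_integrable \<Omega> f" "\<And>x. x \<in> \<Omega> \<Longrightarrow> f x = g x"
  shows "locally_integrable \<Omega> g"
  unfolding locally_integrable_def
proof (intro allI impI)
  fix K assume K: "compact K \<and> K \<subseteq> \<Omega>"
  then have "integrable (lebesgue_on K) f" using assms(1) by (auto simp: locally_integrable_def)
  moreover have "integrable (lebesgue_on K) f \<longleftrightarrow> integrable (lebesgue_on K) g"
    using K assms(2) by (intro Bochner_Integration.integrable_cong) auto
  ultimately show "integrable (lebesgue_on K) g" by simp
qed

lemma weak_partial_cong:
  assumes w: "weak_partial \<Omega> i f g" and eq: "\<And>x. x \<in> \<Omega> \<Longrightarrow> f x = f' x"
  shows "weak_partial \<Omega> i f' g"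
proof -
  have "(LINT x|lebesgue_on \<Omega>. f' x * h x) = (LINT x|lebesgue_on \<Omega>. f x * h x)" for h
    using eq by (intro Bochner_Integration.integral_cong) auto
  then show ?thesis using w locally_integrable_cong[of \<Omega> f f'] eq by (auto simp: weak_partial_def)
qed

lemma W_inf_cong:
  assumes w: "W_inf k \<Omega> f" and eq: "\<And>x. x \<in> \<Omega> \<Longrightarrow> f x = f' x"
  shows "W_inf k \<Omega> f'"
proof -
  have L: "L_inf \<Omega> f \<Longrightarrow> L_inf \<Omega> f'"
  proof -
    assume L: "L_inf \<Omega> f"
    have "f' \<in> borel_measurable (lebesgue_on \<Omega>) \<longleftrightarrow> f \<in> borel_measurable (lebesgue_on \<Omega>)"
      using eq by (intro measurable_cong) auto
    moreover have "(AE x in lebesgue_on \<Omega>. \<bar>f' x\<bar> \<le> M) \<longleftrightarrow> (AE x in lebesgue_on \<Omega>. \<bar>f x\<bar> \<le> M)" for M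
      using eq by (intro AE_cong) auto
    ultimately show ?thesis using L by (simp add: L_inf_def)
  qed
  have "weak_partial \<Omega> i f' g" if "weak_partial \<Omega> i f g" for i g
    using weak_partial_cong[OF that] eq by blast
  then show ?thesis
    using w L by (cases k) (simp, simp, blast)
qed

lemma locally_integrable_continuous:
  fixes f :: "'a::euclidean_space \<Rightarrow> real"
  assumes "continuous_on UNIV f" shows "locally_integrable \<Omega> f"
  unfolding locally_integrable_def
proof (intro allI impI)
  fix K :: "'a set" assume K: "compact K \<and> K \<subseteq> \<Omega>"
  obtain a b where ab: "K \<subseteq> cbox a b"
    using bounded_subset_cbox_symmetric K compact_imp_bounded by metis
  have "integrable (lebesgue_on (cbox a b)) f"
    by (rule continuous_imp_integrable, rule continuous_on_subset[OF assms], rule subset_UNIV)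
  then have "set_integrable lebesgue (cbox a b) f"
    by (simp add: set_integrable_def integrable_restrict_space)
  then have "set_integrable lebesgue K f"
    by (rule set_integrable_subset[OF _ _ ab]) (use K lmeasurable_compact fmeasurableD in blast)
  then show "integrable (lebesgue_on K) f"
    using K lmeasurable_compact[of K] by (simp add: set_integrable_def integrable_restrict_space fmeasurableD)
qed

lemma L_inf_bound:
  fixes f :: "'a::euclidean_space \<Rightarrow> real"
  assumes f: "continuous_on UNIV f" and \<Omega>: "open \<Omega>" and L: "L_inf \<Omega> f"
  obtains M where "\<And>y. y \<in> \<Omega> \<Longrightarrow> \<bar>f y\<bar> \<le> M"
proof -
  obtain M where M: "f \<in> borel_measurable (lebesgue_on \<Omega>)" "AE x in lebesgue_on \<Omega>. \<bar>f x\<bar> \<le> M"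
    using L by (auto simp: L_inf_def)
  have "\<bar>f y\<bar> \<le> M" if y: "y \<in> \<Omega>" for y
  proof (rule tendsto_upperbound)
    show "((\<lambda>r. \<bar>moll f r y\<bar>) \<longlongrightarrow> \<bar>f y\<bar>) (at_right 0)"
      by (intro tendsto_intros moll_tendsto f)
    have "\<forall>\<^sub>F r in at_right 0. \<forall>y\<in>{y}. cball y r \<subseteq> \<Omega>"
      using y by (intro eventually_cball_subset \<Omega>) auto
    with eventually_at_right_less[of 0]
    show "\<forall>\<^sub>F r in at_right 0. \<bar>moll f r y\<bar> \<le> M"
    proof eventually_elim
      case (elim r)
      have "conv f (bump 0 r) y = (LINT x|lebesgue_on \<Omega>. f x * bump 0 r (y - x))"
        using elim \<Omega> by (intro ball_kernel.conv_eq_LINT[OF kernel_bump f]) (auto intro: borel_open)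
      then show ?case
        using conv_bump_bound[OF elim(1) \<Omega> _ M, of y] elim mass_pos[OF elim(1), where 'a='a]
        by (simp add: moll_def abs_divide divide_le_eq)
    qed
  qed simp
  then show ?thesis using that by blast
qed

lemma slab_bound_closure:
  assumes "0 < T" "continuous_on (closed_slab T) u" "\<And>p. p \<in> open_slab T \<Longrightarrow> u p \<le> (M::real)" "p \<in> closed_slab T"
  shows "u p \<le> M"
  using continuous_le_on_closure[of "open_slab T" u p M] assms closure_open_slab by metis

lemma electric_bounded:
  assumes T: "0 < T" and E: "electric_field T \<phi> E"
  obtains M where "\<And>p. p \<in> closed_slab T \<Longrightarrow> norm (E p) \<le> M"
proof -
  have cE: "continuous_on (closed_slab T) E" using E by (simp add: electric_field_def)
  have "\<exists>M. \<forall>p\<in>closed_slab T. \<bar>E p $ i\<bar> \<le> M" for i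
  proof -
    have W: "W_inf 1 (open_slab T) (\<lambda>p. E p $ i)" using E by (simp add: electric_field_def)
    have c: "continuous_on (closed_slab T) (\<lambda>p. E p $ i)" by (intro continuous_intros cE)
    have "L_inf (open_slab T) (slab_ext T (\<lambda>p. E p $ i))"
      using W_inf_cong[OF W, of "slab_ext T (\<lambda>p. E p $ i)"]
      by (simp add: slab_ext_eq_open)
    then obtain M where M: "\<And>y. y \<in> open_slab T \<Longrightarrow> \<bar>slab_ext T (\<lambda>p. E p $ i) y\<bar> \<le> M"
      by (rule L_inf_bound[OF continuous_slab_ext[OF T c] open_open_slab]) (rule that)
    have "\<bar>E p $ i\<bar> \<le> M" if "p \<in> closed_slab T" for p
      by (rule slab_bound_closure[OF T _ _ that, of "\<lambda>p. \<bar>E p $ i\<bar>"])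
        (use M in \<open>auto intro!: continuous_intros cE simp: slab_ext_eq_open\<close>)
    then show ?thesis by blast
  qed
  then obtain M where M: "\<And>i p. p \<in> closed_slab T \<Longrightarrow> \<bar>E p $ i\<bar> \<le> M i" by metis
  have "norm (E p) \<le> (\<Sum>i\<in>UNIV. M i)" if "p \<in> closed_slab T" for p
    using order_trans[OF norm_le_l1_cart[of "E p"] sum_mono[of UNIV "\<lambda>i. \<bar>E p $ i\<bar>" M, OF M[OF that]]] .
  then show ?thesis using that by blast
qed

text \<open>Perpendicular velocities will be of size \<open>O(\<epsilon>)\<close>, so that by this estimate \<open>\<chi>\<close> returns the
  energy up to \<open>O(\<epsilon>)\<close>.\<close>

lemma chi_Lipschitz:
  fixes chi :: "real \<times> vec3 \<Rightarrow> real"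
  assumes "admissible_chi chi"
  obtains L where "0 \<le> L" "\<And>e w. \<bar>e\<bar> \<le> R \<Longrightarrow> norm w \<le> R \<Longrightarrow> \<bar>chi (e, w) - chi (e, 0)\<bar> \<le> L * norm w"
proof -
  have W: "W_inf 1 (ball 0 (2 * R + 1)) chi" and c: "continuous_on UNIV chi"
    using assms by (auto simp: admissible_chi_def W_inf_loc_def)
  obtain L where L: "0 \<le> L"
    "\<And>p q. p \<in> ball 0 (2 * R + 1) \<Longrightarrow> q \<in> ball 0 (2 * R + 1) \<Longrightarrow> \<bar>chi q - chi p\<bar> \<le> L * norm (q - p)"
    by (rule W1_Lipschitz[OF c open_ball convex_ball W]) (rule that)
  have "\<bar>chi (e, w) - chi (e, 0)\<bar> \<le> L * norm w" if "\<bar>e\<bar> \<le> R" "norm w \<le> R" for e w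
  proof -
    have "norm (e, w) < 2 * R + 1" using norm_Pair_le[of e w] that by simp
    moreover have "norm (e, 0::vec3) < 2 * R + 1" using that by simp
    ultimately show ?thesis using L(2)[of "(e, 0)" "(e, w)"] by simp
  qed
  then show ?thesis using that L(1) by blast
qed

section \<open>The magnetic intensity is continuously differentiable in space\<close>

text \<open>Moves a point of the closed slab into the open one, along the time axis. Estimates on the
  open slab, where the weak derivatives live, then extend to the times \<open>0\<close> and \<open>T\<close> by continuity.\<close>

definition shrink :: "real \<Rightarrow> real \<Rightarrow> spacetime \<Rightarrow> spacetime" where
  "shrink T d p = ((1 - d) * fst p + d * (T / 2), snd p)"

lemma shrink_mem:
  assumes "0 < T" "p \<in> closed_slab T" "0 < d" "d < 1" shows "shrink T d p \<in> open_slab T"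
proof -
  have t: "0 \<le> fst p" "fst p \<le> T" using assms(2) by (auto simp: closed_slab_def)
  have "0 \<le> (1 - d) * fst p" "(1 - d) * fst p \<le> (1 - d) * T" "0 < d * (T / 2)"
    using t assms by (auto intro!: mult_nonneg_nonneg mult_left_mono)
  moreover have "(1 - d) * T + d * (T / 2) < T"
    using assms by (simp add: algebra_simps)
  ultimately show ?thesis by (auto simp: shrink_def open_slab_def)
qed

lemma shrink_tendsto: "((\<lambda>d. shrink T d p) \<longlongrightarrow> p) (at_right 0)"
  unfolding shrink_def by (rule tendsto_eq_intros refl | simp)+

lemma shrink_add: "shrink T d (p + (0, w)) = shrink T d p + (0, w)"
  by (simp add: shrink_def)

lemma eventually_shrink:
  assumes "0 < T" "p \<in> closed_slab T"
  shows "\<forall>\<^sub>F d in at_right 0. shrink T d p \<in> open_slab T"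
  using eventually_at_right_real[OF zero_less_one]
  by eventually_elim (auto intro: shrink_mem assms)

lemma continuous_shrink_tendsto:
  assumes "continuous_on UNIV f"
  shows "((\<lambda>d. f (shrink T d p)) \<longlongrightarrow> f p) (at_right 0)"
  using continuous_on_tendsto_compose[OF assms shrink_tendsto] by simp

lemma difference_quotient_limit:
  fixes d :: "real \<Rightarrow> real"
  assumes L: "\<And>h k. h \<noteq> 0 \<Longrightarrow> k \<noteq> 0 \<Longrightarrow> \<bar>d h - d k\<bar> \<le> L * (\<bar>h\<bar> + \<bar>k\<bar>)"
  obtains G where "\<And>h. h \<noteq> 0 \<Longrightarrow> \<bar>d h - G\<bar> \<le> L * \<bar>h\<bar>" "(d \<longlongrightarrow> G) (at 0)"
proof -
  have "0 \<le> L" using L[of 1 1] by simp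
  let ?u = "\<lambda>n. d (inverse (real (Suc n)))"
  have u0: "(\<lambda>n. inverse (real (Suc n))) \<longlonglongrightarrow> 0" by (rule LIMSEQ_inverse_real_of_nat)
  have "Cauchy ?u"
  proof (rule metric_CauchyI)
    fix e :: real assume e: "0 < e"
    then have "\<forall>\<^sub>F n in sequentially. inverse (real (Suc n)) < e / (2 * (L + 1))"
      using order_tendstoD(2)[OF u0, of "e / (2 * (L + 1))"] \<open>0 \<le> L\<close> by simp
    then obtain N where N: "\<And>n. n \<ge> N \<Longrightarrow> inverse (real (Suc n)) < e / (2 * (L + 1))"
      by (auto simp: eventually_sequentially)
    have "dist (?u m) (?u n) < e" if "m \<ge> N" "n \<ge> N" for m n
    proof -
      have "\<bar>?u m - ?u n\<bar> \<le> L * (inverse (real (Suc m)) + inverse (real (Suc n)))"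
        using L[of "inverse (real (Suc m))" "inverse (real (Suc n))"] by simp
      also have "\<dots> \<le> (L + 1) * (inverse (real (Suc m)) + inverse (real (Suc n)))"
        by (intro mult_right_mono) auto
      also have "\<dots> < (L + 1) * (e / (2 * (L + 1)) + e / (2 * (L + 1)))"
        using N[OF that(1)] N[OF that(2)] \<open>0 \<le> L\<close> by (intro mult_strict_left_mono add_strict_mono) auto
      also have "\<dots> = e" using \<open>0 \<le> L\<close> by (simp add: divide_simps)
      finally show ?thesis by (simp add: dist_real_def)
    qed
    then show "\<exists>N. \<forall>m\<ge>N. \<forall>n\<ge>N. dist (?u m) (?u n) < e" by blast
  qed
  then obtain G where G: "?u \<longlonglongrightarrow> G" by (auto simp: Cauchy_convergent_iff convergent_def)
  have b: "\<bar>d h - G\<bar> \<le> L * \<bar>h\<bar>" if h: "h \<noteq> 0" for h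
  proof (rule LIMSEQ_le)
    show "(\<lambda>n. \<bar>d h - ?u n\<bar>) \<longlonglongrightarrow> \<bar>d h - G\<bar>" by (intro tendsto_intros G)
    show "(\<lambda>n. L * (\<bar>h\<bar> + \<bar>inverse (real (Suc n))\<bar>)) \<longlonglongrightarrow> L * \<bar>h\<bar>"
      by (rule tendsto_eq_intros u0 refl | simp)+
    show "\<exists>N. \<forall>n\<ge>N. \<bar>d h - ?u n\<bar> \<le> L * (\<bar>h\<bar> + \<bar>inverse (real (Suc n))\<bar>)"
    proof (intro exI allI impI)
      show "\<bar>d h - ?u n\<bar> \<le> L * (\<bar>h\<bar> + \<bar>inverse (real (Suc n))\<bar>)" for n
        by (rule L[OF h]) simp
    qed
  qed
  have "((\<lambda>h. d h - G) \<longlongrightarrow> 0) (at 0)"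
  proof (rule Lim_null_comparison)
    show "\<forall>\<^sub>F h in at 0. norm (d h - G) \<le> L * \<bar>h\<bar>"
      using b by (auto simp: eventually_at_filter)
    show "((\<lambda>h. L * \<bar>h\<bar>) \<longlongrightarrow> 0) (at 0)" by (rule tendsto_eq_intros refl | simp)+
  qed
  then have "(d \<longlongrightarrow> G) (at 0)" by (simp add: LIM_zero_iff)
  then show ?thesis using that b by blast
qed

lemma vec3_norm_le: "norm (w::vec3) \<le> \<bar>w $ 1\<bar> + \<bar>w $ 2\<bar> + \<bar>w $ 3\<bar>"
  using norm_le_l1_cart[of w] by (simp add: sum_3)

lemma vec3_eqI: "v $ 1 = w $ 1 \<Longrightarrow> v $ 2 = w $ 2 \<Longrightarrow> v $ 3 = w $ 3 \<Longrightarrow> (v::vec3) = w"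
  by (simp add: vec_eq_iff forall_3)

lemma grad_perp_nth [simp]:
  "grad_perp f p $ 1 = deriv (\<lambda>s. f (fst p, snd p + s *\<^sub>R axis 1 1)) 0"
  "grad_perp f p $ 2 = deriv (\<lambda>s. f (fst p, snd p + s *\<^sub>R axis 2 1)) 0"
  "grad_perp f p $ 3 = 0"
  by (simp_all add: grad_perp_def)

text \<open>Membership in \<open>W\<^sup>2\<^sup>,\<^sup>\<infinity>\<close> makes the difference quotients of \<open>b\<close> converge, uniformly enough
  for the limits to be Lipschitz. Hence the pointwise derivatives in \<open>grad_perp\<close>, which are
  arbitrary values where a limit fails to exist, are genuine ones.\<close>

lemma magnetic_facts:
  assumes T: "0 < T" and b: "magnetic_intensity T b0 b"
  obtains L where "0 \<le> L"
    "\<And>p q. p \<in> closed_slab T \<Longrightarrow> q \<in> closed_slab T \<Longrightarrow> \<bar>b q - b p\<bar> \<le> L * norm (q - p)"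
    "\<And>t x i. t \<in> {0..T} \<Longrightarrow> i = 1 \<or> i = 2 \<Longrightarrow>
      ((\<lambda>s. b (t, x + s *\<^sub>R axis i 1)) has_real_derivative grad_perp b (t, x) $ i) (at 0)"
    "\<And>p. p \<in> closed_slab T \<Longrightarrow> norm (grad_perp b p) \<le> L"
    "continuous_on (closed_slab T) (grad_perp b)"
proof -
  define B where "B = slab_ext T b"
  have cb: "continuous_on (closed_slab T) b" and W2: "W_inf 2 (open_slab T) b"
    using b by (auto simp: magnetic_intensity_def)
  have cB: "continuous_on UNIV B" unfolding B_def by (rule continuous_slab_ext[OF T cb])
  have W2B: "W_inf 2 (open_slab T) B"
    by (rule W_inf_cong[OF W2]) (simp add: B_def slab_ext_eq_open)
  then have W1B: "W_inf 1 (open_slab T) B" by (auto simp: numeral_2_eq_2)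
  have eqB: "B p = b p" if "p \<in> closed_slab T" for p using slab_ext_eq[OF that] by (simp add: B_def)
  obtain L1 where L1: "0 \<le> L1"
    "\<And>p q. p \<in> open_slab T \<Longrightarrow> q \<in> open_slab T \<Longrightarrow> \<bar>B q - B p\<bar> \<le> L1 * norm (q - p)"
    by (rule W1_Lipschitz[OF cB open_open_slab convex_open_slab W1B]) (rule that)
  obtain L2 where L2: "0 \<le> L2"
    "\<And>i p q h k. i \<in> Basis \<Longrightarrow> h \<noteq> 0 \<Longrightarrow> k \<noteq> 0 \<Longrightarrow> p \<in> open_slab T \<Longrightarrow> p + h *\<^sub>R i \<in> open_slab T \<Longrightarrow>
      q \<in> open_slab T \<Longrightarrow> q + k *\<^sub>R i \<in> open_slab T \<Longrightarrow>
      \<bar>(B (p + h *\<^sub>R i) - B p) / h - (B (q + k *\<^sub>R i) - B q) / k\<bar> \<le> L2 * (\<bar>h\<bar> + \<bar>k\<bar> + norm (q - p))"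
    by (rule W2_difference_quotients[OF cB open_open_slab convex_open_slab W2B]) (rule that)
  have lip: "\<bar>b q - b p\<bar> \<le> L1 * norm (q - p)" if pq: "p \<in> closed_slab T" "q \<in> closed_slab T" for p q
  proof -
    have "\<bar>B q - B p\<bar> \<le> L1 * norm (q - p)"
    proof (rule tendsto_le[OF trivial_limit_at_right_real])
      show "((\<lambda>d. \<bar>B (shrink T d q) - B (shrink T d p)\<bar>) \<longlongrightarrow> \<bar>B q - B p\<bar>) (at_right 0)"
        by (intro tendsto_intros continuous_shrink_tendsto cB)
      show "((\<lambda>d. L1 * norm (shrink T d q - shrink T d p)) \<longlongrightarrow> L1 * norm (q - p)) (at_right 0)"
        by (intro tendsto_intros shrink_tendsto)
      show "\<forall>\<^sub>F d in at_right 0. \<bar>B (shrink T d q) - B (shrink T d p)\<bar> \<le> L1 * norm (shrink T d q - shrink T d p)"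
        using eventually_shrink[OF T pq(1)] eventually_shrink[OF T pq(2)]
        by eventually_elim (rule L1)
    qed
    then show ?thesis using pq by (simp add: eqB)
  qed
  let ?e = "\<lambda>i. (0, axis i 1) :: spacetime"
  have quot: "\<bar>(b (p + h *\<^sub>R ?e i) - b p) / h - (b (q + k *\<^sub>R ?e i) - b q) / k\<bar> \<le> L2 * (\<bar>h\<bar> + \<bar>k\<bar> + norm (q - p))"
    if hk: "h \<noteq> 0" "k \<noteq> 0" and pq: "p \<in> closed_slab T" "q \<in> closed_slab T" for i p q h k
  proof -
    have i: "?e i \<in> Basis" by (auto simp: Basis_prod_def Basis_vec_def)
    have pq': "p + h *\<^sub>R ?e i \<in> closed_slab T" "q + k *\<^sub>R ?e i \<in> closed_slab T"
      using pq by (simp_all add: closed_slab_def mem_Times_iff)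
    have "\<bar>(B (p + h *\<^sub>R ?e i) - B p) / h - (B (q + k *\<^sub>R ?e i) - B q) / k\<bar> \<le> L2 * (\<bar>h\<bar> + \<bar>k\<bar> + norm (q - p))"
    proof (rule tendsto_le[OF trivial_limit_at_right_real])
      let ?D = "\<lambda>d p h. (B (shrink T d (p + h *\<^sub>R ?e i)) - B (shrink T d p)) / h"
      show "((\<lambda>d. \<bar>?D d p h - ?D d q k\<bar>) \<longlongrightarrow> \<bar>(B (p + h *\<^sub>R ?e i) - B p) / h - (B (q + k *\<^sub>R ?e i) - B q) / k\<bar>) (at_right 0)"
        by (intro tendsto_intros continuous_shrink_tendsto cB hk)
      show "((\<lambda>d. L2 * (\<bar>h\<bar> + \<bar>k\<bar> + norm (shrink T d q - shrink T d p))) \<longlongrightarrow> L2 * (\<bar>h\<bar> + \<bar>k\<bar> + norm (q - p))) (at_right 0)"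
        by (intro tendsto_intros shrink_tendsto)
      show "\<forall>\<^sub>F d in at_right 0. \<bar>?D d p h - ?D d q k\<bar> \<le> L2 * (\<bar>h\<bar> + \<bar>k\<bar> + norm (shrink T d q - shrink T d p))"
        using eventually_shrink[OF T pq(1)] eventually_shrink[OF T pq(2)]
          eventually_shrink[OF T pq'(1)] eventually_shrink[OF T pq'(2)]
      proof eventually_elim
        case (elim d)
        have s: "shrink T d (p + h *\<^sub>R ?e i) = shrink T d p + h *\<^sub>R ?e i" for p h
          using shrink_add[of T d p "h *\<^sub>R axis i 1"] by simp
        show ?case unfolding s by (rule L2(2)[OF i hk]) (use elim s in auto)
      qed
    qed
    then show ?thesis using pq pq' by (simp add: eqB)
  qed
  have exG: "\<exists>G. (\<forall>h. h \<noteq> 0 \<longrightarrow> \<bar>(b (p + h *\<^sub>R ?e i) - b p) / h - G\<bar> \<le> L2 * \<bar>h\<bar>) \<and>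
      ((\<lambda>h. (b (p + h *\<^sub>R ?e i) - b p) / h) \<longlongrightarrow> G) (at 0)" if "p \<in> closed_slab T" for p i
  proof -
    have "\<bar>(b (p + h *\<^sub>R ?e i) - b p) / h - (b (p + k *\<^sub>R ?e i) - b p) / k\<bar> \<le> L2 * (\<bar>h\<bar> + \<bar>k\<bar>)"
      if "h \<noteq> 0" "k \<noteq> 0" for h k
      using quot[OF that \<open>p \<in> closed_slab T\<close> \<open>p \<in> closed_slab T\<close>, of i] by simp
    then obtain G where "\<And>h. h \<noteq> 0 \<Longrightarrow> \<bar>(b (p + h *\<^sub>R ?e i) - b p) / h - G\<bar> \<le> L2 * \<bar>h\<bar>"
      "((\<lambda>h. (b (p + h *\<^sub>R ?e i) - b p) / h) \<longlongrightarrow> G) (at 0)"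
      by (rule difference_quotient_limit) (assumption | rule that)+
    then show ?thesis by (intro exI[of _ G] conjI allI impI)
  qed
  define G where "G p i = (SOME G. (\<forall>h. h \<noteq> 0 \<longrightarrow> \<bar>(b (p + h *\<^sub>R ?e i) - b p) / h - G\<bar> \<le> L2 * \<bar>h\<bar>) \<and>
      ((\<lambda>h. (b (p + h *\<^sub>R ?e i) - b p) / h) \<longlongrightarrow> G) (at 0))" for p i
  have G: "((\<lambda>h. (b (p + h *\<^sub>R ?e i) - b p) / h) \<longlongrightarrow> G p i) (at 0)" if "p \<in> closed_slab T" for p i
    using someI_ex[OF exG[OF that, of i]] unfolding G_def by (rule conjunct2)
  have D: "((\<lambda>s. b (t, x + s *\<^sub>R axis i 1)) has_real_derivative G (t, x) i) (at 0)" if "t \<in> {0..T}" for t x i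
    using G[of "(t, x)" i] that by (simp add: DERIV_def closed_slab_def)
  have gG: "grad_perp b p $ i = G p i" if "p \<in> closed_slab T" "i = 1 \<or> i = 2" for p i
    using that D[of "fst p" "snd p"] by (auto simp: closed_slab_def intro!: DERIV_imp_deriv)
  have Gb: "\<bar>G p i\<bar> \<le> L1" if p: "p \<in> closed_slab T" for p i
  proof (rule tendsto_upperbound)
    show "((\<lambda>h. \<bar>(b (p + h *\<^sub>R ?e i) - b p) / h\<bar>) \<longlongrightarrow> \<bar>G p i\<bar>) (at 0)"
      by (intro tendsto_intros G p)
    have "\<bar>(b (p + h *\<^sub>R ?e i) - b p) / h\<bar> \<le> L1" if "h \<noteq> 0" for h
      using lip[OF p, of "p + h *\<^sub>R ?e i"] p that
      by (auto simp: closed_slab_def mem_Times_iff abs_divide divide_le_eq)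
    then show "\<forall>\<^sub>F h in at 0. \<bar>(b (p + h *\<^sub>R ?e i) - b p) / h\<bar> \<le> L1"
      by (auto simp: eventually_at_filter)
  qed simp
  have Glip: "\<bar>G p i - G q i\<bar> \<le> L2 * norm (q - p)" if pq: "p \<in> closed_slab T" "q \<in> closed_slab T" for p q i
  proof (rule tendsto_le[where F="at 0"])
    let ?D = "\<lambda>p h. (b (p + h *\<^sub>R ?e i) - b p) / h"
    show "((\<lambda>h. \<bar>?D p h - ?D q h\<bar>) \<longlongrightarrow> \<bar>G p i - G q i\<bar>) (at 0)"
      by (intro tendsto_intros G pq)
    show "((\<lambda>h. L2 * (\<bar>h\<bar> + \<bar>h\<bar> + norm (q - p))) \<longlongrightarrow> L2 * norm (q - p)) (at 0)"
      by (rule tendsto_eq_intros refl | simp)+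
    show "\<forall>\<^sub>F h in at 0. \<bar>?D p h - ?D q h\<bar> \<le> L2 * (\<bar>h\<bar> + \<bar>h\<bar> + norm (q - p))"
      unfolding eventually_at_filter by (intro always_eventually allI impI quot pq)
  qed simp
  have Gc: "continuous_on (closed_slab T) (\<lambda>p. G p i)" for i
  proof (rule continuous_on_subset[OF lipschitz_on_continuous_on subset_refl])
    show "L2-lipschitz_on (closed_slab T) (\<lambda>p. G p i)"
      using Glip L2(1) by (intro lipschitz_onI) (auto simp: dist_norm norm_minus_commute)
  qed
  show ?thesis
  proof (rule that[of "2 * L1"])
    show "0 \<le> 2 * L1" using L1 by simp
    show "\<bar>b q - b p\<bar> \<le> (2 * L1) * norm (q - p)" if pq: "p \<in> closed_slab T" "q \<in> closed_slab T" for p q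
      using order_trans[OF lip[OF pq] mult_right_mono[of L1 "2 * L1" "norm (q - p)"]] L1 by simp
    show "((\<lambda>s. b (t, x + s *\<^sub>R axis i 1)) has_real_derivative grad_perp b (t, x) $ i) (at 0)"
      if "t \<in> {0..T}" "i = 1 \<or> i = 2" for t x i
      using D[OF that(1), of x i] gG[of "(t, x)" i] that by (simp add: closed_slab_def)
    show "norm (grad_perp b p) \<le> 2 * L1" if "p \<in> closed_slab T" for p
      using vec3_norm_le[of "grad_perp b p"] gG[OF that] Gb[OF that, of 1] Gb[OF that, of 2] by (simp del: grad_perp_nth(1,2))
    have "continuous_on (closed_slab T) (\<lambda>p. \<chi> i. if i = 3 then 0 else G p i)"
    proof (intro continuous_intros)
      show "continuous_on (closed_slab T) (\<lambda>p. if i = 3 then 0 else G p i)" for i :: 3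
        using Gc by (cases "i = 3") auto
    qed
    moreover have "(\<chi> i. if i = 3 then 0 else G p i) = grad_perp b p" if "p \<in> closed_slab T" for p
      using gG[OF that] by (intro vec3_eqI) (auto simp del: grad_perp_nth(1,2))
    ultimately show "continuous_on (closed_slab T) (grad_perp b)"
      by (simp cong: continuous_on_cong)
  qed
qed

section \<open>The divergence of the drift field\<close>

lemma integrable_bounded_support:
  fixes u :: "'a::euclidean_space \<Rightarrow> real"
  assumes "bounded K" "continuous_on UNIV u" "\<And>x. x \<notin> K \<Longrightarrow> u x = 0"
  shows "integrable lebesgue u"
proof -
  obtain R where R: "K \<subseteq> cball 0 R"
    using assms(1) by (auto simp: bounded_iff subset_iff)
  have "u x = 0" if "x \<notin> cball 0 R" for x
    using assms(3) that R by blast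
  then show ?thesis
    using compact_support_integral(1)[OF assms(2), of 0 R UNIV] by (simp add: lebesgue_on_UNIV_eq)
qed

lemma integral_translation:
  fixes u :: "'a::euclidean_space \<Rightarrow> real"
  assumes u: "continuous_on UNIV u" and out: "\<And>x. x \<notin> cball c r \<Longrightarrow> u x = 0"
  shows "(LINT x|lebesgue. u (d + x)) = (LINT x|lebesgue. u x)"
proof -
  obtain a b :: 'a where ab: "cball c r \<subseteq> cbox a b"
    using bounded_subset_cbox_symmetric[OF bounded_cball] by blast
  have sub: "cball (c - d) r \<subseteq> cbox (a - d) (b - d)"
  proof
    fix x assume "x \<in> cball (c - d) r"
    then have "d + x \<in> cball c r" by (simp add: dist_norm algebra_simps)
    then have "d + x \<in> cbox a b" using ab by blast
    then show "x \<in> cbox (a - d) (b - d)" by (simp add: mem_box algebra_simps)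
  qed
  have "(LINT x|lebesgue. u (d + x)) = integral (cbox (a - d) (b - d)) (\<lambda>x. u (d + x))"
  proof (rule compact_support_integral_cbox[OF _ _ sub])
    show "continuous_on UNIV (\<lambda>x. u (d + x))"
      by (rule continuous_on_compose2[OF u]) (auto intro!: continuous_intros)
    show "u (d + x) = 0" if "x \<notin> cball (c - d) r" for x
      by (rule out) (use that in \<open>simp add: dist_norm algebra_simps\<close>)
  qed
  also have "\<dots> = integral (cbox a b) u"
    using integral_shift_cbox_plus[of "a - d" "b - d" u d] by (simp add: o_def)
  also have "\<dots> = (LINT x|lebesgue. u x)"
    by (rule compact_support_integral_cbox[symmetric, OF u out ab])
  finally show ?thesis .
qed

lemma integral_directional_derivative_zero:
  fixes u :: "'a::euclidean_space \<Rightarrow> real"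
  assumes u: "continuous_on UNIV u" and out: "\<And>x. x \<notin> cball c r \<Longrightarrow> u x = 0"
    and u': "continuous_on UNIV u'" and out': "\<And>x. x \<notin> cball c r \<Longrightarrow> u' x = 0"
    and d: "\<And>x. ((\<lambda>s. u (x + s *\<^sub>R v)) has_real_derivative u' x) (at 0)"
  shows "(LINT x|lebesgue. u' x) = 0"
proof -
  obtain a b :: 'a where ab: "cball c (r + norm v) \<subseteq> cbox a b"
    using bounded_subset_cbox_symmetric[OF bounded_cball] by blast
  have sub: "cball (c - s *\<^sub>R v) r \<subseteq> cbox a b" if "s \<in> ball 0 1" for s
  proof -
    have "cball (c - s *\<^sub>R v) r \<subseteq> cball c (r + norm v)"
      using that mult_left_le_one_le[of "norm v" "\<bar>s\<bar>"] by (simp add: cball_subset_cball_iff dist_norm)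
    then show ?thesis using ab by blast
  qed
  have ds: "((\<lambda>s. u (x + s *\<^sub>R v)) has_real_derivative u' (x + s *\<^sub>R v)) (at s)" for x s
    using d[of "x + s *\<^sub>R v"] DERIV_shift[of "\<lambda>s. u (x + s *\<^sub>R v)" "u' (x + s *\<^sub>R v)" 0 s]
    by (simp add: algebra_simps)
  have dI: "((\<lambda>s. integral (cbox a b) (\<lambda>x. u (x + s *\<^sub>R v))) has_real_derivative
      integral (cbox a b) (\<lambda>x. u' (x + 0 *\<^sub>R v))) (at 0 within ball 0 1)"
  proof (rule leibniz_rule_field_derivative)
    show "((\<lambda>s. u (x + s *\<^sub>R v)) has_real_derivative u' (x + s *\<^sub>R v)) (at s within ball 0 1)" for x s
      by (rule has_field_derivative_at_within[OF ds])
    show "(\<lambda>x. u (x + s *\<^sub>R v)) integrable_on cbox a b" for s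
      by (intro integrable_continuous continuous_on_compose2[OF u] continuous_intros) auto
    show "continuous_on (ball 0 1 \<times> cbox a b) (\<lambda>(s, x). u' (x + s *\<^sub>R v))"
      unfolding split_beta by (intro continuous_on_compose2[OF u'] continuous_intros) auto
  qed auto
  have eq: "integral (cbox a b) (\<lambda>x. u (x + s *\<^sub>R v)) = (LINT x|lebesgue. u x)" if s: "s \<in> ball 0 1" for s
  proof -
    have "integral (cbox a b) (\<lambda>x. u (x + s *\<^sub>R v)) = (LINT x|lebesgue. u (s *\<^sub>R v + x))"
      unfolding add.commute[of "s *\<^sub>R v"]
    proof (rule compact_support_integral_cbox[OF _ _ sub[OF s], symmetric])
      show "continuous_on UNIV (\<lambda>x. u (x + s *\<^sub>R v))"
        by (rule continuous_on_compose2[OF u]) (auto intro!: continuous_intros)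
      show "u (x + s *\<^sub>R v) = 0" if "x \<notin> cball (c - s *\<^sub>R v) r" for x
        by (rule out) (use that in \<open>simp add: dist_norm algebra_simps\<close>)
    qed
    then show ?thesis using integral_translation[OF u out] by simp
  qed
  have "((\<lambda>s. LINT x|lebesgue. u x) has_real_derivative integral (cbox a b) (\<lambda>x. u' (x + 0 *\<^sub>R v))) (at 0 within ball 0 1)"
    by (rule has_field_derivative_transform_within[OF dI zero_less_one]) (use eq in auto)
  then have "integral (cbox a b) u' = 0"
    using DERIV_unique[OF _ DERIV_const[of "LINT x|lebesgue. u x"], of _ 0]
    by (simp add: at_within_open[of 0 "ball 0 1"])
  moreover have "cball c r \<subseteq> cbox a b" using sub[of 0] by simp
  ultimately show ?thesis
    using compact_support_integral_cbox[OF u' out'] by metis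
qed

lemma continuous_conv:
  fixes f :: "'a::euclidean_space \<Rightarrow> real"
  assumes f: "continuous_on UNIV f" and k: "ball_kernel \<psi> r"
  shows "continuous_on UNIV (conv f \<psi>)"
proof (rule continuous_at_imp_continuous_on, rule ballI)
  interpret k: ball_kernel \<psi> r by fact
  fix y0 :: 'a
  obtain a b where ab: "cball y0 (r + 1) \<subseteq> cbox a b"
    using bounded_subset_cbox_symmetric[OF bounded_cball] by blast
  have sub: "cball y r \<subseteq> cbox a b" if "y \<in> ball y0 1" for y
  proof -
    have "cball y r \<subseteq> cball y0 (r + 1)"
      using that by (simp add: cball_subset_cball_iff dist_commute)
    then show ?thesis using ab by blast
  qed
  have "continuous_on (ball y0 1) (\<lambda>y. integral (cbox a b) (\<lambda>x. f x * \<psi> (y - x)))"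
    by (rule integral_continuous_on_param)
      (auto simp: split_beta intro!: continuous_intros continuous_on_compose2[OF f] continuous_on_compose2[OF k.cont])
  then have "continuous_on (ball y0 1) (conv f \<psi>)"
    by (subst continuous_on_cong[OF refl k.conv_eq_cbox[OF f sub]])
  then show "isCont (conv f \<psi>) y0"
    by (simp add: continuous_on_eq_continuous_at)
qed

text \<open>Both sides are the mollified mixed second derivative of \<open>- \<phi>\<close>. Since the derivatives of
  the bump commute, this is the vanishing of the curl of a gradient, without any pointwise
  derivative of the field.\<close>

lemma weak_curl_free:
  assumes w: "weak_partial \<Omega> i \<phi> (\<lambda>p. - f p)" "weak_partial \<Omega> j \<phi> (\<lambda>p. - g p)"
    and c: "continuous_on UNIV f" "continuous_on UNIV g"
    and r: "0 < r" and \<Omega>: "open \<Omega>" "cball y r \<subseteq> \<Omega>"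
  shows "moll_d1 f r j y = moll_d1 g r i y"
proof -
  have \<Omega>': "\<Omega> \<in> sets lebesgue" using \<Omega> by (auto intro: borel_open)
  have "conv f (bump_d1 r j) y = (LINT x|lebesgue_on \<Omega>. f x * bump_d1 r j (y - x))"
    by (rule ball_kernel.conv_eq_LINT[OF kernel_bump_d1[OF r] c(1) \<Omega>' \<Omega>(2)])
  also have "\<dots> = - (LINT x|lebesgue_on \<Omega>. \<phi> x * bump_d2 r j i (y - x))"
    by (subst weak_partial_reflected[OF w(1) \<Omega>(2) C_k_on_bump_d1 kernel_bump_d1[OF r] bump_d1_has_derivative]) simp
  also have "\<dots> = - (LINT x|lebesgue_on \<Omega>. \<phi> x * bump_d2 r i j (y - x))"
    by (simp add: bump_d2_commute)
  also have "\<dots> = (LINT x|lebesgue_on \<Omega>. g x * bump_d1 r i (y - x))"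
    by (subst weak_partial_reflected[OF w(2) \<Omega>(2) C_k_on_bump_d1 kernel_bump_d1[OF r] bump_d1_has_derivative]) simp
  also have "\<dots> = conv g (bump_d1 r i) y"
    by (rule ball_kernel.conv_eq_LINT[OF kernel_bump_d1[OF r] c(2) \<Omega>' \<Omega>(2), symmetric])
  finally show ?thesis by (simp add: moll_d1_def)
qed

lemma moll_bound:
  fixes f :: "'a::euclidean_space \<Rightarrow> real"
  assumes f: "continuous_on UNIV f" and r: "0 < r" and M: "\<And>x. \<bar>f x\<bar> \<le> M"
  shows "\<bar>moll f r y\<bar> \<le> M"
proof -
  have "f \<in> borel_measurable (lebesgue_on UNIV)"
    by (rule continuous_imp_measurable_on_sets_lebesgue[OF f]) simp
  then have "\<bar>LINT x|lebesgue_on UNIV. f x * bump 0 r (y - x)\<bar> \<le> M * mass TYPE('a) r"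
    using M by (intro conv_bump_bound[OF r]) auto
  then show ?thesis
    using mass_pos[OF r, where 'a='a]
    by (simp add: moll_def conv_def lebesgue_on_UNIV_eq abs_divide divide_le_eq)
qed

text \<open>Integration by parts would reduce the integral to the curl of \<open>(f, g)\<close>, which exists as
  a distribution only. It is therefore carried out for the mollified fields, whose curl vanishes on
  the support of \<open>\<theta>\<close> once the radius is small, and the limit is taken by dominated convergence. The
  multiplier \<open>\<theta>\<close> is not assumed smooth, because it will be a test function divided by \<open>b\<close>.\<close>

lemma curl_free_integral:
  fixes f g :: "'a::euclidean_space \<Rightarrow> real"
  assumes w: "weak_partial \<Omega> i \<phi> (\<lambda>p. - f p)" "weak_partial \<Omega> j \<phi> (\<lambda>p. - g p)"
    and c: "continuous_on UNIV f" "continuous_on UNIV g"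
    and M: "\<And>x. \<bar>f x\<bar> \<le> M" "\<And>x. \<bar>g x\<bar> \<le> M"
    and \<Omega>: "open \<Omega>" and K: "compact K" "K \<subseteq> \<Omega>"
    and \<theta>: "continuous_on UNIV \<theta>" "\<And>x. x \<notin> K \<Longrightarrow> \<theta> x = 0"
    and \<theta>i: "continuous_on UNIV \<theta>i" "\<And>x. x \<notin> K \<Longrightarrow> \<theta>i x = 0"
      "\<And>x. ((\<lambda>s. \<theta> (x + s *\<^sub>R i)) has_real_derivative \<theta>i x) (at 0)"
    and \<theta>j: "continuous_on UNIV \<theta>j" "\<And>x. x \<notin> K \<Longrightarrow> \<theta>j x = 0"
      "\<And>x. ((\<lambda>s. \<theta> (x + s *\<^sub>R j)) has_real_derivative \<theta>j x) (at 0)"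
  shows "(LINT x|lebesgue. f x * \<theta>j x - g x * \<theta>i x) = 0"
proof -
  obtain R where R: "K \<subseteq> cball 0 R"
    using compact_imp_bounded[OF K(1)] by (auto simp: bounded_iff subset_iff)
  have cm0: "continuous_on UNIV (moll h r)" if "continuous_on UNIV h" "0 < r" for h :: "'a \<Rightarrow> real" and r
    unfolding moll_def[abs_def] using mass_pos[OF that(2), where 'a='a]
    by (intro continuous_intros continuous_conv[OF that(1) kernel_bump] that(2)) simp
  have cm1: "continuous_on UNIV (moll_d1 h r v)" if "continuous_on UNIV h" "0 < r" for h :: "'a \<Rightarrow> real" and r v
    unfolding moll_d1_def[abs_def] using mass_pos[OF that(2), where 'a='a]
    by (intro continuous_intros continuous_conv[OF that(1) kernel_bump_d1] that(2)) simp
  note cm = cm0 cm1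
  have parts: "(LINT x|lebesgue. moll_d1 h r v x * \<theta> x + moll h r x * \<theta>' x) = 0"
    if h: "continuous_on UNIV h" "0 < r" and \<theta>': "continuous_on UNIV \<theta>'" "\<And>x. x \<notin> K \<Longrightarrow> \<theta>' x = 0"
      "\<And>x. ((\<lambda>s. \<theta> (x + s *\<^sub>R v)) has_real_derivative \<theta>' x) (at 0)" for h \<theta>' :: "'a \<Rightarrow> real" and r v
  proof (rule integral_directional_derivative_zero[where c=0 and r=R and v=v and u="\<lambda>x. moll h r x * \<theta> x"])
    show "((\<lambda>s. moll h r (x + s *\<^sub>R v) * \<theta> (x + s *\<^sub>R v)) has_real_derivative
        moll_d1 h r v x * \<theta> x + moll h r x * \<theta>' x) (at 0)" for x
      using DERIV_mult[OF moll_has_derivative[OF h, of x v 0] \<theta>'(3)[of x]] by (simp add: mult.commute add.commute)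
    fix x :: 'a assume "x \<notin> cball 0 R"
    then have "x \<notin> K" using R by blast
    then show "moll h r x * \<theta> x = 0" "moll_d1 h r v x * \<theta> x + moll h r x * \<theta>' x = 0"
      using \<theta>(2) \<theta>'(2) by auto
  qed (intro continuous_intros cm h \<theta>(1) \<theta>'(1))+
  note int = integrable_bounded_support[OF compact_imp_bounded[OF K(1)]]
  define \<rho> where "\<rho> n = inverse (real (Suc n))" for n
  have \<rho>: "filterlim \<rho> (at_right 0) sequentially"
    unfolding \<rho>_def filterlim_at
    using LIMSEQ_inverse_real_of_nat by (auto intro!: always_eventually)
  define I where "I n = (LINT x|lebesgue. moll f (\<rho> n) x * \<theta>j x - moll g (\<rho> n) x * \<theta>i x)" for n
  have "I \<longlonglongrightarrow> (LINT x|lebesgue. f x * \<theta>j x - g x * \<theta>i x)"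
    unfolding I_def
  proof (rule integral_dominated_convergence[where w="\<lambda>x. M * \<bar>\<theta>j x\<bar> + M * \<bar>\<theta>i x\<bar>"])
    have \<rho>0: "0 < \<rho> n" for n by (simp add: \<rho>_def)
    show "integrable lebesgue (\<lambda>x. M * \<bar>\<theta>j x\<bar> + M * \<bar>\<theta>i x\<bar>)"
      using \<theta>j(2) \<theta>i(2) by (intro int continuous_intros \<theta>j(1) \<theta>i(1)) auto
    show "(\<lambda>x. f x * \<theta>j x - g x * \<theta>i x) \<in> borel_measurable lebesgue"
      using \<theta>j(2) \<theta>i(2) by (intro borel_measurable_integrable int continuous_intros \<theta>j(1) \<theta>i(1) c) auto
    show "(\<lambda>x. moll f (\<rho> n) x * \<theta>j x - moll g (\<rho> n) x * \<theta>i x) \<in> borel_measurable lebesgue" for n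
      using \<theta>j(2) \<theta>i(2) by (intro borel_measurable_integrable int continuous_intros \<theta>j(1) \<theta>i(1) cm c \<rho>0) auto
    show "AE x in lebesgue. (\<lambda>n. moll f (\<rho> n) x * \<theta>j x - moll g (\<rho> n) x * \<theta>i x) \<longlonglongrightarrow> f x * \<theta>j x - g x * \<theta>i x"
      by (intro always_eventually allI tendsto_intros filterlim_compose[OF moll_tendsto \<rho>] c)
    show "AE x in lebesgue. norm (moll f (\<rho> n) x * \<theta>j x - moll g (\<rho> n) x * \<theta>i x) \<le> M * \<bar>\<theta>j x\<bar> + M * \<bar>\<theta>i x\<bar>" for n
    proof (intro always_eventually allI)
      fix x
      have "\<bar>moll f (\<rho> n) x\<bar> * \<bar>\<theta>j x\<bar> \<le> M * \<bar>\<theta>j x\<bar>" "\<bar>moll g (\<rho> n) x\<bar> * \<bar>\<theta>i x\<bar> \<le> M * \<bar>\<theta>i x\<bar>"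
        by (intro mult_right_mono moll_bound c M \<rho>0; simp)+
      then show "norm (moll f (\<rho> n) x * \<theta>j x - moll g (\<rho> n) x * \<theta>i x) \<le> M * \<bar>\<theta>j x\<bar> + M * \<bar>\<theta>i x\<bar>"
        using abs_triangle_ineq4[of "moll f (\<rho> n) x * \<theta>j x" "moll g (\<rho> n) x * \<theta>i x"] by (simp add: abs_mult)
    qed
  qed
  moreover have "\<forall>\<^sub>F n in sequentially. I n = 0"
  proof -
    have "\<forall>\<^sub>F n in sequentially. \<forall>y\<in>K. cball y (\<rho> n) \<subseteq> \<Omega>"
      using \<rho>[unfolded filterlim_iff, rule_format, OF eventually_cball_subset[OF K(1) \<Omega> K(2)]] .
    then show ?thesis
    proof eventually_elim
      case (elim n)
      have r: "0 < \<rho> n" by (simp add: \<rho>_def)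
      let ?a = "\<lambda>x. moll_d1 f (\<rho> n) j x * \<theta> x" and ?b = "\<lambda>x. moll f (\<rho> n) x * \<theta>j x"
      let ?a' = "\<lambda>x. moll_d1 g (\<rho> n) i x * \<theta> x" and ?b' = "\<lambda>x. moll g (\<rho> n) x * \<theta>i x"
      have ii: "integrable lebesgue ?a" "integrable lebesgue ?b" "integrable lebesgue ?a'" "integrable lebesgue ?b'"
        using \<theta>(2) \<theta>i(2) \<theta>j(2) by (intro int continuous_intros cm c r \<theta>(1) \<theta>i(1) \<theta>j(1); simp)+
      have "?a = ?a'"
      proof
        show "?a x = ?a' x" for x
        proof (cases "x \<in> K")
          case True
          then show ?thesis using weak_curl_free[OF w c r \<Omega>] elim by auto
        qed (simp add: \<theta>(2))
      qed
      then have "(LINT x|lebesgue. ?a x) = (LINT x|lebesgue. ?a' x)" by metis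
      moreover have "(LINT x|lebesgue. ?a x) + (LINT x|lebesgue. ?b x) = 0"
        using parts[OF c(1) r \<theta>j] ii by simp
      moreover have "(LINT x|lebesgue. ?a' x) + (LINT x|lebesgue. ?b' x) = 0"
        using parts[OF c(2) r \<theta>i] ii by simp
      ultimately show ?case using ii by (simp add: I_def)
    qed
  qed
  ultimately show ?thesis
    using LIMSEQ_unique tendsto_eventually by blast
qed

lemma rot_nth [simp]: "rot w $ 1 = - (w $ 2)" "rot w $ 2 = w $ 1" "rot w $ 3 = 0"
  by (simp_all add: rot_def)

lemma perp_nth [simp]: "perp w $ 1 = w $ 1" "perp w $ 2 = w $ 2" "perp w $ 3 = 0"
  by (simp_all add: perp_def)

lemma inner_vec3: "(v::vec3) \<bullet> w = v $ 1 * w $ 1 + v $ 2 * w $ 2 + v $ 3 * w $ 3"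
  by (simp add: inner_vec_def sum_3)

lemma slab_clamp_mem: "0 < T \<Longrightarrow> (max 0 (min T (fst p)), snd p) \<in> closed_slab T"
  by (simp add: closed_slab_def)

text \<open>This makes the choice in the definition of \<open>div_perp\<close> harmless: bumps are test functions,
  so two continuous representatives have the same mollifications.\<close>

lemma weak_div_perp_unique:
  assumes T: "0 < T" and c: "continuous_on (closed_slab T) h1" "continuous_on (closed_slab T) h2"
    and w: "weak_div_perp (open_slab T) G h1" "weak_div_perp (open_slab T) G h2" and p: "p \<in> closed_slab T"
  shows "h1 p = h2 p"
proof -
  have eq: "h1 y = h2 y" if y: "y \<in> open_slab T" for y
  proof -
    let ?m = "\<lambda>h r. moll (slab_ext T h) r y"
    have "\<forall>\<^sub>F r in at_right 0. \<forall>y\<in>{y}. cball y r \<subseteq> open_slab T"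
      using y by (intro eventually_cball_subset open_open_slab) auto
    with eventually_at_right_less[of 0] have ev: "\<forall>\<^sub>F r in at_right 0. ?m h1 r = ?m h2 r"
    proof eventually_elim
      case (elim r)
      have t: "test_function (open_slab T) (\<lambda>x. bump 0 r (y - x))"
        using elim by (intro test_function_reflected[OF C_k_on_bump kernel_bump]) auto
      have "conv (slab_ext T h) (bump 0 r) y = (LINT x|lebesgue_on (open_slab T). h x * bump 0 r (y - x))"
        if "continuous_on (closed_slab T) h" for h
      proof -
        have "conv (slab_ext T h) (bump 0 r) y = (LINT x|lebesgue_on (open_slab T). slab_ext T h x * bump 0 r (y - x))"
          using elim open_open_slab[of T]
          by (intro ball_kernel.conv_eq_LINT[OF kernel_bump continuous_slab_ext[OF T that]]) (auto intro: borel_open)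
        also have "\<dots> = (LINT x|lebesgue_on (open_slab T). h x * bump 0 r (y - x))"
          by (intro Bochner_Integration.integral_cong) (auto simp: slab_ext_eq_open)
        finally show ?thesis .
      qed
      moreover have "(LINT x|lebesgue_on (open_slab T). h1 x * bump 0 r (y - x))
          = (LINT x|lebesgue_on (open_slab T). h2 x * bump 0 r (y - x))"
        using w t by (simp add: weak_div_perp_def)
      ultimately show ?case using c by (simp add: moll_def)
    qed
    have "slab_ext T h1 y = slab_ext T h2 y"
      by (rule tendsto_unique[OF trivial_limit_at_right_real moll_tendsto[OF continuous_slab_ext[OF T c(1)]]])
        (rule Lim_transform_eventually[OF moll_tendsto[OF continuous_slab_ext[OF T c(2)]] eventually_mono[OF ev sym]])
    then show ?thesis using y by (simp add: slab_ext_eq_open)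
  qed
  have "\<bar>h1 p - h2 p\<bar> \<le> 0"
    by (rule slab_bound_closure[OF T _ _ p, of "\<lambda>p. \<bar>h1 p - h2 p\<bar>"]) (auto intro!: continuous_intros c simp: eq)
  then show ?thesis by simp
qed

lemma integral_lebesgue_on_support:
  fixes u :: "'a::euclidean_space \<Rightarrow> real"
  assumes "\<And>x. x \<notin> S \<Longrightarrow> u x = 0" "S \<in> sets lebesgue"
  shows "(LINT x|lebesgue_on S. u x) = (LINT x|lebesgue. u x)"
proof -
  have "(\<lambda>x. if x \<in> S then u x else 0) = u" using assms(1) by auto
  then show ?thesis using Lebesgue_Measure.integral_restrict_UNIV[OF assms(2), of u] by simp
qed

lemma test_function_derivative:
  fixes \<psi> :: "spacetime \<Rightarrow> real"
  assumes "test_function \<Omega> \<psi>"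
  obtains D where "\<And>p. (\<psi> has_derivative D p) (at p)" "\<And>v. continuous_on UNIV (\<lambda>p. D p v)"
    "\<And>p v. p \<notin> closure {x. \<psi> x \<noteq> 0} \<Longrightarrow> D p v = 0"
    "\<And>p v. ((\<lambda>s. \<psi> (p + s *\<^sub>R v)) has_real_derivative D p v) (at 0)"
    "\<And>p. grad_perp \<psi> p $ 1 = D p (0, axis 1 1)" "\<And>p. grad_perp \<psi> p $ 2 = D p (0, axis 2 1)"
proof -
  have "C_k_on 1 UNIV \<psi>" using assms by (simp add: test_function_def del: C_k_on.simps)
  then obtain D where D: "\<And>p. (\<psi> has_derivative D p) (at p)" "\<And>v. continuous_on UNIV (\<lambda>p. D p v)"
    by auto
  have z: "D p v = 0" if "p \<notin> closure {x. \<psi> x \<noteq> 0}" for p v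
  proof -
    have "(\<psi> has_derivative (\<lambda>_. 0)) (at p)"
    proof (rule has_derivative_transform_within_open[of "\<lambda>_. 0" _ _ _ "- closure {x. \<psi> x \<noteq> 0}"])
      show "0 = \<psi> x" if "x \<in> - closure {x. \<psi> x \<noteq> 0}" for x
        using that closure_subset[of "{x. \<psi> x \<noteq> 0}"] by auto
    qed (use that in auto)
    then show ?thesis using has_derivative_unique[OF D(1)] by metis
  qed
  have d: "((\<lambda>s. \<psi> (p + s *\<^sub>R v)) has_real_derivative D p v) (at 0)" for p v
  proof -
    have "((\<lambda>s. \<psi> (p + s *\<^sub>R v)) has_derivative (\<lambda>t. D (p + 0 *\<^sub>R v) (t *\<^sub>R v))) (at 0)"
      by (rule has_derivative_compose[OF _ D(1)]) (auto intro!: derivative_eq_intros)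
    moreover have "D p (t *\<^sub>R v) = D p v * t" for t
      using linear_cmul[OF has_derivative_linear[OF D(1)]] by (simp add: mult.commute)
    ultimately show ?thesis by (simp add: has_field_derivative_def)
  qed
  have g: "deriv (\<lambda>s. \<psi> (fst p, snd p + s *\<^sub>R axis i 1)) 0 = D p (0, axis i 1)" for p i
    using d[of p "(0, axis i 1)"] by (intro DERIV_imp_deriv) (simp add: plus_prod_def)
  show ?thesis by (rule that[OF D z d]) (simp_all add: g)
qed

text \<open>Formally \<open>div\<^sub>\<perp> ((E / b)\<^sup>\<perp>) = div\<^sub>\<perp> (E\<^sup>\<perp>) / b + E \<bullet> (\<nabla>\<^sub>\<perp> b)\<^sup>\<perp> / b\<^sup>2\<close>, and the first term
  vanishes because \<open>E\<close> is a gradient. The remaining expression is continuous, so that it is the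
  representative chosen by \<open>div_perp\<close> as soon as it satisfies the weak identity. For a test
  function \<open>\<psi>\<close> that identity is \<open>curl_free_integral\<close> with \<open>\<theta> = \<psi> / b\<close>.\<close>

theorem drift_divergence:
  assumes T: "0 < T" and E: "electric_field T \<phi> E" and b: "magnetic_intensity T b0 b" and t: "t \<in> {0..T}"
  shows "g_field T E b t x = (E (t, x) \<bullet> rot (grad_perp b (t, x))) / (b (t, x))\<^sup>2"
proof -
  let ?S = "closed_slab T" and ?\<Omega> = "open_slab T" and ?e = "\<lambda>i. (0, axis i 1) :: spacetime"
  define G where "G p = rot (perp (F_field E b p))" for p
  define h where "h p = (E p \<bullet> rot (grad_perp b p)) / (b p)\<^sup>2" for p
  have L:
    "\<And>t x i. t \<in> {0..T} \<Longrightarrow> i = 1 \<or> i = 2 \<Longrightarrow>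
      ((\<lambda>s. b (t, x + s *\<^sub>R axis i 1)) has_real_derivative grad_perp b (t, x) $ i) (at 0)"
    and cg: "continuous_on ?S (grad_perp b)"
    by (rule magnetic_facts[OF T b], assumption)+
  have cE: "continuous_on ?S E" using E by (simp add: electric_field_def)
  have cb: "continuous_on ?S b" and b0: "0 < b0" "\<And>p. p \<in> ?S \<Longrightarrow> b0 < b p"
    using b by (auto simp: magnetic_intensity_def closed_slab_def)
  have bnz: "b p \<noteq> 0" if "p \<in> ?S" for p using b0(1) b0(2)[OF that] by linarith
  define B where "B = slab_ext T b"
  define Ef where "Ef i = slab_ext T (\<lambda>p. E p $ i)" for i
  define Gf where "Gf i = slab_ext T (\<lambda>p. grad_perp b p $ i)" for i
  have cB: "continuous_on UNIV B" unfolding B_def by (rule continuous_slab_ext[OF T cb])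
  have cEf: "continuous_on UNIV (Ef i)" for i unfolding Ef_def by (intro continuous_slab_ext[OF T] continuous_intros cE)
  have cGf: "continuous_on UNIV (Gf i)" for i unfolding Gf_def by (intro continuous_slab_ext[OF T] continuous_on_component cg)
  have Bnz: "B p \<noteq> 0" for p unfolding B_def slab_ext_def by (rule bnz) (rule slab_clamp_mem[OF T])
  have dB: "((\<lambda>s. B (p + s *\<^sub>R ?e i)) has_real_derivative Gf i p) (at 0)" if "i = 1 \<or> i = 2" for p i
    using L[OF _ that, of "max 0 (min T (fst p))" "snd p"] T
    by (simp add: B_def Gf_def slab_ext_def del: grad_perp_nth)
  obtain M where M: "\<And>p. p \<in> ?S \<Longrightarrow> norm (E p) \<le> M"
    by (rule electric_bounded[OF T E]) (rule that)
  have MEf: "\<bar>Ef i p\<bar> \<le> M" for i p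
    unfolding Ef_def slab_ext_def
    using order_trans[OF component_le_norm_cart M[OF slab_clamp_mem[OF T]]] .
  have wE: "weak_partial ?\<Omega> (?e i) \<phi> (\<lambda>p. - Ef i p)" for i
  proof -
    have w: "weak_partial ?\<Omega> (?e i) \<phi> (\<lambda>p. - (E p $ i))" using E by (simp add: electric_field_def)
    have eq: "- (E p $ i) = - Ef i p" if "p \<in> ?\<Omega>" for p by (simp add: Ef_def slab_ext_eq_open[OF that])
    have "(LINT x|lebesgue_on ?\<Omega>. - (E x $ i) * u x) = (LINT x|lebesgue_on ?\<Omega>. - Ef i x * u x)" for u
      using eq by (intro Bochner_Integration.integral_cong) auto
    then show ?thesis using w locally_integrable_cong[of ?\<Omega> "\<lambda>p. - (E p $ i)" "\<lambda>p. - Ef i p"] eq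
      by (simp add: weak_partial_def)
  qed
  have ext: "E p $ i = Ef i p" "grad_perp b p $ i = Gf i p" "b p = B p" if "p \<in> ?S" for p i
    using that by (simp_all add: Ef_def Gf_def B_def slab_ext_eq)
  have h_eq: "h p = (Ef 2 p * Gf 1 p - Ef 1 p * Gf 2 p) / (B p)\<^sup>2" if "p \<in> ?S" for p
    using ext[OF that] by (simp add: h_def inner_vec3 del: grad_perp_nth)
  have G_eq: "G p $ 1 = - Ef 2 p / B p" "G p $ 2 = Ef 1 p / B p" "G p $ 3 = 0" if "p \<in> ?S" for p
    using ext[OF that] by (simp_all add: G_def F_field_def divide_inverse)
  note sub = subsetD[OF open_slab_subset]
  have ch: "continuous_on ?S h"
    unfolding h_def inner_vec3 rot_nth using bnz
    by (intro continuous_intros cE cb continuous_on_component[OF cg]) auto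
  have "weak_div_perp ?\<Omega> G h"
    unfolding weak_div_perp_def
  proof (intro conjI allI impI)
    have l1: "locally_integrable ?\<Omega> (\<lambda>p. G p $ 1)"
      by (rule locally_integrable_cong[of _ "\<lambda>p. - Ef 2 p / B p"], rule locally_integrable_continuous)
        (use Bnz G_eq(1)[OF sub] in \<open>auto intro!: continuous_intros cEf cB\<close>)
    have l2: "locally_integrable ?\<Omega> (\<lambda>p. G p $ 2)"
      by (rule locally_integrable_cong[of _ "\<lambda>p. Ef 1 p / B p"], rule locally_integrable_continuous)
        (use Bnz G_eq(2)[OF sub] in \<open>auto intro!: continuous_intros cEf cB\<close>)
    have l3: "locally_integrable ?\<Omega> (\<lambda>p. G p $ 3)"
      by (rule locally_integrable_cong[of _ "\<lambda>p. 0"], rule locally_integrable_continuous)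
        (use G_eq(3)[OF sub] in auto)
    show "locally_integrable ?\<Omega> (\<lambda>p. G p $ i)" for i
      using l1 l2 l3 exhaust_3[of i] by auto
    show "locally_integrable ?\<Omega> h"
      by (rule locally_integrable_cong[of _ "\<lambda>p. (Ef 2 p * Gf 1 p - Ef 1 p * Gf 2 p) / (B p)\<^sup>2"],
          rule locally_integrable_continuous)
        (use Bnz h_eq[OF sub] in \<open>auto intro!: continuous_intros cEf cB cGf\<close>)
    fix \<psi> assume tf: "test_function ?\<Omega> \<psi>"
    define K where "K = closure {x. \<psi> x \<noteq> 0}"
    have K: "compact K" "K \<subseteq> ?\<Omega>" using tf by (auto simp: test_function_def K_def)
    have \<psi>0: "\<psi> p = 0" if "p \<notin> K" for p using that closure_subset[of "{x. \<psi> x \<noteq> 0}"] by (auto simp: K_def)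
    obtain D where D: "\<And>v. continuous_on UNIV (\<lambda>p. D p v)" "\<And>p v. p \<notin> K \<Longrightarrow> D p v = 0"
      "\<And>p v. ((\<lambda>s. \<psi> (p + s *\<^sub>R v)) has_real_derivative D p v) (at 0)"
      "\<And>p. grad_perp \<psi> p $ 1 = D p (?e 1)" "\<And>p. grad_perp \<psi> p $ 2 = D p (?e 2)"
      by (rule test_function_derivative[OF tf, folded K_def]) (rule that)
    have c\<psi>: "continuous_on UNIV \<psi>"
      using tf C_k_on_continuous[of 0 UNIV \<psi>] unfolding test_function_def by blast
    define \<theta> where "\<theta> p = \<psi> p / B p" for p
    define \<theta>' where "\<theta>' i p = D p (?e i) / B p - \<psi> p * Gf i p / (B p)\<^sup>2" for i p
    have d\<theta>: "((\<lambda>s. \<theta> (p + s *\<^sub>R ?e i)) has_real_derivative \<theta>' i p) (at 0)" if "i = 1 \<or> i = 2" for p i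
    proof -
      have "((\<lambda>s. \<psi> (p + s *\<^sub>R ?e i) / B (p + s *\<^sub>R ?e i)) has_real_derivative
         (D p (?e i) * B (p + 0 *\<^sub>R ?e i) - \<psi> (p + 0 *\<^sub>R ?e i) * Gf i p) / (B (p + 0 *\<^sub>R ?e i) * B (p + 0 *\<^sub>R ?e i))) (at 0)"
        by (rule DERIV_divide[OF D(3) dB[OF that] Bnz])
      moreover have "(D p (?e i) * B p - \<psi> p * Gf i p) / (B p * B p) = \<theta>' i p"
        using Bnz[of p] by (simp add: \<theta>'_def field_simps power2_eq_square)
      ultimately show ?thesis by (simp add: \<theta>_def flip: zero_prod_def)
    qed
    have c\<theta>: "continuous_on UNIV \<theta>" unfolding \<theta>_def using Bnz by (intro continuous_intros c\<psi> cB) auto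
    have c\<theta>': "continuous_on UNIV (\<theta>' i)" for i
      unfolding \<theta>'_def using Bnz by (intro continuous_intros c\<psi> cB cGf D(1)) auto
    have zero: "(LINT p|lebesgue. Ef 1 p * \<theta>' 2 p - Ef 2 p * \<theta>' 1 p) = 0"
      by (rule curl_free_integral[OF wE[of 1] wE[of 2] cEf cEf MEf MEf open_open_slab K c\<theta> _ c\<theta>' _ _ c\<theta>'])
        (use \<psi>0 D(2) d\<theta> in \<open>auto simp: \<theta>_def \<theta>'_def\<close>)
    define A where "A p = (Ef 1 p * D p (?e 2) - Ef 2 p * D p (?e 1)) / B p" for p
    define C where "C p = (Ef 2 p * Gf 1 p - Ef 1 p * Gf 2 p) / (B p)\<^sup>2 * \<psi> p" for p
    have AC: "Ef 1 p * \<theta>' 2 p - Ef 2 p * \<theta>' 1 p = A p + C p" for p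
      using Bnz[of p] by (simp add: A_def C_def \<theta>'_def field_simps power2_eq_square)
    note int = integrable_bounded_support[OF compact_imp_bounded[OF K(1)]]
    have iA: "integrable lebesgue A"
      by (rule int) (use Bnz D(2) in \<open>auto simp: A_def[abs_def] intro!: continuous_intros cEf cB D(1)\<close>)
    have iC: "integrable lebesgue C"
      by (rule int) (use Bnz \<psi>0 in \<open>auto simp: C_def[abs_def] intro!: continuous_intros cEf cB cGf c\<psi>\<close>)
    have out: "D p v = 0" "\<psi> p = 0" if "p \<notin> ?\<Omega>" for p v
      using D(2)[of p v] \<psi>0[of p] K(2) that by blast+
    have \<Omega>': "?\<Omega> \<in> sets lebesgue" using open_open_slab by (auto intro: borel_open)
    have "(LINT p|lebesgue_on ?\<Omega>. G p \<bullet> grad_perp \<psi> p) = (LINT p|lebesgue_on ?\<Omega>. A p)"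
    proof (rule Bochner_Integration.integral_cong[OF refl])
      fix p assume "p \<in> space (lebesgue_on ?\<Omega>)"
      then have "p \<in> ?S" using open_slab_subset by auto
      then show "G p \<bullet> grad_perp \<psi> p = A p"
        unfolding inner_vec3 D(4,5) A_def by (simp add: G_eq diff_divide_distrib)
    qed
    also have "\<dots> = (LINT p|lebesgue. A p)"
      by (rule integral_lebesgue_on_support[OF _ \<Omega>']) (simp add: A_def out)
    also have "\<dots> = - (LINT p|lebesgue. C p)"
      using zero iA iC by (simp add: AC)
    also have "(LINT p|lebesgue. C p) = (LINT p|lebesgue_on ?\<Omega>. C p)"
      by (rule integral_lebesgue_on_support[OF _ \<Omega>', symmetric]) (simp add: C_def out)
    also have "\<dots> = (LINT p|lebesgue_on ?\<Omega>. h p * \<psi> p)"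
      using h_eq[OF sub] by (intro Bochner_Integration.integral_cong) (auto simp: C_def)
    finally show "(LINT p|lebesgue_on ?\<Omega>. G p \<bullet> grad_perp \<psi> p) = - (LINT p|lebesgue_on ?\<Omega>. h p * \<psi> p)" .
  qed
  with ch have ex: "\<exists>h. continuous_on ?S h \<and> weak_div_perp ?\<Omega> G h" by blast
  have d: "continuous_on ?S (div_perp T G)" "weak_div_perp ?\<Omega> G (div_perp T G)"
    using someI_ex[OF ex] unfolding div_perp_def by blast+
  have "div_perp T G (t, x) = h (t, x)"
    using t by (intro weak_div_perp_unique[OF T d(1) ch d(2) \<open>weak_div_perp ?\<Omega> G h\<close>]) (simp add: closed_slab_def)
  then show ?thesis by (simp add: g_field_def G_def[abs_def] h_def)
qed

section \<open>One step of the scheme in the plane orthogonal to the magnetic field\<close>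

text \<open>The decimal bounds leave ample room in the estimates below. Exact relations between the
  coefficients matter for the stability function and for the cancellation that gives third order.\<close>

lemma \<alpha>_bounds: "0.24 < \<alpha>" "\<alpha> < 0.25"
proof -
  have l: "7.5 < sqrt 57" by (rule real_less_rsqrt) (simp add: power2_eq_square)
  have u: "sqrt 57 < 7.56" by (rule real_less_lsqrt) (simp_all add: power2_eq_square)
  show "0.24 < \<alpha>" "\<alpha> < 0.25" using l u by (simp_all add: \<alpha>_def)
qed

lemma \<alpha>_quadratic: "3 * \<alpha>\<^sup>2 = 9 * \<alpha> - 2"
  by (simp add: \<alpha>_def power2_eq_square field_simps)

lemma \<gamma>_eq: "\<gamma> = (1 - 3 * \<alpha>) / 4"
  by (simp add: \<gamma>_def \<eta>_def \<beta>_def)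

text \<open>One implicit stage \<open>v = w + \<alpha> f\<close>, \<open>f = a - i l v\<close> is solved by multiplication with the
  resolvent. Its modulus is at most \<open>1\<close>, and at most \<open>1 / (\<alpha> l)\<close> for the large angles \<open>l = \<Delta>t b / \<epsilon>\<close>
  of the strongly magnetized regime.\<close>

definition resolvent :: "real \<Rightarrow> complex" where
  "resolvent l = 1 / (1 + \<i> * of_real (\<alpha> * l))"

lemma resolvent_denom_nz: "1 + \<i> * complex_of_real y \<noteq> 0"
  by (simp add: complex_eq_iff)

lemma norm_denom: "cmod (1 + \<i> * complex_of_real y) = sqrt (1 + y\<^sup>2)"
  by (simp add: cmod_def)

lemma norm_resolvent_le_1: "cmod (resolvent l) \<le> 1"
proof -
  have "1 \<le> sqrt (1 + (\<alpha> * l)\<^sup>2)" by simp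
  then have "1 / sqrt (1 + (\<alpha> * l)\<^sup>2) \<le> 1 / 1" by (intro divide_left_mono) (auto intro: add_pos_nonneg)
  then show ?thesis by (simp add: resolvent_def norm_divide norm_denom del: of_real_mult)
qed

lemma norm_resolvent_le: "0 < l \<Longrightarrow> cmod (resolvent l) * l \<le> 1 / \<alpha>"
proof -
  assume l: "0 < l"
  have "\<alpha> * l \<le> sqrt (1 + (\<alpha> * l)\<^sup>2)" by (rule real_le_rsqrt) simp
  moreover have "0 < sqrt (1 + (\<alpha> * l)\<^sup>2)" by (simp add: add_pos_nonneg)
  ultimately show ?thesis
    using \<alpha>_bounds by (simp add: resolvent_def norm_divide norm_denom field_simps del: of_real_mult)
qed

text \<open>A change of the angle is damped by two resolvents. One of them compensates the factor
  \<open>1 / \<epsilon>\<close> in the angles when the magnetic field varies between the stages.\<close>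

lemma resolvent_diff:
  "cmod (resolvent l - resolvent l') = \<alpha> * \<bar>l - l'\<bar> * cmod (resolvent l) * cmod (resolvent l')"
proof -
  have "resolvent l - resolvent l' = - \<i> * of_real (\<alpha> * (l - l')) * resolvent l * resolvent l'"
    using resolvent_denom_nz[of "\<alpha> * l"] resolvent_denom_nz[of "\<alpha> * l'"]
    by (simp add: resolvent_def field_simps)
  then show ?thesis
    using \<alpha>_bounds by (simp add: norm_mult abs_mult del: of_real_mult of_real_diff)
qed

text \<open>The coefficients of the initial velocity in the stage forces, and in the new velocity:
  the stability function of the method, with a different resolvent in each stage because the
  magnetic field is evaluated at different points.\<close>

definition amp2 :: "complex \<Rightarrow> complex" where
  "amp2 r1 = (r1 - 1) * (2 - r1) / complex_of_real \<alpha>"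
definition amp3 :: "complex \<Rightarrow> complex \<Rightarrow> complex" where
  "amp3 r1 r3 = (r3 - 1) / complex_of_real \<alpha> * (1 + (1 - complex_of_real \<alpha>) * amp2 r1)"
definition amp4 :: "complex \<Rightarrow> complex \<Rightarrow> complex \<Rightarrow> complex" where
  "amp4 r1 r3 r4 = (r4 - 1) / complex_of_real \<alpha> *
     (1 + complex_of_real \<beta> * ((r1 - 1) / complex_of_real \<alpha>) + complex_of_real \<eta> * amp2 r1
        + complex_of_real \<gamma> * amp3 r1 r3)"
definition amplification :: "complex \<Rightarrow> complex \<Rightarrow> complex \<Rightarrow> complex" where
  "amplification r1 r3 r4 = 1 + (amp2 r1 + amp3 r1 r3 + 4 * amp4 r1 r3 r4) / 6"

text \<open>The stability function on the imaginary axis. A denominator of degree four meets a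
  numerator of degree three, because the L-stability condition \<open>2 u\<^sup>2 = 9 u - 3\<close> for \<open>u = 1 / \<alpha>\<close>
  annihilates the leading coefficient.\<close>

lemma amplification_diagonal:
  fixes z :: real
  defines "u \<equiv> 1 / \<alpha>" and "d \<equiv> 1 + \<i> * complex_of_real z"
  shows "amplification (1 / d) (1 / d) (1 / d) * d ^ 4 =
    Complex (1 - (21 - 7 * u) / 4 * z\<^sup>2) ((4 - u) * z - (17 - u) / 8 * z ^ 3)"
proof -
  have a: "\<alpha> \<noteq> 0" using \<alpha>_bounds by simp
  have u2: "2 * u\<^sup>2 = 9 * u - 3"
    using \<alpha>_quadratic a by (simp add: u_def field_simps power2_eq_square)
  define x where "x = \<i> * complex_of_real z"
  define U where "U = complex_of_real u"
  have U2: "2 * U\<^sup>2 = 9 * U - 3"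
    using arg_cong[OF u2, of complex_of_real] by (simp add: U_def)
  have d: "d = 1 + x" "d \<noteq> 0" using resolvent_denom_nz[of z] by (simp_all add: d_def x_def)
  have s: "complex_of_real \<alpha> * U = 1" using a by (simp add: U_def u_def)
  have aU: "complex_of_real \<alpha> = 1 / U" and Unz: "U \<noteq> 0" using s by (auto simp: eq_divide_eq mult.commute)
  have "amplification (1 / d) (1 / d) (1 / d) * d ^ 4 = d ^ 4 +
    (- x * U * (1 + 2 * x) * d\<^sup>2 - x * U * d ^ 3 + x\<^sup>2 * U * (U - 1) * (1 + 2 * x) * d
     - 4 * x * U * (d ^ 3 - x * d\<^sup>2 / 4 - x * (U / 4 - 1 / 2) * (1 + 2 * x) * d
        + (U / 4 - 3 / 4) * (- x * d\<^sup>2 + x\<^sup>2 * (U - 1) * (1 + 2 * x)))) / 6"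
  proof -
    have r: "1 / d - 1 = - x / d" "2 - 1 / d = (1 + 2 * x) / d"
      using d(2) by (simp_all add: field_simps) (simp_all add: d(1) algebra_simps)
    have p2: "amp2 (1 / d) = - x * U * (1 + 2 * x) / d\<^sup>2"
      unfolding amp2_def r aU using d(2) by (simp add: power2_eq_square)
    have p3: "amp3 (1 / d) (1 / d) = - x * U / d + x\<^sup>2 * U * (U - 1) * (1 + 2 * x) / d ^ 3"
      unfolding amp3_def p2 r aU using d(2) Unz
      by (simp add: field_simps power2_eq_square power3_eq_cube)
    have p4: "amp4 (1 / d) (1 / d) (1 / d) = - x * U / d * (1 - x / (4 * d) - x * (U / 4 - 1 / 2) * (1 + 2 * x) / d\<^sup>2
        + (U / 4 - 3 / 4) * (- x / d + x\<^sup>2 * (U - 1) * (1 + 2 * x) / d ^ 3))"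
    proof -
      have coef: "complex_of_real \<beta> = 1 / (4 * U)" "complex_of_real \<eta> = 1 / 4 - 1 / (2 * U)"
        "complex_of_real \<gamma> = 1 / 4 - 3 / (4 * U)"
        using Unz by (simp_all add: \<beta>_def \<eta>_def \<gamma>_eq aU field_simps)
      have "complex_of_real \<beta> * (- x / d * U) = - x / (4 * d)"
        "complex_of_real \<eta> * (- x * U * (1 + 2 * x) / d\<^sup>2) = - (x * (U / 4 - 1 / 2) * (1 + 2 * x) / d\<^sup>2)"
        "complex_of_real \<gamma> * (- x * U / d + x\<^sup>2 * U * (U - 1) * (1 + 2 * x) / d ^ 3)
          = (U / 4 - 3 / 4) * (- x / d + x\<^sup>2 * (U - 1) * (1 + 2 * x) / d ^ 3)"
        unfolding coef using Unz d(2) by (simp_all add: divide_simps) (simp_all add: algebra_simps)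
      then show ?thesis
        unfolding amp4_def p2 p3 r aU by simp
    qed
    have dd: "(p / d) * d ^ 4 = p * d ^ 3" "(p / d\<^sup>2) * d ^ 4 = p * d\<^sup>2" "(p / d ^ 3) * d ^ 4 = p * d" for p
      using d(2) by (simp_all add: power_eq_if)
    show ?thesis
      unfolding amplification_def p2 p3 p4 using d(2)
      by (simp add: divide_simps) (simp add: algebra_simps power_eq_if)
  qed
  also have "\<dots> = 1 + (4 - U) * x + (21 - 7 * U) / 4 * x\<^sup>2 + (17 - U) / 8 * x ^ 3"
    unfolding d(1) using U2 by algebra
  also have "\<dots> = Complex (1 - (21 - 7 * u) / 4 * z\<^sup>2) ((4 - u) * z - (17 - u) / 8 * z ^ 3)"
    by (simp add: x_def U_def complex_eq_iff power2_eq_square power3_eq_cube)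
  finally show ?thesis .
qed

text \<open>With \<open>y = (\<alpha> l)\<^sup>2\<close> the claim is a polynomial inequality in \<open>y\<close> of degree three. Its linear
  coefficient vanishes because the method has order two, and the other two are nonnegative. The deficit
  \<open>y\<^sup>4\<close> is the leading term of \<open>(1 + y)\<^sup>4\<close>, which the numerator lacks: the damping is uniform for
  angles bounded away from \<open>0\<close>.\<close>

lemma norm_amplification_diagonal:
  fixes l :: real
  defines "y \<equiv> (\<alpha> * l)\<^sup>2" and "r \<equiv> resolvent l"
  shows "(cmod (amplification r r r))\<^sup>2 \<le> 1 - (y / (1 + y)) ^ 4"
proof -
  define u where "u = 1 / \<alpha>"
  define z where "z = \<alpha> * l"
  define d where "d = 1 + \<i> * complex_of_real z"
  have a: "0 < \<alpha>" using \<alpha>_bounds by simp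
  have u2: "2 * u\<^sup>2 = 9 * u - 3"
    using \<alpha>_quadratic a by (simp add: u_def field_simps power2_eq_square)
  have u: "4 < u" "u < 4.17" using \<alpha>_bounds by (simp_all add: u_def field_simps)
  have y: "y = z\<^sup>2" "0 \<le> y" by (simp_all add: y_def z_def)
  define n1 n2 n3 where "n1 = 4 - u" and "n2 = (21 - 7 * u) / 4" and "n3 = (17 - u) / 8"
  have "amplification r r r * d ^ 4 = Complex (1 - n2 * z\<^sup>2) (n1 * z - n3 * z ^ 3)"
    using amplification_diagonal[of z] by (simp add: r_def resolvent_def d_def z_def u_def n1_def n2_def n3_def)
  then have "(cmod (amplification r r r * d ^ 4))\<^sup>2 = (1 - n2 * y)\<^sup>2 + (n1 * z - n3 * z ^ 3)\<^sup>2"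
    by (simp add: cmod_power2 y)
  also have "(n1 * z - n3 * z ^ 3)\<^sup>2 = y * (n1 - n3 * y)\<^sup>2"
    by (simp add: y power2_eq_square power3_eq_cube algebra_simps)
  also have "(1 - n2 * y)\<^sup>2 + y * (n1 - n3 * y)\<^sup>2 \<le> (1 + y) ^ 4 - y ^ 4"
  proof -
    \<comment> \<open>the coefficients of \<open>y\<close>, \<open>y\<^sup>3\<close> and \<open>y\<^sup>2\<close>\<close>
    have c1: "4 + 2 * n2 - n1\<^sup>2 = 0"
      using u2 by (simp add: n1_def n2_def power2_eq_square field_simps)
    have c3: "0 \<le> 4 - n3\<^sup>2"
    proof -
      have "n3\<^sup>2 \<le> 2\<^sup>2" using u by (intro power_mono) (auto simp: n3_def)
      then show ?thesis by simp
    qed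
    have "6 - n2\<^sup>2 + 2 * n1 * n3 = 6 - (441 - 294 * u + 49 * u\<^sup>2) / 16 + (68 - 21 * u + u\<^sup>2) / 4"
      by (simp add: n1_def n2_def n3_def power2_eq_square field_simps)
    also have "\<dots> = 6 - (441 - 294 * u + 49 * ((9 * u - 3) / 2)) / 16 + (68 - 21 * u + (9 * u - 3) / 2) / 4"
    proof -
      have "u\<^sup>2 = (9 * u - 3) / 2" using u2 by simp
      then show ?thesis by (simp only:)
    qed
    also have "\<dots> \<ge> 0" using u by (simp add: field_simps)
    finally have c2: "0 \<le> 6 - n2\<^sup>2 + 2 * n1 * n3" .
    have "(1 + y) ^ 4 - y ^ 4 - ((1 - n2 * y)\<^sup>2 + y * (n1 - n3 * y)\<^sup>2)
        = (4 + 2 * n2 - n1\<^sup>2) * y + (6 - n2\<^sup>2 + 2 * n1 * n3) * y\<^sup>2 + (4 - n3\<^sup>2) * y ^ 3"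
      by (simp add: power_eq_if algebra_simps)
    also have "\<dots> \<ge> 0"
      using c1 c2 c3 y(2) by (auto intro!: add_nonneg_nonneg mult_nonneg_nonneg)
    finally show ?thesis by simp
  qed
  finally have N: "(cmod (amplification r r r * d ^ 4))\<^sup>2 \<le> (1 + y) ^ 4 - y ^ 4" .
  have "(cmod d)\<^sup>2 = 1 + y" using norm_denom[of z] y by (simp add: d_def)
  then have "(cmod (d ^ 4))\<^sup>2 = (1 + y) ^ 4"
    by (metis norm_power power_mult mult.commute)
  then have "(cmod (amplification r r r))\<^sup>2 * (1 + y) ^ 4 \<le> (1 + y) ^ 4 - y ^ 4"
    using N by (simp add: norm_mult power_mult_distrib)
  moreover have "0 < (1 + y) ^ 4" using y(2) by simp
  ultimately have "(cmod (amplification r r r))\<^sup>2 \<le> ((1 + y) ^ 4 - y ^ 4) / (1 + y) ^ 4"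
    by (simp add: pos_le_divide_eq)
  also have "\<dots> = 1 - (y / (1 + y)) ^ 4"
    using y(2) by (simp add: diff_divide_distrib power_divide)
  finally show ?thesis .
qed

lemma stage_solution:
  assumes "v = w + complex_of_real \<alpha> * f" "f = a - \<i> * complex_of_real l * v"
  shows "v = resolvent l * (w + complex_of_real \<alpha> * a)"
    "f = (resolvent l - 1) / complex_of_real \<alpha> * w + resolvent l * a"
proof -
  have a: "complex_of_real \<alpha> \<noteq> 0" using \<alpha>_bounds by simp
  have "(1 + \<i> * complex_of_real (\<alpha> * l)) * v = w + complex_of_real \<alpha> * a"
    using assms by (simp add: algebra_simps)
  then show v: "v = resolvent l * (w + complex_of_real \<alpha> * a)"
    using resolvent_denom_nz[of "\<alpha> * l"] by (simp add: resolvent_def field_simps)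
  have "f = (v - w) / complex_of_real \<alpha>" using assms(1) a by (simp add: field_simps)
  then show "f = (resolvent l - 1) / complex_of_real \<alpha> * w + resolvent l * a"
    using a unfolding v by (simp add: field_simps)
qed

text \<open>The perpendicular part of one step, written in the complex plane: \<open>f\<^sub>k\<close> is \<open>\<Delta>t F\<^sup>(\<^sup>k\<^sup>)\<close>,
  \<open>a\<^sub>k\<close> the explicit force and \<open>l\<^sub>k\<close> the rotation angle \<open>\<Delta>t b / \<epsilon>\<close> at stage \<open>k\<close>.\<close>

locale complex_step =
  fixes v a1 a3 a4 v1 v2 v3 v4 f1 f2 f3 f4 v' :: complex and l1 l3 l4 A :: real
  assumes v1: "v1 = v + complex_of_real \<alpha> * f1" and f1: "f1 = a1 - \<i> * complex_of_real l1 * v1"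
    and v2: "v2 = (v - complex_of_real \<alpha> * f1) + complex_of_real \<alpha> * f2" and f2: "f2 = a1 - \<i> * complex_of_real l1 * v2"
    and v3: "v3 = (v + (1 - complex_of_real \<alpha>) * f2) + complex_of_real \<alpha> * f3" and f3: "f3 = a3 - \<i> * complex_of_real l3 * v3"
    and v4: "v4 = (v + complex_of_real \<beta> * f1 + complex_of_real \<eta> * f2 + complex_of_real \<gamma> * f3) + complex_of_real \<alpha> * f4"
    and f4: "f4 = a4 - \<i> * complex_of_real l4 * v4"
    and v': "v' = v + (f2 + f3 + 4 * f4) / 6"
    and A: "cmod a1 \<le> A" "cmod a3 \<le> A" "cmod a4 \<le> A"
begin

abbreviation "r1 \<equiv> resolvent l1"
abbreviation "r3 \<equiv> resolvent l3"
abbreviation "r4 \<equiv> resolvent l4"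

end

lemma coefficient_bounds:
  "0 < \<beta>" "\<beta> \<le> 0.0625" "0 < \<eta>" "\<eta> \<le> 0.13" "0 < \<gamma>" "\<gamma> \<le> 0.07" "1 / \<alpha> \<le> 4.17" "0 < \<alpha>"
  using \<alpha>_bounds by (simp_all add: \<beta>_def \<eta>_def \<gamma>_eq field_simps)

lemma norm_resolvent_diff_le: "cmod ((resolvent l - 1) / complex_of_real \<alpha>) \<le> 8.34"
proof -
  have "cmod (resolvent l - 1) \<le> 2"
    using norm_triangle_ineq4[of "resolvent l" 1] norm_resolvent_le_1[of l] by simp
  then show ?thesis using \<alpha>_bounds by (simp add: norm_divide field_simps)
qed

lemma norm_mult_le: "cmod x \<le> p \<Longrightarrow> cmod y \<le> q \<Longrightarrow> cmod (x * y) \<le> p * q"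
  unfolding norm_mult by (intro mult_mono) (auto intro: order_trans[OF norm_ge_zero])

lemma norm_add_le: "norm x \<le> p \<Longrightarrow> norm y \<le> q \<Longrightarrow> norm (x + y) \<le> p + q"
  by (rule norm_triangle_le) simp

lemma norm_diff_le: "norm x \<le> p \<Longrightarrow> norm y \<le> q \<Longrightarrow> norm (x - y) \<le> p + q"
  by (rule order_trans[OF norm_triangle_ineq4]) simp

lemma norm_amp_le:
  "cmod (amp2 (resolvent l)) \<le> 26" "cmod (amp3 (resolvent l) (resolvent l')) \<le> 226"
  "cmod (amp4 (resolvent l) (resolvent l') (resolvent l'')) \<le> 180"
proof -
  let ?r = "resolvent l"
  have e: "amp2 ?r = (?r - 1) / complex_of_real \<alpha> * (2 - ?r)" by (simp add: amp2_def)
  have "cmod (amp2 ?r) \<le> 8.34 * (2 + 1)"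
    unfolding e by (intro norm_mult_le norm_resolvent_diff_le norm_diff_le norm_resolvent_le_1) simp
  then show a2: "cmod (amp2 ?r) \<le> 26" by simp
  have c: "cmod (1 - complex_of_real \<alpha>) \<le> 1"
    using \<alpha>_bounds norm_of_real[of "1 - \<alpha>", where 'a=complex] by simp
  have "cmod (amp3 ?r (resolvent l')) \<le> 8.34 * (1 + 1 * 26)"
    unfolding amp3_def by (intro norm_mult_le norm_resolvent_diff_le norm_add_le a2 c) simp
  then show a3: "cmod (amp3 ?r (resolvent l')) \<le> 226" by simp
  have "cmod (amp4 ?r (resolvent l') (resolvent l'')) \<le> 8.34 * (1 + 0.0625 * 8.34 + 0.13 * 26 + 0.07 * 226)"
    unfolding amp4_def by (intro norm_mult_le norm_resolvent_diff_le norm_add_le a2 a3)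
      (use coefficient_bounds in auto)
  then show "cmod (amp4 ?r (resolvent l') (resolvent l'')) \<le> 180" by simp
qed

text \<open>The freezing of the magnetic field at its value in the first stage, where the stability
  function has modulus at most one, costs only a multiple of the differences of the resolvents.\<close>

lemma amplification_perturbation:
  fixes l1 l3 l4 :: real
  defines "r1 \<equiv> resolvent l1" and "r3 \<equiv> resolvent l3" and "r4 \<equiv> resolvent l4"
  shows "cmod (amplification r1 r3 r4) \<le> cmod (amplification r1 r1 r1) + 200 * (cmod (r3 - r1) + cmod (r4 - r1))"
proof -
  have c: "cmod (1 - complex_of_real \<alpha>) \<le> 1"
    using \<alpha>_bounds norm_of_real[of "1 - \<alpha>", where 'a=complex] by simp
  have ia: "cmod (1 / complex_of_real \<alpha>) \<le> 4.17" using coefficient_bounds by (simp add: norm_divide)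
  have n: "cmod ((r1 - 1) / complex_of_real \<alpha>) \<le> 8.34" "cmod (amp2 r1) \<le> 26" "cmod (amp3 r1 r3) \<le> 226"
    unfolding r1_def r3_def by (rule norm_resolvent_diff_le norm_amp_le)+
  have "amp3 r1 r3 - amp3 r1 r1 = (r3 - r1) * (1 / complex_of_real \<alpha> * (1 + (1 - complex_of_real \<alpha>) * amp2 r1))"
    using \<alpha>_bounds by (simp add: amp3_def field_simps)
  moreover have "cmod \<dots> \<le> cmod (r3 - r1) * (4.17 * (1 + 1 * 26))"
    unfolding r1_def by (intro norm_mult_le norm_add_le norm_amp_le c ia) auto
  moreover have "cmod (r3 - r1) * (4.17 * (1 + 1 * 26)) \<le> cmod (r3 - r1) * 113"
    by (rule mult_left_mono) auto
  ultimately have d3: "cmod (amp3 r1 r3 - amp3 r1 r1) \<le> 113 * cmod (r3 - r1)"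
    by (metis mult.commute order_trans)
  have "amp4 r1 r3 r4 - amp4 r1 r1 r1 =
    (r4 - r1) * (1 / complex_of_real \<alpha> * (1 + complex_of_real \<beta> * ((r1 - 1) / complex_of_real \<alpha>) + complex_of_real \<eta> * amp2 r1
        + complex_of_real \<gamma> * amp3 r1 r3)) + (r1 - 1) / complex_of_real \<alpha> * (complex_of_real \<gamma> * (amp3 r1 r3 - amp3 r1 r1))"
    using \<alpha>_bounds by (simp add: amp4_def field_simps)
  moreover have "cmod \<dots> \<le> cmod (r4 - r1) * (4.17 * (1 + 0.0625 * 8.34 + 0.13 * 26 + 0.07 * 226))
      + 8.34 * (0.07 * (113 * cmod (r3 - r1)))"
    by (intro norm_mult_le norm_add_le ia d3 n order_refl) (use coefficient_bounds in auto)
  ultimately have "cmod (amp4 r1 r3 r4 - amp4 r1 r1 r1) \<le> cmod (r4 - r1) * (4.17 * (1 + 0.0625 * 8.34 + 0.13 * 26 + 0.07 * 226))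
      + 8.34 * (0.07 * (113 * cmod (r3 - r1)))" by (simp only:)
  then have d4: "cmod (amp4 r1 r3 r4 - amp4 r1 r1 r1) \<le> 90 * cmod (r4 - r1) + 66 * cmod (r3 - r1)"
    using norm_ge_zero[of "r4 - r1"] norm_ge_zero[of "r3 - r1"] by (simp add: field_simps del: norm_ge_zero)
  have "amplification r1 r3 r4 = amplification r1 r1 r1 +
      ((amp3 r1 r3 - amp3 r1 r1) / 6 + 4 * (amp4 r1 r3 r4 - amp4 r1 r1 r1) / 6)"
    by (simp add: amplification_def field_simps)
  then have "cmod (amplification r1 r3 r4) \<le> cmod (amplification r1 r1 r1) +
      (cmod ((amp3 r1 r3 - amp3 r1 r1) / 6) + cmod (4 * (amp4 r1 r3 r4 - amp4 r1 r1 r1) / 6))"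
    by (simp add: norm_add_le norm_triangle_ineq)
  also have "\<dots> \<le> cmod (amplification r1 r1 r1) + 200 * (cmod (r3 - r1) + cmod (r4 - r1))"
    using d3 d4 norm_ge_zero[of "r4 - r1"] norm_ge_zero[of "r3 - r1"]
    unfolding norm_divide norm_mult norm_numeral by argo
  finally show ?thesis .
qed

context complex_step
begin

lemma A_nonneg: "0 \<le> A" using A(1) norm_ge_zero order_trans by blast

text \<open>The explicit forces are multiplied by resolvents and by \<open>(r - 1) / \<alpha>\<close> only, all of which
  are bounded whatever the angles are.\<close>

lemma forced_parts:
  "cmod (f1 - (r1 - 1) / complex_of_real \<alpha> * v) \<le> A"
  "cmod (f2 - amp2 r1 * v) \<le> 3 * A" "cmod (f3 - amp3 r1 r3 * v) \<le> 27 * A" "cmod (f4 - amp4 r1 r3 r4 * v) \<le> 21 * A"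
proof -
  have a: "complex_of_real \<alpha> \<noteq> 0" using \<alpha>_bounds by simp
  have c: "cmod (1 - complex_of_real \<alpha>) \<le> 1"
    using \<alpha>_bounds norm_of_real[of "1 - \<alpha>", where 'a=complex] by simp
  have rA: "cmod (resolvent l * a) \<le> A" if "cmod a \<le> A" for l a
    using norm_mult_le[OF norm_resolvent_le_1 that, of l] by simp
  define g1 where "g1 = f1 - (r1 - 1) / complex_of_real \<alpha> * v"
  have g1_eq: "g1 = r1 * a1" using stage_solution(2)[OF v1 f1] by (simp add: g1_def)
  then show g1: "cmod g1 \<le> A" using rA[OF A(1)] by simp
  define g2 where "g2 = f2 - amp2 r1 * v"
  have "v - complex_of_real \<alpha> * f1 = (2 - r1) * v - complex_of_real \<alpha> * g1"
    using a by (simp add: g1_def field_simps)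
  then have "f2 = (r1 - 1) / complex_of_real \<alpha> * ((2 - r1) * v - complex_of_real \<alpha> * g1) + r1 * a1"
    using stage_solution(2)[OF v2 f2] by simp
  then have "g2 = - (r1 - 1) * g1 + r1 * a1"
    using a by (simp add: g2_def amp2_def field_simps)
  moreover have "cmod \<dots> \<le> (1 + 1) * A + A"
    by (intro norm_add_le norm_mult_le rA A g1, unfold norm_minus_cancel, intro norm_diff_le norm_resolvent_le_1) simp
  ultimately show g2: "cmod g2 \<le> 3 * A" by simp
  define g3 where "g3 = f3 - amp3 r1 r3 * v"
  have "f2 = amp2 r1 * v + g2" by (simp add: g2_def)
  then have "f3 = (r3 - 1) / complex_of_real \<alpha> * (v + (1 - complex_of_real \<alpha>) * (amp2 r1 * v + g2)) + r3 * a3"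
    using stage_solution(2)[OF v3 f3] by simp
  then have "f3 = amp3 r1 r3 * v + ((r3 - 1) / complex_of_real \<alpha> * ((1 - complex_of_real \<alpha>) * g2) + r3 * a3)"
    unfolding amp3_def by (simp only: distrib_left distrib_right mult.assoc mult_1_left add.assoc)
  then have "g3 = (r3 - 1) / complex_of_real \<alpha> * ((1 - complex_of_real \<alpha>) * g2) + r3 * a3"
    by (simp add: g3_def)
  moreover have "cmod \<dots> \<le> 8.34 * (1 * (3 * A)) + A"
    by (intro norm_add_le norm_mult_le rA A g2 norm_resolvent_diff_le c)
  ultimately show g3: "cmod g3 \<le> 27 * A" using A_nonneg by simp
  define g4 where "g4 = f4 - amp4 r1 r3 r4 * v"
  have "f1 = (r1 - 1) / complex_of_real \<alpha> * v + g1" "f2 = amp2 r1 * v + g2" "f3 = amp3 r1 r3 * v + g3"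
    by (simp_all add: g1_def g2_def g3_def)
  then have "g4 = (r4 - 1) / complex_of_real \<alpha> *
      (complex_of_real \<beta> * g1 + complex_of_real \<eta> * g2 + complex_of_real \<gamma> * g3) + r4 * a4"
    using stage_solution(2)[OF v4 f4] by (simp add: g4_def amp4_def algebra_simps)
  moreover have "cmod \<dots> \<le> 8.34 * (0.0625 * A + 0.13 * (3 * A) + 0.07 * (27 * A)) + A"
    by (intro norm_add_le norm_mult_le rA A g1 g2 g3 norm_resolvent_diff_le) (use coefficient_bounds in auto)
  ultimately show "cmod g4 \<le> 21 * A" using A_nonneg by simp
qed

lemma step_amplification: "cmod v' \<le> cmod (amplification r1 r3 r4) * cmod v + 20 * A"
proof -
  have "v' = amplification r1 r3 r4 * v +
      ((f2 - amp2 r1 * v) + (f3 - amp3 r1 r3 * v) + 4 * (f4 - amp4 r1 r3 r4 * v)) / 6"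
    by (simp add: v' amplification_def field_simps)
  moreover have "cmod ((f2 - amp2 r1 * v) + (f3 - amp3 r1 r3 * v) + 4 * (f4 - amp4 r1 r3 r4 * v)) \<le> 3 * A + 27 * A + 4 * (21 * A)"
    by (intro norm_add_le norm_mult_le forced_parts) simp
  then have "cmod (amplification r1 r3 r4 * v + ((f2 - amp2 r1 * v) + (f3 - amp3 r1 r3 * v) + 4 * (f4 - amp4 r1 r3 r4 * v)) / 6)
      \<le> cmod (amplification r1 r3 r4) * cmod v + (3 * A + 27 * A + 4 * (21 * A)) / 6"
    by (intro norm_add_le norm_mult_le order_refl) (simp add: norm_divide)
  ultimately show ?thesis using A_nonneg by simp
qed

lemma force_bounds:
  "cmod f1 \<le> 250 * (cmod v + A)" "cmod f2 \<le> 250 * (cmod v + A)" "cmod f3 \<le> 250 * (cmod v + A)" "cmod f4 \<le> 250 * (cmod v + A)"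
proof -
  have *: "cmod f \<le> 250 * (cmod v + A)" if "cmod (f - p * v) \<le> c * A" "cmod p \<le> 250" "c \<le> 250" for f p c
  proof -
    have "cmod ((f - p * v) + p * v) \<le> c * A + 250 * cmod v"
      by (intro norm_add_le that norm_mult_le) simp
    also have "\<dots> \<le> 250 * (cmod v + A)" using mult_right_mono[OF that(3) A_nonneg] by simp
    finally show ?thesis by simp
  qed
  show "cmod f1 \<le> 250 * (cmod v + A)"
    by (rule *[of _ "(r1 - 1) / complex_of_real \<alpha>" 1]) (use forced_parts(1) norm_resolvent_diff_le[of l1] in auto)
  show "cmod f2 \<le> 250 * (cmod v + A)"
    by (rule *[OF forced_parts(2)]) (use norm_amp_le(1)[of l1] in auto)
  show "cmod f3 \<le> 250 * (cmod v + A)"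
    by (rule *[OF forced_parts(3)]) (use norm_amp_le(2)[of l1 l3] in auto)
  show "cmod f4 \<le> 250 * (cmod v + A)"
    by (rule *[OF forced_parts(4)]) (use norm_amp_le(3)[of l1 l3 l4] in auto)
qed

lemma velocity_bounds:
  "cmod v1 \<le> cmod r1 * (300 * (cmod v + A))" "cmod v2 \<le> cmod r1 * (300 * (cmod v + A))"
  "cmod v3 \<le> cmod r3 * (300 * (cmod v + A))" "cmod v4 \<le> cmod r4 * (300 * (cmod v + A))"
proof -
  let ?X = "cmod v + A"
  have X: "cmod v \<le> ?X" "A \<le> ?X" using A_nonneg by auto
  have al: "cmod (complex_of_real \<alpha>) \<le> 0.25" using \<alpha>_bounds by simp
  have c: "cmod (1 - complex_of_real \<alpha>) \<le> 1"
    using \<alpha>_bounds norm_of_real[of "1 - \<alpha>", where 'a=complex] by simp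
  have be: "cmod (complex_of_real \<beta>) \<le> 0.0625" "cmod (complex_of_real \<eta>) \<le> 0.13" "cmod (complex_of_real \<gamma>) \<le> 0.07"
    using coefficient_bounds by auto
  have st: "cmod (resolvent l * (w + complex_of_real \<alpha> * a)) \<le> cmod (resolvent l) * (300 * ?X)"
    if "cmod w \<le> 260 * ?X" "cmod a \<le> A" for l w a
  proof -
    have "cmod (w + complex_of_real \<alpha> * a) \<le> 260 * ?X + 0.25 * A"
      by (intro norm_add_le norm_mult_le that al)
    then have "cmod (w + complex_of_real \<alpha> * a) \<le> 300 * ?X" using A_nonneg norm_ge_zero[of v] by (simp add: field_simps del: norm_ge_zero)
    then show ?thesis by (intro norm_mult_le order_refl)
  qed
  have b1: "cmod v \<le> 260 * ?X" using A_nonneg norm_ge_zero[of v] by (simp add: field_simps del: norm_ge_zero)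
  have "cmod (v - complex_of_real \<alpha> * f1) \<le> ?X + 0.25 * (250 * ?X)"
    by (intro norm_diff_le norm_mult_le al force_bounds X)
  then have b2: "cmod (v - complex_of_real \<alpha> * f1) \<le> 260 * ?X" using A_nonneg norm_ge_zero[of v] by (simp add: field_simps del: norm_ge_zero)
  have "cmod (v + (1 - complex_of_real \<alpha>) * f2) \<le> ?X + 1 * (250 * ?X)"
    by (intro norm_add_le norm_mult_le c force_bounds X)
  then have b3: "cmod (v + (1 - complex_of_real \<alpha>) * f2) \<le> 260 * ?X" using A_nonneg norm_ge_zero[of v] by (simp add: field_simps del: norm_ge_zero)
  have "cmod (v + complex_of_real \<beta> * f1 + complex_of_real \<eta> * f2 + complex_of_real \<gamma> * f3)
      \<le> ?X + 0.0625 * (250 * ?X) + 0.13 * (250 * ?X) + 0.07 * (250 * ?X)"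
    by (intro norm_add_le norm_mult_le be force_bounds X)
  then have b4: "cmod (v + complex_of_real \<beta> * f1 + complex_of_real \<eta> * f2 + complex_of_real \<gamma> * f3) \<le> 260 * ?X"
    using A_nonneg norm_ge_zero[of v] by (simp add: field_simps del: norm_ge_zero)
  show "cmod v1 \<le> cmod r1 * (300 * ?X)"
    unfolding stage_solution(1)[OF v1 f1] by (rule st[OF b1 A(1)])
  show "cmod v2 \<le> cmod r1 * (300 * ?X)"
    unfolding stage_solution(1)[OF v2 f2] by (rule st[OF b2 A(1)])
  show "cmod v3 \<le> cmod r3 * (300 * ?X)"
    unfolding stage_solution(1)[OF v3 f3] by (rule st[OF b3 A(2)])
  show "cmod v4 \<le> cmod r4 * (300 * ?X)"
    unfolding stage_solution(1)[OF v4 f4] by (rule st[OF b4 A(3)])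
qed

text \<open>In \<open>v'\<close>, when the forces are eliminated in favour of the stage velocities, the coefficient of
  the initial velocity is the stability function at infinity, which is zero. Hence the new velocity
  is small as soon as the stage velocities are, whatever the initial velocity was.\<close>

lemma step_from_stages:
  assumes m: "cmod v1 \<le> m" "cmod v2 \<le> m" "cmod v3 \<le> m" "cmod v4 \<le> m"
  shows "cmod v' \<le> 20 * m"
proof -
  have a: "complex_of_real \<alpha> \<noteq> 0" using \<alpha>_bounds by simp
  have m0: "0 \<le> m" using m(1) norm_ge_zero order_trans by blast
  let ?u = "1 / complex_of_real \<alpha>"
  have u: "cmod ?u \<le> 4.17" using coefficient_bounds by (simp add: norm_divide)
  have c: "cmod (1 - complex_of_real \<alpha>) \<le> 0.76"
    using \<alpha>_bounds norm_of_real[of "1 - \<alpha>", where 'a=complex] by simp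
  have be: "cmod (complex_of_real \<beta>) \<le> 0.0625" "cmod (complex_of_real \<eta>) \<le> 0.13" "cmod (complex_of_real \<gamma>) \<le> 0.07"
    using coefficient_bounds by auto
  define g1 g2 where "g1 = ?u * v1" and "g2 = ?u * (v1 + v2)"
  define g3 where "g3 = ?u * (v3 - (1 - complex_of_real \<alpha>) * g2)"
  define g4 where "g4 = ?u * (v4 - complex_of_real \<beta> * g1 - complex_of_real \<eta> * g2 - complex_of_real \<gamma> * g3)"
  define q3 where "q3 = (2 - 3 * \<alpha>) / \<alpha>\<^sup>2"
  define q4 where "q4 = - (1 / \<alpha>) * (1 - \<beta> / \<alpha> - 2 * \<eta> / \<alpha> + \<gamma> * q3)"
  have e1: "f1 = g1 - ?u * v" using v1 a by (simp add: g1_def field_simps)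
  have e2: "f2 = g2 - 2 * ?u * v"
    using v2 v1 a by (simp add: g2_def field_simps)
  have e3: "f3 = g3 + complex_of_real q3 * v"
  proof -
    have "complex_of_real \<alpha> * f3 = v3 - v - (1 - complex_of_real \<alpha>) * (g2 - 2 * ?u * v)" using v3 e2 by simp
    then have "f3 = ?u * (v3 - v - (1 - complex_of_real \<alpha>) * (g2 - 2 * ?u * v))"
      using a by (simp add: field_simps)
    also have "\<dots> = g3 + complex_of_real q3 * v"
      using a by (simp add: g3_def q3_def field_simps power2_eq_square)
    finally show ?thesis .
  qed
  have e4: "f4 = g4 + complex_of_real q4 * v"
  proof -
    have eq: "complex_of_real \<alpha> * f4 = v4 - v - complex_of_real \<beta> * (g1 - ?u * v) - complex_of_real \<eta> * (g2 - 2 * ?u * v)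
        - complex_of_real \<gamma> * (g3 + complex_of_real q3 * v)" using v4 e1 e2 e3 by simp
    have "f4 = ?u * (complex_of_real \<alpha> * f4)" using a by simp
    also have "\<dots> = ?u * (v4 - v - complex_of_real \<beta> * (g1 - ?u * v) - complex_of_real \<eta> * (g2 - 2 * ?u * v)
        - complex_of_real \<gamma> * (g3 + complex_of_real q3 * v))"
      unfolding eq ..
    also have "\<dots> = g4 + complex_of_real q4 * v"
      using a by (simp add: g4_def q4_def field_simps)
    finally show ?thesis .
  qed
  have "1 + (- 2 / \<alpha> + q3 + 4 * q4) / 6 = 0"
    using L_stability_condition by (simp add: q3_def q4_def)
  then have z: "1 + (- 2 * ?u + complex_of_real q3 + 4 * complex_of_real q4) / 6 = 0"
    by (metis (no_types, lifting) of_real_0 of_real_1 of_real_add of_real_divide of_real_minus of_real_mult of_real_numeral mult_minus_left times_divide_eq_right mult.right_neutral)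
  have "v' = (g2 + g3 + 4 * g4) / 6 + (1 + (- 2 * ?u + complex_of_real q3 + 4 * complex_of_real q4) / 6) * v"
    unfolding v' e2 e3 e4 by (simp add: field_simps)
  then have w: "v' = (g2 + g3 + 4 * g4) / 6" unfolding z by simp
  have G1: "cmod g1 \<le> 4.17 * m" unfolding g1_def by (intro norm_mult_le u m)
  have G2: "cmod g2 \<le> 4.17 * (m + m)" unfolding g2_def by (intro norm_mult_le norm_add_le u m)
  have G3: "cmod g3 \<le> 4.17 * (m + 0.76 * (4.17 * (m + m)))"
    unfolding g3_def by (intro norm_mult_le norm_diff_le u m c G2)
  have G4: "cmod g4 \<le> 4.17 * (m + 0.0625 * (4.17 * m) + 0.13 * (4.17 * (m + m)) + 0.07 * (4.17 * (m + 0.76 * (4.17 * (m + m)))))"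
    unfolding g4_def by (intro norm_mult_le norm_diff_le u m be G1 G2 G3)
  have "cmod (g2 + g3 + 4 * g4) \<le> 4.17 * (m + m) + 4.17 * (m + 0.76 * (4.17 * (m + m)))
      + 4 * (4.17 * (m + 0.0625 * (4.17 * m) + 0.13 * (4.17 * (m + m)) + 0.07 * (4.17 * (m + 0.76 * (4.17 * (m + m))))))"
    by (intro norm_add_le norm_mult_le G2 G3 G4) simp
  then have "cmod (g2 + g3 + 4 * g4) \<le> 120 * m" using m0 by simp
  then show ?thesis unfolding w by (simp add: norm_divide)
qed

end

section \<open>Uniform bounds for the scheme\<close>

text \<open>Lets the bounds for a complete step be applied to its first stages: the missing stages
  are filled with any solution.\<close>

lemma stage_exists:
  "\<exists>v f. v = w + complex_of_real \<alpha> * f \<and> f = a - \<i> * complex_of_real l * v"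
proof -
  define v where "v = resolvent l * (w + complex_of_real \<alpha> * a)"
  define f where "f = a - \<i> * complex_of_real l * v"
  have "(1 + \<i> * complex_of_real (\<alpha> * l)) * v = w + complex_of_real \<alpha> * a"
    using resolvent_denom_nz[of "\<alpha> * l"] by (simp add: v_def resolvent_def)
  then have "v = w + complex_of_real \<alpha> * f" by (simp add: f_def algebra_simps)
  then show ?thesis using f_def by blast
qed

lemma second_velocity_bound:
  assumes v1: "v1 = v + complex_of_real \<alpha> * f1" and f1: "f1 = a1 - \<i> * complex_of_real l1 * v1"
    and v2: "v2 = (v - complex_of_real \<alpha> * f1) + complex_of_real \<alpha> * f2" and f2: "f2 = a1 - \<i> * complex_of_real l1 * v2"
  shows "cmod v2 \<le> 300 * (cmod v + cmod a1)"
proof -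
  obtain v3 f3 where 3: "v3 = (v + (1 - complex_of_real \<alpha>) * f2) + complex_of_real \<alpha> * f3"
    "f3 = 0 - \<i> * complex_of_real 0 * v3" using stage_exists by blast
  obtain v4 f4 where 4: "v4 = (v + complex_of_real \<beta> * f1 + complex_of_real \<eta> * f2 + complex_of_real \<gamma> * f3) + complex_of_real \<alpha> * f4"
    "f4 = 0 - \<i> * complex_of_real 0 * v4" using stage_exists by blast
  interpret complex_step v a1 0 0 v1 v2 v3 v4 f1 f2 f3 f4 "v + (f2 + f3 + 4 * f4) / 6" l1 0 0 "cmod a1"
    by unfold_locales (fact assms 3 4 refl | simp)+
  show ?thesis
    using velocity_bounds(2) mult_right_mono[OF norm_resolvent_le_1[of l1], of "300 * (cmod v + cmod a1)"] by simp
qed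

lemma third_velocity_bound:
  assumes v1: "v1 = v + complex_of_real \<alpha> * f1" and f1: "f1 = a1 - \<i> * complex_of_real l1 * v1"
    and v2: "v2 = (v - complex_of_real \<alpha> * f1) + complex_of_real \<alpha> * f2" and f2: "f2 = a1 - \<i> * complex_of_real l1 * v2"
    and v3: "v3 = (v + (1 - complex_of_real \<alpha>) * f2) + complex_of_real \<alpha> * f3" and f3: "f3 = a3 - \<i> * complex_of_real l3 * v3"
    and A: "cmod a1 \<le> A" "cmod a3 \<le> A"
  shows "cmod v3 \<le> 300 * (cmod v + A)"
proof -
  obtain v4 f4 where 4: "v4 = (v + complex_of_real \<beta> * f1 + complex_of_real \<eta> * f2 + complex_of_real \<gamma> * f3) + complex_of_real \<alpha> * f4"
    "f4 = 0 - \<i> * complex_of_real 0 * v4" using stage_exists by blast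
  have A0: "0 \<le> A" using A(1) norm_ge_zero order_trans by blast
  interpret complex_step v a1 a3 0 v1 v2 v3 v4 f1 f2 f3 f4 "v + (f2 + f3 + 4 * f4) / 6" l1 l3 0 A
    by unfold_locales (fact assms 4 refl | simp add: A0)+
  show ?thesis
    using velocity_bounds(3) mult_right_mono[OF norm_resolvent_le_1[of l3], of "300 * (cmod v + A)"] A0 by simp
qed

lemma abs_quarter_sum: "\<bar>1 / 4 * (a + b)\<bar> \<le> A + B" if "\<bar>a\<bar> \<le> A" "\<bar>b\<bar> \<le> B" for a b A B :: real
  using that by (simp add: abs_le_iff field_simps)

lemma abs_simpson_sum: "\<bar>1 / 6 * (a + b + 4 * c)\<bar> \<le> A"
  if "\<bar>a\<bar> \<le> A" "\<bar>b\<bar> \<le> A" "\<bar>c\<bar> \<le> A" for a b c A :: real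
  using that by (simp add: abs_le_iff field_simps)

text \<open>In the plane orthogonal to the field, the rotation \<open>rot\<close> is multiplication by \<open>i\<close>, so that
  the implicit equations become scalar.\<close>

definition cplx :: "vec3 \<Rightarrow> complex" where "cplx w = Complex (w $ 1) (w $ 2)"

lemma cplx_simps:
  "cplx (v + w) = cplx v + cplx w" "cplx (v - w) = cplx v - cplx w" "cplx (- w) = - cplx w"
  "cplx (c *\<^sub>R w) = complex_of_real c * cplx w" "cplx (rot w) = \<i> * cplx w"
  by (simp_all add: cplx_def complex_eq_iff)

lemma norm_perp: "norm (perp w) = cmod (cplx w)"
  by (simp add: norm_vec_def L2_set_def sum_3 cplx_def cmod_def)

lemma cmod_cplx_le: "cmod (cplx w) \<le> norm w"
  by (simp add: norm_vec_def L2_set_def sum_3 cplx_def cmod_def)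

lemma norm_le_cplx: "norm w \<le> cmod (cplx w) + \<bar>w $ 3\<bar>"
proof -
  have "w = perp w + vector [0, 0, w $ 3]" by (rule vec3_eqI) simp_all
  then have "norm w \<le> norm (perp w) + norm (vector [0, 0, w $ 3] :: vec3)"
    by (metis norm_triangle_ineq)
  moreover have "norm (vector [0, 0, w $ 3] :: vec3) \<le> \<bar>w $ 3\<bar>"
    using vec3_norm_le[of "vector [0, 0, w $ 3]"] by simp
  ultimately show ?thesis by (simp add: norm_perp)
qed

lemma abs_inner_perp_le: "\<bar>perp a \<bullet> perp w\<bar> \<le> norm a * cmod (cplx w)"
  using Cauchy_Schwarz_ineq2[of "perp a" "perp w"] cmod_cplx_le[of a]
  by (metis norm_perp mult_right_mono norm_ge_zero order_trans)

lemma S_stepE: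
  assumes "S_step E b chi \<epsilon> dt t (x, v, e) s (x', v', e')" "0 < dt"
  obtains F1 F2 F3 F4 where
    "F1 = H_field E b chi t x v e - (b (t, x) / \<epsilon>) *\<^sub>R rot (vel1 s)"
    "F2 = H_field E b chi t x v e - (b (t, x) / \<epsilon>) *\<^sub>R rot (vel2 s)"
    "F3 = H_field E b chi (t + dt) (pos2 s) (hvel2 s) (en2 s) - (b (t + dt, pos2 s) / \<epsilon>) *\<^sub>R rot (vel3 s)"
    "F4 = H_field E b chi (t + dt / 2) (pos3 s) (hvel3 s) (en3 s) - (b (t + dt / 2, pos3 s) / \<epsilon>) *\<^sub>R rot (vel4 s)"
    "vel1 s = v + dt *\<^sub>R (\<alpha> *\<^sub>R F1)"
    "vel2 s = v + dt *\<^sub>R (- (\<alpha> *\<^sub>R F1) + \<alpha> *\<^sub>R F2)"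
    "pos2 s = x + dt *\<^sub>R vel2 s"
    "en2 s = e + dt * (perp (E (t, x)) \<bullet> perp (vel2 s))"
    "hvel2 s = v + dt *\<^sub>R F2"
    "vel3 s = v + dt *\<^sub>R ((1 - \<alpha>) *\<^sub>R F2 + \<alpha> *\<^sub>R F3)"
    "pos3 s = x + dt *\<^sub>R ((1 / 4) *\<^sub>R (vel2 s + vel3 s))"
    "en3 s = e + dt * (1 / 4 * (perp (E (t, x)) \<bullet> perp (vel2 s) + perp (E (t + dt, pos2 s)) \<bullet> perp (vel3 s)))"
    "hvel3 s = v + dt *\<^sub>R ((1 / 4) *\<^sub>R (F2 + F3))"
    "vel4 s = v + dt *\<^sub>R (\<beta> *\<^sub>R F1 + \<eta> *\<^sub>R F2 + \<gamma> *\<^sub>R F3 + \<alpha> *\<^sub>R F4)"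
    "x' = x + dt *\<^sub>R ((1 / 6) *\<^sub>R (vel2 s + vel3 s + 4 *\<^sub>R vel4 s))"
    "v' = v + dt *\<^sub>R ((1 / 6) *\<^sub>R (F2 + F3 + 4 *\<^sub>R F4))"
    "e' = e + dt * (1 / 6 * (perp (E (t, x)) \<bullet> perp (vel2 s) + perp (E (t + dt, pos2 s)) \<bullet> perp (vel3 s)
       + 4 * (perp (E (t + dt / 2, pos3 s)) \<bullet> perp (vel4 s))))"
proof -
  have V: "(p - q) /\<^sub>R dt = c \<longleftrightarrow> p = q + dt *\<^sub>R c" for p q c :: vec3
  proof -
    have "(p - q) /\<^sub>R dt = c \<longleftrightarrow> p - q = dt *\<^sub>R c"
      using assms(2) vector_fraction_eq_iff[of 1 dt "p - q" c] by (simp add: inverse_eq_divide)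
    then show ?thesis by (simp add: diff_eq_eq add.commute)
  qed
  have R: "(p - q) / dt = c \<longleftrightarrow> p = q + dt * c" for p q c :: real
    using assms(2) by (auto simp: field_simps)
  show ?thesis
    by (rule that[OF refl refl refl refl]; insert assms(1), unfold S_step_def Let_def V R prod.case, elim conjE, assumption)
qed

lemma grad_perp_ln:
  assumes "\<And>i. i = 1 \<or> i = 2 \<Longrightarrow>
      ((\<lambda>s. b (t, x + s *\<^sub>R axis i 1)) has_real_derivative grad_perp b (t, x) $ i) (at 0)" "0 < b (t, x)"
  shows "grad_perp (\<lambda>p. ln (b p)) (t, x) = grad_perp b (t, x) /\<^sub>R b (t, x)"
proof -
  have "((\<lambda>s. ln (b (t, x + s *\<^sub>R axis i 1))) has_real_derivative inverse (b (t, x)) * grad_perp b (t, x) $ i) (at 0)"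
    if "i = 1 \<or> i = 2" for i
  proof -
    have "((\<lambda>s. ln (b (t, x + s *\<^sub>R axis i 1))) has_real_derivative
        inverse (b (t, x + 0 *\<^sub>R axis i 1)) * grad_perp b (t, x) $ i) (at 0)"
      by (rule DERIV_chain2[where f=ln, OF DERIV_ln assms(1)[OF that]]) (use assms(2) in simp)
    then show ?thesis by simp
  qed
  from this[of 1, THEN DERIV_imp_deriv] this[of 2, THEN DERIV_imp_deriv]
  show ?thesis by (intro vec3_eqI) (simp_all del: grad_perp_nth(1,2) add: grad_perp_nth(1,2)[of "\<lambda>p. ln (b p)"])
qed

text \<open>What the analysis of the scheme retains of the Sobolev hypotheses.\<close>

locale bounded_data =
  fixes T b0 M L :: real and E :: "spacetime \<Rightarrow> vec3" and b :: "spacetime \<Rightarrow> real"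
    and chi :: "real \<times> vec3 \<Rightarrow> real"
  assumes T: "0 < T" and b0: "0 < b0" and M0: "0 \<le> M" and L0: "0 \<le> L"
    and E_le: "p \<in> closed_slab T \<Longrightarrow> norm (E p) \<le> M"
    and b_gt: "p \<in> closed_slab T \<Longrightarrow> b0 < b p"
    and b_lip: "p \<in> closed_slab T \<Longrightarrow> q \<in> closed_slab T \<Longrightarrow> \<bar>b q - b p\<bar> \<le> L * norm (q - p)"
    and grad_le: "p \<in> closed_slab T \<Longrightarrow> norm (grad_perp b p) \<le> L"
    and grad_ln: "p \<in> closed_slab T \<Longrightarrow> grad_perp (\<lambda>p. ln (b p)) p = grad_perp b p /\<^sub>R b p"
    and chi_le: "\<bar>chi (e, perp w)\<bar> \<le> \<bar>e\<bar>"
begin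

definition "KH = M + L / b0"

lemma KH0: "0 \<le> KH" using M0 L0 b0 by (simp add: KH_def)

lemma slab_mem: "0 \<le> t \<Longrightarrow> t \<le> T \<Longrightarrow> (t, x) \<in> closed_slab T"
  by (simp add: closed_slab_def)

lemma H_le:
  assumes t: "0 \<le> t" "t \<le> T" shows "norm (H_field E b chi t x w e) \<le> KH * (1 + \<bar>e\<bar>)"
proof -
  have p: "(t, x) \<in> closed_slab T" using t by (rule slab_mem)
  have bp: "0 < b (t, x)" using b0 b_gt[OF p] by simp
  have "norm (grad_perp (\<lambda>p. ln (b p)) (t, x)) = norm (grad_perp b (t, x)) / b (t, x)"
    using bp by (simp add: grad_ln[OF p] divide_inverse mult.commute)
  also have "\<dots> \<le> L / b0"
    using b0 L0 b_gt[OF p] grad_le[OF p] by (intro frac_le) auto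
  finally have g: "norm (grad_perp (\<lambda>p. ln (b p)) (t, x)) \<le> L / b0" .
  have "norm (chi (e, perp w) *\<^sub>R grad_perp (\<lambda>p. ln (b p)) (t, x)) \<le> \<bar>e\<bar> * (L / b0)"
    unfolding norm_scaleR by (rule mult_mono[OF chi_le g]) auto
  then have "norm (H_field E b chi t x w e) \<le> M + \<bar>e\<bar> * (L / b0)"
    unfolding H_field_def by (intro norm_diff_le E_le p)
  also have "\<dots> \<le> KH * (1 + \<bar>e\<bar>)"
    using M0 L0 b0 by (simp add: KH_def algebra_simps)
  finally show ?thesis .
qed

lemma H_nth_3: "H_field E b chi t x w e $ 3 = E (t, x) $ 3"
  by (simp add: H_field_def)

lemma E3_le: "0 \<le> t \<Longrightarrow> t \<le> T \<Longrightarrow> \<bar>E (t, x) $ 3\<bar> \<le> M"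
  using order_trans[OF component_le_norm_cart E_le[OF slab_mem]] .

text \<open>Bounds for the quantities of one step relative to its initial weight \<open>1 + \<bar>v\<^sub>\<perp>\<bar> + \<bar>e\<bar>\<close>, in the
  order in which the stages produce them: \<open>C1\<close> and \<open>C3\<close> for the second and third velocity,
  \<open>C2\<close> and \<open>C4\<close> for the hat energies computed from them, \<open>C6\<close> for all explicit forces, and \<open>C5\<close>
  for all perpendicular velocities. None of them involves \<open>\<epsilon>\<close> or the time step.\<close>

definition "C1 = 300 * (1 + T * KH)"
definition "C2 = 1 + T * M * C1"
definition "C3 = 300 * (1 + T * (KH * (1 + C2)))"
definition "C4 = 1 + T * M * (C1 + C3)"
definition "C6 = KH * (1 + C2 + C4)"
definition "C5 = 300 * (1 + T * C6)"

lemma constants_nonneg: "0 \<le> C1" "0 \<le> C2" "0 \<le> C3" "0 \<le> C4" "0 \<le> C5" "0 \<le> C6"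
proof -
  show 1: "0 \<le> C1" using T KH0 by (simp add: C1_def)
  show 2: "0 \<le> C2" using T M0 1 by (simp add: C2_def)
  show 3: "0 \<le> C3" using T KH0 2 by (simp add: C3_def)
  show 4: "0 \<le> C4" using T M0 1 3 by (simp add: C4_def)
  show 6: "0 \<le> C6" using KH0 2 4 by (simp add: C6_def)
  show "0 \<le> C5" using T 6 by (simp add: C5_def)
qed

end

text \<open>The bound \<open>P\<close> on the parallel velocity enters through the displacements, hence through the
  variation of the magnetic field between the stages.\<close>

locale data_step = bounded_data +
  fixes dt \<epsilon> t :: real and x v :: vec3 and e :: real and s :: S_stages and x' v' :: vec3 and e' :: real
    and F1 F2 F3 F4 :: vec3 and P :: real
  assumes dt: "0 < dt" and \<epsilon>: "0 < \<epsilon>" and t0: "0 \<le> t" and tT: "t + dt \<le> T"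
    and F1: "F1 = H_field E b chi t x v e - (b (t, x) / \<epsilon>) *\<^sub>R rot (vel1 s)"
    and F2: "F2 = H_field E b chi t x v e - (b (t, x) / \<epsilon>) *\<^sub>R rot (vel2 s)"
    and F3: "F3 = H_field E b chi (t + dt) (pos2 s) (hvel2 s) (en2 s) - (b (t + dt, pos2 s) / \<epsilon>) *\<^sub>R rot (vel3 s)"
    and F4: "F4 = H_field E b chi (t + dt / 2) (pos3 s) (hvel3 s) (en3 s) - (b (t + dt / 2, pos3 s) / \<epsilon>) *\<^sub>R rot (vel4 s)"
    and vel1: "vel1 s = v + dt *\<^sub>R (\<alpha> *\<^sub>R F1)"
    and vel2: "vel2 s = v + dt *\<^sub>R (- (\<alpha> *\<^sub>R F1) + \<alpha> *\<^sub>R F2)"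
    and pos2: "pos2 s = x + dt *\<^sub>R vel2 s"
    and en2: "en2 s = e + dt * (perp (E (t, x)) \<bullet> perp (vel2 s))"
    and hvel2: "hvel2 s = v + dt *\<^sub>R F2"
    and vel3: "vel3 s = v + dt *\<^sub>R ((1 - \<alpha>) *\<^sub>R F2 + \<alpha> *\<^sub>R F3)"
    and pos3: "pos3 s = x + dt *\<^sub>R ((1 / 4) *\<^sub>R (vel2 s + vel3 s))"
    and en3: "en3 s = e + dt * (1 / 4 * (perp (E (t, x)) \<bullet> perp (vel2 s) + perp (E (t + dt, pos2 s)) \<bullet> perp (vel3 s)))"
    and hvel3: "hvel3 s = v + dt *\<^sub>R ((1 / 4) *\<^sub>R (F2 + F3))"
    and vel4: "vel4 s = v + dt *\<^sub>R (\<beta> *\<^sub>R F1 + \<eta> *\<^sub>R F2 + \<gamma> *\<^sub>R F3 + \<alpha> *\<^sub>R F4)"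
    and x': "x' = x + dt *\<^sub>R ((1 / 6) *\<^sub>R (vel2 s + vel3 s + 4 *\<^sub>R vel4 s))"
    and v': "v' = v + dt *\<^sub>R ((1 / 6) *\<^sub>R (F2 + F3 + 4 *\<^sub>R F4))"
    and e': "e' = e + dt * (1 / 6 * (perp (E (t, x)) \<bullet> perp (vel2 s) + perp (E (t + dt, pos2 s)) \<bullet> perp (vel3 s)
       + 4 * (perp (E (t + dt / 2, pos3 s)) \<bullet> perp (vel4 s))))"
    and v3: "\<bar>v $ 3\<bar> \<le> P"
begin

definition "W = 1 + cmod (cplx v) + \<bar>e\<bar>"
definition "f1 = complex_of_real dt * cplx F1"
definition "f2 = complex_of_real dt * cplx F2"
definition "f3 = complex_of_real dt * cplx F3"
definition "f4 = complex_of_real dt * cplx F4"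
definition "a1 = complex_of_real dt * cplx (H_field E b chi t x v e)"
definition "a3 = complex_of_real dt * cplx (H_field E b chi (t + dt) (pos2 s) (hvel2 s) (en2 s))"
definition "a4 = complex_of_real dt * cplx (H_field E b chi (t + dt / 2) (pos3 s) (hvel3 s) (en3 s))"
definition "l1 = dt * b (t, x) / \<epsilon>"
definition "l3 = dt * b (t + dt, pos2 s) / \<epsilon>"
definition "l4 = dt * b (t + dt / 2, pos3 s) / \<epsilon>"

lemma dtT: "dt \<le> T" using t0 tT by simp

lemma times: "0 \<le> t" "t \<le> T" "0 \<le> t + dt" "t + dt \<le> T" "0 \<le> t + dt / 2" "t + dt / 2 \<le> T"
  using dt t0 tT by auto

lemma W_ge: "1 \<le> W" "cmod (cplx v) \<le> W" "\<bar>e\<bar> \<le> W" "0 \<le> W" "1 + \<bar>e\<bar> \<le> W"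
  using norm_ge_zero[of "cplx v"] by (simp_all add: W_def del: norm_ge_zero)

lemma st1: "cplx (vel1 s) = cplx v + complex_of_real \<alpha> * f1"
    "f1 = a1 - \<i> * complex_of_real l1 * cplx (vel1 s)"
  by (subst vel1, simp add: cplx_simps f1_def f2_def f3_def f4_def algebra_simps)
    (subst f1_def, subst F1, simp add: cplx_simps a1_def l1_def algebra_simps)

lemma st2: "cplx (vel2 s) = (cplx v - complex_of_real \<alpha> * f1) + complex_of_real \<alpha> * f2"
    "f2 = a1 - \<i> * complex_of_real l1 * cplx (vel2 s)"
  by (subst vel2, simp add: cplx_simps f1_def f2_def f3_def f4_def algebra_simps)
    (subst f2_def, subst F2, simp add: cplx_simps a1_def l1_def algebra_simps)

lemma st3: "cplx (vel3 s) = (cplx v + (1 - complex_of_real \<alpha>) * f2) + complex_of_real \<alpha> * f3"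
    "f3 = a3 - \<i> * complex_of_real l3 * cplx (vel3 s)"
  by (subst vel3, simp add: cplx_simps f1_def f2_def f3_def f4_def algebra_simps)
    (subst f3_def, subst F3, simp add: cplx_simps a3_def l3_def algebra_simps)

lemma st4: "cplx (vel4 s) = (cplx v + complex_of_real \<beta> * f1 + complex_of_real \<eta> * f2 + complex_of_real \<gamma> * f3) + complex_of_real \<alpha> * f4"
    "f4 = a4 - \<i> * complex_of_real l4 * cplx (vel4 s)"
  by (subst vel4, simp add: cplx_simps f1_def f2_def f3_def f4_def algebra_simps)
    (subst f4_def, subst F4, simp add: cplx_simps a4_def l4_def algebra_simps)

lemma st5: "cplx v' = cplx v + (f2 + f3 + 4 * f4) / 6"
  by (subst v') (simp add: cplx_simps f2_def f3_def f4_def field_simps)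

lemma force_le:
  assumes "0 \<le> t'" "t' \<le> T" "1 + \<bar>y\<bar> \<le> c * W"
  shows "cmod (complex_of_real dt * cplx (H_field E b chi t' z w y)) \<le> dt * (KH * c * W)"
proof -
  have "cmod (cplx (H_field E b chi t' z w y)) \<le> KH * (1 + \<bar>y\<bar>)"
    using order_trans[OF cmod_cplx_le H_le[OF assms(1,2)]] .
  also have "\<dots> \<le> KH * (c * W)" using assms(3) KH0 by (rule mult_left_mono)
  finally show ?thesis using dt by (simp add: norm_mult mult.assoc)
qed

lemma inner_E_le:
  assumes "0 \<le> t'" "t' \<le> T" "cmod (cplx w) \<le> c"
  shows "\<bar>perp (E (t', z)) \<bullet> perp w\<bar> \<le> M * c"
  using order_trans[OF abs_inner_perp_le mult_mono[OF E_le[OF slab_mem[OF assms(1,2)]] assms(3) M0 norm_ge_zero]] .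

lemma TW: "0 \<le> c \<Longrightarrow> dt * (c * W) \<le> T * c * W"
  using mult_right_mono[OF dtT, of "c * W"] W_ge by (simp add: mult.assoc)

lemma vel2_le0: "cmod (cplx (vel2 s)) \<le> C1 * W"
proof -
  have "cmod a1 \<le> dt * (KH * 1 * W)" unfolding a1_def by (rule force_le) (use times W_ge in auto)
  then have "cmod a1 \<le> T * KH * W" using TW[OF KH0] by simp
  then have "300 * (cmod (cplx v) + cmod a1) \<le> 300 * (W + T * KH * W)" using W_ge by simp
  then show ?thesis using second_velocity_bound[OF st1 st2] by (simp add: C1_def algebra_simps)
qed

lemma en2_le: "\<bar>en2 s\<bar> \<le> C2 * W"
proof -
  have "\<bar>dt * (perp (E (t, x)) \<bullet> perp (vel2 s))\<bar> \<le> dt * (M * (C1 * W))"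
    using inner_E_le[OF times(1,2) vel2_le0, of x] dt by (simp add: abs_mult)
  also have "\<dots> \<le> T * (M * C1) * W"
    using TW[of "M * C1"] M0 constants_nonneg by (simp add: mult.assoc)
  finally show ?thesis using W_ge by (simp add: en2 C2_def algebra_simps)
qed

lemma en_weight: "\<bar>y\<bar> \<le> c * W \<Longrightarrow> 1 + \<bar>y\<bar> \<le> (1 + c) * W"
  using W_ge(1) by (simp add: distrib_right)

lemma vel3_le0: "cmod (cplx (vel3 s)) \<le> C3 * W"
proof -
  let ?c = "KH * (1 + C2)"
  have c0: "0 \<le> ?c" using KH0 constants_nonneg by simp
  have "cmod a3 \<le> dt * (?c * W)" unfolding a3_def
    by (rule force_le) (use times en_weight[OF en2_le] in auto)
  moreover have "cmod a1 \<le> dt * (?c * W)" unfolding a1_def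
  proof (rule force_le)
    show "1 + \<bar>e\<bar> \<le> (1 + C2) * W"
      using W_ge(5) mult_nonneg_nonneg[OF constants_nonneg(2) W_ge(4)] unfolding distrib_right mult_1_left by linarith
  qed (use times in auto)
  ultimately have "cmod (cplx (vel3 s)) \<le> 300 * (cmod (cplx v) + dt * (?c * W))"
    by (intro third_velocity_bound[OF st1 st2 st3]) auto
  also have "\<dots> \<le> 300 * (W + T * ?c * W)" using W_ge TW[OF c0] by simp
  finally show ?thesis by (simp add: C3_def algebra_simps)
qed

lemma en3_le: "\<bar>en3 s\<bar> \<le> C4 * W"
proof -
  have "\<bar>perp (E (t, x)) \<bullet> perp (vel2 s)\<bar> \<le> M * (C1 * W)" "\<bar>perp (E (t + dt, pos2 s)) \<bullet> perp (vel3 s)\<bar> \<le> M * (C3 * W)"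
    by (intro inner_E_le times vel2_le0 vel3_le0)+
  then have "\<bar>1 / 4 * (perp (E (t, x)) \<bullet> perp (vel2 s) + perp (E (t + dt, pos2 s)) \<bullet> perp (vel3 s))\<bar> \<le> M * (C1 * W) + M * (C3 * W)"
    by (rule abs_quarter_sum)
  then have "\<bar>dt * (1 / 4 * (perp (E (t, x)) \<bullet> perp (vel2 s) + perp (E (t + dt, pos2 s)) \<bullet> perp (vel3 s)))\<bar> \<le> dt * (M * (C1 + C3) * W)"
    unfolding abs_mult[of dt] abs_of_pos[OF dt] using dt by (intro mult_left_mono) (simp_all add: algebra_simps)
  also have "\<dots> \<le> T * (M * (C1 + C3)) * W"
    using TW[of "M * (C1 + C3)"] M0 constants_nonneg by simp
  finally show ?thesis using W_ge by (simp add: en3 C4_def algebra_simps)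
qed

definition "A = dt * (C6 * W)"

lemma A_le: "cmod a1 \<le> A" "cmod a3 \<le> A" "cmod a4 \<le> A"
proof -
  have *: "1 + \<bar>y\<bar> \<le> (1 + C2 + C4) * W" if "\<bar>y\<bar> \<le> c * W" "c \<le> C2 + C4" for y c
    using en_weight[OF that(1)] mult_right_mono[OF that(2) W_ge(4)] by (simp add: algebra_simps)
  show "cmod a1 \<le> A" unfolding a1_def A_def C6_def
    by (rule force_le[OF times(1,2)], rule *[of _ 1]) (use W_ge T M0 constants_nonneg in \<open>auto simp: C2_def\<close>)
  show "cmod a3 \<le> A" unfolding a3_def A_def C6_def
    by (rule force_le[OF times(3,4)], rule *[OF en2_le]) (use constants_nonneg in auto)
  show "cmod a4 \<le> A" unfolding a4_def A_def C6_def
    by (rule force_le[OF times(5,6)], rule *[OF en3_le]) (use constants_nonneg in auto)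
qed

sublocale plane: complex_step "cplx v" a1 a3 a4 "cplx (vel1 s)" "cplx (vel2 s)" "cplx (vel3 s)" "cplx (vel4 s)" f1 f2 f3 f4 "cplx v'" l1 l3 l4 A
  by unfold_locales (fact st1 st2 st3 st4 st5 A_le)+

lemma vA_le: "300 * (cmod (cplx v) + A) \<le> C5 * W"
proof -
  have "C5 * W = 300 * (W + T * C6 * W)" by (simp add: C5_def algebra_simps)
  moreover have "cmod (cplx v) + A \<le> W + T * C6 * W"
    unfolding A_def by (intro add_mono W_ge TW constants_nonneg)
  ultimately show ?thesis by simp
qed

lemma vel_le:
  "cmod (cplx (vel1 s)) \<le> cmod (resolvent l1) * (C5 * W)" "cmod (cplx (vel2 s)) \<le> cmod (resolvent l1) * (C5 * W)"
  "cmod (cplx (vel3 s)) \<le> cmod (resolvent l3) * (C5 * W)" "cmod (cplx (vel4 s)) \<le> cmod (resolvent l4) * (C5 * W)"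
  using plane.velocity_bounds[THEN order_trans[OF _ mult_left_mono[OF vA_le norm_ge_zero]]] by auto

lemma vel_le': "cmod (cplx (vel1 s)) \<le> C5 * W" "cmod (cplx (vel2 s)) \<le> C5 * W"
  "cmod (cplx (vel3 s)) \<le> C5 * W" "cmod (cplx (vel4 s)) \<le> C5 * W"
  using vel_le[THEN order_trans[OF _ mult_right_mono[OF norm_resolvent_le_1]]] constants_nonneg W_ge by auto

lemma P0: "0 \<le> P" using v3 by linarith

lemma par: "F1 $ 3 = E (t, x) $ 3" "F2 $ 3 = E (t, x) $ 3" "F3 $ 3 = E (t + dt, pos2 s) $ 3" "F4 $ 3 = E (t + dt / 2, pos3 s) $ 3"
  by (simp_all add: F1 F2 F3 F4 H_nth_3)

lemma vel_par: "vel2 s $ 3 = v $ 3" "vel3 s $ 3 = v $ 3 + dt * ((1 - \<alpha>) * E (t, x) $ 3 + \<alpha> * E (t + dt, pos2 s) $ 3)"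
  "vel4 s $ 3 = v $ 3 + dt * ((\<beta> + \<eta>) * E (t, x) $ 3 + \<gamma> * E (t + dt, pos2 s) $ 3 + \<alpha> * E (t + dt / 2, pos3 s) $ 3)"
  "v' $ 3 = v $ 3 + dt * (1 / 6 * (E (t, x) $ 3 + E (t + dt, pos2 s) $ 3 + 4 * E (t + dt / 2, pos3 s) $ 3))"
  using arg_cong[OF vel2, of "\<lambda>w. w $ 3"] arg_cong[OF vel3, of "\<lambda>w. w $ 3"] arg_cong[OF vel4, of "\<lambda>w. w $ 3"] arg_cong[OF v', of "\<lambda>w. w $ 3"]
  by (simp_all add: par algebra_simps)

lemma E3: "\<bar>E (t, x) $ 3\<bar> \<le> M" "\<bar>E (t + dt, pos2 s) $ 3\<bar> \<le> M" "\<bar>E (t + dt / 2, pos3 s) $ 3\<bar> \<le> M"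
  by (intro E3_le times)+

lemma weighted_E3:
  assumes "0 \<le> p" "0 \<le> q" "0 \<le> r" "p + q + r \<le> 1"
  shows "\<bar>dt * (p * E (t, x) $ 3 + q * E (t + dt, pos2 s) $ 3 + r * E (t + dt / 2, pos3 s) $ 3)\<bar> \<le> dt * M"
proof -
  have "\<bar>p * E (t, x) $ 3 + q * E (t + dt, pos2 s) $ 3 + r * E (t + dt / 2, pos3 s) $ 3\<bar> \<le> p * M + q * M + r * M"
    using mult_left_mono[OF E3(1) assms(1)] mult_left_mono[OF E3(2) assms(2)] mult_left_mono[OF E3(3) assms(3)]
    by (auto simp: abs_mult assms intro!: order_trans[OF abs_triangle_ineq] add_mono)
  also have "\<dots> \<le> M" using mult_right_mono[OF assms(4) M0] by (simp add: distrib_right)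
  finally show ?thesis using dt by (simp add: abs_mult)
qed

lemma vel_par_le: "\<bar>vel2 s $ 3\<bar> \<le> P + T * M" "\<bar>vel3 s $ 3\<bar> \<le> P + T * M" "\<bar>vel4 s $ 3\<bar> \<le> P + T * M"
  "\<bar>v' $ 3\<bar> \<le> \<bar>v $ 3\<bar> + dt * M"
proof -
  have TM: "dt * M \<le> T * M" by (rule mult_right_mono[OF dtT M0])
  show "\<bar>vel2 s $ 3\<bar> \<le> P + T * M" using v3 T M0 by (simp add: vel_par add_increasing2)
  show "\<bar>vel3 s $ 3\<bar> \<le> P + T * M"
    using weighted_E3[of "1 - \<alpha>" \<alpha> 0] v3 TM coefficient_bounds \<alpha>_bounds by (simp add: vel_par)
  show "\<bar>vel4 s $ 3\<bar> \<le> P + T * M"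
    using weighted_E3[of "\<beta> + \<eta>" \<gamma> \<alpha>] v3 TM coefficient_bounds \<alpha>_bounds by (simp add: vel_par)
  show "\<bar>v' $ 3\<bar> \<le> \<bar>v $ 3\<bar> + dt * M"
    using weighted_E3[of "1 / 6" "1 / 6" "4 / 6"] by (simp add: vel_par algebra_simps)
qed

definition "C7 = C5 + P + T * M"

lemma C7_0: "0 \<le> C7" using constants_nonneg P0 T M0 by (simp add: C7_def)

lemma norm_vel_le: "norm (vel2 s) \<le> C7 * W" "norm (vel3 s) \<le> C7 * W" "norm (vel4 s) \<le> C7 * W"
proof -
  have *: "norm w \<le> C7 * W" if "cmod (cplx w) \<le> C5 * W" "\<bar>w $ 3\<bar> \<le> P + T * M" for w
  proof -
    have "norm w \<le> C5 * W + (P + T * M) * 1" using norm_le_cplx[of w] that by simp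
    also have "\<dots> \<le> C5 * W + (P + T * M) * W"
      using W_ge P0 T M0 by (intro add_left_mono mult_left_mono) auto
    finally show ?thesis by (simp add: C7_def algebra_simps)
  qed
  show "norm (vel2 s) \<le> C7 * W" "norm (vel3 s) \<le> C7 * W" "norm (vel4 s) \<le> C7 * W"
    by (intro * vel_le' vel_par_le)+
qed

lemma displacement:
  "norm (pos2 s - x) \<le> dt * (C7 * W)" "norm (pos3 s - x) \<le> dt * (C7 * W)" "norm (x' - x) \<le> dt * (C7 * W)"
proof -
  define D where "D = C7 * W"
  have C: "0 \<le> D" using C7_0 W_ge by (simp add: D_def)
  note nv = norm_vel_le[folded D_def]
  show "norm (pos2 s - x) \<le> dt * (C7 * W)" using norm_vel_le dt by (simp add: pos2)
  have "norm (vel2 s + vel3 s) \<le> D + D" by (intro norm_add_le nv)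
  then have "norm ((1 / 4) *\<^sub>R (vel2 s + vel3 s)) \<le> C7 * W" unfolding norm_scaleR using C by (simp add: D_def[symmetric])
  then show "norm (pos3 s - x) \<le> dt * (C7 * W)" using dt by (simp add: pos3)
  have "norm (4 *\<^sub>R vel4 s) \<le> 4 * D" using nv(3) by simp
  then have "norm (vel2 s + vel3 s + 4 *\<^sub>R vel4 s) \<le> D + D + 4 * D"
    by (intro norm_add_le nv)
  then have "norm ((1 / 6) *\<^sub>R (vel2 s + vel3 s + 4 *\<^sub>R vel4 s)) \<le> C7 * W" unfolding norm_scaleR using C by (simp add: D_def[symmetric])
  then show "norm (x' - x) \<le> dt * (C7 * W)" using dt by (simp add: x')
qed

lemma energy_le: "\<bar>e'\<bar> \<le> \<bar>e\<bar> + dt * (M * C5 * W)"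
proof -
  have "\<bar>perp (E (t, x)) \<bullet> perp (vel2 s)\<bar> \<le> M * (C5 * W)" "\<bar>perp (E (t + dt, pos2 s)) \<bullet> perp (vel3 s)\<bar> \<le> M * (C5 * W)"
    "\<bar>perp (E (t + dt / 2, pos3 s)) \<bullet> perp (vel4 s)\<bar> \<le> M * (C5 * W)"
    by (intro inner_E_le times vel_le')+
  then have "\<bar>1 / 6 * (perp (E (t, x)) \<bullet> perp (vel2 s) + perp (E (t + dt, pos2 s)) \<bullet> perp (vel3 s)
       + 4 * (perp (E (t + dt / 2, pos3 s)) \<bullet> perp (vel4 s)))\<bar> \<le> M * (C5 * W)"
    by (rule abs_simpson_sum)
  then have "\<bar>e' - e\<bar> \<le> dt * (M * C5 * W)"
    using dt by (simp add: e' abs_mult mult.assoc)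
  then show "\<bar>e'\<bar> \<le> \<bar>e\<bar> + dt * (M * C5 * W)" by linarith
qed

text \<open>For large time steps the forces are useless as increments; L-stability gives a bound
  without them.\<close>

lemma velocity_crude: "cmod (cplx v') \<le> 20 * C5 * W"
  using plane.step_from_stages[OF vel_le'] by simp

lemma b_diff: "\<bar>b (t + dt, pos2 s) - b (t, x)\<bar> \<le> dt * (L * (1 + C7) * W)" "\<bar>b (t + dt / 2, pos3 s) - b (t, x)\<bar> \<le> dt * (L * (1 + C7) * W)"
proof -
  have *: "\<bar>b (t', z) - b (t, x)\<bar> \<le> dt * (L * (1 + C7) * W)"
    if "0 \<le> t'" "t' \<le> T" "\<bar>t' - t\<bar> \<le> dt" "norm (z - x) \<le> dt * (C7 * W)" for t' z
  proof -
    have "\<bar>b (t', z) - b (t, x)\<bar> \<le> L * norm ((t', z) - (t, x))"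
      by (intro b_lip slab_mem times that)
    also have "\<dots> \<le> L * (dt * W + dt * (C7 * W))"
    proof (rule mult_left_mono[OF _ L0])
      have "norm ((t', z) - (t, x)) \<le> \<bar>t' - t\<bar> + norm (z - x)"
        using norm_Pair_le[of "t' - t" "z - x"] by simp
      also have "\<dots> \<le> dt * W + dt * (C7 * W)"
      proof (rule add_mono[OF _ that(4)])
        have "dt * 1 \<le> dt * W" by (rule mult_left_mono[OF W_ge(1)]) (use dt in simp)
        then show "\<bar>t' - t\<bar> \<le> dt * W" using that(3) by simp
      qed
      finally show "norm ((t', z) - (t, x)) \<le> dt * W + dt * (C7 * W)" .
    qed
    finally show ?thesis by (simp add: algebra_simps)
  qed
  show "\<bar>b (t + dt, pos2 s) - b (t, x)\<bar> \<le> dt * (L * (1 + C7) * W)"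
    "\<bar>b (t + dt / 2, pos3 s) - b (t, x)\<bar> \<le> dt * (L * (1 + C7) * W)"
    by (rule *; use times displacement dt in simp)+
qed

lemma b_pos: "b0 < b (t, x)" "b0 < b (t + dt, pos2 s)" "b0 < b (t + dt / 2, pos3 s)"
  by (intro b_gt slab_mem times)+

lemma l_ge: "b0 * (dt / \<epsilon>) \<le> l1" "b0 * (dt / \<epsilon>) \<le> l3" "b0 * (dt / \<epsilon>) \<le> l4"
  using b_pos dt \<epsilon> by (simp_all add: l1_def l3_def l4_def divide_right_mono mult.commute)

lemma \<tau>0: "0 < dt / \<epsilon>" using dt \<epsilon> by simp

lemma resolvent_decay: "cmod (resolvent l) * (dt / \<epsilon>) \<le> 5 / b0" if "b0 * (dt / \<epsilon>) \<le> l" for l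
proof -
  have l: "0 < l" using mult_pos_pos[OF b0 \<tau>0] that by linarith
  have "cmod (resolvent l) * (b0 * (dt / \<epsilon>)) \<le> cmod (resolvent l) * l"
    by (rule mult_left_mono[OF that norm_ge_zero])
  also have "\<dots> \<le> 5" using norm_resolvent_le[OF l] coefficient_bounds(7) by simp
  finally show ?thesis using b0 by (simp add: pos_le_divide_eq mult_ac)
qed

text \<open>The angles of the stages differ by \<open>O(\<Delta>t\<^sup>2 / \<epsilon>)\<close>. The decay of the resolvent turns this into
  \<open>O(\<Delta>t)\<close> uniformly in \<open>\<epsilon>\<close>, with an additional factor \<open>\<Delta>t / \<epsilon>\<close> when that ratio is small.\<close>

lemma amplification_le:
  "cmod (amplification (resolvent l1) (resolvent l3) (resolvent l4))
    \<le> cmod (amplification (resolvent l1) (resolvent l1) (resolvent l1))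
      + 100 * L * (1 + C7) * dt * W * min (dt / \<epsilon>) (5 / b0)"
proof -
  have *: "cmod (resolvent l - resolvent l1) \<le> 0.25 * (dt * (L * (1 + C7) * W)) * min (dt / \<epsilon>) (5 / b0)"
    if d: "\<bar>l - l1\<bar> \<le> (dt / \<epsilon>) * (dt * (L * (1 + C7) * W))" for l
  proof -
    have "cmod (resolvent l - resolvent l1) = \<alpha> * \<bar>l - l1\<bar> * cmod (resolvent l) * cmod (resolvent l1)"
      by (rule resolvent_diff)
    also have "\<dots> \<le> 0.25 * ((dt / \<epsilon>) * (dt * (L * (1 + C7) * W))) * 1 * cmod (resolvent l1)"
      using d \<alpha>_bounds by (intro mult_mono norm_resolvent_le_1 mult_nonneg_nonneg) (use \<epsilon> dt L0 C7_0 W_ge in auto)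
    also have "\<dots> = 0.25 * (dt * (L * (1 + C7) * W)) * (cmod (resolvent l1) * (dt / \<epsilon>))" by simp
    also have "\<dots> \<le> 0.25 * (dt * (L * (1 + C7) * W)) * min (dt / \<epsilon>) (5 / b0)"
    proof (rule mult_left_mono)
      show "cmod (resolvent l1) * (dt / \<epsilon>) \<le> min (dt / \<epsilon>) (5 / b0)"
        using resolvent_decay[OF l_ge(1)] mult_right_mono[OF norm_resolvent_le_1[of l1], of "dt / \<epsilon>"] \<tau>0 by simp
      show "0 \<le> 0.25 * (dt * (L * (1 + C7) * W))" using dt L0 C7_0 W_ge by simp
    qed
    finally show ?thesis .
  qed
  have ll: "l3 - l1 = (dt / \<epsilon>) * (b (t + dt, pos2 s) - b (t, x))" "l4 - l1 = (dt / \<epsilon>) * (b (t + dt / 2, pos3 s) - b (t, x))"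
    by (simp_all add: l1_def l3_def l4_def diff_divide_distrib right_diff_distrib)
  have "\<bar>l3 - l1\<bar> \<le> (dt / \<epsilon>) * (dt * (L * (1 + C7) * W))" "\<bar>l4 - l1\<bar> \<le> (dt / \<epsilon>) * (dt * (L * (1 + C7) * W))"
    unfolding ll abs_mult abs_of_pos[OF \<tau>0] by (intro mult_left_mono b_diff less_imp_le \<tau>0)+
  note d = *[OF this(1)] *[OF this(2)]
  define D where "D = dt * (L * (1 + C7) * W) * min (dt / \<epsilon>) (5 / b0)"
  have "cmod (resolvent l3 - resolvent l1) \<le> 0.25 * D" "cmod (resolvent l4 - resolvent l1) \<le> 0.25 * D"
    using d by (simp_all add: D_def)
  moreover have "100 * L * (1 + C7) * dt * W * min (dt / \<epsilon>) (5 / b0) = 100 * D" by (simp add: D_def)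
  ultimately show ?thesis
    using amplification_perturbation[of l1 l3 l4] by simp
qed

lemma velocity_growth:
  "cmod (cplx v') \<le> (cmod (amplification (resolvent l1) (resolvent l1) (resolvent l1))
      + 100 * L * (1 + C7) * dt * W * min (dt / \<epsilon>) (5 / b0)) * cmod (cplx v) + 20 * (dt * (C6 * W))"
  using plane.step_amplification mult_right_mono[OF amplification_le norm_ge_zero[of "cplx v"]] by (simp add: A_def)

end

text \<open>The scalar recursion behind the uniform bounds: \<open>p\<close> stands for \<open>\<bar>v\<^sub>\<perp>\<bar>\<close>, \<open>q\<close> for \<open>\<bar>e\<bar>\<close>, \<open>\<tau>\<close> for
  \<open>\<Delta>t / \<epsilon>\<close>, \<open>\<mu>\<close> for \<open>min \<tau> C\<close> and \<open>m n\<close> for the modulus of the stability function in step \<open>n\<close>.\<close>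

definition growth_data ::
  "real \<Rightarrow> (real \<Rightarrow> real) \<Rightarrow> real \<Rightarrow> real \<Rightarrow> real \<Rightarrow> real \<Rightarrow> real \<Rightarrow> nat \<Rightarrow>
    (nat \<Rightarrow> real) \<Rightarrow> (nat \<Rightarrow> real) \<Rightarrow> (nat \<Rightarrow> real) \<Rightarrow> bool" where
  "growth_data C c T W0 dt \<tau> \<mu> N p q m \<longleftrightarrow>
     0 < dt \<and> 0 < \<tau> \<and> real N * dt \<le> T \<and> 0 \<le> \<mu> \<and> \<mu> \<le> \<tau> \<and> \<mu> \<le> C \<and>
     (\<forall>n\<le>N. 0 \<le> p n \<and> 0 \<le> q n) \<and> 1 + p 0 + q 0 \<le> W0 \<and>
     (\<forall>n<N. q (Suc n) \<le> q n + C * dt * (1 + p n + q n) \<and>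
        p (Suc n) \<le> (m n + C * dt * (1 + p n + q n) * \<mu>) * p n + C * dt * (1 + p n + q n) \<and>
        p (Suc n) \<le> C * (1 + p n + q n) \<and>
        m n \<le> 1 \<and> (\<forall>\<theta>. 0 < \<theta> \<and> \<theta> \<le> \<tau> \<longrightarrow> m n \<le> 1 - c \<theta>))"

text \<open>The obstacle is the quadratic term \<open>C \<Delta>t (1 + p + q) \<mu> p\<close>, from the variation of the magnetic
  field along the step. As long as the weight \<open>W = 1 + p + q\<close> stays below \<open>K\<close>, the factor in front
  of \<open>p\<close> is at most \<open>1 + \<Delta>t\<close> in two cases: for \<open>\<tau> < \<theta>\<close>, because then \<open>C K \<mu> \<le> 1\<close>; and for
  \<open>\<tau> \<ge> \<theta>\<close> and \<open>\<Delta>t \<le> h\<close>, because the damping \<open>c \<theta>\<close> absorbs the term. A discrete Gronwall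
  argument then gives \<open>W \<le> K\<close> with \<open>K\<close> fixed beforehand, which closes the bootstrap. In the
  remaining case \<open>\<Delta>t > h\<close> there are at most \<open>T / h\<close> steps, and the crude bound on \<open>p\<close> suffices.\<close>

lemma growth_bound:
  fixes C T W0 :: real and c :: "real \<Rightarrow> real"
  assumes C: "1 \<le> C" and T: "0 < T" and W0: "1 \<le> W0" and c: "\<And>\<theta>. 0 < \<theta> \<Longrightarrow> 0 < c \<theta>"
  obtains K where "\<And>dt \<tau> \<mu> N p q m n. growth_data C c T W0 dt \<tau> \<mu> N p q m \<Longrightarrow> n \<le> N \<Longrightarrow> 1 + p n + q n \<le> (K::real)"
proof -
  define D where "D = 2 * C + 1"
  define K where "K = W0 * exp (D * T)"
  have D: "0 < D" using C by (simp add: D_def)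
  have K1: "1 \<le> K" using W0 D T one_le_exp_iff[of "D * T"] mult_mono[of 1 W0 1 "exp (D * T)"] by (simp add: K_def)
  \<comment> \<open>\<open>\<theta>\<close> separates small from large angles, and \<open>h\<close> small from large steps: with these values
    \<open>C K \<theta> = 1\<close> and \<open>C\<^sup>2 K h = c \<theta>\<close>.\<close>
  define \<theta> where "\<theta> = 1 / (C * K)"
  have \<theta>: "0 < \<theta>" using C K1 by (simp add: \<theta>_def)
  define h where "h = c \<theta> / (C * C * K)"
  have h: "0 < h" using c[OF \<theta>] C K1 by (simp add: h_def)
  define G where "G = 1 + 2 * C + C * T"
  define Q where "Q = nat \<lceil>T / h\<rceil>"
  have G: "1 \<le> G" using C T by (simp add: G_def)
  show ?thesis
  proof (rule that[of "max K (W0 * G ^ Q)"])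
    fix dt \<tau> \<mu> :: real and N n :: nat and p q m :: "nat \<Rightarrow> real"
    assume data: "growth_data C c T W0 dt \<tau> \<mu> N p q m"
      and n: "n \<le> N"
    have dt: "0 < dt" and \<tau>: "0 < \<tau>" and N: "real N * dt \<le> T" and \<mu>: "0 \<le> \<mu>" "\<mu> \<le> \<tau>" "\<mu> \<le> C"
      and pq: "\<And>n. n \<le> N \<Longrightarrow> 0 \<le> p n \<and> 0 \<le> q n" and init: "1 + p 0 + q 0 \<le> W0"
      and q: "\<And>n. n < N \<Longrightarrow> q (Suc n) \<le> q n + C * dt * (1 + p n + q n)"
      and p: "\<And>n. n < N \<Longrightarrow> p (Suc n) \<le> (m n + C * dt * (1 + p n + q n) * \<mu>) * p n + C * dt * (1 + p n + q n)"
      and crude: "\<And>n. n < N \<Longrightarrow> p (Suc n) \<le> C * (1 + p n + q n)"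
      and m1: "\<And>n. n < N \<Longrightarrow> m n \<le> 1" and mc: "\<And>n \<theta>. n < N \<Longrightarrow> 0 < \<theta> \<Longrightarrow> \<theta> \<le> \<tau> \<Longrightarrow> m n \<le> 1 - c \<theta>"
      using data unfolding growth_data_def by blast+
    define W where "W n = 1 + p n + q n" for n
    have Wpos: "1 \<le> W n" if "n \<le> N" for n using pq[OF that] by (simp add: W_def)
    show "1 + p n + q n \<le> max K (W0 * G ^ Q)"
    proof (cases "\<tau> < \<theta> \<or> dt \<le> h")
      case True
      have amp: "m k + C * dt * W k * \<mu> \<le> 1 + dt" if k: "k < N" and W: "W k \<le> K" for k
      proof -
        have CK: "C * W k \<le> C * K" "0 \<le> C * W k" using W C Wpos[of k] k by (auto intro: mult_left_mono)
        show ?thesis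
        proof (cases "\<tau> < \<theta>")
          case True
          have "(C * W k) * \<mu> \<le> (C * K) * \<theta>"
            by (rule mult_mono[OF CK(1)]) (use \<mu> True C K1 in auto)
          also have "\<dots> = 1" using C K1 by (simp add: \<theta>_def)
          finally have "dt * ((C * W k) * \<mu>) \<le> dt * 1" using dt by (intro mult_left_mono) auto
          then show ?thesis using m1[OF k] by (simp add: mult_ac)
        next
          case False
          then have d: "dt \<le> h" using \<open>\<tau> < \<theta> \<or> dt \<le> h\<close> by simp
          have "dt * ((C * W k) * \<mu>) \<le> h * ((C * K) * C)"
            by (rule mult_mono[OF d mult_mono[OF CK(1) \<mu>(3)]]) (use CK \<mu> h C K1 in auto)
          also have "\<dots> = c \<theta>" using C K1 by (simp add: h_def)
          finally show ?thesis using mc[OF k \<theta>] False dt by (simp add: mult_ac)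
        qed
      qed
      have "W n \<le> W0 * (1 + D * dt) ^ n \<and> W0 * (1 + D * dt) ^ n \<le> K" if "n \<le> N" for n
        using that
      proof (induction n)
        case 0
        have "1 \<le> exp (D * T)" using D T by simp
        then show ?case using init W0 by (simp add: W_def K_def)
      next
        case (Suc k)
        then have k: "k < N" and IH: "W k \<le> W0 * (1 + D * dt) ^ k" "W k \<le> K" by auto
        have pk: "0 \<le> p k" "p k \<le> W k" using pq[of k] k by (auto simp: W_def)
        have "(m k + C * dt * W k * \<mu>) * p k \<le> (1 + dt) * p k"
          using amp[OF k IH(2)] pk by (intro mult_right_mono) auto
        then have "W (Suc k) \<le> W k + dt * p k + 2 * (C * dt * W k)"
          using p[OF k] q[OF k] by (simp add: W_def algebra_simps)
        also have "\<dots> \<le> W k + dt * W k + 2 * (C * dt * W k)" using pk dt by simp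
        also have "\<dots> = W k * (1 + D * dt)" by (simp add: D_def algebra_simps)
        also have "\<dots> \<le> (W0 * (1 + D * dt) ^ k) * (1 + D * dt)"
          using IH(1) D dt by (intro mult_right_mono) auto
        finally have 1: "W (Suc k) \<le> W0 * (1 + D * dt) ^ Suc k" by (simp add: mult_ac)
        have "(1 + D * dt) ^ Suc k \<le> exp (D * dt) ^ Suc k"
          using D dt by (intro power_mono) (auto intro: add_nonneg_nonneg exp_ge_add_one_self)
        also have "\<dots> = exp (D * (real (Suc k) * dt))" unfolding exp_of_nat_mult[symmetric] by (simp only: mult_ac)
        also have "\<dots> \<le> exp (D * T)"
        proof -
          have "real (Suc k) * dt \<le> real N * dt" using Suc.prems dt by (intro mult_right_mono) auto
          then show ?thesis using N D by simp
        qed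
        finally show ?case using 1 W0 by (simp add: K_def mult_left_mono del: power_Suc)
      qed
      from this[OF n] have "W n \<le> K" by linarith
      then show ?thesis by (simp add: W_def)
    next
      case False
      then have d: "h < dt" by auto
      have "W k \<le> W0 * G ^ k" if "k \<le> N" for k
        using that
      proof (induction k)
        case 0
        then show ?case using init by (simp add: W_def)
      next
        case (Suc k)
        then have k: "k < N" and IH: "W k \<le> W0 * G ^ k" by auto
        have "dt \<le> real N * dt" using k dt by simp
        then have dT: "dt \<le> T" using N by simp
        have W0k: "1 \<le> W k" using Wpos[of k] k by simp
        have "C * dt * W k \<le> C * T * W k" using dT C W0k by (intro mult_right_mono mult_left_mono) auto
        moreover have "1 + q k \<le> W k" "1 * W k \<le> C * W k" using pq[of k] k C W0k by (auto simp: W_def intro: mult_right_mono)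
        moreover have "p (Suc k) \<le> C * W k" "q (Suc k) \<le> q k + C * dt * W k"
          using crude[OF k] q[OF k] by (simp_all add: W_def)
        moreover have "G * W k = W k + 2 * (C * W k) + C * T * W k" by (simp add: G_def algebra_simps)
        ultimately have "W (Suc k) \<le> G * W k"
          using W0k unfolding W_def[of "Suc k"] by linarith
        also have "\<dots> \<le> G * (W0 * G ^ k)" using IH G by (intro mult_left_mono) auto
        finally show ?case by (simp add: mult_ac)
      qed
      from this[OF n] have "W n \<le> W0 * G ^ n" .
      also have "\<dots> \<le> W0 * G ^ Q"
      proof -
        have "real n * h \<le> real N * dt" using n d h dt by (intro mult_mono) auto
        then have "real n \<le> T / h" using N h by (simp add: pos_le_divide_eq)
        then have "n \<le> Q" unfolding Q_def by linarith
        then show ?thesis using G W0 by (intro mult_left_mono power_increasing) auto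
      qed
      finally show ?thesis by (simp add: W_def)
    qed
  qed
qed

text \<open>Half of the deficit in the square of the stability function, since
  \<open>1 - 2 c \<le> (1 - c)\<^sup>2\<close>.\<close>

definition damping :: "real \<Rightarrow> real \<Rightarrow> real" where
  "damping b0 \<theta> = ((\<alpha> * (b0 * \<theta>))\<^sup>2 / (1 + (\<alpha> * (b0 * \<theta>))\<^sup>2)) ^ 4 / 2"

lemma damping_pos: "0 < b0 \<Longrightarrow> 0 < \<theta> \<Longrightarrow> 0 < damping b0 \<theta>"
proof -
  assume "0 < b0" "0 < \<theta>"
  then have y: "0 < (\<alpha> * (b0 * \<theta>))\<^sup>2" using coefficient_bounds(8) by simp
  show ?thesis unfolding damping_def by (intro divide_pos_pos zero_less_power add_pos_pos y) auto
qed

lemma amplification_damped: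
  assumes "0 < b0" "0 \<le> \<theta>" "b0 * \<theta> \<le> l"
  shows "cmod (amplification (resolvent l) (resolvent l) (resolvent l)) \<le> 1 - damping b0 \<theta>"
proof -
  define y0 y where "y0 = (\<alpha> * (b0 * \<theta>))\<^sup>2" and "y = (\<alpha> * l)\<^sup>2"
  have y: "0 \<le> y0" "y0 \<le> y"
    using assms coefficient_bounds(8) by (auto simp: y0_def y_def intro!: power_mono mult_left_mono)
  have "y0 / (1 + y0) \<le> y / (1 + y)" using y by (simp add: divide_simps) (simp add: algebra_simps)
  then have "(y0 / (1 + y0)) ^ 4 \<le> (y / (1 + y)) ^ 4" using y by (intro power_mono) auto
  then have "(cmod (amplification (resolvent l) (resolvent l) (resolvent l)))\<^sup>2 \<le> 1 - 2 * damping b0 \<theta>"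
    using norm_amplification_diagonal[of l, folded y_def] unfolding damping_def y0_def[symmetric] by simp
  also have "\<dots> \<le> (1 - damping b0 \<theta>)\<^sup>2" by (simp add: power2_eq_square algebra_simps)
  finally have "(cmod (amplification (resolvent l) (resolvent l) (resolvent l)))\<^sup>2 \<le> (1 - damping b0 \<theta>)\<^sup>2" .
  moreover have "0 \<le> 1 - damping b0 \<theta>"
  proof -
    have "(y0 / (1 + y0)) ^ 4 \<le> 1" using y by (intro power_le_one) auto
    then show ?thesis by (simp add: damping_def y0_def)
  qed
  ultimately show ?thesis by (rule power2_le_imp_le)
qed

lemma bounded_data_exists:
  assumes T: "0 < T" and E: "electric_field T \<phi> E" and b: "magnetic_intensity T b0 b" and chi: "admissible_chi chi"
  obtains M L where "bounded_data T b0 M L E b chi"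
proof -
  obtain M where M: "\<And>p. p \<in> closed_slab T \<Longrightarrow> norm (E p) \<le> M"
    by (rule electric_bounded[OF T E]) (rule that)
  obtain L where L: "0 \<le> L"
    "\<And>p q. p \<in> closed_slab T \<Longrightarrow> q \<in> closed_slab T \<Longrightarrow> \<bar>b q - b p\<bar> \<le> L * norm (q - p)"
    "\<And>t x i. t \<in> {0..T} \<Longrightarrow> i = 1 \<or> i = 2 \<Longrightarrow>
      ((\<lambda>s. b (t, x + s *\<^sub>R axis i 1)) has_real_derivative grad_perp b (t, x) $ i) (at 0)"
    "\<And>p. p \<in> closed_slab T \<Longrightarrow> norm (grad_perp b p) \<le> L"
    by (rule magnetic_facts[OF T b]) (rule that)
  have b0: "0 < b0" "\<And>p. p \<in> closed_slab T \<Longrightarrow> b0 < b p"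
    using b by (auto simp: magnetic_intensity_def closed_slab_def)
  have "bounded_data T b0 (max 0 M) L E b chi"
  proof
    fix p assume p: "p \<in> closed_slab T"
    show "norm (E p) \<le> max 0 M" using M[OF p] by simp
    have "0 < b p" using b0 p by fastforce
    then show "grad_perp (\<lambda>p. ln (b p)) p = grad_perp b p /\<^sub>R b p"
      using grad_perp_ln[of b "fst p" "snd p", OF L(3)] p by (simp add: closed_slab_def mem_Times_iff)
  next
    fix e w
    show "\<bar>chi (e, perp w)\<bar> \<le> \<bar>e\<bar>"
    proof (cases "0 \<le> e")
      case True
      then have "0 \<le> chi (e, perp w) \<and> chi (e, perp w) \<le> e" using chi by (auto simp: admissible_chi_def)
      then show ?thesis using True by simp
    next
      case False
      then show ?thesis using chi by (auto simp: admissible_chi_def)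
    qed
  qed (use T b0 L in auto)
  then show ?thesis by (rule that)
qed

context bounded_data
begin

lemma data_stepI:
  assumes "S_step E b chi \<epsilon> dt t (x, v, e) s (x', v', e')" "0 < dt" "0 < \<epsilon>" "0 \<le> t" "t + dt \<le> T" "\<bar>v $ 3\<bar> \<le> P"
  obtains F1 F2 F3 F4 where "data_step T b0 M L E b chi dt \<epsilon> t x v e s x' v' e' F1 F2 F3 F4 P"
  by (rule S_stepE[OF assms(1,2)], rule that, unfold_locales) (assumption | rule assms)+

lemma step_growth:
  assumes P: "0 \<le> P"
  obtains C where "1 \<le> C" "\<And>dt \<epsilon> t x v e s x' v' e'. 0 < dt \<Longrightarrow> 0 < \<epsilon> \<Longrightarrow> 0 \<le> t \<Longrightarrow> t + dt \<le> T \<Longrightarrow> \<bar>v $ 3\<bar> \<le> P \<Longrightarrow>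
      S_step E b chi \<epsilon> dt t (x, v, e) s (x', v', e') \<Longrightarrow>
      \<bar>e'\<bar> \<le> \<bar>e\<bar> + C * dt * (1 + cmod (cplx v) + \<bar>e\<bar>) \<and>
      cmod (cplx v') \<le> (cmod (amplification (resolvent (dt * b (t, x) / \<epsilon>)) (resolvent (dt * b (t, x) / \<epsilon>)) (resolvent (dt * b (t, x) / \<epsilon>)))
        + C * dt * (1 + cmod (cplx v) + \<bar>e\<bar>) * min (dt / \<epsilon>) C) * cmod (cplx v) + C * dt * (1 + cmod (cplx v) + \<bar>e\<bar>) \<and>
      cmod (cplx v') \<le> C * (1 + cmod (cplx v) + \<bar>e\<bar>) \<and>
      norm (x' - x) \<le> C * dt * (1 + cmod (cplx v) + \<bar>e\<bar>) \<and> \<bar>v' $ 3\<bar> \<le> \<bar>v $ 3\<bar> + dt * M"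
proof -
  define C7' where "C7' = C5 + P + T * M"
  have C7': "0 \<le> C7'" using constants_nonneg P T M0 by (simp add: C7'_def)
  define C where "C = 1 + M * C5 + 100 * L * (1 + C7') + 5 / b0 + 20 * C6 + 20 * C5 + C7'"
  have terms: "0 \<le> M * C5" "0 \<le> 100 * L * (1 + C7')" "0 \<le> 5 / b0" "0 \<le> 20 * C6" "0 \<le> 20 * C5"
    using M0 L0 b0 constants_nonneg C7' by auto
  show ?thesis
  proof (rule that[of C])
    show "1 \<le> C" unfolding C_def using terms C7' by linarith
    fix dt \<epsilon> t :: real and x v :: vec3 and e and s and x' v' :: vec3 and e'
    assume a: "0 < dt" "0 < \<epsilon>" "0 \<le> t" "t + dt \<le> T" "\<bar>v $ 3\<bar> \<le> P" "S_step E b chi \<epsilon> dt t (x, v, e) s (x', v', e')"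
    obtain F1 F2 F3 F4 where "data_step T b0 M L E b chi dt \<epsilon> t x v e s x' v' e' F1 F2 F3 F4 P"
      by (rule data_stepI[OF a(6,1-5)])
    then interpret data_step T b0 M L E b chi dt \<epsilon> t x v e s x' v' e' F1 F2 F3 F4 P .
    have W: "1 + cmod (cplx v) + \<bar>e\<bar> = W" by (simp add: W_def)
    have C7: "C7 = C7'" by (simp add: C7_def C7'_def)
    have le: "c * dt * W \<le> C * dt * W" "dt * (c * W) \<le> C * dt * W" if "c \<le> C" for c
      using that a(1) W_ge by (auto intro!: mult_right_mono simp: mult_ac)
    have cs: "M * C5 \<le> C" "100 * L * (1 + C7') \<le> C" "5 / b0 \<le> C" "20 * C6 \<le> C" "20 * C5 \<le> C" "C7' \<le> C"
      unfolding C_def using terms C7' by linarith+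
    have "\<bar>e'\<bar> \<le> \<bar>e\<bar> + C * dt * W" using energy_le le(2)[OF cs(1)] by simp
    moreover have "cmod (cplx v') \<le> C * W" using velocity_crude mult_right_mono[OF cs(5) W_ge(4)] by simp
    moreover have "norm (x' - x) \<le> C * dt * W" using displacement(3) le(2)[OF cs(6)] by (simp add: C7)
    moreover have "cmod (cplx v') \<le> (cmod (amplification (resolvent l1) (resolvent l1) (resolvent l1))
        + C * dt * W * min (dt / \<epsilon>) C) * cmod (cplx v) + C * dt * W"
    proof -
      have "100 * L * (1 + C7) * dt * W * min (dt / \<epsilon>) (5 / b0) \<le> C * dt * W * min (dt / \<epsilon>) C"
        using le(1)[OF cs(2)] cs(3) a b0 terms(2) W_ge C7' L0
        by (intro mult_mono min.mono order_refl) (auto simp: C7 intro!: mult_nonneg_nonneg order_trans[OF terms(5) cs(5)])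
      then have "(cmod (amplification (resolvent l1) (resolvent l1) (resolvent l1))
          + 100 * L * (1 + C7) * dt * W * min (dt / \<epsilon>) (5 / b0)) * cmod (cplx v)
        \<le> (cmod (amplification (resolvent l1) (resolvent l1) (resolvent l1))
          + C * dt * W * min (dt / \<epsilon>) C) * cmod (cplx v)"
        by (intro mult_right_mono add_left_mono) auto
      moreover have "20 * (dt * (C6 * W)) \<le> C * dt * W" using le(2)[OF cs(4)] by simp
      ultimately show ?thesis using velocity_growth by linarith
    qed
    ultimately show "\<bar>e'\<bar> \<le> \<bar>e\<bar> + C * dt * (1 + cmod (cplx v) + \<bar>e\<bar>) \<and>
      cmod (cplx v') \<le> (cmod (amplification (resolvent (dt * b (t, x) / \<epsilon>)) (resolvent (dt * b (t, x) / \<epsilon>)) (resolvent (dt * b (t, x) / \<epsilon>)))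
        + C * dt * (1 + cmod (cplx v) + \<bar>e\<bar>) * min (dt / \<epsilon>) C) * cmod (cplx v) + C * dt * (1 + cmod (cplx v) + \<bar>e\<bar>) \<and>
      cmod (cplx v') \<le> C * (1 + cmod (cplx v) + \<bar>e\<bar>) \<and>
      norm (x' - x) \<le> C * dt * (1 + cmod (cplx v) + \<bar>e\<bar>) \<and> \<bar>v' $ 3\<bar> \<le> \<bar>v $ 3\<bar> + dt * M"
      unfolding W l1_def using vel_par_le(4) by blast
  qed
qed

end

lemma N_steps_le: "0 < dt \<Longrightarrow> 0 < T \<Longrightarrow> n \<le> N_steps T dt \<Longrightarrow> real n * dt \<le> T"
proof -
  assume a: "0 < dt" "0 < T" "n \<le> N_steps T dt"
  have "real n \<le> T / dt"
    using a unfolding N_steps_def by (simp add: le_nat_iff le_floor_iff)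
  then show ?thesis using a by (simp add: pos_le_divide_eq)
qed

text \<open>The parallel velocity grows at most by \<open>\<Delta>t M\<close> in each step; the perpendicular velocity and
  the energy obey the recursion of \<open>growth_bound\<close>; and the position moves by \<open>O(\<Delta>t)\<close>.\<close>

theorem (in bounded_data) uniform_bounds:
  fixes x0 v0 :: "real \<Rightarrow> vec3" and e0 :: "real \<Rightarrow> real"
    and x v :: "real \<Rightarrow> real \<Rightarrow> nat \<Rightarrow> vec3" and e :: "real \<Rightarrow> real \<Rightarrow> nat \<Rightarrow> real"
    and s :: "real \<Rightarrow> real \<Rightarrow> nat \<Rightarrow> S_stages"
  assumes R: "\<And>\<epsilon>. 0 < \<epsilon> \<Longrightarrow> norm (x0 \<epsilon>) \<le> R \<and> norm (v0 \<epsilon>) \<le> R \<and> \<bar>e0 \<epsilon>\<bar> \<le> R"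
    and initial: "\<And>dt \<epsilon>. 0 < dt \<Longrightarrow> 0 < \<epsilon> \<Longrightarrow> x dt \<epsilon> 0 = x0 \<epsilon> \<and> v dt \<epsilon> 0 = v0 \<epsilon> \<and> e dt \<epsilon> 0 = e0 \<epsilon>"
    and scheme: "\<And>dt \<epsilon> n. 0 < dt \<Longrightarrow> 0 < \<epsilon> \<Longrightarrow> n < N_steps T dt \<Longrightarrow>
      S_step E b chi \<epsilon> dt (real n * dt) (x dt \<epsilon> n, v dt \<epsilon> n, e dt \<epsilon> n) (s dt \<epsilon> n)
        (x dt \<epsilon> (Suc n), v dt \<epsilon> (Suc n), e dt \<epsilon> (Suc n))"
  shows "\<exists>C. \<forall>dt>0. \<forall>\<epsilon>>0. \<forall>n\<le>N_steps T dt.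
        norm (x dt \<epsilon> n) \<le> C \<and> norm (v dt \<epsilon> n) \<le> C \<and> \<bar>e dt \<epsilon> n\<bar> \<le> C"
proof -
  have R0: "0 \<le> R" using R[of 1] norm_ge_zero[of "x0 1"] by linarith
  define P where "P = R + T * M"
  have P0: "0 \<le> P" using R0 T M0 by (simp add: P_def)
  obtain C where C1: "1 \<le> C" and step: "\<And>dt \<epsilon> t x v e s x' v' e'. 0 < dt \<Longrightarrow> 0 < \<epsilon> \<Longrightarrow> 0 \<le> t \<Longrightarrow> t + dt \<le> T \<Longrightarrow> \<bar>v $ 3\<bar> \<le> P \<Longrightarrow>
      S_step E b chi \<epsilon> dt t (x, v, e) s (x', v', e') \<Longrightarrow>
      \<bar>e'\<bar> \<le> \<bar>e\<bar> + C * dt * (1 + cmod (cplx v) + \<bar>e\<bar>) \<and>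
      cmod (cplx v') \<le> (cmod (amplification (resolvent (dt * b (t, x) / \<epsilon>)) (resolvent (dt * b (t, x) / \<epsilon>)) (resolvent (dt * b (t, x) / \<epsilon>)))
        + C * dt * (1 + cmod (cplx v) + \<bar>e\<bar>) * min (dt / \<epsilon>) C) * cmod (cplx v) + C * dt * (1 + cmod (cplx v) + \<bar>e\<bar>) \<and>
      cmod (cplx v') \<le> C * (1 + cmod (cplx v) + \<bar>e\<bar>) \<and>
      norm (x' - x) \<le> C * dt * (1 + cmod (cplx v) + \<bar>e\<bar>) \<and> \<bar>v' $ 3\<bar> \<le> \<bar>v $ 3\<bar> + dt * M"
    by (rule step_growth[OF P0]) (rule that)
  have W0: "1 \<le> 1 + 2 * R" using R0 by simp
  obtain K where K: "\<And>dt \<tau> \<mu> N p q m n. growth_data C (damping b0) T (1 + 2 * R) dt \<tau> \<mu> N p q m \<Longrightarrow> n \<le> N \<Longrightarrow> 1 + p n + q n \<le> K"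
    by (rule growth_bound[where c="damping b0", OF C1 T W0 damping_pos[OF b0]], assumption) (rule that)
  have main: "norm (x dt \<epsilon> n) \<le> R + C * T * K \<and> norm (v dt \<epsilon> n) \<le> K + P \<and> \<bar>e dt \<epsilon> n\<bar> \<le> K"
    if dt: "0 < dt" and \<epsilon>: "0 < \<epsilon>" and n: "n \<le> N_steps T dt" for dt \<epsilon> n
  proof -
    define N where "N = N_steps T dt"
    have time: "real k * dt \<le> T" if "k \<le> N" for k using N_steps_le[OF dt T] that by (simp add: N_def)
    have tstep: "0 \<le> real k * dt" "real k * dt + dt \<le> T" if "k < N" for k
      using time[of "Suc k"] that dt by (auto simp: algebra_simps)
    have ini: "norm (x dt \<epsilon> 0) \<le> R" "norm (v dt \<epsilon> 0) \<le> R" "\<bar>e dt \<epsilon> 0\<bar> \<le> R"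
      using initial[OF dt \<epsilon>] R[OF \<epsilon>] by auto
    have par0: "\<bar>v dt \<epsilon> k $ 3\<bar> \<le> R + real k * dt * M" if "k \<le> N" for k
      using that
    proof (induction k)
      case 0
      then show ?case using component_le_norm_cart[of "v dt \<epsilon> 0" 3] ini by simp
    next
      case (Suc k)
      have "real k * dt * M \<le> T * M" using time[of k] Suc.prems M0 by (intro mult_right_mono) auto
      then have "\<bar>v dt \<epsilon> k $ 3\<bar> \<le> P" using Suc by (simp add: P_def)
      then have "\<bar>v dt \<epsilon> (Suc k) $ 3\<bar> \<le> \<bar>v dt \<epsilon> k $ 3\<bar> + dt * M"
        using step[OF dt \<epsilon> tstep _ scheme[OF dt \<epsilon>]] Suc.prems by (simp add: N_def)
      then show ?case using Suc by (simp add: algebra_simps)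
    qed
    have par: "\<bar>v dt \<epsilon> k $ 3\<bar> \<le> P" if "k \<le> N" for k
      using order_trans[OF par0[OF that]] mult_right_mono[OF time[OF that] M0] by (simp add: P_def)
    have st: "S_step E b chi \<epsilon> dt (real k * dt) (x dt \<epsilon> k, v dt \<epsilon> k, e dt \<epsilon> k) (s dt \<epsilon> k)
        (x dt \<epsilon> (Suc k), v dt \<epsilon> (Suc k), e dt \<epsilon> (Suc k))" "\<bar>v dt \<epsilon> k $ 3\<bar> \<le> P" if "k < N" for k
      using scheme[OF dt \<epsilon>] par that by (auto simp: N_def)
    note stp = step[OF dt \<epsilon> tstep st(2) st(1)]
    have WK: "1 + cmod (cplx (v dt \<epsilon> k)) + \<bar>e dt \<epsilon> k\<bar> \<le> K" if "k \<le> N" for k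
    proof -
      let ?m = "\<lambda>k. cmod (amplification (resolvent (dt * b (real k * dt, x dt \<epsilon> k) / \<epsilon>)) (resolvent (dt * b (real k * dt, x dt \<epsilon> k) / \<epsilon>)) (resolvent (dt * b (real k * dt, x dt \<epsilon> k) / \<epsilon>)))"
      have m: "?m k \<le> 1 - damping b0 \<theta>" if k: "k < N" and \<theta>: "0 \<le> \<theta>" "\<theta> \<le> dt / \<epsilon>" for k \<theta>
      proof -
        have "b0 < b (real k * dt, x dt \<epsilon> k)"
          by (rule b_gt[OF slab_mem[OF tstep(1)[OF k] time]]) (use k in simp)
        then have "b0 * \<theta> \<le> b (real k * dt, x dt \<epsilon> k) * (dt / \<epsilon>)"
          using \<theta> b0 by (intro mult_mono) auto
        then have "b0 * \<theta> \<le> dt * b (real k * dt, x dt \<epsilon> k) / \<epsilon>" by (simp add: mult.commute)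
        then show ?thesis by (rule amplification_damped[OF b0 \<theta>(1)])
      qed
      have "growth_data C (damping b0) T (1 + 2 * R) dt (dt / \<epsilon>) (min (dt / \<epsilon>) C) N (\<lambda>k. cmod (cplx (v dt \<epsilon> k))) (\<lambda>k. \<bar>e dt \<epsilon> k\<bar>) ?m"
        unfolding growth_data_def
      proof (intro conjI allI impI)
        show "1 + cmod (cplx (v dt \<epsilon> 0)) + \<bar>e dt \<epsilon> 0\<bar> \<le> 1 + 2 * R"
          using cmod_cplx_le[of "v dt \<epsilon> 0"] ini by simp
        show "?m k \<le> 1" if "k < N" for k using m[OF that, of 0] dt \<epsilon> by (simp add: damping_def)
      qed (use dt \<epsilon> C1 stp m time[of N] in auto)
      then show ?thesis using K that by blast
    qed
    have K0: "0 \<le> K" using WK[of 0] norm_ge_zero[of "cplx (v dt \<epsilon> 0)"] abs_ge_zero[of "e dt \<epsilon> 0"] by linarith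
    have xn: "norm (x dt \<epsilon> k) \<le> R + C * (real k * dt) * K" if "k \<le> N" for k
      using that
    proof (induction k)
      case 0
      then show ?case using ini by simp
    next
      case (Suc k)
      have "norm (x dt \<epsilon> (Suc k) - x dt \<epsilon> k) \<le> C * dt * (1 + cmod (cplx (v dt \<epsilon> k)) + \<bar>e dt \<epsilon> k\<bar>)"
        using stp[of k] Suc.prems by simp
      also have "\<dots> \<le> C * dt * K" using WK[of k] Suc.prems C1 dt by (intro mult_left_mono) auto
      finally show ?case using Suc norm_triangle_sub[of "x dt \<epsilon> (Suc k)" "x dt \<epsilon> k"]
        by (simp add: algebra_simps)
    qed
    have nN: "n \<le> N" using n by (simp add: N_def)
    have "C * (real n * dt) * K \<le> C * T * K"
      using time[OF nN] C1 K0 by (intro mult_right_mono mult_left_mono) auto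
    moreover have "norm (v dt \<epsilon> n) \<le> cmod (cplx (v dt \<epsilon> n)) + \<bar>v dt \<epsilon> n $ 3\<bar>" by (rule norm_le_cplx)
    ultimately show ?thesis
      using xn[OF nN] par[OF nN] WK[OF nN] norm_ge_zero[of "cplx (v dt \<epsilon> n)"] by linarith
  qed
  show ?thesis
    by (rule exI[of _ "max (R + C * T * K) (max (K + P) K)"]) (use main in \<open>auto simp: le_max_iff_disj\<close>)
qed

section \<open>Consistency with the drift-kinetic scheme\<close>

text \<open>By the stage equations, \<open>f\<^sub>k\<close> is a combination of velocities with bounded coefficients. So the forces are as small as the velocities, although each of them contains the
  stiff term \<open>b v\<^sup>\<perp> / \<epsilon>\<close>.\<close>

lemma (in complex_step) forces_from_stages:
  assumes m: "cmod v \<le> m" "cmod v1 \<le> m" "cmod v2 \<le> m" "cmod v3 \<le> m" "cmod v4 \<le> m"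
  shows "cmod f1 \<le> 100 * m" "cmod f2 \<le> 100 * m" "cmod f3 \<le> 100 * m" "cmod f4 \<le> 100 * m"
proof -
  have a: "complex_of_real \<alpha> \<noteq> 0" using \<alpha>_bounds by simp
  have m0: "0 \<le> m" using m(1) norm_ge_zero order_trans by blast
  let ?u = "1 / complex_of_real \<alpha>"
  have u: "cmod ?u \<le> 4.17" using coefficient_bounds by (simp add: norm_divide)
  have c: "cmod (1 - complex_of_real \<alpha>) \<le> 1"
    using \<alpha>_bounds norm_of_real[of "1 - \<alpha>", where 'a=complex] by simp
  have be: "cmod (complex_of_real \<beta>) \<le> 0.0625" "cmod (complex_of_real \<eta>) \<le> 0.13" "cmod (complex_of_real \<gamma>) \<le> 0.07"
    using coefficient_bounds by auto
  have e1: "f1 = ?u * (v1 - v)" using v1 a by simp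
  have e2: "f2 = ?u * ((v2 - v) + (v1 - v))" using v2 v1 a by (simp add: field_simps)
  have e3: "f3 = ?u * ((v3 - v) - (1 - complex_of_real \<alpha>) * f2)" using v3 a by simp
  have e4: "f4 = ?u * ((v4 - v) - complex_of_real \<beta> * f1 - complex_of_real \<eta> * f2 - complex_of_real \<gamma> * f3)"
    using v4 a by simp
  have 1: "cmod f1 \<le> 4.17 * (m + m)" unfolding e1 by (intro norm_mult_le norm_diff_le u m)
  have 2: "cmod f2 \<le> 4.17 * ((m + m) + (m + m))" unfolding e2 by (intro norm_mult_le norm_add_le norm_diff_le u m)
  have 3: "cmod f3 \<le> 4.17 * ((m + m) + 1 * (4.17 * ((m + m) + (m + m))))"
    unfolding e3 by (intro norm_mult_le norm_diff_le u m c 2)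
  have 4: "cmod f4 \<le> 4.17 * ((m + m) + 0.0625 * (4.17 * (m + m)) + 0.13 * (4.17 * ((m + m) + (m + m)))
      + 0.07 * (4.17 * ((m + m) + 1 * (4.17 * ((m + m) + (m + m))))))"
    unfolding e4 by (intro norm_mult_le norm_diff_le u m be 1 2 3)
  show "cmod f1 \<le> 100 * m" "cmod f2 \<le> 100 * m" "cmod f3 \<le> 100 * m" "cmod f4 \<le> 100 * m"
    using 1 2 3 4 m0 by simp_all
qed

context bounded_data
begin

text \<open>Solving \<open>F = H - (b / \<epsilon>) u\<^sup>\<perp>\<close> for \<open>u\<close> gives \<open>u\<^sub>\<perp> = - (\<epsilon> / b) (H - F)\<^sup>\<perp>\<close>, and
  \<open>- (\<epsilon> / b) H\<^sup>\<perp>\<close> is the guiding centre drift except that it carries \<open>\<chi>\<close> in place of the energy. A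
  force and an error in \<open>\<chi>\<close> of size \<open>O(\<epsilon>)\<close> thus leave a residual of size \<open>O(\<epsilon>\<^sup>2)\<close>.\<close>

lemma drift_velocity:
  assumes t: "0 \<le> t" "t \<le> T" and \<epsilon>: "0 < \<epsilon>"
    and F: "F = H_field E b chi t z w y - (b (t, z) / \<epsilon>) *\<^sub>R rot u"
    and \<delta>: "\<bar>chi (y, perp w) - y\<bar> \<le> \<delta>"
  shows "norm (u - U_gc E b \<epsilon> t z y (u $ 3)) \<le> \<epsilon> / b0 * cmod (cplx F) + \<epsilon> * \<delta> * L / b0\<^sup>2"
proof -
  have p: "(t, z) \<in> closed_slab T" using t by (rule slab_mem)
  define B where "B = b (t, z)"
  define g where "g = cplx (grad_perp b (t, z))"
  have B: "b0 < B" "0 < B" using b_gt[OF p] b0 by (auto simp: B_def)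
  define D where "D = u - U_gc E b \<epsilon> t z y (u $ 3)"
  have "D $ 3 = 0" by (simp add: D_def U_gc_def e_z_def)
  then have nD: "norm D \<le> cmod (cplx D)" using norm_le_cplx[of D] by simp
  have cp: "cplx (perp a) = cplx a" for a by (simp add: cplx_def)
  have ez: "cplx e_z = 0" by (simp add: cplx_def e_z_def complex_eq_iff)
  have U: "cplx (U_gc E b \<epsilon> t z y (u $ 3)) = - complex_of_real \<epsilon> * (\<i> * (cplx (E (t, z)) / complex_of_real B
      - complex_of_real y / (complex_of_real B)\<^sup>2 * g))"
    by (simp add: U_gc_def cplx_simps cp ez F_field_def B_def g_def divide_inverse mult.commute)
  have H: "cplx (H_field E b chi t z w y) = cplx (E (t, z)) - complex_of_real (chi (y, perp w)) * (g / complex_of_real B)"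
    by (simp add: H_field_def cplx_simps grad_ln[OF p] g_def B_def divide_inverse mult.commute)
  have "cplx F = cplx (H_field E b chi t z w y) - complex_of_real (B / \<epsilon>) * (\<i> * cplx u)"
    by (simp add: F cplx_simps B_def)
  then have u: "cplx u = - \<i> * complex_of_real \<epsilon> / complex_of_real B * (cplx (H_field E b chi t z w y) - cplx F)"
  proof -
    have "cplx (H_field E b chi t z w y) - cplx F = complex_of_real (B / \<epsilon>) * (\<i> * cplx u)"
      unfolding \<open>cplx F = _\<close> by simp
    then show ?thesis using B(2) \<epsilon> by simp
  qed
  have "cplx D = \<i> * complex_of_real (\<epsilon> / B) * cplx F + \<i> * complex_of_real (\<epsilon> * (chi (y, perp w) - y) / B\<^sup>2) * g"
    unfolding D_def cplx_simps U u H using B(2) by (simp add: field_simps power2_eq_square)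
  then have "cmod (cplx D) \<le> cmod (\<i> * complex_of_real (\<epsilon> / B) * cplx F) + cmod (\<i> * complex_of_real (\<epsilon> * (chi (y, perp w) - y) / B\<^sup>2) * g)"
    by (simp add: norm_triangle_ineq)
  also have "\<dots> = \<epsilon> / B * cmod (cplx F) + \<epsilon> * \<bar>chi (y, perp w) - y\<bar> * cmod g / B\<^sup>2"
    using \<epsilon> B(2) by (simp add: norm_mult norm_divide abs_mult norm_power del: of_real_diff)
  also have "\<dots> \<le> \<epsilon> / b0 * cmod (cplx F) + \<epsilon> * \<delta> * L / b0\<^sup>2"
  proof (rule add_mono)
    show "\<epsilon> / B * cmod (cplx F) \<le> \<epsilon> / b0 * cmod (cplx F)"
      using \<epsilon> B b0 by (intro mult_right_mono divide_left_mono) auto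
    have g: "cmod g \<le> L" using order_trans[OF cmod_cplx_le grad_le[OF p]] by (simp add: g_def)
    have "b0\<^sup>2 \<le> B\<^sup>2" using B b0 by (intro power_mono) auto
    moreover have "\<epsilon> * \<bar>chi (y, perp w) - y\<bar> * cmod g \<le> \<epsilon> * \<delta> * L"
      using g \<delta> \<epsilon> by (intro mult_mono) auto
    moreover have "0 \<le> \<epsilon> * \<delta> * L" using \<epsilon> L0 order_trans[OF abs_ge_zero \<delta>] by simp
    ultimately show "\<epsilon> * \<bar>chi (y, perp w) - y\<bar> * cmod g / B\<^sup>2 \<le> \<epsilon> * \<delta> * L / b0\<^sup>2"
      using \<epsilon> b0 by (intro frac_le) auto
  qed
  finally show ?thesis using nD by (simp add: D_def)
qed

end

text \<open>The part \<open>E\<^sup>\<perp> / b\<close> of the drift is orthogonal to \<open>E\<close>. What remains is the work of \<open>E\<close> along the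
  gradient drift, which is the divergence of \<open>(E / b)\<^sup>\<perp>\<close> times \<open>\<epsilon>\<close> and the energy.\<close>

lemma drift_work:
  "perp (E (t, z)) \<bullet> perp (U_gc E b \<epsilon> t z y q) =
    \<epsilon> * (y * ((E (t, z) \<bullet> rot (grad_perp b (t, z))) / (b (t, z))\<^sup>2))"
proof -
  have "U_gc E b \<epsilon> t z y q $ 1 = \<epsilon> * (E (t, z) $ 2 / b (t, z) - y / (b (t, z))\<^sup>2 * grad_perp b (t, z) $ 2)"
    "U_gc E b \<epsilon> t z y q $ 2 = - \<epsilon> * (E (t, z) $ 1 / b (t, z) - y / (b (t, z))\<^sup>2 * grad_perp b (t, z) $ 1)"
    by (simp_all add: U_gc_def e_z_def F_field_def divide_inverse algebra_simps del: grad_perp_nth(1,2))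
  then show ?thesis
    unfolding inner_vec3 perp_nth rot_nth
    by (simp only:) (simp add: divide_inverse algebra_simps del: grad_perp_nth(1,2))
qed

lemma work_residual:
  assumes "norm (E (t, z)) \<le> M" "norm (u - U_gc E b \<epsilon> t z y q) \<le> \<rho>" "0 \<le> M"
  shows "\<bar>perp (E (t, z)) \<bullet> perp u - \<epsilon> * (y * ((E (t, z) \<bullet> rot (grad_perp b (t, z))) / (b (t, z))\<^sup>2))\<bar> \<le> M * \<rho>"
proof -
  have "perp (E (t, z)) \<bullet> perp u - perp (E (t, z)) \<bullet> perp (U_gc E b \<epsilon> t z y q)
      = perp (E (t, z)) \<bullet> perp (u - U_gc E b \<epsilon> t z y q)"
    by (simp add: inner_vec3 algebra_simps)
  then have "perp (E (t, z)) \<bullet> perp u - \<epsilon> * (y * ((E (t, z) \<bullet> rot (grad_perp b (t, z))) / (b (t, z))\<^sup>2))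
      = perp (E (t, z)) \<bullet> perp (u - U_gc E b \<epsilon> t z y q)"
    unfolding drift_work .
  also have "\<bar>\<dots>\<bar> \<le> norm (E (t, z)) * cmod (cplx (u - U_gc E b \<epsilon> t z y q))"
    by (rule abs_inner_perp_le)
  also have "\<dots> \<le> M * \<rho>"
    using assms order_trans[OF cmod_cplx_le assms(2)] by (intro mult_mono) auto
  finally show ?thesis .
qed

context data_step
begin

lemma L_step_residuals:
  assumes g: "\<And>t x. t \<in> {0..T} \<Longrightarrow> g_field T E b t x = (E (t, x) \<bullet> rot (grad_perp b (t, x))) / (b (t, x))\<^sup>2"
    and \<rho>: "norm (vel2 s - U_gc E b \<epsilon> t x e (vel2 s $ 3)) \<le> \<rho>"
      "norm (vel3 s - U_gc E b \<epsilon> (t + dt) (pos2 s) (en2 s) (vel3 s $ 3)) \<le> \<rho>"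
      "norm (vel4 s - U_gc E b \<epsilon> (t + dt / 2) (pos3 s) (en3 s) (vel4 s $ 3)) \<le> \<rho>"
  shows "L_step_upto ((1 + M) * \<rho>) T E b \<epsilon> dt t (x, e, v $ 3) (L_part s) (x', e', v' $ 3)"
proof -
  have \<rho>0: "0 \<le> \<rho>" using \<rho>(1) norm_ge_zero order_trans by blast
  let ?\<delta> = "(1 + M) * \<rho>"
  have \<delta>: "\<rho> \<le> ?\<delta>" "M * \<rho> \<le> ?\<delta>" "0 \<le> ?\<delta>" using \<rho>0 M0 by (simp_all add: distrib_right)
  define U2 U3 U4 where "U2 = U_gc E b \<epsilon> t x e (vel2 s $ 3)" and
    "U3 = U_gc E b \<epsilon> (t + dt) (pos2 s) (en2 s) (vel3 s $ 3)" and
    "U4 = U_gc E b \<epsilon> (t + dt / 2) (pos3 s) (en3 s) (vel4 s $ 3)"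
  define G2 G3 G4 where "G2 = e * g_field T E b t x" and "G3 = en2 s * g_field T E b (t + dt) (pos2 s)" and
    "G4 = en3 s * g_field T E b (t + dt / 2) (pos3 s)"
  define P2 P3 P4 where "P2 = perp (E (t, x)) \<bullet> perp (vel2 s)" and "P3 = perp (E (t + dt, pos2 s)) \<bullet> perp (vel3 s)"
    and "P4 = perp (E (t + dt / 2, pos3 s)) \<bullet> perp (vel4 s)"
  have r: "norm (vel2 s - U2) \<le> \<rho>" "norm (vel3 s - U3) \<le> \<rho>" "norm (vel4 s - U4) \<le> \<rho>"
    using \<rho> by (simp_all add: U2_def U3_def U4_def)
  have w: "\<bar>P2 - \<epsilon> * G2\<bar> \<le> M * \<rho>" "\<bar>P3 - \<epsilon> * G3\<bar> \<le> M * \<rho>" "\<bar>P4 - \<epsilon> * G4\<bar> \<le> M * \<rho>"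
    using work_residual[OF E_le[OF slab_mem[OF times(1,2)]] \<rho>(1) M0]
      work_residual[OF E_le[OF slab_mem[OF times(3,4)]] \<rho>(2) M0]
      work_residual[OF E_le[OF slab_mem[OF times(5,6)]] \<rho>(3) M0] times
    by (simp_all add: P2_def P3_def P4_def G2_def G3_def G4_def g)
  have V: "(p - q) /\<^sub>R dt = c" if "p = q + dt *\<^sub>R c" for p q c :: vec3 using dt that by simp
  have R: "(p - q) / dt = c" if "p = q + dt * c" for p q c :: real using dt that by simp
  have Q: "norm ((1 / 4) *\<^sub>R (vel2 s + vel3 s) - (1 / 4) *\<^sub>R (U2 + U3)) \<le> \<rho>"
  proof -
    have "norm ((vel2 s - U2) + (vel3 s - U3)) \<le> \<rho> + \<rho>" by (intro norm_add_le r)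
    moreover have "(1 / 4) *\<^sub>R (vel2 s + vel3 s) - (1 / 4) *\<^sub>R (U2 + U3) = (1 / 4) *\<^sub>R ((vel2 s - U2) + (vel3 s - U3))"
      by (simp add: algebra_simps)
    ultimately show ?thesis using \<rho>0 by simp
  qed
  have Q': "norm ((1 / 6) *\<^sub>R (vel2 s + vel3 s + 4 *\<^sub>R vel4 s) - (1 / 6) *\<^sub>R (U2 + U3 + 4 *\<^sub>R U4)) \<le> \<rho>"
  proof -
    have "norm (4 *\<^sub>R (vel4 s - U4)) \<le> 4 * \<rho>" unfolding norm_scaleR using r(3) by simp
    then have "norm ((vel2 s - U2) + (vel3 s - U3) + 4 *\<^sub>R (vel4 s - U4)) \<le> \<rho> + \<rho> + 4 * \<rho>" by (intro norm_add_le r)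
    moreover have "(1 / 6) *\<^sub>R (vel2 s + vel3 s + 4 *\<^sub>R vel4 s) - (1 / 6) *\<^sub>R (U2 + U3 + 4 *\<^sub>R U4)
        = (1 / 6) *\<^sub>R ((vel2 s - U2) + (vel3 s - U3) + 4 *\<^sub>R (vel4 s - U4))"
      by (simp add: algebra_simps)
    ultimately show ?thesis by simp
  qed
  have q4: "\<bar>1 / 4 * (P2 + P3) - \<epsilon> / 4 * (G2 + G3)\<bar> \<le> M * \<rho>"
  proof -
    have "1 / 4 * (P2 + P3) - \<epsilon> / 4 * (G2 + G3) = 1 / 4 * ((P2 - \<epsilon> * G2) + (P3 - \<epsilon> * G3))" by (simp add: field_simps)
    moreover have "\<bar>(P2 - \<epsilon> * G2) + (P3 - \<epsilon> * G3)\<bar> \<le> M * \<rho> + M * \<rho>"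
      using w by (intro order_trans[OF abs_triangle_ineq] add_mono)
    moreover have "0 \<le> M * \<rho>" using M0 \<rho>0 by simp
    ultimately show ?thesis by (simp only: abs_mult) simp
  qed
  have q6: "\<bar>1 / 6 * (P2 + P3 + 4 * P4) - \<epsilon> / 6 * (G2 + G3 + 4 * G4)\<bar> \<le> M * \<rho>"
  proof -
    have "1 / 6 * (P2 + P3 + 4 * P4) - \<epsilon> / 6 * (G2 + G3 + 4 * G4) = 1 / 6 * ((P2 - \<epsilon> * G2) + (P3 - \<epsilon> * G3) + 4 * (P4 - \<epsilon> * G4))"
      by (simp add: field_simps)
    then show ?thesis by (simp only: abs_simpson_sum[OF w])
  qed
  have e2': "(en2 s - e) / dt = P2" using R[OF en2] by (simp add: P2_def)
  have e3': "(en3 s - e) / dt = 1 / 4 * (P2 + P3)" using R[OF en3] by (simp add: P2_def P3_def)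
  have e4': "(e' - e) / dt = 1 / 6 * (P2 + P3 + 4 * P4)" using R[OF e'] by (simp add: P2_def P3_def P4_def)
  show ?thesis
    unfolding L_step_upto_def prod.case Let_def L_part_def L_stages.simps
      U2_def[symmetric] U3_def[symmetric] U4_def[symmetric] G2_def[symmetric] G3_def[symmetric] G4_def[symmetric]
      V[OF pos2] V[OF pos3] V[OF x'] e2' e3' e4' R[OF vel_par(2)] R[OF vel_par(3)] R[OF vel_par(4)]
    using \<delta> r(1) w(1) Q Q' q4 q6 by (auto simp: vel_par(1))
qed

text \<open>Every stage velocity is a resolvent times a bounded quantity, and the resolvent is
  \<open>O(\<epsilon> / \<Delta>t)\<close>.\<close>

lemma stages_small:
  "cmod (cplx (vel1 s)) \<le> 5 / (b0 * dt) * (C5 * W) * \<epsilon>" "cmod (cplx (vel2 s)) \<le> 5 / (b0 * dt) * (C5 * W) * \<epsilon>"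
  "cmod (cplx (vel3 s)) \<le> 5 / (b0 * dt) * (C5 * W) * \<epsilon>" "cmod (cplx (vel4 s)) \<le> 5 / (b0 * dt) * (C5 * W) * \<epsilon>"
  "cmod (cplx v') \<le> 20 * (5 / (b0 * dt) * (C5 * W) * \<epsilon>)"
proof -
  have *: "cmod (resolvent l) * (C5 * W) \<le> 5 / (b0 * dt) * (C5 * W) * \<epsilon>" if "b0 * (dt / \<epsilon>) \<le> l" for l
  proof -
    have "cmod (resolvent l) \<le> (5 / b0) / (dt / \<epsilon>)"
      using resolvent_decay[OF that] by (rule mult_imp_le_div_pos[OF \<tau>0])
    then have "cmod (resolvent l) * (C5 * W) \<le> (5 / b0) / (dt / \<epsilon>) * (C5 * W)"
      using constants_nonneg W_ge by (intro mult_right_mono) auto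
    then show ?thesis using dt \<epsilon> b0 by (simp add: field_simps)
  qed
  show 1: "cmod (cplx (vel1 s)) \<le> 5 / (b0 * dt) * (C5 * W) * \<epsilon>" "cmod (cplx (vel2 s)) \<le> 5 / (b0 * dt) * (C5 * W) * \<epsilon>"
    "cmod (cplx (vel3 s)) \<le> 5 / (b0 * dt) * (C5 * W) * \<epsilon>" "cmod (cplx (vel4 s)) \<le> 5 / (b0 * dt) * (C5 * W) * \<epsilon>"
    using order_trans[OF vel_le(1) *[OF l_ge(1)]] order_trans[OF vel_le(2) *[OF l_ge(1)]]
      order_trans[OF vel_le(3) *[OF l_ge(2)]] order_trans[OF vel_le(4) *[OF l_ge(3)]] .
  show "cmod (cplx v') \<le> 20 * (5 / (b0 * dt) * (C5 * W) * \<epsilon>)"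
    by (rule plane.step_from_stages[OF 1])
qed

lemma energies_change:
  assumes m: "cmod (cplx (vel2 s)) \<le> m" "cmod (cplx (vel3 s)) \<le> m" "cmod (cplx (vel4 s)) \<le> m"
  shows "\<bar>en2 s - e\<bar> \<le> dt * (M * m)" "\<bar>en3 s - e\<bar> \<le> dt * (M * m)" "\<bar>e' - e\<bar> \<le> dt * (M * m)"
proof -
  have p: "\<bar>perp (E (t, x)) \<bullet> perp (vel2 s)\<bar> \<le> M * m" "\<bar>perp (E (t + dt, pos2 s)) \<bullet> perp (vel3 s)\<bar> \<le> M * m"
    "\<bar>perp (E (t + dt / 2, pos3 s)) \<bullet> perp (vel4 s)\<bar> \<le> M * m"
    by (intro inner_E_le times m)+
  have "\<bar>1 / 4 * (perp (E (t, x)) \<bullet> perp (vel2 s) + perp (E (t + dt, pos2 s)) \<bullet> perp (vel3 s))\<bar> \<le> M * m"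
    using p(1,2) by (simp add: abs_le_iff field_simps)
  then show "\<bar>en3 s - e\<bar> \<le> dt * (M * m)" using dt by (simp only: en3 add_diff_cancel_left' abs_mult abs_of_pos mult_left_mono less_imp_le)
  show "\<bar>en2 s - e\<bar> \<le> dt * (M * m)" using p(1) dt by (simp add: en2 abs_mult)
  show "\<bar>e' - e\<bar> \<le> dt * (M * m)"
    using abs_simpson_sum[OF p] dt by (simp only: e' add_diff_cancel_left' abs_mult abs_of_pos mult_left_mono less_imp_le)
qed

lemma hat_velocities:
  "cplx (hvel2 s) = cplx v + f2" "cplx (hvel3 s) = cplx v + (f2 + f3) / 4"
  by (simp_all add: hvel2 hvel3 cplx_simps f2_def f3_def field_simps)

lemma hat_velocities_le:
  assumes "cmod f2 \<le> c" "cmod f3 \<le> c"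
  shows "norm (perp (hvel2 s)) \<le> cmod (cplx v) + c" "norm (perp (hvel3 s)) \<le> cmod (cplx v) + c"
proof -
  have c: "0 \<le> c" using assms(1) norm_ge_zero order_trans by blast
  show "norm (perp (hvel2 s)) \<le> cmod (cplx v) + c"
    unfolding norm_perp hat_velocities by (intro norm_add_le assms order_refl)
  have "cmod (f2 + f3) \<le> c + c" by (intro norm_add_le assms)
  then have "cmod ((f2 + f3) / 4) \<le> c" using c by (simp add: norm_divide)
  then show "norm (perp (hvel3 s)) \<le> cmod (cplx v) + c"
    unfolding norm_perp hat_velocities by (intro norm_add_le order_refl)
qed

lemma residual_bound:
  assumes g: "\<And>t x. t \<in> {0..T} \<Longrightarrow> g_field T E b t x = (E (t, x) \<bullet> rot (grad_perp b (t, x))) / (b (t, x))\<^sup>2"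
    and m: "cmod (cplx v) \<le> m" "cmod (cplx (vel1 s)) \<le> m" "cmod (cplx (vel2 s)) \<le> m" "cmod (cplx (vel3 s)) \<le> m" "cmod (cplx (vel4 s)) \<le> m"
    and \<delta>: "\<bar>chi (e, perp v) - e\<bar> \<le> \<delta>" "\<bar>chi (en2 s, perp (hvel2 s)) - en2 s\<bar> \<le> \<delta>" "\<bar>chi (en3 s, perp (hvel3 s)) - en3 s\<bar> \<le> \<delta>"
  shows "L_step_upto ((1 + M) * (\<epsilon> / b0 * (100 * m / dt) + \<epsilon> * \<delta> * L / b0\<^sup>2)) T E b \<epsilon> dt t (x, e, v $ 3) (L_part s) (x', e', v' $ 3)"
proof (rule L_step_residuals[OF g], assumption)
  note f = plane.forces_from_stages[OF m]
  have *: "norm (u - U_gc E b \<epsilon> t' z y (u $ 3)) \<le> \<epsilon> / b0 * (100 * m / dt) + \<epsilon> * \<delta> * L / b0\<^sup>2"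
    if "0 \<le> t'" "t' \<le> T" "F = H_field E b chi t' z w y - (b (t', z) / \<epsilon>) *\<^sub>R rot u" "\<bar>chi (y, perp w) - y\<bar> \<le> \<delta>"
      "cmod (complex_of_real dt * cplx F) \<le> 100 * m" for t' z w y u F
  proof -
    have "cmod (cplx F) \<le> 100 * m / dt" using that(5) dt by (simp add: norm_mult pos_le_divide_eq mult.commute)
    then have "\<epsilon> / b0 * cmod (cplx F) \<le> \<epsilon> / b0 * (100 * m / dt)" using \<epsilon> b0 by (intro mult_left_mono) auto
    then show ?thesis using drift_velocity[OF that(1,2) \<epsilon> that(3,4)] by linarith
  qed
  show "norm (vel2 s - U_gc E b \<epsilon> t x e (vel2 s $ 3)) \<le> \<epsilon> / b0 * (100 * m / dt) + \<epsilon> * \<delta> * L / b0\<^sup>2"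
    by (rule *[OF times(1,2) F2 \<delta>(1)]) (use f in \<open>simp add: f2_def\<close>)
  show "norm (vel3 s - U_gc E b \<epsilon> (t + dt) (pos2 s) (en2 s) (vel3 s $ 3)) \<le> \<epsilon> / b0 * (100 * m / dt) + \<epsilon> * \<delta> * L / b0\<^sup>2"
    by (rule *[OF times(3,4) F3 \<delta>(2)]) (use f in \<open>simp add: f3_def\<close>)
  show "norm (vel4 s - U_gc E b \<epsilon> (t + dt / 2) (pos3 s) (en3 s) (vel4 s $ 3)) \<le> \<epsilon> / b0 * (100 * m / dt) + \<epsilon> * \<delta> * L / b0\<^sup>2"
    by (rule *[OF times(5,6) F4 \<delta>(3)]) (use f in \<open>simp add: f4_def\<close>)
qed

end

text \<open>After one step, all perpendicular velocities are of size \<open>O(\<epsilon>)\<close> by the decay of the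
  resolvent and by L-stability; hence so are the forces, and \<open>drift_velocity\<close> applies in each stage.
  The energies also change by \<open>O(\<epsilon>)\<close> only. If they start from nonnegative values, they stay above
  \<open>- O(\<epsilon>)\<close>, where \<open>\<bar>\<chi> (e, 0) - e\<bar>\<close> is \<open>O(\<epsilon>)\<close> even if \<open>\<chi> (e, 0) = e\<close> is required for \<open>e \<ge> 0\<close> only.\<close>

theorem (in bounded_data) consistency:
  fixes x0 v0 :: "real \<Rightarrow> vec3" and e0 :: "real \<Rightarrow> real"
    and x v :: "real \<Rightarrow> real \<Rightarrow> nat \<Rightarrow> vec3" and e :: "real \<Rightarrow> real \<Rightarrow> nat \<Rightarrow> real"
    and s :: "real \<Rightarrow> real \<Rightarrow> nat \<Rightarrow> S_stages"
  assumes R: "\<And>\<epsilon>. 0 < \<epsilon> \<Longrightarrow> norm (x0 \<epsilon>) \<le> R \<and> norm (v0 \<epsilon>) \<le> R \<and> \<bar>e0 \<epsilon>\<bar> \<le> R"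
    and initial: "\<And>dt \<epsilon>. 0 < dt \<Longrightarrow> 0 < \<epsilon> \<Longrightarrow> x dt \<epsilon> 0 = x0 \<epsilon> \<and> v dt \<epsilon> 0 = v0 \<epsilon> \<and> e dt \<epsilon> 0 = e0 \<epsilon>"
    and scheme: "\<And>dt \<epsilon> n. 0 < dt \<Longrightarrow> 0 < \<epsilon> \<Longrightarrow> n < N_steps T dt \<Longrightarrow>
      S_step E b chi \<epsilon> dt (real n * dt) (x dt \<epsilon> n, v dt \<epsilon> n, e dt \<epsilon> n) (s dt \<epsilon> n)
        (x dt \<epsilon> (Suc n), v dt \<epsilon> (Suc n), e dt \<epsilon> (Suc n))"
    and chi: "admissible_chi chi"
    and g: "\<And>t x. t \<in> {0..T} \<Longrightarrow> g_field T E b t x = (E (t, x) \<bullet> rot (grad_perp b (t, x))) / (b (t, x))\<^sup>2"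
    and sign: "(\<forall>\<epsilon>>0. 0 \<le> e0 \<epsilon>) \<or> (\<forall>y. chi (y, 0) = y)"
    and dt: "0 < dt"
  shows "\<exists>C. \<forall>\<epsilon>>0. \<forall>n. 1 \<le> n \<and> n < N_steps T dt \<longrightarrow>
        L_step_upto (C * \<epsilon>\<^sup>2) T E b \<epsilon> dt (real n * dt)
          (x dt \<epsilon> n, e dt \<epsilon> n, v dt \<epsilon> n $ 3) (L_part (s dt \<epsilon> n))
          (x dt \<epsilon> (Suc n), e dt \<epsilon> (Suc n), v dt \<epsilon> (Suc n) $ 3)"
proof -
  obtain C where C: "\<And>dt \<epsilon> n. 0 < dt \<Longrightarrow> 0 < \<epsilon> \<Longrightarrow> n \<le> N_steps T dt \<Longrightarrow>
      norm (x dt \<epsilon> n) \<le> C \<and> norm (v dt \<epsilon> n) \<le> C \<and> \<bar>e dt \<epsilon> n\<bar> \<le> C"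
    using uniform_bounds[OF R initial scheme] by blast
  define W0 where "W0 = 1 + C + C"
  have C0: "0 \<le> C" using C[OF dt zero_less_one, of 0] norm_ge_zero[of "x dt 1 0"] by linarith
  have W0: "1 \<le> W0" using C0 by (simp add: W0_def)
  define \<kappa> where "\<kappa> = 5 / (b0 * dt) * (C5 * W0)"
  have \<kappa>: "0 \<le> \<kappa>" using b0 dt constants_nonneg W0 by (simp add: \<kappa>_def)
  define \<mu> where "\<mu> = 2 * (T * (M * \<kappa>))"
  have \<mu>: "0 \<le> \<mu>" using T M0 \<kappa> by (simp add: \<mu>_def)
  define B where "B = (1 + C2 + C4 + C5) * W0"
  have CB: "C2 * W0 \<le> B" "C4 * W0 \<le> B" "W0 \<le> B" "W0 + C5 * W0 \<le> B"
    using constants_nonneg W0 by (auto simp: B_def algebra_simps)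
  obtain \<Lambda> where \<Lambda>: "0 \<le> \<Lambda>" "\<And>y w. \<bar>y\<bar> \<le> B \<Longrightarrow> norm w \<le> B \<Longrightarrow> \<bar>chi (y, w) - chi (y, 0)\<bar> \<le> \<Lambda> * norm w"
    by (rule chi_Lipschitz[OF chi, of B]) (rule that)
  define K where "K = (1 + M) * (100 * (20 * \<kappa>) / (b0 * dt) + (\<Lambda> * (101 * (20 * \<kappa>)) + 2 * \<mu>) * L / b0\<^sup>2)"
  have "L_step_upto (K * \<epsilon>\<^sup>2) T E b \<epsilon> dt (real n * dt)
          (x dt \<epsilon> n, e dt \<epsilon> n, v dt \<epsilon> n $ 3) (L_part (s dt \<epsilon> n))
          (x dt \<epsilon> (Suc n), e dt \<epsilon> (Suc n), v dt \<epsilon> (Suc n) $ 3)"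
    if \<epsilon>: "0 < \<epsilon>" and n: "1 \<le> n" "n < N_steps T dt" for \<epsilon> n
  proof -
    define m where "m = \<kappa> * \<epsilon>"
    have m0: "0 \<le> m" using \<kappa> \<epsilon> by (simp add: m_def)
    have step: "\<exists>F1 F2 F3 F4. data_step T b0 M L E b chi dt \<epsilon> (real k * dt) (x dt \<epsilon> k) (v dt \<epsilon> k) (e dt \<epsilon> k) (s dt \<epsilon> k)
        (x dt \<epsilon> (Suc k)) (v dt \<epsilon> (Suc k)) (e dt \<epsilon> (Suc k)) F1 F2 F3 F4 C" if k: "k < N_steps T dt" for k
    proof -
      have "real k * dt + dt \<le> T" using N_steps_le[OF dt T, of "Suc k"] k by (simp add: algebra_simps)
      moreover have "\<bar>v dt \<epsilon> k $ 3\<bar> \<le> C"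
        using C[OF dt \<epsilon>, of k] k component_le_norm_cart[of "v dt \<epsilon> k" 3] by simp
      ultimately show ?thesis
        using data_stepI[OF scheme[OF dt \<epsilon> k] dt \<epsilon>, of C] dt by (metis mult_nonneg_nonneg of_nat_0_le_iff less_imp_le)
    qed
    have small: "cmod (cplx (v dt \<epsilon> (Suc k))) \<le> 20 * m \<and> \<bar>e dt \<epsilon> (Suc k) - e dt \<epsilon> k\<bar> \<le> dt * (M * m)"
      if k: "k < N_steps T dt" for k
    proof -
      obtain F1 F2 F3 F4 where "data_step T b0 M L E b chi dt \<epsilon> (real k * dt) (x dt \<epsilon> k) (v dt \<epsilon> k) (e dt \<epsilon> k) (s dt \<epsilon> k)
        (x dt \<epsilon> (Suc k)) (v dt \<epsilon> (Suc k)) (e dt \<epsilon> (Suc k)) F1 F2 F3 F4 C" using step[OF k] by blast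
      then interpret st: data_step T b0 M L E b chi dt \<epsilon> "real k * dt" "x dt \<epsilon> k" "v dt \<epsilon> k" "e dt \<epsilon> k" "s dt \<epsilon> k"
        "x dt \<epsilon> (Suc k)" "v dt \<epsilon> (Suc k)" "e dt \<epsilon> (Suc k)" F1 F2 F3 F4 C .
      have "st.W \<le> W0"
        using C[OF dt \<epsilon>, of k] k cmod_cplx_le[of "v dt \<epsilon> k"] by (simp add: st.W_def W0_def)
      then have "5 / (b0 * dt) * (C5 * st.W) * \<epsilon> \<le> m"
        unfolding m_def \<kappa>_def using b0 dt \<epsilon> constants_nonneg by (intro mult_right_mono mult_left_mono) auto
      note sm = order_trans[OF st.stages_small(1) this] order_trans[OF st.stages_small(2) this]
        order_trans[OF st.stages_small(3) this] order_trans[OF st.stages_small(4) this]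
      show ?thesis using st.plane.step_from_stages[OF sm] st.energies_change(3)[OF sm(2-4)] by simp
    qed
    have low: "e0 \<epsilon> - real k * (dt * (M * m)) \<le> e dt \<epsilon> k" if "k \<le> N_steps T dt" for k
      using that
    proof (induction k)
      case 0
      then show ?case using initial[OF dt \<epsilon>] by simp
    next
      case (Suc k)
      then have "\<bar>e dt \<epsilon> (Suc k) - e dt \<epsilon> k\<bar> \<le> dt * (M * m)" using small[of k] by simp
      then show ?case using Suc by (simp add: algebra_simps)
    qed
    \<comment> \<open>both hat energies differ from \<open>e\<close> by at most \<open>dt * (M * m)\<close>\<close>
    have chi0: "\<bar>chi (y, 0) - y\<bar> \<le> 2 * \<mu> * \<epsilon>" if y: "e dt \<epsilon> n - dt * (M * m) \<le> y" for y
      using sign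
    proof
      assume "\<forall>y. chi (y, 0) = y"
      then show ?thesis using \<mu> \<epsilon> by simp
    next
      assume "\<forall>\<epsilon>>0. 0 \<le> e0 \<epsilon>"
      then have "0 \<le> e0 \<epsilon>" using \<epsilon> by simp
      have Mm: "0 \<le> M * m" using M0 m0 by simp
      have "(real n * dt) * (M * m) \<le> T * (M * m)" "dt * (M * m) \<le> T * (M * m)"
        using N_steps_le[OF dt T, of n] N_steps_le[OF dt T, of 1] n Mm by (auto intro!: mult_right_mono)
      moreover have "e0 \<epsilon> - real n * (dt * (M * m)) \<le> e dt \<epsilon> n" by (rule low) (use n in simp)
      ultimately have y': "- (\<mu> * \<epsilon>) \<le> y"
        using y \<open>0 \<le> e0 \<epsilon>\<close> by (simp add: \<mu>_def m_def algebra_simps)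
      show ?thesis
      proof (cases "0 \<le> y")
        case True
        then have "chi (y, 0) = y" using chi by (auto simp: admissible_chi_def)
        then show ?thesis using \<mu> \<epsilon> by simp
      next
        case False
        have "perp 0 = 0" by (rule vec3_eqI) simp_all
        then have "\<bar>chi (y, 0)\<bar> \<le> \<bar>y\<bar>" using chi_le[of y 0] by simp
        then show ?thesis using False y' by simp
      qed
    qed
    obtain F1 F2 F3 F4 where "data_step T b0 M L E b chi dt \<epsilon> (real n * dt) (x dt \<epsilon> n) (v dt \<epsilon> n) (e dt \<epsilon> n) (s dt \<epsilon> n)
        (x dt \<epsilon> (Suc n)) (v dt \<epsilon> (Suc n)) (e dt \<epsilon> (Suc n)) F1 F2 F3 F4 C" using step[OF n(2)] by blast
    then interpret st: data_step T b0 M L E b chi dt \<epsilon> "real n * dt" "x dt \<epsilon> n" "v dt \<epsilon> n" "e dt \<epsilon> n" "s dt \<epsilon> n"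
        "x dt \<epsilon> (Suc n)" "v dt \<epsilon> (Suc n)" "e dt \<epsilon> (Suc n)" F1 F2 F3 F4 C .
    have W: "st.W \<le> W0"
      using C[OF dt \<epsilon>, of n] n cmod_cplx_le[of "v dt \<epsilon> n"] by (simp add: st.W_def W0_def)
    then have le: "5 / (b0 * dt) * (C5 * st.W) * \<epsilon> \<le> m"
      unfolding m_def \<kappa>_def using b0 dt \<epsilon> constants_nonneg by (intro mult_right_mono mult_left_mono) auto
    note sm = order_trans[OF st.stages_small(1) le] order_trans[OF st.stages_small(2) le]
      order_trans[OF st.stages_small(3) le] order_trans[OF st.stages_small(4) le]
    have m20: "y \<le> 20 * m" if "y \<le> m" for y using that m0 by simp
    have vn: "cmod (cplx (v dt \<epsilon> n)) \<le> 20 * m" using small[of "n - 1"] n by simp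
    note sm20 = vn sm[THEN m20]
    note f = st.plane.forces_from_stages[OF sm20]
    have cW: "c * st.W \<le> c * W0" if "0 \<le> c" for c using W that by (rule mult_left_mono)
    have f': "cmod st.f2 \<le> C5 * st.W" "cmod st.f3 \<le> C5 * st.W"
    proof -
      have "250 * (cmod (cplx (v dt \<epsilon> n)) + st.A) \<le> 300 * (cmod (cplx (v dt \<epsilon> n)) + st.A)"
        using st.plane.A_nonneg by simp
      note le = order_trans[OF this st.vA_le]
      show "cmod st.f2 \<le> C5 * st.W" "cmod st.f3 \<le> C5 * st.W"
        using order_trans[OF st.plane.force_bounds(2) le] order_trans[OF st.plane.force_bounds(3) le] .
    qed
    have vW: "cmod (cplx (v dt \<epsilon> n)) \<le> st.W" by (rule st.W_ge)
    have big: "norm (perp (v dt \<epsilon> n)) \<le> B" "norm (perp (hvel2 (s dt \<epsilon> n))) \<le> B" "norm (perp (hvel3 (s dt \<epsilon> n))) \<le> B"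
      using st.hat_velocities_le[OF f'] vW W cW[of C5] CB constants_nonneg by (simp_all add: norm_perp)
    have tiny: "norm (perp (v dt \<epsilon> n)) \<le> 101 * (20 * m)" "norm (perp (hvel2 (s dt \<epsilon> n))) \<le> 101 * (20 * m)"
      "norm (perp (hvel3 (s dt \<epsilon> n))) \<le> 101 * (20 * m)"
      using st.hat_velocities_le[OF f(2,3)] vn m0 by (simp_all add: norm_perp)
    have en: "\<bar>e dt \<epsilon> n\<bar> \<le> B" "\<bar>en2 (s dt \<epsilon> n)\<bar> \<le> B" "\<bar>en3 (s dt \<epsilon> n)\<bar> \<le> B"
      using st.W_ge(3) W CB st.en2_le st.en3_le cW[of C2] cW[of C4] constants_nonneg by linarith+
    have Mm: "0 \<le> dt * (M * m)" using dt M0 m0 by simp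
    have elow: "e dt \<epsilon> n - dt * (M * m) \<le> e dt \<epsilon> n" "e dt \<epsilon> n - dt * (M * m) \<le> en2 (s dt \<epsilon> n)"
      "e dt \<epsilon> n - dt * (M * m) \<le> en3 (s dt \<epsilon> n)"
      using st.energies_change(1,2)[OF sm(2-4)] Mm by linarith+
    define \<delta> where "\<delta> = \<Lambda> * (101 * (20 * m)) + 2 * \<mu> * \<epsilon>"
    have chi\<delta>: "\<bar>chi (y, perp w) - y\<bar> \<le> \<delta>"
      if "\<bar>y\<bar> \<le> B" "norm (perp w) \<le> B" "norm (perp w) \<le> 101 * (20 * m)" "e dt \<epsilon> n - dt * (M * m) \<le> y" for y w
      using \<Lambda>(2)[OF that(1,2)] chi0[OF that(4)] mult_left_mono[OF that(3) \<Lambda>(1)] unfolding \<delta>_def by linarith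
    have "L_step_upto ((1 + M) * (\<epsilon> / b0 * (100 * (20 * m) / dt) + \<epsilon> * \<delta> * L / b0\<^sup>2)) T E b \<epsilon> dt (real n * dt)
          (x dt \<epsilon> n, e dt \<epsilon> n, v dt \<epsilon> n $ 3) (L_part (s dt \<epsilon> n))
          (x dt \<epsilon> (Suc n), e dt \<epsilon> (Suc n), v dt \<epsilon> (Suc n) $ 3)"
      by (rule st.residual_bound[OF g sm20], assumption)
        (intro chi\<delta> en big tiny elow)+
    moreover have "(1 + M) * (\<epsilon> / b0 * (100 * (20 * m) / dt) + \<epsilon> * \<delta> * L / b0\<^sup>2) = K * \<epsilon>\<^sup>2"
      using b0 dt by (simp add: K_def \<delta>_def m_def field_simps power2_eq_square)
    ultimately show ?thesis by simp
  qed
  then show ?thesis by blast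
qed

section \<open>Error analysis of the Runge-Kutta method\<close>

lemma vector_increment_bound:
  fixes R :: "real \<Rightarrow> 'a::real_normed_vector"
  assumes h: "0 \<le> h" and d: "\<And>s. s \<in> {0..h} \<Longrightarrow> (R has_vector_derivative R' s) (at s within {0..h})"
    and B: "\<And>s. s \<in> {0..h} \<Longrightarrow> norm (R' s) \<le> B"
  shows "norm (R h - R 0) \<le> B * h"
proof -
  have "norm (R h - R 0) \<le> B * norm (h - 0)"
  proof (rule differentiable_bound[of "{0..h}"])
    show "(R has_derivative (\<lambda>r. r *\<^sub>R R' s)) (at s within {0..h})" if "s \<in> {0..h}" for s
      using d[OF that] by (simp add: has_vector_derivative_def)
    show "onorm (\<lambda>r. r *\<^sub>R R' s) \<le> B" if "s \<in> {0..h}" for s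
      using B[OF that] by (intro onorm_le) (simp add: mult.commute[of B] mult_left_mono)
  qed (use h in auto)
  then show ?thesis using h by simp
qed

lemma taylor_bound:
  fixes w :: "nat \<Rightarrow> real \<Rightarrow> 'a::real_normed_vector"
  assumes "\<And>i s. i < k \<Longrightarrow> s \<in> {0..T} \<Longrightarrow> (w i has_vector_derivative w (Suc i) s) (at s within {0..T})"
    and "\<And>s. s \<in> {0..T} \<Longrightarrow> norm (w k s) \<le> L" and "0 \<le> t" "0 \<le> h" "t + h \<le> T"
  shows "norm (w 0 (t + h) - (\<Sum>i<k. (h ^ i / fact i) *\<^sub>R w i t)) \<le> L * h ^ k"
  using assms
proof (induction k arbitrary: w h)
  case 0
  then show ?case by simp
next
  case (Suc k)
  have "norm (w (Suc k) t) \<le> L" using Suc.prems(2)[of t] Suc.prems(3-5) by auto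
  then have L: "0 \<le> L" using norm_ge_zero[of "w (Suc k) t"] by linarith
  define R where "R s = w 0 (t + s) - (\<Sum>i<Suc k. (s ^ i / fact i) *\<^sub>R w i t)" for s
  define R' where "R' s = w 1 (t + s) - (\<Sum>i<k. (s ^ i / fact i) *\<^sub>R w (Suc i) t)" for s
  have "norm (R h - R 0) \<le> (L * h ^ k) * h"
  proof (rule vector_increment_bound[OF Suc.prems(4)])
    fix s assume s: "s \<in> {0..h}"
    have w0: "((\<lambda>s. w 0 (t + s)) has_vector_derivative w 1 (t + s)) (at s within {0..h})"
    proof -
      have "((\<lambda>s. t + s) has_real_derivative 1) (at s within {0..h})" by (auto intro!: derivative_eq_intros)
      moreover have "(w 0 has_vector_derivative w 1 (t + s)) (at (t + s) within (\<lambda>s. t + s) ` {0..h})"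
        using Suc.prems(1)[of 0 "t + s"] Suc.prems(3-5) s
        by (auto intro: has_vector_derivative_within_subset)
      ultimately show ?thesis
        using vector_diff_chain_within[of "\<lambda>s. t + s" 1 s "{0..h}" "w 0" "w 1 (t + s)"]
        by (simp add: o_def has_real_derivative_iff_has_vector_derivative)
    qed
    have p: "((\<lambda>s. \<Sum>i<Suc k. (s ^ i / fact i) *\<^sub>R w i t) has_vector_derivative
        (\<Sum>i<k. (s ^ i / fact i) *\<^sub>R w (Suc i) t)) (at s within {0..h})"
    proof -
      have "((\<lambda>s. s ^ Suc i / fact (Suc i)) has_real_derivative s ^ i / fact i) (at s within {0..h})" for i
      proof -
        have "((\<lambda>s. s ^ Suc i / fact (Suc i)) has_real_derivative (real (Suc i) * s ^ i) / fact (Suc i)) (at s within {0..h})"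
          using DERIV_cdivide[OF DERIV_pow[of "Suc i" s], of "fact (Suc i)"] has_field_derivative_at_within
          by (simp del: power_Suc of_nat_Suc fact_Suc)
        then show ?thesis by (simp add: field_simps del: of_nat_Suc)
      qed
      then have "((\<lambda>s. (s ^ Suc i / fact (Suc i)) *\<^sub>R w (Suc i) t) has_vector_derivative (s ^ i / fact i) *\<^sub>R w (Suc i) t) (at s within {0..h})" for i
        using has_vector_derivative_scaleR[OF _ has_vector_derivative_const] by fastforce
      then have "((\<lambda>s. w 0 t + (\<Sum>i<k. (s ^ Suc i / fact (Suc i)) *\<^sub>R w (Suc i) t)) has_vector_derivative
          0 + (\<Sum>i<k. (s ^ i / fact i) *\<^sub>R w (Suc i) t)) (at s within {0..h})"
        by (intro has_vector_derivative_add has_vector_derivative_const has_vector_derivative_sum)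
      then show ?thesis by (simp only: sum.lessThan_Suc_shift power_0 fact_0 div_by_1 scaleR_one add_0_left)
    qed
    show "(R has_vector_derivative R' s) (at s within {0..h})"
      unfolding R_def R'_def by (rule has_vector_derivative_diff[OF w0 p])
    have "norm (R' s) \<le> L * s ^ k"
      unfolding R'_def
      using Suc.IH[of "\<lambda>i. w (Suc i)" s] Suc.prems s by auto
    also have "\<dots> \<le> L * h ^ k" using s L by (intro mult_left_mono power_mono) auto
    finally show "norm (R' s) \<le> L * h ^ k" .
  qed
  moreover have "R 0 = 0"
    unfolding R_def by (simp add: sum.lessThan_Suc_shift del: sum.lessThan_Suc)
  ultimately show ?case by (simp add: R_def mult_ac)
qed

text \<open>An exact solution \<open>y\<close> of \<open>y' = f (t, y)\<close>, with the bounds on \<open>f\<close> and on the derivatives of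
  \<open>y\<close> that the error analysis uses. The operator \<open>A t\<close> is the Jacobian of \<open>f\<close> along \<open>y\<close>, and \<open>P\<close>
  selects the components that are treated with the coefficients of the implicit tableau.\<close>

locale exact_solution =
  fixes f :: "real \<Rightarrow> 'a::real_normed_vector \<Rightarrow> 'a" and P :: "'a \<Rightarrow> 'a" and K :: "'a set"
    and A :: "real \<Rightarrow> 'a \<Rightarrow> 'a" and y u u1 u2 u3 :: "real \<Rightarrow> 'a" and T L :: real
  assumes P: "linear P" and P_le: "norm (P z) \<le> norm z"
    and L1: "1 \<le> L"
    and lip: "t \<in> {0..T} \<Longrightarrow> z \<in> K \<Longrightarrow> w \<in> K \<Longrightarrow> norm (f t z - f t w) \<le> L * norm (z - w)"
    and quad: "t \<in> {0..T} \<Longrightarrow> z \<in> K \<Longrightarrow> norm (f t z - f t (y t) - A t (z - y t)) \<le> L * (norm (z - y t))\<^sup>2"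
    and A: "t \<in> {0..T} \<Longrightarrow> linear (A t)" and A_le: "t \<in> {0..T} \<Longrightarrow> norm (A t z) \<le> L * norm z"
    and A_lip: "t \<in> {0..T} \<Longrightarrow> s \<in> {0..T} \<Longrightarrow> norm (A s z - A t z) \<le> L * \<bar>s - t\<bar> * norm z"
    and yK: "t \<in> {0..T} \<Longrightarrow> y t \<in> K" and u: "u t = f t (y t)"
    and dy: "t \<in> {0..T} \<Longrightarrow> (y has_vector_derivative u t) (at t within {0..T})"
    and du: "t \<in> {0..T} \<Longrightarrow> (u has_vector_derivative u1 t) (at t within {0..T})"
    and du1: "t \<in> {0..T} \<Longrightarrow> (u1 has_vector_derivative u2 t) (at t within {0..T})"
    and du2: "t \<in> {0..T} \<Longrightarrow> (u2 has_vector_derivative u3 t) (at t within {0..T})"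
    and u_le: "t \<in> {0..T} \<Longrightarrow> norm (u1 t) \<le> L" "t \<in> {0..T} \<Longrightarrow> norm (u2 t) \<le> L" "t \<in> {0..T} \<Longrightarrow> norm (u3 t) \<le> L"
    and K_le: "z \<in> K \<Longrightarrow> w \<in> K \<Longrightarrow> norm (z - w) \<le> L"
begin

definition der :: "nat \<Rightarrow> real \<Rightarrow> 'a" where "der i = [y, u, u1, u2, u3] ! i"

lemma der_simps: "der 0 = y" "der (Suc 0) = u" "der 1 = u" "der 2 = u1" "der 3 = u2" "der 4 = u3"
  by (simp_all add: der_def eval_nat_numeral)

lemma der_step:
  assumes "i < 4" "t \<in> {0..T}"
  shows "(der i has_vector_derivative der (Suc i) t) (at t within {0..T})"
proof -
  consider "i = 0" | "i = 1" | "i = 2" | "i = 3" using assms(1) by linarith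
  then show ?thesis
    using dy[OF assms(2)] du[OF assms(2)] du1[OF assms(2)] du2[OF assms(2)]
    by cases (simp_all add: der_def eval_nat_numeral)
qed

lemma taylor_der:
  assumes "j + k \<le> 4" "2 \<le> j + k" "0 \<le> t" "0 \<le> h" "t + h \<le> T"
  shows "norm (der j (t + h) - (\<Sum>i<k. (h ^ i / fact i) *\<^sub>R der (j + i) t)) \<le> L * h ^ k"
proof -
  have "norm (der (j + k) s) \<le> L" if "s \<in> {0..T}" for s
  proof -
    consider "j + k = 2" | "j + k = 3" | "j + k = 4" using assms(1,2) by linarith
    then show ?thesis using u_le[OF that] by cases (simp_all add: der_simps)
  qed
  then show ?thesis
    using taylor_bound[of k T "\<lambda>i. der (j + i)" L t h] der_step assms by simp
qed

lemma taylor: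
  assumes "0 \<le> t" "0 \<le> h" "t + h \<le> T"
  shows "norm (y (t + h) - (y t + h *\<^sub>R u t + (h\<^sup>2 / 2) *\<^sub>R u1 t)) \<le> L * h ^ 3"
    and "norm (y (t + h) - (y t + h *\<^sub>R u t + (h\<^sup>2 / 2) *\<^sub>R u1 t + (h ^ 3 / 6) *\<^sub>R u2 t)) \<le> L * h ^ 4"
    and "norm (u (t + h) - (u t + h *\<^sub>R u1 t)) \<le> L * h\<^sup>2"
    and "norm (u (t + h) - (u t + h *\<^sub>R u1 t + (h\<^sup>2 / 2) *\<^sub>R u2 t)) \<le> L * h ^ 3"
proof -
  have s: "(\<Sum>i<2. F i) = F 0 + F 1" "(\<Sum>i<3. F i) = F 0 + F 1 + F 2" "(\<Sum>i<4. F i) = F 0 + F 1 + F 2 + F 3" for F :: "nat \<Rightarrow> 'a"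
    by (simp_all add: eval_nat_numeral)
  have f: "fact 2 = (2::real)" "fact 3 = (6::real)" by (simp_all add: fact_numeral)
  show "norm (y (t + h) - (y t + h *\<^sub>R u t + (h\<^sup>2 / 2) *\<^sub>R u1 t)) \<le> L * h ^ 3"
    using taylor_der[of 0 3 t h] assms by (simp add: s f der_simps)
  show "norm (y (t + h) - (y t + h *\<^sub>R u t + (h\<^sup>2 / 2) *\<^sub>R u1 t + (h ^ 3 / 6) *\<^sub>R u2 t)) \<le> L * h ^ 4"
    using taylor_der[of 0 4 t h] assms by (simp add: s f der_simps)
  show "norm (u (t + h) - (u t + h *\<^sub>R u1 t)) \<le> L * h\<^sup>2"
    using taylor_der[of 1 2 t h] assms by (simp add: s f der_simps flip: numeral_2_eq_2)
  show "norm (u (t + h) - (u t + h *\<^sub>R u1 t + (h\<^sup>2 / 2) *\<^sub>R u2 t)) \<le> L * h ^ 3"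
    using taylor_der[of 1 3 t h] assms by (simp add: s f der_simps flip: numeral_2_eq_2)
qed

lemma P_simps: "P (a + b) = P a + P b" "P (a - b) = P a - P b" "P (c *\<^sub>R a) = c *\<^sub>R P a"
  using P by (simp_all add: linear_add linear_diff linear_scale)

lemma P_bound: "norm a \<le> c \<Longrightarrow> norm (P a) \<le> c"
  using P_le order_trans by blast

lemma scale_bound: "norm a \<le> c \<Longrightarrow> \<bar>r\<bar> \<le> q \<Longrightarrow> norm (r *\<^sub>R a) \<le> q * c" for a :: 'a
  unfolding norm_scaleR by (intro mult_mono) (auto intro: order_trans[OF abs_ge_zero])

text \<open>A stage \<open>Z\<close> is compared with the stage \<open>Y\<close> that uses the exact slopes. The latter has a defect
  \<open>h\<^sup>2 d\<close> up to third order, and linearization carries it to the slope as \<open>h\<^sup>2 A t d\<close>, with an error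
  that is again of third order.\<close>

lemma slope_error:
  assumes s: "s \<in> {0..T}" and t: "t \<in> {0..T}" and st: "\<bar>s - t\<bar> \<le> h" and h: "0 \<le> h" "h * L \<le> 1"
    and Z: "Z \<in> K" and E: "0 \<le> E" "E \<le> L"
    and d: "norm d \<le> L" and X: "norm (Z - Y) \<le> 4 * E + 4 * L\<^sup>2 * h ^ 3"
    and Y: "norm (Y - y s - h\<^sup>2 *\<^sub>R d) \<le> 2 * L * h ^ 3"
  shows "norm (f s Z - u s - h\<^sup>2 *\<^sub>R A t d) \<le> 160 * L ^ 3 * (E + h ^ 3)"
proof -
  have hL: "L\<^sup>2 * h ^ 3 \<le> L * h\<^sup>2" "L * h ^ 3 \<le> L * h\<^sup>2"
  proof -
    have "(h * L) * (L * h\<^sup>2) \<le> 1 * (L * h\<^sup>2)" by (rule mult_right_mono[OF h(2)]) (use L1 in simp)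
    then show "L\<^sup>2 * h ^ 3 \<le> L * h\<^sup>2" by (simp add: power2_eq_square power3_eq_cube mult_ac)
    have "h \<le> 1" using order_trans[OF mult_left_mono[OF L1] h(2)] h(1) by simp
    then have "h * (L * h\<^sup>2) \<le> 1 * (L * h\<^sup>2)" by (rule mult_right_mono) (use L1 in simp)
    then show "L * h ^ 3 \<le> L * h\<^sup>2" by (simp add: power2_eq_square power3_eq_cube mult_ac)
  qed
  define N where "N = norm (Z - y s)"
  have N: "N \<le> 4 * E + 7 * L * h\<^sup>2"
  proof -
    have "Z - y s = (Z - Y) + ((Y - y s - h\<^sup>2 *\<^sub>R d) + h\<^sup>2 *\<^sub>R d)" by simp
    then have "N \<le> (4 * E + 4 * L\<^sup>2 * h ^ 3) + (2 * L * h ^ 3 + h\<^sup>2 * L)"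
      unfolding N_def by (metis X Y d norm_add_le scale_bound abs_of_nonneg order_refl zero_le_power2)
    then show ?thesis using hL by (simp add: algebra_simps)
  qed
  define q where "q = f s Z - f s (y s) - A s (Z - y s)"
  have q: "norm q \<le> 32 * L\<^sup>2 * E + 98 * L\<^sup>2 * h ^ 3"
  proof -
    have "N\<^sup>2 \<le> (4 * E + 7 * L * h\<^sup>2)\<^sup>2" using N by (intro power_mono) (auto simp: N_def)
    also have "\<dots> \<le> 2 * (4 * E)\<^sup>2 + 2 * (7 * L * h\<^sup>2)\<^sup>2"
      using sum_squares_bound[of "4 * E" "7 * L * h\<^sup>2"] by (simp add: power2_sum)
    finally have "L * N\<^sup>2 \<le> L * (2 * (4 * E)\<^sup>2 + 2 * (7 * L * h\<^sup>2)\<^sup>2)" using L1 by (intro mult_left_mono) auto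
    also have "\<dots> = 32 * L * (E * E) + 98 * (L\<^sup>2 * h ^ 3) * (h * L)"
      by (simp add: power2_eq_square power3_eq_cube algebra_simps)
    also have "\<dots> \<le> 32 * L * (E * L) + 98 * (L\<^sup>2 * h ^ 3) * 1"
      using E h L1 by (intro add_mono mult_left_mono) auto
    finally have "L * N\<^sup>2 \<le> 32 * L\<^sup>2 * E + 98 * L\<^sup>2 * h ^ 3" by (simp add: power2_eq_square mult_ac)
    then show ?thesis using quad[OF s Z] by (simp add: q_def N_def)
  qed
  have lin: "A s (Z - y s) = A s (Z - Y) + A s (Y - y s - h\<^sup>2 *\<^sub>R d) + h\<^sup>2 *\<^sub>R A s d"
    using A[OF s] by (simp add: linear_add linear_diff linear_scale)
  have "f s Z - u s - h\<^sup>2 *\<^sub>R A t d = q + (A s (Z - Y) + (A s (Y - y s - h\<^sup>2 *\<^sub>R d) + h\<^sup>2 *\<^sub>R (A s d - A t d)))"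
    by (simp add: q_def u lin algebra_simps)
  moreover have "norm \<dots> \<le> (32 * L\<^sup>2 * E + 98 * L\<^sup>2 * h ^ 3) + (L * (4 * E + 4 * L\<^sup>2 * h ^ 3) + (L * (2 * L * h ^ 3) + h\<^sup>2 * (L * h * L)))"
  proof (intro norm_add_le q scale_bound)
    show "norm (A s (Z - Y)) \<le> L * (4 * E + 4 * L\<^sup>2 * h ^ 3)"
      using order_trans[OF A_le[OF s] mult_left_mono[OF X]] L1 by simp
    show "norm (A s (Y - y s - h\<^sup>2 *\<^sub>R d)) \<le> L * (2 * L * h ^ 3)"
      using order_trans[OF A_le[OF s] mult_left_mono[OF Y]] L1 by simp
    have "norm (A s d - A t d) \<le> L * \<bar>s - t\<bar> * norm d" by (rule A_lip[OF t s])
    also have "\<dots> \<le> L * h * L" using st d L1 h by (intro mult_mono) auto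
    finally show "norm (A s d - A t d) \<le> L * h * L" .
  qed simp
  moreover have "(32 * L\<^sup>2 * E + 98 * L\<^sup>2 * h ^ 3) + (L * (4 * E + 4 * L\<^sup>2 * h ^ 3) + (L * (2 * L * h ^ 3) + h\<^sup>2 * (L * h * L)))
      \<le> 160 * L ^ 3 * (E + h ^ 3)"
  proof -
    have "L\<^sup>2 \<le> L ^ 3" "L \<le> L ^ 3" using L1 by (auto intro: power_increasing self_le_power)
    then have "L\<^sup>2 * E \<le> L ^ 3 * E" "L * E \<le> L ^ 3 * E" "L\<^sup>2 * h ^ 3 \<le> L ^ 3 * h ^ 3"
      using E h by (auto intro: mult_right_mono)
    moreover have "0 \<le> L ^ 3 * E" "0 \<le> L ^ 3 * h ^ 3" using E h L1 by auto
    moreover have "(32 * L\<^sup>2 * E + 98 * L\<^sup>2 * h ^ 3) + (L * (4 * E + 4 * L\<^sup>2 * h ^ 3) + (L * (2 * L * h ^ 3) + h\<^sup>2 * (L * h * L)))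
      = 32 * (L\<^sup>2 * E) + 101 * (L\<^sup>2 * h ^ 3) + 4 * (L * E) + 4 * (L ^ 3 * h ^ 3)"
      by (simp add: power2_eq_square power3_eq_cube algebra_simps)
    ultimately show ?thesis by (simp add: algebra_simps)
  qed
  ultimately show ?thesis by (simp only: order_trans)
qed

lemma slope_crude:
  assumes "s \<in> {0..T}" "Z \<in> K" "norm (Z - Y) \<le> c" "norm (Y - y s) \<le> c'"
  shows "norm (f s Z - u s) \<le> L * (c + c')"
proof -
  have "norm (f s Z - u s) \<le> L * norm (Z - y s)" unfolding u by (rule lip[OF assms(1,2) yK[OF assms(1)]])
  also have "\<dots> \<le> L * (c + c')"
    using norm_add_le[OF assms(3,4)] L1 by (intro mult_left_mono) auto
  finally show ?thesis .
qed

text \<open>The quadrature in the last line is Simpson's rule, exact enough for third order. The stages,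
  however, have defects of second order: \<open>h\<^sup>2 d2\<close> with \<open>d2 = \<alpha> P y'' - y'' / 2\<close> at the second stage,
  whose unprojected part is an Euler step, and \<open>h\<^sup>2 d3\<close> with
  \<open>d3 = y'' / 8 + (\<gamma> - 1 / 4 + \<alpha> / 2) P y''\<close> at the third one. They enter the result with weights \<open>1\<close>
  and \<open>4\<close>, and \<open>d2 + 4 d3 = 0\<close>: on the range of \<open>P\<close> this is the third order condition on \<open>\<alpha>\<close> and \<open>\<gamma>\<close>.\<close>

theorem local_error:
  assumes h: "0 < h" "h * L \<le> 1" and t: "0 \<le> t" "t + h \<le> T"
    and K: "z \<in> K" "Z2 \<in> K" "Z3 \<in> K"
    and Z2: "Z2 = z + h *\<^sub>R (f t z + \<alpha> *\<^sub>R P (f (t + h) Z2 - f t z))"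
    and Z3: "Z3 = z + h *\<^sub>R ((1 / 4) *\<^sub>R (f t z + f (t + h) Z2)
      + P ((\<beta> + \<eta> - 1 / 4) *\<^sub>R f t z + (\<gamma> - 1 / 4) *\<^sub>R f (t + h) Z2 + \<alpha> *\<^sub>R f (t + h / 2) Z3))"
    and z': "z' = z + (h / 6) *\<^sub>R (f t z + f (t + h) Z2 + 4 *\<^sub>R f (t + h / 2) Z3)"
  shows "norm (z' - y (t + h)) \<le> norm (z - y t) + 160 * L ^ 3 * h * (norm (z - y t) + h ^ 3)"
proof -
  define E where "E = norm (z - y t)"
  have mem: "t \<in> {0..T}" "t + h \<in> {0..T}" "t + h / 2 \<in> {0..T}" using h t by auto
  have E: "0 \<le> E" "E \<le> L" using K_le[OF K(1) yK[OF mem(1)]] by (simp_all add: E_def)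
  have L0: "0 \<le> L" using L1 by simp
  have h1: "h \<le> 1" using order_trans[OF mult_left_mono[OF L1] h(2)] h(1) by simp
  have hE: "h * L * E \<le> E" using mult_right_mono[OF h(2) E(1)] by simp
  have co: "\<bar>\<alpha>\<bar> \<le> 1 / 4" "\<bar>\<beta> + \<eta> - 1 / 4\<bar> \<le> 1 / 4" "\<bar>\<gamma> - 1 / 4\<bar> \<le> 1 / 4" "\<bar>\<gamma> - 1 / 4 + \<alpha> / 2\<bar> \<le> 1 / 4"
    using coefficient_bounds \<alpha>_bounds by auto
  have ul: "norm (u1 t) \<le> L" by (rule u_le(1)[OF mem(1)])
  define F1 F2 F3 where "F1 = f t z - u t" and "F2 = f (t + h) Z2 - u (t + h)" and "F3 = f (t + h / 2) Z3 - u (t + h / 2)"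
  have f: "f t z = u t + F1" "f (t + h) Z2 = u (t + h) + F2" "f (t + h / 2) Z3 = u (t + h / 2) + F3"
    by (simp_all add: F1_def F2_def F3_def)
  have F1: "norm F1 \<le> L * E" unfolding F1_def u E_def by (rule lip[OF mem(1) K(1) yK[OF mem(1)]])
  define ry r1 r2 ry' where "ry = y (t + h) - (y t + h *\<^sub>R u t + (h\<^sup>2 / 2) *\<^sub>R u1 t)"
    and "r1 = u (t + h) - (u t + h *\<^sub>R u1 t)"
    and "r2 = u (t + h / 2) - (u t + (h / 2) *\<^sub>R u1 t)"
    and "ry' = y (t + h / 2) - (y t + (h / 2) *\<^sub>R u t + ((h / 2)\<^sup>2 / 2) *\<^sub>R u1 t)"
  have r: "norm ry \<le> L * h ^ 3" "norm r1 \<le> L * h\<^sup>2" "norm r2 \<le> L * h\<^sup>2" "norm ry' \<le> L * h ^ 3"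
  proof -
    show "norm ry \<le> L * h ^ 3" "norm r1 \<le> L * h\<^sup>2"
      unfolding ry_def r1_def using taylor(1,3)[of t h] h t by auto
    have "L * (h / 2)\<^sup>2 \<le> L * h\<^sup>2" "L * (h / 2) ^ 3 \<le> L * h ^ 3"
      using h L0 by (auto intro!: mult_left_mono power_mono)
    then show "norm r2 \<le> L * h\<^sup>2" "norm ry' \<le> L * h ^ 3"
      unfolding ry'_def r2_def using taylor(1,3)[of t "h / 2"] h t by auto
  qed
  have uu: "u (t + h) = u t + h *\<^sub>R u1 t + r1" "u (t + h / 2) = u t + (h / 2) *\<^sub>R u1 t + r2"
    by (simp_all add: r1_def r2_def)
  have yy: "y (t + h) = y t + h *\<^sub>R u t + (h\<^sup>2 / 2) *\<^sub>R u1 t + ry"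
    "y (t + h / 2) = y t + (h / 2) *\<^sub>R u t + (h\<^sup>2 / 8) *\<^sub>R u1 t + ry'"
    by (simp_all add: ry_def ry'_def power_divide)
  have h3: "h * (L * h\<^sup>2) = L * h ^ 3" by (simp add: power2_eq_square power3_eq_cube)
  define Y2 where "Y2 = y t + h *\<^sub>R (u t + \<alpha> *\<^sub>R P (u (t + h) - u t))"
  define d2 where "d2 = \<alpha> *\<^sub>R P (u1 t) - (1 / 2) *\<^sub>R u1 t"
  have d2: "norm d2 \<le> 3 / 4 * L"
  proof -
    have "norm d2 \<le> 1 / 4 * L + 1 / 2 * L"
      unfolding d2_def by (intro norm_diff_le scale_bound P_bound ul co) simp
    then show ?thesis by simp
  qed
  have Y2: "norm (Y2 - y (t + h) - h\<^sup>2 *\<^sub>R d2) \<le> 2 * L * h ^ 3"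
  proof -
    have eq: "Y2 - y (t + h) - h\<^sup>2 *\<^sub>R d2 = h *\<^sub>R (\<alpha> *\<^sub>R P r1) - ry"
      unfolding Y2_def d2_def yy(1) uu(1) by (simp add: P_simps algebra_simps power2_eq_square)
    have "norm (h *\<^sub>R (\<alpha> *\<^sub>R P r1) - ry) \<le> h * (1 / 4 * (L * h\<^sup>2)) + L * h ^ 3"
      by (intro norm_diff_le scale_bound P_bound r co) (use h in simp)
    moreover have "h * (1 / 4 * (L * h\<^sup>2)) = 1 / 4 * (L * h ^ 3)" using h3 by simp
    moreover have "0 \<le> L * h ^ 3" using h L0 by simp
    ultimately show ?thesis unfolding eq by linarith
  qed
  have Lh: "L * h ^ 3 \<le> L * h\<^sup>2" using h h1 L0 by (intro mult_left_mono power_decreasing) auto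
  have Lh0: "0 \<le> L * h\<^sup>2" "0 \<le> L\<^sup>2 * h ^ 3" using h L0 by auto
  have near: "norm (Y - y s) \<le> 3 * (L * h\<^sup>2)" if "norm (Y - y s - h\<^sup>2 *\<^sub>R d) \<le> 2 * L * h ^ 3" "norm d \<le> 3 / 4 * L" for Y s d
  proof -
    have "norm ((Y - y s - h\<^sup>2 *\<^sub>R d) + h\<^sup>2 *\<^sub>R d) \<le> 2 * L * h ^ 3 + h\<^sup>2 * (3 / 4 * L)"
      by (intro norm_add_le that scale_bound) simp
    then show ?thesis using Lh Lh0 by (simp add: algebra_simps)
  qed
  define X2 where "X2 = norm (Z2 - Y2)"
  have F2c: "norm F2 \<le> L * (X2 + 3 * (L * h\<^sup>2))"
    unfolding F2_def by (rule slope_crude[OF mem(2) K(2) _ near[OF Y2 d2]]) (simp add: X2_def)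
  have hLX: "h * (L * (X + 3 * (L * h\<^sup>2))) \<le> X + 3 * (L\<^sup>2 * h ^ 3)" if "0 \<le> X" for X
  proof -
    have "h * L * X \<le> X" using mult_right_mono[OF h(2) that] by simp
    then show ?thesis by (simp add: algebra_simps power2_eq_square power3_eq_cube)
  qed
  have X2: "X2 \<le> 3 * E + L\<^sup>2 * h ^ 3"
  proof -
    have "Z2 - Y2 = (z - y t) + h *\<^sub>R (F1 + \<alpha> *\<^sub>R P (F2 - F1))"
      by (subst Z2, simp only: Y2_def f) (simp add: P_simps algebra_simps)
    moreover have "norm \<dots> \<le> E + h * (L * E + 1 / 4 * (L * (X2 + 3 * (L * h\<^sup>2)) + L * E))"
      by (intro norm_add_le scale_bound P_bound norm_diff_le F1 F2c co) (use h in \<open>auto simp: E_def\<close>)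
    ultimately have "X2 \<le> E + h * (L * E + 1 / 4 * (L * (X2 + 3 * (L * h\<^sup>2)) + L * E))" by (simp add: X2_def)
    also have "\<dots> = E + 5 / 4 * (h * L * E) + 1 / 4 * (h * (L * (X2 + 3 * (L * h\<^sup>2))))"
      by (simp add: algebra_simps)
    also have "\<dots> \<le> E + 5 / 4 * E + 1 / 4 * (X2 + 3 * (L\<^sup>2 * h ^ 3))"
      by (intro add_mono mult_left_mono hE hLX order_refl) (simp_all add: X2_def)
    finally show ?thesis by argo
  qed
  have hF2: "h * norm F2 \<le> 3 * E + 4 * (L\<^sup>2 * h ^ 3)"
  proof -
    have "h * norm F2 \<le> h * (L * (X2 + 3 * (L * h\<^sup>2)))" using F2c h by (intro mult_left_mono) auto
    also have "\<dots> \<le> X2 + 3 * (L\<^sup>2 * h ^ 3)" by (rule hLX) (simp add: X2_def)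
    finally show ?thesis using X2 by argo
  qed
  define Y3 where "Y3 = y t + h *\<^sub>R ((1 / 4) *\<^sub>R (u t + u (t + h))
      + P ((\<beta> + \<eta> - 1 / 4) *\<^sub>R u t + (\<gamma> - 1 / 4) *\<^sub>R u (t + h) + \<alpha> *\<^sub>R u (t + h / 2)))"
  define d3 where "d3 = (1 / 8) *\<^sub>R u1 t + (\<gamma> - 1 / 4 + \<alpha> / 2) *\<^sub>R P (u1 t)"
  have d3: "norm d3 \<le> 3 / 4 * L"
  proof -
    have "norm d3 \<le> 1 / 8 * L + 1 / 4 * L"
      unfolding d3_def by (intro norm_add_le scale_bound P_bound ul co) simp
    then show ?thesis using L0 by simp
  qed
  have csum: "\<beta> + \<eta> - 1 / 4 = - (\<gamma> - 1 / 4) - \<alpha>" by (simp add: \<gamma>_def)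
  have Y3: "norm (Y3 - y (t + h / 2) - h\<^sup>2 *\<^sub>R d3) \<le> 2 * L * h ^ 3"
  proof -
    have eq: "Y3 - y (t + h / 2) - h\<^sup>2 *\<^sub>R d3 = h *\<^sub>R ((1 / 4) *\<^sub>R r1 + P ((\<gamma> - 1 / 4) *\<^sub>R r1 + \<alpha> *\<^sub>R r2)) - ry'"
    proof -
      define g where "g = \<gamma> - 1 / 4"
      have p: "P ((- g - \<alpha>) *\<^sub>R u t + g *\<^sub>R (u t + h *\<^sub>R u1 t + r1) + \<alpha> *\<^sub>R (u t + (h / 2) *\<^sub>R u1 t + r2))
          = (h * (g + \<alpha> / 2)) *\<^sub>R P (u1 t) + P (g *\<^sub>R r1 + \<alpha> *\<^sub>R r2)"
        by (simp add: P_simps algebra_simps)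
      show ?thesis
        unfolding Y3_def d3_def yy(2) uu csum g_def[symmetric] p
        by (simp add: algebra_simps power2_eq_square) (simp flip: scaleR_left_distrib)
    qed
    have "norm (h *\<^sub>R ((1 / 4) *\<^sub>R r1 + P ((\<gamma> - 1 / 4) *\<^sub>R r1 + \<alpha> *\<^sub>R r2)) - ry') \<le> h * (1 / 4 * (L * h\<^sup>2) + (1 / 4 * (L * h\<^sup>2) + 1 / 4 * (L * h\<^sup>2))) + L * h ^ 3"
      by (intro norm_diff_le norm_add_le scale_bound P_bound r co) (use h in auto)
    moreover have "h * (1 / 4 * (L * h\<^sup>2) + (1 / 4 * (L * h\<^sup>2) + 1 / 4 * (L * h\<^sup>2))) = 3 / 4 * (L * h ^ 3)"
      using h3 by (simp add: algebra_simps)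
    moreover have "0 \<le> L * h ^ 3" using h L0 by simp
    ultimately show ?thesis unfolding eq by linarith
  qed
  define X3 where "X3 = norm (Z3 - Y3)"
  have F3c: "norm F3 \<le> L * (X3 + 3 * (L * h\<^sup>2))"
    unfolding F3_def by (rule slope_crude[OF mem(3) K(3) _ near[OF Y3 d3]]) (simp add: X3_def)
  have X3: "X3 \<le> 4 * E + 4 * (L\<^sup>2 * h ^ 3)"
  proof -
    have "Z3 - Y3 = (z - y t) + h *\<^sub>R ((1 / 4) *\<^sub>R (F1 + F2) + P ((\<beta> + \<eta> - 1 / 4) *\<^sub>R F1 + (\<gamma> - 1 / 4) *\<^sub>R F2 + \<alpha> *\<^sub>R F3))"
      by (subst Z3) (simp only: Y3_def f, simp add: P_simps algebra_simps)
    moreover have "norm \<dots> \<le> E + h * (1 / 4 * (L * E + norm F2) + (1 / 4 * (L * E) + 1 / 4 * norm F2 + 1 / 4 * (L * (X3 + 3 * (L * h\<^sup>2)))))"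
      by (intro norm_add_le scale_bound P_bound F1 F3c co) (use h in \<open>auto simp: E_def\<close>)
    ultimately have "X3 \<le> E + h * (1 / 4 * (L * E + norm F2) + (1 / 4 * (L * E) + 1 / 4 * norm F2 + 1 / 4 * (L * (X3 + 3 * (L * h\<^sup>2)))))"
      by (simp add: X3_def)
    also have "\<dots> = E + 1 / 2 * (h * L * E) + 1 / 2 * (h * norm F2) + 1 / 4 * (h * (L * (X3 + 3 * (L * h\<^sup>2))))"
      by (simp add: field_simps)
    also have "\<dots> \<le> E + 1 / 2 * E + 1 / 2 * (3 * E + 4 * (L\<^sup>2 * h ^ 3)) + 1 / 4 * (X3 + 3 * (L\<^sup>2 * h ^ 3))"
      by (intro add_mono mult_left_mono hE hF2 hLX order_refl) (simp_all add: X3_def)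
    finally show ?thesis using Lh0 by argo
  qed
  define G where "G = 160 * L ^ 3 * (E + h ^ 3)"
  have e2: "norm (F2 - h\<^sup>2 *\<^sub>R A t d2) \<le> G"
    unfolding F2_def G_def
  proof (rule slope_error[OF mem(2,1) _ _ h(2) K(2) E])
    show "norm (Z2 - Y2) \<le> 4 * E + 4 * L\<^sup>2 * h ^ 3" using X2 E Lh0(2) by (simp only: X2_def mult.assoc)
  qed (use h d2 L0 Y2 in auto)
  have e3: "norm (F3 - h\<^sup>2 *\<^sub>R A t d3) \<le> G"
    unfolding F3_def G_def
  proof (rule slope_error[OF mem(3,1) _ _ h(2) K(3) E])
    show "norm (Z3 - Y3) \<le> 4 * E + 4 * L\<^sup>2 * h ^ 3" using X3 by (simp only: X3_def mult.assoc)
  qed (use h d3 L0 Y3 in auto)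
  have cancel: "A t d2 + 4 *\<^sub>R A t d3 = 0"
  proof -
    have "d2 + 4 *\<^sub>R d3 = (\<alpha> + 4 * (\<gamma> - 1 / 4 + \<alpha> / 2)) *\<^sub>R P (u1 t)"
      by (simp add: d2_def d3_def algebra_simps) (simp flip: scaleR_left_distrib)
    also have "\<alpha> + 4 * (\<gamma> - 1 / 4 + \<alpha> / 2) = 0" by (simp add: \<gamma>_eq field_simps)
    finally have "d2 + 4 *\<^sub>R d3 = 0" by simp
    then show ?thesis using A[OF mem(1)] by (metis linear_0 linear_add linear_scale)
  qed
  define \<rho> where "\<rho> = y t + (h / 6) *\<^sub>R (u t + u (t + h) + 4 *\<^sub>R u (t + h / 2)) - y (t + h)"
  have \<rho>: "norm \<rho> \<le> 2 * (L * h ^ 4)"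
  proof -
    define s0 s1 s2 where "s0 = y (t + h) - (y t + h *\<^sub>R u t + (h\<^sup>2 / 2) *\<^sub>R u1 t + (h ^ 3 / 6) *\<^sub>R u2 t)"
      and "s1 = u (t + h) - (u t + h *\<^sub>R u1 t + (h\<^sup>2 / 2) *\<^sub>R u2 t)"
      and "s2 = u (t + h / 2) - (u t + (h / 2) *\<^sub>R u1 t + ((h / 2)\<^sup>2 / 2) *\<^sub>R u2 t)"
    have "norm s0 \<le> L * h ^ 4" "norm s1 \<le> L * h ^ 3"
      unfolding s0_def s1_def using taylor(2,4)[of t h] h t by auto
    moreover have "norm s2 \<le> L * h ^ 3"
    proof -
      have "L * (h / 2) ^ 3 \<le> L * h ^ 3" using h L0 by (intro mult_left_mono power_mono) auto
      then show ?thesis unfolding s2_def using taylor(4)[of t "h / 2"] h t by auto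
    qed
    moreover have "\<rho> = (h / 6) *\<^sub>R (s1 + 4 *\<^sub>R s2) - s0"
    proof -
      have split: "h *\<^sub>R a = (h / 6) *\<^sub>R a + ((h / 6) *\<^sub>R a + (h * 2 / 3) *\<^sub>R a)"
        "(h * h / 2) *\<^sub>R a = (h * h / 3) *\<^sub>R a + (h * h / 6) *\<^sub>R a" for a :: 'a
        by (simp_all flip: scaleR_left_distrib)
      have "y (t + h) = y t + h *\<^sub>R u t + (h\<^sup>2 / 2) *\<^sub>R u1 t + (h ^ 3 / 6) *\<^sub>R u2 t + s0"
        "u (t + h) = u t + h *\<^sub>R u1 t + (h\<^sup>2 / 2) *\<^sub>R u2 t + s1"
        "u (t + h / 2) = u t + (h / 2) *\<^sub>R u1 t + (h\<^sup>2 / 8) *\<^sub>R u2 t + s2"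
        by (simp_all add: s0_def s1_def s2_def power_divide)
      then show ?thesis
        unfolding \<rho>_def by (simp add: algebra_simps power2_eq_square power3_eq_cube)
          (simp only: split, simp add: add_ac, simp flip: scaleR_left_distrib)
    qed
    ultimately have s: "norm s0 \<le> L * h ^ 4" "norm s1 \<le> L * h ^ 3" "norm s2 \<le> L * h ^ 3"
      and eq: "\<rho> = (h / 6) *\<^sub>R (s1 + 4 *\<^sub>R s2) - s0" by auto
    have "norm \<rho> \<le> h / 6 * (L * h ^ 3 + 4 * (L * h ^ 3)) + L * h ^ 4"
      unfolding eq by (intro norm_diff_le scale_bound norm_add_le s) (use h in auto)
    also have "\<dots> = 11 / 6 * (L * h ^ 4)" by (simp add: eval_nat_numeral algebra_simps)
    also have "\<dots> \<le> 2 * (L * h ^ 4)" using h L0 by (intro mult_right_mono) auto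
    finally show ?thesis .
  qed
  have "z' - y (t + h) = (z - y t) + (h / 6) *\<^sub>R (F1 + ((F2 - h\<^sup>2 *\<^sub>R A t d2) + 4 *\<^sub>R (F3 - h\<^sup>2 *\<^sub>R A t d3))) + \<rho>"
  proof -
    have "h\<^sup>2 *\<^sub>R A t d2 + 4 *\<^sub>R (h\<^sup>2 *\<^sub>R A t d3) = h\<^sup>2 *\<^sub>R (A t d2 + 4 *\<^sub>R A t d3)"
      by (simp add: algebra_simps)
    then have c: "h\<^sup>2 *\<^sub>R A t d2 + 4 *\<^sub>R (h\<^sup>2 *\<^sub>R A t d3) = 0" by (simp add: cancel)
    have "F1 + ((F2 - h\<^sup>2 *\<^sub>R A t d2) + 4 *\<^sub>R (F3 - h\<^sup>2 *\<^sub>R A t d3)) = F1 + F2 + 4 *\<^sub>R F3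
        - (h\<^sup>2 *\<^sub>R A t d2 + 4 *\<^sub>R (h\<^sup>2 *\<^sub>R A t d3))"
      by (simp only: scaleR_right_diff_distrib) (simp add: algebra_simps del: scaleR_scaleR)
    then show ?thesis unfolding c z' \<rho>_def f by (simp add: algebra_simps)
  qed
  moreover have "norm \<dots> \<le> E + h / 6 * (L * E + (G + 4 * G)) + 2 * (L * h ^ 4)"
    by (intro norm_add_le scale_bound F1 e2 e3 \<rho>) (use h in \<open>auto simp: E_def\<close>)
  moreover have "h / 6 * (L * E + (G + 4 * G)) + 2 * (L * h ^ 4) \<le> h * G"
  proof -
    have le: "L * E \<le> L ^ 3 * E" "L * h ^ 3 \<le> L ^ 3 * h ^ 3"
      using E h L1 by (auto intro!: mult_right_mono self_le_power)
    have "L * E + 12 * (L * h ^ 3) \<le> G"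
    proof -
      have "0 \<le> L ^ 3 * E" "0 \<le> L ^ 3 * h ^ 3" using E h L1 by auto
      moreover have "G = 160 * (L ^ 3 * E) + 160 * (L ^ 3 * h ^ 3)" by (simp add: G_def algebra_simps)
      ultimately show ?thesis using le by argo
    qed
    then have "h / 6 * (L * E + 12 * (L * h ^ 3)) \<le> h / 6 * G" using h by (intro mult_left_mono) auto
    then show ?thesis by (simp add: algebra_simps eval_nat_numeral)
  qed
  ultimately show ?thesis by (simp add: G_def E_def mult_ac)
qed

end

text \<open>For \<open>h L \<le> 1\<close> the local errors accumulate by a discrete Gronwall argument. Larger steps
  are covered by the diameter of \<open>K\<close>, because \<open>h\<^sup>3\<close> is then bounded below.\<close>

theorem (in exact_solution) global_error:
  assumes h: "0 < h" and time: "\<And>n. n \<le> N \<Longrightarrow> real n * h \<le> T"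
    and z0: "z 0 = y 0" and zK: "\<And>n. n \<le> N \<Longrightarrow> z n \<in> K"
    and step: "\<And>n. n < N \<Longrightarrow> \<exists>Z2\<in>K. \<exists>Z3\<in>K. let t = real n * h in
      Z2 = z n + h *\<^sub>R (f t (z n) + \<alpha> *\<^sub>R P (f (t + h) Z2 - f t (z n))) \<and>
      Z3 = z n + h *\<^sub>R ((1 / 4) *\<^sub>R (f t (z n) + f (t + h) Z2)
        + P ((\<beta> + \<eta> - 1 / 4) *\<^sub>R f t (z n) + (\<gamma> - 1 / 4) *\<^sub>R f (t + h) Z2 + \<alpha> *\<^sub>R f (t + h / 2) Z3)) \<and>
      z (Suc n) = z n + (h / 6) *\<^sub>R (f t (z n) + f (t + h) Z2 + 4 *\<^sub>R f (t + h / 2) Z3)"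
    and n: "n \<le> N"
  shows "norm (z n - y (real n * h)) \<le> (exp (160 * L ^ 3 * T) + L ^ 4) * h ^ 3"
proof (cases "h * L \<le> 1")
  case True
  have "norm (z k - y (real k * h)) + h ^ 3 \<le> (1 + 160 * L ^ 3 * h) ^ k * h ^ 3" if "k \<le> N" for k
    using that
  proof (induction k)
    case 0
    then show ?case by (simp add: z0)
  next
    case (Suc k)
    define t where "t = real k * h"
    have th: "real (Suc k) * h = t + h" by (simp add: t_def algebra_simps)
    obtain Z2 Z3 where Z: "Z2 \<in> K" "Z3 \<in> K"
      "Z2 = z k + h *\<^sub>R (f t (z k) + \<alpha> *\<^sub>R P (f (t + h) Z2 - f t (z k)))"
      "Z3 = z k + h *\<^sub>R ((1 / 4) *\<^sub>R (f t (z k) + f (t + h) Z2)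
        + P ((\<beta> + \<eta> - 1 / 4) *\<^sub>R f t (z k) + (\<gamma> - 1 / 4) *\<^sub>R f (t + h) Z2 + \<alpha> *\<^sub>R f (t + h / 2) Z3))"
      "z (Suc k) = z k + (h / 6) *\<^sub>R (f t (z k) + f (t + h) Z2 + 4 *\<^sub>R f (t + h / 2) Z3)"
      using step[of k] Suc.prems by (auto simp: Let_def t_def)
    have "norm (z (Suc k) - y (t + h)) \<le> norm (z k - y t) + 160 * L ^ 3 * h * (norm (z k - y t) + h ^ 3)"
      by (rule local_error[OF h True _ _ zK Z(1,2,3,4,5)])
        (use h time[OF Suc.prems] th Suc.prems in \<open>auto simp: t_def\<close>)
    then have "norm (z (Suc k) - y (t + h)) + h ^ 3 \<le> (1 + 160 * L ^ 3 * h) * (norm (z k - y t) + h ^ 3)"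
      by (simp add: algebra_simps)
    also have "\<dots> \<le> (1 + 160 * L ^ 3 * h) * ((1 + 160 * L ^ 3 * h) ^ k * h ^ 3)"
      using Suc h L1 by (intro mult_left_mono) (auto simp: t_def)
    finally show ?case unfolding th by (simp add: mult.assoc)
  qed
  then have "norm (z n - y (real n * h)) \<le> (1 + 160 * L ^ 3 * h) ^ n * h ^ 3"
    using n h by (smt (verit) zero_less_power)
  also have "(1 + 160 * L ^ 3 * h) ^ n \<le> exp (160 * L ^ 3 * T)"
  proof -
    have p: "0 \<le> 160 * L ^ 3" using L1 by simp
    have "(1 + 160 * L ^ 3 * h) ^ n \<le> exp (160 * L ^ 3 * h) ^ n"
      using h L1 by (intro power_mono exp_ge_add_one_self) (simp add: add_nonneg_nonneg)
    also have "\<dots> = exp (160 * L ^ 3 * (real n * h))"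
      by (simp add: mult_ac flip: exp_of_nat_mult)
    also have "\<dots> \<le> exp (160 * L ^ 3 * T)"
      using mult_left_mono[OF time[OF n] p] by simp
    finally show ?thesis .
  qed
  also have "exp (160 * L ^ 3 * T) \<le> exp (160 * L ^ 3 * T) + L ^ 4" using L1 by simp
  finally show ?thesis using h by simp
next
  case False
  have "norm (z n - y (real n * h)) \<le> L"
    by (rule K_le[OF zK[OF n] yK]) (use time[OF n] h in auto)
  also have "\<dots> \<le> L * (h * L) ^ 3" using False L1 by simp
  also have "\<dots> = L ^ 4 * h ^ 3" by (simp add: power_mult_distrib eval_nat_numeral)
  also have "\<dots> \<le> (exp (160 * L ^ 3 * T) + L ^ 4) * h ^ 3" using h by (intro mult_right_mono) auto
  finally show ?thesis .
qed

section \<open>Uniform constants for smooth fields\<close>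

text \<open>The derivative of \<open>G\<close> along the trajectories of \<open>F\<close> is again a function of the point, one
  order less regular. Iterated, it yields the derivatives of a solution without differentiating the
  solution itself.\<close>

lemma C_k_on_Lie_derivative:
  fixes F :: "real \<times> 'a::euclidean_space \<Rightarrow> 'a" and G :: "real \<times> 'a \<Rightarrow> 'b::real_normed_vector"
  assumes G: "C_k_on (Suc k) ({0..T} \<times> UNIV) G" and F: "C_k_on k ({0..T} \<times> UNIV) F"
  obtains G' where "C_k_on k ({0..T} \<times> UNIV) G'"
    "\<And>y t. t \<in> {0..T} \<Longrightarrow> (y has_vector_derivative F (t, y t)) (at t within {0..T}) \<Longrightarrow>
      ((\<lambda>t. G (t, y t)) has_vector_derivative G' (t, y t)) (at t within {0..T})"
proof -
  define S :: "(real \<times> 'a) set" where "S = {0..T} \<times> UNIV"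
  obtain D where D: "\<And>p. p \<in> S \<Longrightarrow> (G has_derivative D p) (at p within S)"
    and DC: "\<And>v. C_k_on k S (\<lambda>p. D p v)"
    using G by (auto simp: S_def)
  define G' where "G' p = D p (1, 0) + (\<Sum>i\<in>Basis. (F p \<bullet> i) *\<^sub>R D p (0, i))" for p
  have eq: "G' p = D p (1, F p)" if "p \<in> S" for p
  proof -
    have l: "linear (D p)" using D[OF that] by (simp add: has_derivative_linear)
    have "(1, F p) = (1, 0) + (\<Sum>i\<in>Basis. (F p \<bullet> i) *\<^sub>R (0::real, i))"
      by (simp add: scaleR_Pair sum_prod euclidean_representation)
    then show ?thesis
      unfolding G'_def by (simp only: linear_add[OF l] linear_sum[OF l] linear_scale[OF l])
  qed
  show ?thesis
  proof
    have F': "C_k_on k S F" using F by (simp add: S_def)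
    have "C_k_on k S G'"
      unfolding G'_def[abs_def]
      by (intro C_k_on_add DC C_k_on_sum C_k_on_scaleR C_k_on_bounded_linear[OF bounded_linear_inner_left F'])
    then show "C_k_on k ({0..T} \<times> UNIV) G'" by (simp add: S_def)
    fix y t assume t: "t \<in> {0..T}" and dy: "(y has_vector_derivative F (t, y t)) (at t within {0..T})"
    have p: "(t, y t) \<in> S" using t by (simp add: S_def)
    have "((\<lambda>t. (t, y t)) has_derivative (\<lambda>r. (r, r *\<^sub>R F (t, y t)))) (at t within {0..T})"
      using dy by (auto intro!: has_derivative_Pair simp: has_vector_derivative_def)
    moreover have "(\<lambda>t. (t, y t)) ` {0..T} \<subseteq> S" by (auto simp: S_def)
    ultimately have "((\<lambda>t. G (t, y t)) has_derivative (\<lambda>r. D (t, y t) (r, r *\<^sub>R F (t, y t)))) (at t within {0..T})"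
      using has_derivative_in_compose2[of S G D "\<lambda>t. (t, y t)" "{0..T}" t "\<lambda>r. (r, r *\<^sub>R F (t, y t))"] D t
      by blast
    moreover have "D (t, y t) (r, r *\<^sub>R F (t, y t)) = r *\<^sub>R G' (t, y t)" for r
      using linear_scale[OF has_derivative_linear[OF D[OF p]], of r "(1, F (t, y t))"] eq[OF p]
      by (simp add: scaleR_Pair)
    ultimately show "((\<lambda>t. G (t, y t)) has_vector_derivative G' (t, y t)) (at t within {0..T})"
      by (simp add: has_vector_derivative_def)
  qed
qed

lemma C_k_on_bounded:
  fixes G :: "'a::euclidean_space \<Rightarrow> 'b::real_normed_vector"
  assumes "C_k_on k S G" "compact K" "K \<subseteq> S"
  obtains B where "0 \<le> B" "\<And>p. p \<in> K \<Longrightarrow> norm (G p) \<le> B"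
proof -
  have "compact (G ` K)"
    using continuous_on_subset[OF C_k_on_continuous[OF assms(1)] assms(3)] assms(2) by (rule compact_continuous_image)
  then have "bounded (G ` K)" by (rule compact_imp_bounded)
  then obtain B where "\<And>p. p \<in> K \<Longrightarrow> norm (G p) \<le> B"
    unfolding bounded_iff by blast
  then have "\<And>p. p \<in> K \<Longrightarrow> norm (G p) \<le> max 0 B" by (meson max.cobounded2 order_trans)
  then show ?thesis using that[of "max 0 B"] by simp
qed

lemma norm_linear_le_Basis:
  fixes A :: "'a::euclidean_space \<Rightarrow> 'b::real_normed_vector"
  assumes A: "linear A" and B: "\<And>i. i \<in> Basis \<Longrightarrow> norm (A i) \<le> B i"
  shows "norm (A v) \<le> (\<Sum>i\<in>Basis. B i) * norm v"
proof -
  have "A v = A (\<Sum>i\<in>Basis. (v \<bullet> i) *\<^sub>R i)" by (simp add: euclidean_representation)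
  also have "\<dots> = (\<Sum>i\<in>Basis. (v \<bullet> i) *\<^sub>R A i)"
    by (simp add: linear_sum[OF A] linear_scale[OF A])
  also have "norm \<dots> \<le> (\<Sum>i\<in>Basis. norm v * B i)"
    by (intro sum_norm_le) (auto intro!: mult_mono B Basis_le_norm)
  finally show ?thesis by (simp add: sum_distrib_left mult.commute)
qed

lemma C_1_Lipschitz:
  fixes G :: "'a::euclidean_space \<Rightarrow> 'b::real_normed_vector"
  assumes G: "C_k_on (Suc k) S G" and K: "compact K" "convex K" "K \<subseteq> S"
  obtains B where "0 \<le> B" "\<And>p q. p \<in> K \<Longrightarrow> q \<in> K \<Longrightarrow> norm (G p - G q) \<le> B * norm (p - q)"
proof -
  obtain D where D: "\<And>p. p \<in> S \<Longrightarrow> (G has_derivative D p) (at p within S)"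
    and DC: "\<And>v. C_k_on k S (\<lambda>p. D p v)" using G by auto
  have "\<exists>B. \<forall>p\<in>K. norm (D p i) \<le> B" for i
    by (rule C_k_on_bounded[OF DC[of i] K(1,3)]) blast
  then obtain B where B: "\<And>i p. p \<in> K \<Longrightarrow> norm (D p i) \<le> B i" by metis
  define C where "C = (\<Sum>i\<in>Basis. B i)"
  have DB: "norm (D p v) \<le> C * norm v" if "p \<in> K" for p v
    unfolding C_def by (rule norm_linear_le_Basis) (use D K that B has_derivative_linear in blast)+
  have "norm (G p - G q) \<le> max 0 C * norm (p - q)" if "p \<in> K" "q \<in> K" for p q
  proof (rule differentiable_bound[OF K(2) _ _ that])
    show "(G has_derivative D r) (at r within K)" if "r \<in> K" for r
      using D K that by (blast intro: has_derivative_subset)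
    show "onorm (D r) \<le> max 0 C" if "r \<in> K" for r
      by (rule onorm_le) (meson DB[OF that] max.cobounded2 mult_right_mono norm_ge_zero order_trans)
  qed
  then show ?thesis using that[of "max 0 C"] by simp
qed

lemma C_2_remainder:
  fixes F :: "'a::euclidean_space \<Rightarrow> 'b::real_normed_vector"
  assumes F: "C_k_on (Suc (Suc k)) S F" and K: "compact K" "convex K" "K \<subseteq> S"
  obtains D B where "0 \<le> B" "\<And>p. p \<in> K \<Longrightarrow> linear (D p)"
    "\<And>p v. p \<in> K \<Longrightarrow> norm (D p v) \<le> B * norm v"
    "\<And>p q v. p \<in> K \<Longrightarrow> q \<in> K \<Longrightarrow> norm (D p v - D q v) \<le> B * norm (p - q) * norm v"
    "\<And>p q. p \<in> K \<Longrightarrow> q \<in> K \<Longrightarrow> norm (F q - F p - D p (q - p)) \<le> B * (norm (q - p))\<^sup>2"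
proof -
  obtain D where D: "\<And>p. p \<in> S \<Longrightarrow> (F has_derivative D p) (at p within S)"
    and DC: "\<And>v. C_k_on (Suc k) S (\<lambda>p. D p v)" using F by auto
  have lin: "linear (D p)" if "p \<in> K" for p using D K that has_derivative_linear by blast
  have "\<exists>B. \<forall>p\<in>K. norm (D p i) \<le> B" for i
    by (rule C_k_on_bounded[OF DC[of i] K(1,3)]) blast
  then obtain B where B: "\<And>i p. p \<in> K \<Longrightarrow> norm (D p i) \<le> B i" by metis
  have "\<exists>B. \<forall>p\<in>K. \<forall>q\<in>K. norm (D p i - D q i) \<le> B * norm (p - q)" for i
    by (rule C_1_Lipschitz[OF DC[of i] K]) blast
  then obtain B' where B': "\<And>i p q. p \<in> K \<Longrightarrow> q \<in> K \<Longrightarrow> norm (D p i - D q i) \<le> B' i * norm (p - q)" by metis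
  define C C' where "C = (\<Sum>i\<in>Basis. B i)" and "C' = (\<Sum>i\<in>Basis. B' i)"
  define M where "M = max 0 (max C C')"
  have M: "0 \<le> M" "C \<le> M" "C' \<le> M" by (auto simp: M_def)
  have DB: "norm (D p v) \<le> M * norm v" if "p \<in> K" for p v
  proof -
    have "norm (D p v) \<le> C * norm v"
      unfolding C_def by (rule norm_linear_le_Basis[OF lin[OF that]]) (use that B in auto)
    then show ?thesis using M by (meson mult_right_mono norm_ge_zero order_trans)
  qed
  have DL: "norm (D p v - D q v) \<le> M * norm (p - q) * norm v" if "p \<in> K" "q \<in> K" for p q v
  proof -
    have "norm (D p v - D q v) \<le> (\<Sum>i\<in>Basis. B' i * norm (p - q)) * norm v"
      by (rule norm_linear_le_Basis[of "\<lambda>v. D p v - D q v"])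
        (use that B' lin in \<open>auto intro: linear_compose_sub\<close>)
    also have "\<dots> = C' * norm (p - q) * norm v" by (simp add: C'_def sum_distrib_right)
    also have "\<dots> \<le> M * norm (p - q) * norm v" using M by (intro mult_right_mono) auto
    finally show ?thesis .
  qed
  have R: "norm (F q - F p - D p (q - p)) \<le> M * (norm (q - p))\<^sup>2" if "p \<in> K" "q \<in> K" for p q
  proof -
    have sub: "closed_segment p q \<subseteq> K" using K(2) that by (simp add: closed_segment_subset)
    have "norm (F q - F p - D p (q - p)) \<le> norm (q - p) * (M * norm (q - p))"
    proof (rule differentiable_bound_linearization[of p q "closed_segment p q"])
      show "p + t *\<^sub>R (q - p) \<in> closed_segment p q" if "t \<in> {0..1}" for t
        using that by (auto simp: closed_segment_def algebra_simps intro!: exI[of _ t])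
      show "(F has_derivative D r) (at r within closed_segment p q)" if "r \<in> closed_segment p q" for r
        using D K sub that by (blast intro: has_derivative_subset)
      show "onorm (D r - D p) \<le> M * norm (q - p)" if r: "r \<in> closed_segment p q" for r
      proof (rule onorm_le)
        fix v
        have "norm (D r v - D p v) \<le> M * norm (r - p) * norm v" using DL sub r \<open>p \<in> K\<close> by blast
        also have "\<dots> \<le> M * norm (q - p) * norm v"
          using segment_bound(1)[OF r] M by (intro mult_right_mono mult_left_mono) (auto simp: norm_minus_commute)
        finally show "norm ((D r - D p) v) \<le> M * norm (q - p) * norm v" by simp
      qed
    qed simp
    then show ?thesis by (simp add: power2_eq_square mult_ac)
  qed
  show ?thesis by (rule that[OF M(1) lin DB DL R])
qed

text \<open>The constants come from compactness of \<open>[0, T]\<close> times a ball. They are the same for all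
  solutions which stay in the ball, and this uniformity is what the error estimate needs.\<close>

lemma exact_solution_exists:
  fixes F :: "real \<times> 'a::euclidean_space \<Rightarrow> 'a" and P :: "'a \<Rightarrow> 'a"
  assumes F: "C_k_on 3 ({0..T} \<times> UNIV) F" and P: "linear P" "\<And>z. norm (P z) \<le> norm z"
  obtains L where "\<And>y. (\<And>t. t \<in> {0..T} \<Longrightarrow> (y has_vector_derivative F (t, y t)) (at t within {0..T})) \<Longrightarrow>
      (\<And>t. t \<in> {0..T} \<Longrightarrow> y t \<in> cball 0 \<rho>) \<Longrightarrow>
      \<exists>A u1 u2 u3. exact_solution (\<lambda>t z. F (t, z)) P (cball 0 \<rho>) A y (\<lambda>t. F (t, y t)) u1 u2 u3 T L"
proof -
  define S :: "(real \<times> 'a) set" where "S = {0..T} \<times> UNIV"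
  define K :: "(real \<times> 'a) set" where "K = {0..T} \<times> cball 0 \<rho>"
  have K: "compact K" "convex K" "K \<subseteq> S"
    by (auto simp: K_def S_def intro!: compact_Times convex_Times)
  have F3: "C_k_on (Suc (Suc (Suc 0))) S F" using F by (simp only: S_def numeral_3_eq_3)
  have F2: "C_k_on (Suc (Suc 0)) S F" and F1: "C_k_on (Suc 0) S F" and F0: "C_k_on 0 S F"
    using C_k_on_mono[OF F3, of 2] C_k_on_mono[OF F3, of 1] C_k_on_mono[OF F3, of 0]
    by (simp_all only: numeral_2_eq_2 One_nat_def)
  obtain G1 where G1: "C_k_on (Suc (Suc 0)) S G1"
    "\<And>y t. t \<in> {0..T} \<Longrightarrow> (y has_vector_derivative F (t, y t)) (at t within {0..T}) \<Longrightarrow>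
      ((\<lambda>t. F (t, y t)) has_vector_derivative G1 (t, y t)) (at t within {0..T})"
    using C_k_on_Lie_derivative[OF F3[unfolded S_def] F2[unfolded S_def]] unfolding S_def by blast
  obtain G2 where G2: "C_k_on (Suc 0) S G2"
    "\<And>y t. t \<in> {0..T} \<Longrightarrow> (y has_vector_derivative F (t, y t)) (at t within {0..T}) \<Longrightarrow>
      ((\<lambda>t. G1 (t, y t)) has_vector_derivative G2 (t, y t)) (at t within {0..T})"
    using C_k_on_Lie_derivative[OF G1(1)[unfolded S_def] F1[unfolded S_def]] unfolding S_def by blast
  obtain G3 where G3: "C_k_on 0 S G3"
    "\<And>y t. t \<in> {0..T} \<Longrightarrow> (y has_vector_derivative F (t, y t)) (at t within {0..T}) \<Longrightarrow>
      ((\<lambda>t. G2 (t, y t)) has_vector_derivative G3 (t, y t)) (at t within {0..T})"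
    using C_k_on_Lie_derivative[OF G2(1)[unfolded S_def] F0[unfolded S_def]] unfolding S_def by blast
  obtain B0 where B0: "0 \<le> B0" "\<And>p. p \<in> K \<Longrightarrow> norm (F p) \<le> B0"
    by (rule C_k_on_bounded[OF F0 K(1,3)]) (rule that)
  obtain B1 where B1: "0 \<le> B1" "\<And>p. p \<in> K \<Longrightarrow> norm (G1 p) \<le> B1"
    by (rule C_k_on_bounded[OF G1(1) K(1,3)]) (rule that)
  obtain B2 where B2: "0 \<le> B2" "\<And>p. p \<in> K \<Longrightarrow> norm (G2 p) \<le> B2"
    by (rule C_k_on_bounded[OF G2(1) K(1,3)]) (rule that)
  obtain B3 where B3: "0 \<le> B3" "\<And>p. p \<in> K \<Longrightarrow> norm (G3 p) \<le> B3"
    by (rule C_k_on_bounded[OF G3(1) K(1,3)]) (rule that)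
  obtain BL where BL: "0 \<le> BL" "\<And>p q. p \<in> K \<Longrightarrow> q \<in> K \<Longrightarrow> norm (F p - F q) \<le> BL * norm (p - q)"
    by (rule C_1_Lipschitz[OF F1 K]) (rule that)
  obtain D B where B: "0 \<le> B" and D: "\<And>p. p \<in> K \<Longrightarrow> linear (D p)"
    "\<And>p v. p \<in> K \<Longrightarrow> norm (D p v) \<le> B * norm v"
    "\<And>p q v. p \<in> K \<Longrightarrow> q \<in> K \<Longrightarrow> norm (D p v - D q v) \<le> B * norm (p - q) * norm v"
    "\<And>p q. p \<in> K \<Longrightarrow> q \<in> K \<Longrightarrow> norm (F q - F p - D p (q - p)) \<le> B * (norm (q - p))\<^sup>2"
    by (rule C_2_remainder[OF F2 K]) (rule that)
  define L where "L = 1 + B1 + B2 + B3 + BL + B * (1 + B0) + 2 * \<bar>\<rho>\<bar>"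
  have BB: "0 \<le> B * B0" using B B0 by simp
  have L: "1 \<le> L" "B1 \<le> L" "B2 \<le> L" "B3 \<le> L" "BL \<le> L" "B \<le> L" "B * (1 + B0) \<le> L" "2 * \<bar>\<rho>\<bar> \<le> L"
    using B B0(1) B1(1) B2(1) B3(1) BL(1) BB by (auto simp: L_def algebra_simps)
  show ?thesis
  proof (rule that[of L])
    fix y assume dy: "\<And>t. t \<in> {0..T} \<Longrightarrow> (y has_vector_derivative F (t, y t)) (at t within {0..T})"
      and yK: "\<And>t. t \<in> {0..T} \<Longrightarrow> y t \<in> cball 0 \<rho>"
    have mem: "(t, z) \<in> K" if "t \<in> {0..T}" "z \<in> cball 0 \<rho>" for t z using that by (simp add: K_def)
    have ymem: "(t, y t) \<in> K" if "t \<in> {0..T}" for t using mem that yK by blast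
    have y_lip: "norm (y s - y t) \<le> B0 * \<bar>s - t\<bar>" if "s \<in> {0..T}" "t \<in> {0..T}" for s t
    proof -
      have "norm (y s - y t) \<le> B0 * norm (s - t)"
      proof (rule differentiable_bound[of "{0..T}"])
        show "(y has_derivative (\<lambda>r. r *\<^sub>R F (x, y x))) (at x within {0..T})" if "x \<in> {0..T}" for x
          using dy[OF that] by (simp add: has_vector_derivative_def)
        show "onorm (\<lambda>r. r *\<^sub>R F (x, y x)) \<le> B0" if "x \<in> {0..T}" for x
          using B0(2)[OF ymem[OF that]] by (intro onorm_le) (simp add: mult.commute[of B0] mult_left_mono)
      qed (use that in auto)
      then show ?thesis by simp
    qed
    have "exact_solution (\<lambda>t z. F (t, z)) P (cball 0 \<rho>) (\<lambda>t d. D (t, y t) (0, d)) y (\<lambda>t. F (t, y t))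
      (\<lambda>t. G1 (t, y t)) (\<lambda>t. G2 (t, y t)) (\<lambda>t. G3 (t, y t)) T L"
    proof (rule exact_solution.intro)
      show "F (t, y t) = F (t, y t)" for t ..
      show "linear P" "1 \<le> L" using P L by auto
      show "norm (P z) \<le> norm z" for z by (rule P)
      show "norm (z - w) \<le> L" if "z \<in> cball 0 \<rho>" "w \<in> cball 0 \<rho>" for z w :: 'a
        using norm_triangle_ineq4[of z w] that L(8) by simp
      fix t assume t: "t \<in> {0..T}"
      show "y t \<in> cball 0 \<rho>" by (rule yK[OF t])
      show "(y has_vector_derivative F (t, y t)) (at t within {0..T})" by (rule dy[OF t])
      show "((\<lambda>t. F (t, y t)) has_vector_derivative G1 (t, y t)) (at t within {0..T})"
        by (rule G1(2)[OF t dy[OF t]])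
      show "((\<lambda>t. G1 (t, y t)) has_vector_derivative G2 (t, y t)) (at t within {0..T})"
        by (rule G2(2)[OF t dy[OF t]])
      show "((\<lambda>t. G2 (t, y t)) has_vector_derivative G3 (t, y t)) (at t within {0..T})"
        by (rule G3(2)[OF t dy[OF t]])
      show "norm (G1 (t, y t)) \<le> L" "norm (G2 (t, y t)) \<le> L" "norm (G3 (t, y t)) \<le> L"
        using B1(2)[OF ymem[OF t]] B2(2)[OF ymem[OF t]] B3(2)[OF ymem[OF t]] L by auto
      have lD: "linear (D (t, y t))" by (rule D(1)[OF ymem[OF t]])
      have "linear (\<lambda>d::'a. (0::real, d))" by (rule linearI) auto
      from linear_compose[OF this lD] show "linear (\<lambda>d. D (t, y t) (0, d))" by (simp add: o_def)
      show "norm (D (t, y t) (0, z)) \<le> L * norm z" for z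
      proof -
        have "norm (D (t, y t) (0, z)) \<le> B * norm z" using D(2)[OF ymem[OF t], of "(0, z)"] by simp
        also have "\<dots> \<le> L * norm z" using L by (intro mult_right_mono) auto
        finally show ?thesis .
      qed
      show "norm (D (s, y s) (0, z) - D (t, y t) (0, z)) \<le> L * \<bar>s - t\<bar> * norm z" if s: "s \<in> {0..T}" for s z
      proof -
        have "norm ((s, y s) - (t, y t)) \<le> norm (s - t) + norm (y s - y t)"
          using norm_Pair_le[of "s - t" "y s - y t"] by simp
        also have "\<dots> \<le> (1 + B0) * \<bar>s - t\<bar>" using y_lip[OF s t] by (simp add: algebra_simps)
        finally have n: "norm ((s, y s) - (t, y t)) \<le> (1 + B0) * \<bar>s - t\<bar>" .
        have "norm (D (s, y s) (0, z) - D (t, y t) (0, z)) \<le> B * norm ((s, y s) - (t, y t)) * norm z"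
          using D(3)[OF ymem[OF s] ymem[OF t], of "(0, z)"] by simp
        also have "\<dots> \<le> B * ((1 + B0) * \<bar>s - t\<bar>) * norm z"
          using n B by (intro mult_right_mono mult_left_mono) auto
        also have "\<dots> \<le> L * \<bar>s - t\<bar> * norm z"
          using L(7) by (auto simp: mult.assoc[symmetric] intro!: mult_right_mono)
        finally show ?thesis .
      qed
      fix z :: 'a assume z: "z \<in> cball 0 \<rho>"
      show "norm (F (t, z) - F (t, w)) \<le> L * norm (z - w)" if w: "w \<in> cball 0 \<rho>" for w
      proof -
        have "norm (F (t, z) - F (t, w)) \<le> BL * norm (z - w)"
          using BL(2)[OF mem[OF t z] mem[OF t w]] by simp
        also have "\<dots> \<le> L * norm (z - w)" using L by (intro mult_right_mono) auto
        finally show ?thesis .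
      qed
      show "norm (F (t, z) - F (t, y t) - D (t, y t) (0, z - y t)) \<le> L * (norm (z - y t))\<^sup>2"
      proof -
        have "norm (F (t, z) - F (t, y t) - D (t, y t) (0, z - y t)) \<le> B * (norm (z - y t))\<^sup>2"
          using D(4)[OF ymem[OF t] mem[OF t z]] by simp
        also have "\<dots> \<le> L * (norm (z - y t))\<^sup>2" using L by (intro mult_right_mono) auto
        finally show ?thesis .
      qed
    qed
    then show "\<exists>A u1 u2 u3. exact_solution (\<lambda>t z. F (t, z)) P (cball 0 \<rho>) A y (\<lambda>t. F (t, y t)) u1 u2 u3 T L"
      by blast
  qed
qed

section \<open>The drift-kinetic field\<close>

definition drift_rate :: "(spacetime \<Rightarrow> vec3) \<Rightarrow> (spacetime \<Rightarrow> real) \<Rightarrow> spacetime \<Rightarrow> real" where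
  "drift_rate E b p = (E p \<bullet> rot (grad_perp b p)) / (b p)\<^sup>2"

definition drift_field :: "(spacetime \<Rightarrow> vec3) \<Rightarrow> (spacetime \<Rightarrow> real) \<Rightarrow> real \<Rightarrow>
    real \<times> vec3 \<times> real \<times> real \<Rightarrow> vec3 \<times> real \<times> real" where
  "drift_field E b \<epsilon> = (\<lambda>(t, x, e, v).
     (U_gc E b \<epsilon> t x e v, \<epsilon> * (e * drift_rate E b (t, x)), E (t, x) $ 3))"

lemma bounded_linear_perp: "bounded_linear perp"
  unfolding linear_conv_bounded_linear[symmetric] by (rule linearI) (auto intro!: vec3_eqI)

lemma bounded_linear_rot: "bounded_linear rot"
  unfolding linear_conv_bounded_linear[symmetric] by (rule linearI) (auto intro!: vec3_eqI)

lemma norm_rot: "norm (rot w) = norm (perp w)"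
  by (simp add: norm_vec_def L2_set_def sum_3 add.commute)

lemma norm_perp_le: "norm (perp w) \<le> norm w"
  using cmod_cplx_le[of w] by (simp add: norm_perp)

lemma C_k_on_grad_perp:
  assumes b: "C_k_on (Suc k) (closed_slab T) b"
  shows "C_k_on k (closed_slab T) (grad_perp b)"
proof -
  obtain D where D: "\<And>p. p \<in> closed_slab T \<Longrightarrow> (b has_derivative D p) (at p within closed_slab T)"
    and DC: "\<And>v. C_k_on k (closed_slab T) (\<lambda>p. D p v)" using b by auto
  have dv: "deriv (\<lambda>s. b (fst p, snd p + s *\<^sub>R axis i 1)) 0 = D p (0, axis i 1)" if p: "p \<in> closed_slab T" for p i
  proof -
    have "((\<lambda>s. p + s *\<^sub>R (0, axis i 1)) has_derivative (\<lambda>s. s *\<^sub>R (0, axis i 1))) (at 0)"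
      by (auto intro!: derivative_eq_intros)
    moreover have "(\<lambda>s. p + s *\<^sub>R (0, axis i 1)) ` UNIV \<subseteq> closed_slab T"
      using p by (cases p) (auto simp: closed_slab_def)
    ultimately have "((\<lambda>s. b (p + s *\<^sub>R (0, axis i 1))) has_derivative (\<lambda>s. D (p + 0 *\<^sub>R (0, axis i 1)) (s *\<^sub>R (0, axis i 1)))) (at 0)"
      using has_derivative_in_compose2[of "closed_slab T" b D "\<lambda>s. p + s *\<^sub>R (0, axis i 1)" UNIV 0 "\<lambda>s. s *\<^sub>R (0, axis i 1)"] D
      by blast
    then have "((\<lambda>s. b (p + s *\<^sub>R (0, axis i 1))) has_derivative (\<lambda>s. D p (s *\<^sub>R (0, axis i 1)))) (at 0)"
      by (simp only: scaleR_zero_left add_0_right)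
    moreover have "D p (s *\<^sub>R (0, axis i 1)) = D p (0, axis i 1) * s" for s
      using linear_scale[OF has_derivative_linear[OF D[OF p]], of s "(0, axis i 1)"] by simp
    ultimately have "((\<lambda>s. b (p + s *\<^sub>R (0, axis i 1))) has_real_derivative D p (0, axis i 1)) (at 0)"
      by (simp add: has_field_derivative_def)
    then have "deriv (\<lambda>s. b (p + s *\<^sub>R (0, axis i 1))) 0 = D p (0, axis i 1)"
      by (rule DERIV_imp_deriv)
    then show ?thesis by (simp add: plus_prod_def)
  qed
  have "C_k_on k (closed_slab T) (\<lambda>p. D p (0, axis 1 1) *\<^sub>R axis 1 1 + D p (0, axis 2 1) *\<^sub>R axis 2 1)"
    by (intro C_k_on_add C_k_on_scaleR DC C_k_on_const)
  moreover have "D p (0, axis 1 1) *\<^sub>R axis 1 1 + D p (0, axis 2 1) *\<^sub>R axis 2 1 = grad_perp b p"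
    if "p \<in> closed_slab T" for p
    using dv[OF that] by (intro vec3_eqI) (simp_all add: axis_def)
  ultimately show ?thesis by (rule C_k_on_cong)
qed

lemma C_k_on_drift_field:
  assumes E: "C_k_on k (closed_slab T) E" and b: "C_k_on (Suc k) (closed_slab T) b"
    and b0: "\<And>p. p \<in> closed_slab T \<Longrightarrow> b p \<noteq> 0"
  shows "C_k_on k ({0..T} \<times> UNIV) (drift_field E b \<epsilon>)"
proof -
  define S :: "(real \<times> vec3 \<times> real \<times> real) set" where "S = {0..T} \<times> UNIV"
  define Q :: "real \<times> vec3 \<times> real \<times> real \<Rightarrow> spacetime" where "Q p = (fst p, fst (snd p))" for p
  have Q: "bounded_linear Q" "Q ` S \<subseteq> closed_slab T"
    unfolding Q_def by (auto intro!: bounded_linear_intros simp: S_def closed_slab_def)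
  note lift = C_k_on_compose_linear[OF Q]
  have e: "C_k_on k S (\<lambda>p. fst (snd (snd p)))" and v: "C_k_on k S (\<lambda>p. snd (snd (snd p)))"
    by (intro C_k_on_linear bounded_linear_intros)+
  have ib: "C_k_on k S (\<lambda>p. inverse (b (Q p)))"
    using C_k_on_inverse[OF _ lift[OF C_k_on_Suc_imp[OF b]]] b0 Q by blast
  have E': "C_k_on k S (\<lambda>p. E (Q p))" by (rule lift[OF E])
  have g: "C_k_on k S (\<lambda>p. grad_perp b (Q p))" by (rule lift[OF C_k_on_grad_perp[OF b]])
  have nth: "bounded_linear (\<lambda>w::vec3. w $ i)" for i by (rule bounded_linear_vec_nth)
  have inn: "C_k_on k S (\<lambda>p. E (Q p) \<bullet> rot (grad_perp b (Q p)))"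
    unfolding inner_vec3
    by (intro C_k_on_add C_k_on_mult C_k_on_bounded_linear[OF nth] C_k_on_bounded_linear[OF bounded_linear_rot] E' g)
  have U: "C_k_on k S (\<lambda>p. snd (snd (snd p)) *\<^sub>R e_z - \<epsilon> *\<^sub>R rot (perp (inverse (b (Q p)) *\<^sub>R E (Q p))
      - (fst (snd (snd p)) * (inverse (b (Q p)) * inverse (b (Q p)))) *\<^sub>R grad_perp b (Q p)))"
    by (intro C_k_on_diff C_k_on_scaleR C_k_on_mult C_k_on_const C_k_on_bounded_linear[OF bounded_linear_rot]
      C_k_on_bounded_linear[OF bounded_linear_perp] e v ib E' g)
  have "C_k_on k S (\<lambda>p. (snd (snd (snd p)) *\<^sub>R e_z - \<epsilon> *\<^sub>R rot (perp (inverse (b (Q p)) *\<^sub>R E (Q p))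
      - (fst (snd (snd p)) * (inverse (b (Q p)) * inverse (b (Q p)))) *\<^sub>R grad_perp b (Q p)), 0::real, 0::real)
    + (\<epsilon> * (fst (snd (snd p)) * ((E (Q p) \<bullet> rot (grad_perp b (Q p))) * (inverse (b (Q p)) * inverse (b (Q p)))))) *\<^sub>R (0::vec3, 1::real, 0::real)
    + (E (Q p) $ 3) *\<^sub>R (0::vec3, 0::real, 1::real))"
    by (intro C_k_on_add C_k_on_scaleR C_k_on_mult C_k_on_const C_k_on_bounded_linear[OF nth] inn e ib E'
      C_k_on_bounded_linear[OF _ U, of "\<lambda>w. (w, 0, 0)"] bounded_linear_intros)
  then have "C_k_on k S (drift_field E b \<epsilon>)"
    by (rule C_k_on_cong)
      (auto simp: drift_field_def drift_rate_def U_gc_def F_field_def Q_def divide_inverse power2_eq_square)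
  then show ?thesis by (simp add: S_def)
qed

text \<open>Positions and energies are advanced by the explicit tableau, the parallel velocity by the
  implicit one. The projection selects the component to which the difference of the two applies.\<close>

definition parallel_part :: "vec3 \<times> real \<times> real \<Rightarrow> vec3 \<times> real \<times> real" where
  "parallel_part = (\<lambda>(x, e, v). (0, 0, v))"

lemma parallel_part_linear: "linear parallel_part"
  by (rule linearI) (auto simp: parallel_part_def)

lemma norm_parallel_part_le: "norm (parallel_part z) \<le> norm z"
proof -
  obtain x e v where z: "z = (x, e, v)" by (cases z)
  have "norm v \<le> norm (e, v)" "norm (e, v) \<le> norm (x, e, v)"
    by (rule norm_snd_le)+
  then show ?thesis by (simp add: parallel_part_def z)
qed

lemma increment_eqD:
  "0 < dt \<Longrightarrow> norm ((a - c) /\<^sub>R dt - u) \<le> 0 \<Longrightarrow> a = c + dt *\<^sub>R (u::'a::real_normed_vector)"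
  "0 < dt \<Longrightarrow> \<bar>(r - s) / dt - w\<bar> \<le> 0 \<Longrightarrow> r = s + dt * (w::real)"
proof -
  show "a = c + dt *\<^sub>R u" if "0 < dt" "norm ((a - c) /\<^sub>R dt - u) \<le> 0"
  proof -
    have "dt *\<^sub>R u = a - c" using that by (auto simp: scaleR_scaleR)
    then show ?thesis by simp
  qed
qed (simp add: field_simps)

lemma L_step_equations:
  assumes dt: "0 < dt" and st: "L_step_upto 0 T E b \<epsilon> dt t (x, e, v) s (x', e', v')"
    and g: "\<forall>t\<in>{0..T}. \<forall>x. g_field T E b t x = drift_rate E b (t, x)"
    and t: "0 \<le> t" "t + dt \<le> T"
  defines "U2 \<equiv> U_gc E b \<epsilon> t x e v" and "U3 \<equiv> U_gc E b \<epsilon> (t + dt) (lpos2 s) (len2 s) (vpar3 s)"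
    and "U4 \<equiv> U_gc E b \<epsilon> (t + dt / 2) (lpos3 s) (len3 s) (vpar4 s)"
    and "G2 \<equiv> e * drift_rate E b (t, x)" and "G3 \<equiv> len2 s * drift_rate E b (t + dt, lpos2 s)"
    and "G4 \<equiv> len3 s * drift_rate E b (t + dt / 2, lpos3 s)"
    and "E2 \<equiv> E (t, x) $ 3" and "E3 \<equiv> E (t + dt, lpos2 s) $ 3" and "E4 \<equiv> E (t + dt / 2, lpos3 s) $ 3"
  shows "lpos2 s = x + dt *\<^sub>R U2" "len2 s = e + dt * (\<epsilon> * G2)" "vpar3 s = v + dt * ((1 - \<alpha>) * E2 + \<alpha> * E3)"
    "lpos3 s = x + dt *\<^sub>R ((1 / 4) *\<^sub>R (U2 + U3))" "len3 s = e + dt * (\<epsilon> / 4 * (G2 + G3))"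
    "vpar4 s = v + dt * ((\<beta> + \<eta>) * E2 + \<gamma> * E3 + \<alpha> * E4)"
    "x' = x + dt *\<^sub>R ((1 / 6) *\<^sub>R (U2 + U3 + 4 *\<^sub>R U4))" "e' = e + dt * (\<epsilon> / 6 * (G2 + G3 + 4 * G4))"
    "v' = v + dt * (1 / 6 * (E2 + E3 + 4 * E4))"
proof -
  have gs: "g_field T E b t y = drift_rate E b (t, y)" "g_field T E b (t + dt) y = drift_rate E b (t + dt, y)"
    "g_field T E b (t + dt / 2) y = drift_rate E b (t + dt / 2, y)" for y
    using g t dt by auto
  have v2: "vpar2 s = v" using st by (auto simp: L_step_upto_def Let_def)
  note st' = st[unfolded L_step_upto_def Let_def prod.case gs v2, folded U2_def U3_def U4_def G2_def G3_def G4_def E2_def E3_def E4_def]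
  show "lpos2 s = x + dt *\<^sub>R U2" "len2 s = e + dt * (\<epsilon> * G2)" "vpar3 s = v + dt * ((1 - \<alpha>) * E2 + \<alpha> * E3)"
    "lpos3 s = x + dt *\<^sub>R ((1 / 4) *\<^sub>R (U2 + U3))" "len3 s = e + dt * (\<epsilon> / 4 * (G2 + G3))"
    "vpar4 s = v + dt * ((\<beta> + \<eta>) * E2 + \<gamma> * E3 + \<alpha> * E4)"
    "x' = x + dt *\<^sub>R ((1 / 6) *\<^sub>R (U2 + U3 + 4 *\<^sub>R U4))" "e' = e + dt * (\<epsilon> / 6 * (G2 + G3 + 4 * G4))"
    "v' = v + dt * (1 / 6 * (E2 + E3 + 4 * E4))"
    by (rule increment_eqD[OF dt], use st' in blast)+
qed

text \<open>In this form the implicit tableau appears as a correction of the explicit one on the range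
  of \<open>parallel_part\<close>, which is how \<open>local_error\<close> expects the stages.\<close>

lemma L_step_Runge_Kutta:
  assumes dt: "0 < dt" and st: "L_step_upto 0 T E b \<epsilon> dt t (x, e, v) s (x', e', v')"
    and g: "\<forall>t\<in>{0..T}. \<forall>x. g_field T E b t x = drift_rate E b (t, x)"
    and t: "0 \<le> t" "t + dt \<le> T"
  defines "f \<equiv> \<lambda>t z. drift_field E b \<epsilon> (t, z)" and "z \<equiv> (x, e, v)"
    and "Z2 \<equiv> (lpos2 s, len2 s, vpar3 s)" and "Z3 \<equiv> (lpos3 s, len3 s, vpar4 s)"
  shows "Z2 = z + dt *\<^sub>R (f t z + \<alpha> *\<^sub>R parallel_part (f (t + dt) Z2 - f t z))"
    "Z3 = z + dt *\<^sub>R ((1 / 4) *\<^sub>R (f t z + f (t + dt) Z2)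
      + parallel_part ((\<beta> + \<eta> - 1 / 4) *\<^sub>R f t z + (\<gamma> - 1 / 4) *\<^sub>R f (t + dt) Z2 + \<alpha> *\<^sub>R f (t + dt / 2) Z3))"
    "(x', e', v') = z + (dt / 6) *\<^sub>R (f t z + f (t + dt) Z2 + 4 *\<^sub>R f (t + dt / 2) Z3)"
proof -
  note eqs = L_step_equations[OF dt st g t]
  define U2 U3 U4 G2 G3 G4 E2 E3 E4 where "U2 = U_gc E b \<epsilon> t x e v" and "U3 = U_gc E b \<epsilon> (t + dt) (lpos2 s) (len2 s) (vpar3 s)"
    and "U4 = U_gc E b \<epsilon> (t + dt / 2) (lpos3 s) (len3 s) (vpar4 s)"
    and "G2 = e * drift_rate E b (t, x)" and "G3 = len2 s * drift_rate E b (t + dt, lpos2 s)"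
    and "G4 = len3 s * drift_rate E b (t + dt / 2, lpos3 s)"
    and "E2 = E (t, x) $ 3" and "E3 = E (t + dt, lpos2 s) $ 3" and "E4 = E (t + dt / 2, lpos3 s) $ 3"
  note defs = U2_def U3_def U4_def G2_def G3_def G4_def E2_def E3_def E4_def
  note eqs' = eqs[folded defs]
  have f: "f t z = (U2, \<epsilon> * G2, E2)" "f (t + dt) Z2 = (U3, \<epsilon> * G3, E3)" "f (t + dt / 2) Z3 = (U4, \<epsilon> * G4, E4)"
    by (simp_all add: f_def z_def Z2_def Z3_def drift_field_def defs)
  show "Z2 = z + dt *\<^sub>R (f t z + \<alpha> *\<^sub>R parallel_part (f (t + dt) Z2 - f t z))"
    unfolding f unfolding Z2_def z_def using eqs'(1-3) by (simp add: parallel_part_def algebra_simps)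
  show "Z3 = z + dt *\<^sub>R ((1 / 4) *\<^sub>R (f t z + f (t + dt) Z2)
      + parallel_part ((\<beta> + \<eta> - 1 / 4) *\<^sub>R f t z + (\<gamma> - 1 / 4) *\<^sub>R f (t + dt) Z2 + \<alpha> *\<^sub>R f (t + dt / 2) Z3))"
    unfolding f unfolding Z3_def z_def using eqs'(4-6) by (simp add: parallel_part_def algebra_simps)
  show "(x', e', v') = z + (dt / 6) *\<^sub>R (f t z + f (t + dt) Z2 + 4 *\<^sub>R f (t + dt / 2) Z3)"
    unfolding f unfolding z_def using eqs'(7-9) by (simp add: algebra_simps)
qed

section \<open>A priori bounds and third order of the drift-kinetic scheme\<close>

context bounded_data
begin

definition rate_bound :: real where "rate_bound = M * L / b0\<^sup>2"

definition speed_bound :: "real \<Rightarrow> real \<Rightarrow> real \<Rightarrow> real" where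
  "speed_bound \<epsilon> e v = v + \<epsilon> * (M / b0 + e * L / b0\<^sup>2)"

lemma rate_bound_nonneg: "0 \<le> rate_bound"
  using M0 L0 by (simp add: rate_bound_def)

lemma drift_rate_le: "p \<in> closed_slab T \<Longrightarrow> \<bar>drift_rate E b p\<bar> \<le> rate_bound"
proof -
  assume p: "p \<in> closed_slab T"
  have "\<bar>E p \<bullet> rot (grad_perp b p)\<bar> \<le> norm (E p) * norm (rot (grad_perp b p))"
    by (rule Cauchy_Schwarz_ineq2)
  also have "norm (rot (grad_perp b p)) \<le> L"
    using grad_le[OF p] norm_perp_le[of "grad_perp b p"] by (simp add: norm_rot del: grad_perp_nth)
  then have "norm (E p) * norm (rot (grad_perp b p)) \<le> M * L"
    using E_le[OF p] M0 by (intro mult_mono) auto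
  finally have n: "\<bar>E p \<bullet> rot (grad_perp b p)\<bar> \<le> M * L" .
  have "b0\<^sup>2 \<le> (b p)\<^sup>2" using b_gt[OF p] b0 by (intro power_mono) auto
  then show ?thesis
    unfolding drift_rate_def rate_bound_def abs_divide
    using n b0 M0 L0 by (intro frac_le) auto
qed

lemma U_gc_le:
  assumes "0 < \<epsilon>" "(t, x) \<in> closed_slab T" "\<bar>v\<bar> \<le> vm" "\<bar>e\<bar> \<le> em"
  shows "norm (U_gc E b \<epsilon> t x e v) \<le> speed_bound \<epsilon> em vm"
proof -
  have bp: "b0 < b (t, x)" by (rule b_gt[OF assms(2)])
  have "norm (perp (F_field E b (t, x))) \<le> M / b0"
  proof -
    have "norm (perp (F_field E b (t, x))) \<le> norm (E (t, x)) / b (t, x)"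
      using norm_perp_le[of "F_field E b (t, x)"] bp b0 by (simp add: F_field_def divide_inverse mult.commute)
    also have "\<dots> \<le> M / b0" using E_le[OF assms(2)] M0 bp b0 by (intro frac_le) auto
    finally show ?thesis .
  qed
  moreover have "norm ((e / (b (t, x))\<^sup>2) *\<^sub>R grad_perp b (t, x)) \<le> em * L / b0\<^sup>2"
  proof -
    have "b0\<^sup>2 \<le> (b (t, x))\<^sup>2" using bp b0 by (intro power_mono) auto
    then have "\<bar>e\<bar> * norm (grad_perp b (t, x)) / (b (t, x))\<^sup>2 \<le> em * L / b0\<^sup>2"
      using grad_le[OF assms(2)] assms(4) b0 L0 by (intro frac_le mult_mono mult_nonneg_nonneg) auto
    then show ?thesis by (simp del: grad_perp_nth)
  qed
  ultimately have w: "norm (perp (F_field E b (t, x)) - (e / (b (t, x))\<^sup>2) *\<^sub>R grad_perp b (t, x)) \<le> M / b0 + em * L / b0\<^sup>2"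
    by (rule norm_diff_le)
  have "norm (rot (perp (F_field E b (t, x)) - (e / (b (t, x))\<^sup>2) *\<^sub>R grad_perp b (t, x))) \<le> M / b0 + em * L / b0\<^sup>2"
    unfolding norm_rot using norm_perp_le w by (rule order_trans)
  moreover have "norm (v *\<^sub>R e_z) \<le> vm"
    using vec3_norm_le[of "v *\<^sub>R e_z"] assms(3) by (simp add: e_z_def)
  ultimately show ?thesis
    unfolding U_gc_def speed_bound_def using assms(1)
    by (intro norm_diff_le) (simp_all add: mult_left_mono)
qed

text \<open>The parallel velocity grows linearly, so that no constant depends on the solution. For the
  energy, \<open>Y\<^sup>2 exp (- 2 k t)\<close> is nonincreasing when \<open>k\<close> bounds the growth rate.\<close>

lemma characteristic_bounds:
  assumes \<epsilon>: "0 < \<epsilon>" and c: "characteristic_curve T E b \<epsilon> X Y V"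
    and g: "\<forall>t\<in>{0..T}. \<forall>x. g_field T E b t x = drift_rate E b (t, x)"
    and t: "t \<in> {0..T}" and R: "norm (X 0) \<le> R" "\<bar>Y 0\<bar> \<le> R" "\<bar>V 0\<bar> \<le> R"
  defines "em \<equiv> R * exp (\<epsilon> * rate_bound * T)"
  shows "\<bar>V t\<bar> \<le> R + T * M" "\<bar>Y t\<bar> \<le> em" "norm (X t) \<le> R + T * speed_bound \<epsilon> em (R + T * M)"
proof -
  have R0: "0 \<le> R" using R by linarith
  have dX: "(X has_vector_derivative U_gc E b \<epsilon> t (X t) (Y t) (V t)) (at t within {0..T})"
    and dY: "(Y has_real_derivative \<epsilon> * drift_rate E b (t, X t) * Y t) (at t within {0..T})"
    and dV: "(V has_real_derivative E (t, X t) $ 3) (at t within {0..T})" if "t \<in> {0..T}" for t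
    using bspec[OF c[unfolded characteristic_curve_def] that] g that by simp_all
  have slab: "(t, X t) \<in> closed_slab T" if "t \<in> {0..T}" for t using that by (simp add: closed_slab_def)
  have Vle: "\<bar>V t\<bar> \<le> R + T * M" if t: "t \<in> {0..T}" for t
  proof -
    have "norm (V t - V 0) \<le> M * t"
    proof (rule vector_increment_bound)
      fix s assume s: "s \<in> {0..t}"
      then have s': "s \<in> {0..T}" using t by simp
      show "(V has_vector_derivative E (s, X s) $ 3) (at s within {0..t})"
        using has_field_derivative_subset[OF dV[OF s']] t by (auto simp: has_real_derivative_iff_has_vector_derivative)
      show "norm (E (s, X s) $ 3) \<le> M"
        using component_le_norm_cart[of "E (s, X s)" 3] E_le[OF slab[OF s']] by simp
    qed (use t in simp)
    moreover have "M * t \<le> T * M" using t M0 by (simp add: mult.commute[of T] mult_left_mono)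
    ultimately show ?thesis using R(3) by simp
  qed
  have Yle: "\<bar>Y t\<bar> \<le> em" if t: "t \<in> {0..T}" for t
  proof -
    define k where "k = \<epsilon> * rate_bound"
    have k: "0 \<le> k" using \<epsilon> rate_bound_nonneg by (simp add: k_def)
    \<comment> \<open>the integrating factor removes the largest possible growth rate \<open>k\<close> of \<open>Y\<close>\<close>
    define w where "w s = (Y s)\<^sup>2 * exp (- (2 * k * s))" for s
    define w' where "w' s = 2 * ((\<epsilon> * drift_rate E b (s, X s) - k) * w s)" for s
    have dw: "(w has_real_derivative w' s) (at s within {0..t})" if s: "s \<in> {0..t}" for s
    proof -
      have "(Y has_real_derivative \<epsilon> * drift_rate E b (s, X s) * Y s) (at s within {0..t})"
        using has_field_derivative_subset[OF dY[of s]] t s by auto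
      then show ?thesis unfolding w_def[abs_def] w'_def
        by (auto intro!: derivative_eq_intros simp: algebra_simps power2_eq_square)
    qed
    have "w t \<le> w 0"
    proof (cases "t = 0")
      case False
      then have t0: "0 < t" using t by simp
      have "\<exists>s\<in>{0..t}. w t - w 0 = (\<lambda>r. w' s * r) (t - 0)"
        using t0 by (intro mvt_very_simple) (use dw in \<open>auto simp: has_field_derivative_def\<close>)
      then obtain s where s: "s \<in> {0..t}" "w t - w 0 = w' s * t" by auto
      have "\<epsilon> * drift_rate E b (s, X s) \<le> k"
        using drift_rate_le[OF slab[of s]] s t \<epsilon> unfolding k_def by (intro mult_left_mono) auto
      moreover have "0 \<le> w s" by (simp add: w_def)
      ultimately have "w' s \<le> 0"
        using mult_nonpos_nonneg[of "\<epsilon> * drift_rate E b (s, X s) - k" "w s"] by (simp add: w'_def mult.commute)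
      then show ?thesis using s t0 mult_nonpos_nonneg[of "w' s" t] by simp
    qed simp
    then have "(Y t)\<^sup>2 * exp (- (2 * k * t)) * exp (2 * k * t) \<le> (Y 0)\<^sup>2 * exp (2 * k * t)"
      unfolding w_def by (intro mult_right_mono) auto
    then have "(Y t)\<^sup>2 \<le> (Y 0)\<^sup>2 * exp (2 * k * t)" by (simp add: mult.assoc flip: exp_add)
    also have "\<dots> = (\<bar>Y 0\<bar> * exp (k * t))\<^sup>2"
      by (simp add: power_mult_distrib power2_eq_square mult_ac flip: exp_add)
    finally have "\<bar>Y t\<bar>\<^sup>2 \<le> (\<bar>Y 0\<bar> * exp (k * t))\<^sup>2" by simp
    then have "\<bar>Y t\<bar> \<le> \<bar>Y 0\<bar> * exp (k * t)" by (rule power2_le_imp_le) simp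
    also have "\<dots> \<le> R * exp (k * T)"
      using R(2) R0 t k by (intro mult_mono) (auto intro: mult_left_mono)
    finally show ?thesis by (simp add: em_def k_def)
  qed
  show "\<bar>V t\<bar> \<le> R + T * M" "\<bar>Y t\<bar> \<le> em" by (rule Vle[OF t], rule Yle[OF t])
  have sp: "norm (U_gc E b \<epsilon> s (X s) (Y s) (V s)) \<le> speed_bound \<epsilon> em (R + T * M)" if "s \<in> {0..T}" for s
    by (rule U_gc_le[OF \<epsilon> slab[OF that] Vle[OF that] Yle[OF that]])
  have "norm (X t - X 0) \<le> speed_bound \<epsilon> em (R + T * M) * t"
  proof (rule vector_increment_bound)
    fix s assume "s \<in> {0..t}"
    then have s': "s \<in> {0..T}" using t by simp
    show "(X has_vector_derivative U_gc E b \<epsilon> s (X s) (Y s) (V s)) (at s within {0..t})"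
      using has_vector_derivative_within_subset[OF dX[OF s']] t by auto
    show "norm (U_gc E b \<epsilon> s (X s) (Y s) (V s)) \<le> speed_bound \<epsilon> em (R + T * M)" by (rule sp[OF s'])
  qed (use t in simp)
  moreover have "speed_bound \<epsilon> em (R + T * M) * t \<le> T * speed_bound \<epsilon> em (R + T * M)"
    using t order_trans[OF norm_ge_zero sp[OF t]] by (simp add: mult.commute mult_right_mono)
  ultimately show "norm (X t) \<le> R + T * speed_bound \<epsilon> em (R + T * M)"
    using norm_triangle_ineq[of "X t - X 0" "X 0"] R(1) by simp
qed

text \<open>The discrete counterpart of the bounds for the characteristics, for the stages as well.
  The factor \<open>(1 + T q)\<^sup>2\<close> covers the two explicit energy stages.\<close>

lemma L_step_growth:
  assumes \<epsilon>: "0 < \<epsilon>" and dt: "0 < dt" and t: "0 \<le> t" "t + dt \<le> T"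
    and g: "\<forall>t\<in>{0..T}. \<forall>x. g_field T E b t x = drift_rate E b (t, x)"
    and st: "L_step_upto 0 T E b \<epsilon> dt t (x, e, v) s (x', e', v')"
  defines "q \<equiv> \<epsilon> * rate_bound"
  shows "\<bar>v'\<bar> \<le> \<bar>v\<bar> + dt * M" "\<bar>vpar3 s\<bar> \<le> \<bar>v\<bar> + dt * M" "\<bar>vpar4 s\<bar> \<le> \<bar>v\<bar> + dt * M"
    "\<bar>e'\<bar> \<le> \<bar>e\<bar> * (1 + dt * (q * (1 + T * q)\<^sup>2))" "\<bar>len2 s\<bar> \<le> \<bar>e\<bar> * (1 + T * q)\<^sup>2" "\<bar>len3 s\<bar> \<le> \<bar>e\<bar> * (1 + T * q)\<^sup>2"
    "\<And>vm em. \<bar>v\<bar> + dt * M \<le> vm \<Longrightarrow> \<bar>e\<bar> * (1 + T * q)\<^sup>2 \<le> em \<Longrightarrow>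
      norm (x' - x) \<le> dt * speed_bound \<epsilon> em vm \<and> norm (lpos2 s - x) \<le> dt * speed_bound \<epsilon> em vm
      \<and> norm (lpos3 s - x) \<le> dt * speed_bound \<epsilon> em vm"
proof -
  note eqs = L_step_equations[OF dt st g t]
  have q: "0 \<le> q" using \<epsilon> rate_bound_nonneg by (simp add: q_def)
  have slab: "(t, y) \<in> closed_slab T" "(t + dt, y) \<in> closed_slab T" "(t + dt / 2, y) \<in> closed_slab T" for y
    using t dt by (auto simp: closed_slab_def)
  define E2 E3 E4 where E_defs: "E2 = E (t, x) $ 3" "E3 = E (t + dt, lpos2 s) $ 3" "E4 = E (t + dt / 2, lpos3 s) $ 3"
  have Ele: "\<bar>E2\<bar> \<le> M" "\<bar>E3\<bar> \<le> M" "\<bar>E4\<bar> \<le> M"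
    unfolding E_defs using E_le[OF slab(1)[of x]] E_le[OF slab(2)[of "lpos2 s"]] E_le[OF slab(3)[of "lpos3 s"]]
      component_le_norm_cart order_trans by blast+
  have lin: "\<bar>a * E2 + c * E3 + d * E4\<bar> \<le> M" if "0 \<le> a" "0 \<le> c" "0 \<le> d" "a + c + d \<le> 1" for a c d
  proof -
    have "\<bar>a * E2\<bar> \<le> a * M" "\<bar>c * E3\<bar> \<le> c * M" "\<bar>d * E4\<bar> \<le> d * M"
      using Ele that by (simp_all add: abs_mult mult_left_mono)
    moreover have "(a + c + d) * M \<le> 1 * M" using that M0 by (intro mult_right_mono) auto
    ultimately show ?thesis by (simp add: algebra_simps)
  qed
  have inc: "\<bar>v + dt * w\<bar> \<le> \<bar>v\<bar> + dt * M" if "\<bar>w\<bar> \<le> M" for w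
  proof -
    have "\<bar>dt * w\<bar> \<le> dt * M" using that dt by (simp add: abs_mult)
    then show ?thesis by linarith
  qed
  note co = coefficient_bounds \<alpha>_bounds
  show v3: "\<bar>vpar3 s\<bar> \<le> \<bar>v\<bar> + dt * M"
    unfolding eqs(3) E_defs[symmetric] using lin[of "1 - \<alpha>" \<alpha> 0] co by (intro inc) simp
  show v4: "\<bar>vpar4 s\<bar> \<le> \<bar>v\<bar> + dt * M"
    unfolding eqs(6) E_defs[symmetric] using lin[of "\<beta> + \<eta>" \<gamma> \<alpha>] co by (intro inc) (simp add: \<gamma>_def)
  have "1 / 6 * (E2 + E3 + 4 * E4) = 1 / 6 * E2 + 1 / 6 * E3 + 2 / 3 * E4" by simp
  then show "\<bar>v'\<bar> \<le> \<bar>v\<bar> + dt * M"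
    unfolding eqs(9) E_defs[symmetric] using lin[of "1 / 6" "1 / 6" "2 / 3"] by (intro inc) simp
  define g2 g3 g4 where g_defs: "g2 = drift_rate E b (t, x)" "g3 = drift_rate E b (t + dt, lpos2 s)" "g4 = drift_rate E b (t + dt / 2, lpos3 s)"
  have rate: "\<bar>\<epsilon> * (y * r)\<bar> \<le> q * \<bar>y\<bar>" if "\<bar>r\<bar> \<le> rate_bound" for y r
  proof -
    have "\<bar>\<epsilon> * (y * r)\<bar> = \<epsilon> * \<bar>r\<bar> * \<bar>y\<bar>" using \<epsilon> by (simp add: abs_mult)
    also have "\<dots> \<le> q * \<bar>y\<bar>" unfolding q_def using that \<epsilon> by (intro mult_right_mono mult_left_mono) auto
    finally show ?thesis .
  qed
  have gle: "\<bar>g2\<bar> \<le> rate_bound" "\<bar>g3\<bar> \<le> rate_bound" "\<bar>g4\<bar> \<le> rate_bound"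
    unfolding g_defs by (rule drift_rate_le slab)+
  define Q where "Q = 1 + T * q"
  have dtT: "dt \<le> T" using t by simp
  have Q: "1 \<le> Q" "dt * q \<le> Q - 1" using q T dtT by (auto simp: Q_def mult_right_mono)
  have QQ: "Q \<le> Q\<^sup>2" "1 \<le> Q\<^sup>2" using Q(1) by (auto intro: self_le_power)
  have a0: "0 \<le> \<bar>e\<bar>" by simp
  note r2 = rate[OF gle(1), of e] and r3 = rate[OF gle(2), of "len2 s"] and r4 = rate[OF gle(3), of "len3 s"]
  have l2: "\<bar>len2 s\<bar> \<le> \<bar>e\<bar> * Q"
  proof -
    have "\<bar>dt * (\<epsilon> * (e * g2))\<bar> \<le> dt * (q * \<bar>e\<bar>)" using r2 dt by (simp add: abs_mult)
    also have "\<dots> \<le> (Q - 1) * \<bar>e\<bar>" using mult_right_mono[OF Q(2) a0] by (simp add: mult.assoc)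
    finally show ?thesis unfolding eqs(2) g_defs[symmetric] by (simp add: algebra_simps)
  qed
  have "\<bar>e\<bar> * Q \<le> \<bar>e\<bar> * Q\<^sup>2" using QQ by (intro mult_left_mono) auto
  with l2 show l2': "\<bar>len2 s\<bar> \<le> \<bar>e\<bar> * (1 + T * q)\<^sup>2" by (simp add: Q_def)
  have h3: "q * \<bar>len2 s\<bar> \<le> q * \<bar>e\<bar> * Q" using mult_left_mono[OF l2 q] by (simp add: mult.assoc)
  have h2: "q * \<bar>e\<bar> \<le> q * \<bar>e\<bar> * Q" using q Q(1) mult_left_mono[of 1 Q "q * \<bar>e\<bar>"] by simp
  have "\<bar>len3 s\<bar> \<le> \<bar>e\<bar> * Q\<^sup>2"
  proof -
    have "\<epsilon> / 4 * (e * g2 + len2 s * g3) = 1 / 4 * (\<epsilon> * (e * g2)) + 1 / 4 * (\<epsilon> * (len2 s * g3))"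
      by (simp add: algebra_simps)
    then have "\<bar>\<epsilon> / 4 * (e * g2 + len2 s * g3)\<bar> \<le> q * \<bar>e\<bar> * Q"
      using r2 r3 h2 h3 by linarith
    then have "\<bar>dt * (\<epsilon> / 4 * (e * g2 + len2 s * g3))\<bar> \<le> dt * (q * \<bar>e\<bar> * Q)" using dt by (simp add: abs_mult)
    also have "\<dots> \<le> (Q - 1) * (\<bar>e\<bar> * Q)"
      using mult_right_mono[OF Q(2), of "\<bar>e\<bar> * Q"] Q(1) by (simp add: mult.assoc)
    also have "\<dots> \<le> \<bar>e\<bar> * Q\<^sup>2 - \<bar>e\<bar>"
      using mult_left_mono[OF Q(1) a0] by (simp add: algebra_simps power2_eq_square)
    finally show ?thesis unfolding eqs(5) g_defs[symmetric] by linarith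
  qed
  then show l3: "\<bar>len3 s\<bar> \<le> \<bar>e\<bar> * (1 + T * q)\<^sup>2" by (simp add: Q_def)
  show "\<bar>e'\<bar> \<le> \<bar>e\<bar> * (1 + dt * (q * (1 + T * q)\<^sup>2))"
  proof -
    have eq: "\<epsilon> / 6 * (e * g2 + len2 s * g3 + 4 * (len3 s * g4))
        = 1 / 6 * (\<epsilon> * (e * g2)) + 1 / 6 * (\<epsilon> * (len2 s * g3)) + 2 / 3 * (\<epsilon> * (len3 s * g4))"
      by (simp add: algebra_simps)
    have avg: "\<bar>1 / 6 * a + 1 / 6 * c + 2 / 3 * d\<bar> \<le> B" if "\<bar>a\<bar> \<le> B" "\<bar>c\<bar> \<le> B" "\<bar>d\<bar> \<le> B" for a c d B :: real
      using that by linarith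
    have "q * \<bar>len2 s\<bar> \<le> q * (\<bar>e\<bar> * Q\<^sup>2)" "q * \<bar>len3 s\<bar> \<le> q * (\<bar>e\<bar> * Q\<^sup>2)"
      using l2' l3 q by (auto simp: Q_def intro!: mult_left_mono)
    moreover have "q * \<bar>e\<bar> \<le> q * (\<bar>e\<bar> * Q\<^sup>2)"
      using q QQ(2) mult_left_mono[OF QQ(2) a0] by (intro mult_left_mono) auto
    ultimately have "\<bar>\<epsilon> / 6 * (e * g2 + len2 s * g3 + 4 * (len3 s * g4))\<bar> \<le> q * (\<bar>e\<bar> * Q\<^sup>2)"
      unfolding eq using avg order_trans[OF r2] order_trans[OF r3] order_trans[OF r4] by blast
    then have "\<bar>dt * (\<epsilon> / 6 * (e * g2 + len2 s * g3 + 4 * (len3 s * g4)))\<bar> \<le> dt * (q * (\<bar>e\<bar> * Q\<^sup>2))"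
      using dt by (simp add: abs_mult)
    then have "\<bar>e'\<bar> \<le> \<bar>e\<bar> + dt * (q * (\<bar>e\<bar> * Q\<^sup>2))"
      unfolding eqs(8) g_defs[symmetric] by linarith
    then show ?thesis by (simp add: Q_def algebra_simps)
  qed
  fix vm em assume vm: "\<bar>v\<bar> + dt * M \<le> vm" and em: "\<bar>e\<bar> * (1 + T * q)\<^sup>2 \<le> em"
  define U2 U3 U4 where U_defs: "U2 = U_gc E b \<epsilon> t x e v" "U3 = U_gc E b \<epsilon> (t + dt) (lpos2 s) (len2 s) (vpar3 s)"
    "U4 = U_gc E b \<epsilon> (t + dt / 2) (lpos3 s) (len3 s) (vpar4 s)"
  let ?W = "speed_bound \<epsilon> em vm"
  have v0: "\<bar>v\<bar> \<le> vm" using vm dt M0 mult_nonneg_nonneg[of dt M] by linarith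
  have e0: "\<bar>e\<bar> \<le> em" using em mult_left_mono[OF QQ(2) a0] by (simp add: Q_def)
  have U: "norm U2 \<le> ?W" "norm U3 \<le> ?W" "norm U4 \<le> ?W"
    unfolding U_defs
    by (rule U_gc_le[OF \<epsilon> slab(1) v0 e0] U_gc_le[OF \<epsilon> slab(2) order_trans[OF v3 vm] order_trans[OF l2' em]]
        U_gc_le[OF \<epsilon> slab(3) order_trans[OF v4 vm] order_trans[OF l3 em]])+
  have W0: "0 \<le> ?W" using U(1) norm_ge_zero[of U2] by linarith
  have dtW: "norm (dt *\<^sub>R w) \<le> dt * ?W" if "norm w \<le> ?W" for w :: vec3
    using that dt by (simp add: mult_left_mono)
  note pos = eqs(1,4,7)[folded U_defs]
  have d: "x' - x = dt *\<^sub>R ((1 / 6) *\<^sub>R (U2 + U3 + 4 *\<^sub>R U4))" "lpos2 s - x = dt *\<^sub>R U2"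
    "lpos3 s - x = dt *\<^sub>R ((1 / 4) *\<^sub>R (U2 + U3))"
    by (subst pos(3), simp, subst pos(1), simp, subst pos(2), simp)
  have "norm ((1 / 4) *\<^sub>R (U2 + U3)) \<le> ?W"
    using norm_triangle_ineq[of U2 U3] U W0 by simp
  then have "norm (dt *\<^sub>R ((1 / 4) *\<^sub>R (U2 + U3))) \<le> dt * ?W" by (rule dtW)
  moreover have "norm ((1 / 6) *\<^sub>R (U2 + U3 + 4 *\<^sub>R U4)) \<le> ?W"
    using norm_triangle_ineq[of "U2 + U3" "4 *\<^sub>R U4"] norm_triangle_ineq[of U2 U3] U by simp
  then have "norm (dt *\<^sub>R ((1 / 6) *\<^sub>R (U2 + U3 + 4 *\<^sub>R U4))) \<le> dt * ?W" by (rule dtW)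
  moreover have "norm (dt *\<^sub>R U2) \<le> dt * ?W" by (rule dtW[OF U(1)])
  ultimately show "norm (x' - x) \<le> dt * ?W \<and> norm (lpos2 s - x) \<le> dt * ?W \<and> norm (lpos3 s - x) \<le> dt * ?W"
    unfolding d by blast
qed

end

lemma norm_triple_le: "norm (x, e, v) \<le> norm x + \<bar>e\<bar> + \<bar>v :: real\<bar>" for e :: real
  using norm_Pair_le[of x "(e, v)"] norm_Pair_le[of e v] by simp

text \<open>The numerical and the exact solution stay in a common ball, whose radius depends on the
  data and on \<open>\<epsilon>\<close>, \<open>R\<close> but not on the time step; there \<open>global_error\<close> applies.\<close>

theorem (in bounded_data) third_order:
  assumes E: "C_k_on 3 (closed_slab T) E" and b: "C_k_on 4 (closed_slab T) b"
    and g: "\<forall>t\<in>{0..T}. \<forall>x. g_field T E b t x = drift_rate E b (t, x)" and \<epsilon>: "0 < \<epsilon>"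
  shows "\<exists>C. \<forall>dt>0. \<forall>xs es vs ls X Y V.
        (\<forall>n<N_steps T dt. L_step_upto 0 T E b \<epsilon> dt (real n * dt)
           (xs n, es n, vs n) (ls n) (xs (Suc n), es (Suc n), vs (Suc n))) \<and>
        characteristic_curve T E b \<epsilon> X Y V \<and>
        xs 0 = X 0 \<and> es 0 = Y 0 \<and> vs 0 = V 0 \<and>
        norm (X 0) \<le> R \<and> \<bar>Y 0\<bar> \<le> R \<and> \<bar>V 0\<bar> \<le> R \<longrightarrow>
        (\<forall>n\<le>N_steps T dt. norm (xs n - X (real n * dt)) \<le> C * dt ^ 3 \<and>
           \<bar>es n - Y (real n * dt)\<bar> \<le> C * dt ^ 3 \<and> \<bar>vs n - V (real n * dt)\<bar> \<le> C * dt ^ 3)"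
proof -
  define F where "F = drift_field E b \<epsilon>"
  have F: "C_k_on 3 ({0..T} \<times> UNIV) F"
    unfolding F_def
  proof (rule C_k_on_drift_field[OF E])
    have "Suc 3 = 4" by simp
    with b show "C_k_on (Suc 3) (closed_slab T) b" by (simp only:)
    show "b p \<noteq> 0" if "p \<in> closed_slab T" for p using b_gt[OF that] b0 by simp
  qed
  define r where "r = \<bar>R\<bar>"
  define q where "q = \<epsilon> * rate_bound"
  define \<kappa> where "\<kappa> = q * (1 + T * q)\<^sup>2"
  define vm where "vm = r + T * M + T * M"
  define em where "em = r * exp (\<kappa> * T) * (1 + T * q)\<^sup>2"
  define W where "W = speed_bound \<epsilon> em vm"
  define \<rho> where "\<rho> = (r + T * W + T * W) + em + vm"
  have r0: "0 \<le> r" by (simp add: r_def)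
  have q0: "0 \<le> q" using \<epsilon> rate_bound_nonneg by (simp add: q_def)
  have Tq: "1 \<le> (1 + T * q)\<^sup>2" using q0 T by (simp add: one_le_power)
  have \<kappa>: "q \<le> \<kappa>" "0 \<le> \<kappa>" using q0 mult_left_mono[OF Tq q0] by (simp_all add: \<kappa>_def)
  have em_r: "r * exp (\<kappa> * T) \<le> em"
    using mult_left_mono[OF Tq, of "r * exp (\<kappa> * T)"] r0 by (simp add: em_def)
  have em0: "0 \<le> em" by (rule order_trans[OF _ em_r]) (simp add: r0)
  have TM: "0 \<le> T * M" using T M0 by simp
  have vm0: "r + T * M \<le> vm" "0 \<le> vm" unfolding vm_def using r0 TM by linarith+
  have W0: "0 \<le> W"
    unfolding W_def speed_bound_def using vm0 em0 L0 M0 b0 \<epsilon> by simp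
  have TW: "0 \<le> T * W" using T W0 by simp
  obtain Lc where Lc: "\<And>y. (\<And>t. t \<in> {0..T} \<Longrightarrow> (y has_vector_derivative F (t, y t)) (at t within {0..T})) \<Longrightarrow>
      (\<And>t. t \<in> {0..T} \<Longrightarrow> y t \<in> cball 0 \<rho>) \<Longrightarrow>
      \<exists>A u1 u2 u3. exact_solution (\<lambda>t z. F (t, z)) parallel_part (cball 0 \<rho>) A y (\<lambda>t. F (t, y t)) u1 u2 u3 T Lc"
    by (rule exact_solution_exists[OF F parallel_part_linear norm_parallel_part_le, of \<rho>]) blast
  define C where "C = exp (160 * Lc ^ 3 * T) + Lc ^ 4"
  have in_ball: "(x, e, v) \<in> cball 0 \<rho>" if "norm x \<le> r + T * W + T * W" "\<bar>e\<bar> \<le> em" "\<bar>v\<bar> \<le> vm" for x :: vec3 and e v :: real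
    using norm_triple_le[of x e v] that by (simp add: \<rho>_def)
  show ?thesis
  proof (intro exI[of _ C] allI impI, elim conjE)
    fix dt :: real and xs :: "nat \<Rightarrow> vec3" and es vs :: "nat \<Rightarrow> real" and ls X and Y V :: "real \<Rightarrow> real" and n
    assume dt: "0 < dt" and n: "n \<le> N_steps T dt"
      and steps: "\<forall>n<N_steps T dt. L_step_upto 0 T E b \<epsilon> dt (real n * dt)
           (xs n, es n, vs n) (ls n) (xs (Suc n), es (Suc n), vs (Suc n))"
      and curve: "characteristic_curve T E b \<epsilon> X Y V"
      and ini: "xs 0 = X 0" "es 0 = Y 0" "vs 0 = V 0"
      and R: "norm (X 0) \<le> R" "\<bar>Y 0\<bar> \<le> R" "\<bar>V 0\<bar> \<le> R"
    define N where "N = N_steps T dt"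
    have rR: "norm (X 0) \<le> r" "\<bar>Y 0\<bar> \<le> r" "\<bar>V 0\<bar> \<le> r" using R by (simp_all add: r_def)
    have time: "real k * dt \<le> T" if "k \<le> N" for k using N_steps_le[OF dt T] that by (simp add: N_def)
    have tstep: "0 \<le> real k * dt" "real k * dt + dt \<le> T" if "k < N" for k
      using time[of "Suc k"] that dt by (auto simp: algebra_simps)
    have dtT: "dt \<le> T" if "k < N" for k using tstep[OF that] by linarith
    define y where "y t = (X t, Y t, V t)" for t
    have dy: "(y has_vector_derivative F (t, y t)) (at t within {0..T})" if t: "t \<in> {0..T}" for t
    proof -
      have "(X has_vector_derivative U_gc E b \<epsilon> t (X t) (Y t) (V t)) (at t within {0..T})"
        "(Y has_vector_derivative \<epsilon> * (Y t * drift_rate E b (t, X t))) (at t within {0..T})"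
        "(V has_vector_derivative E (t, X t) $ 3) (at t within {0..T})"
        using bspec[OF curve[unfolded characteristic_curve_def] t] g t
        by (simp_all add: mult_ac flip: has_real_derivative_iff_has_vector_derivative)
      then show ?thesis
        unfolding y_def[abs_def] F_def drift_field_def prod.case
        by (intro has_vector_derivative_Pair)
    qed
    have yK: "y t \<in> cball 0 \<rho>" if t: "t \<in> {0..T}" for t
    proof -
      have c: "\<bar>V t\<bar> \<le> r + T * M" "\<bar>Y t\<bar> \<le> r * exp (q * T)"
        "norm (X t) \<le> r + T * speed_bound \<epsilon> (r * exp (q * T)) (r + T * M)"
        using characteristic_bounds[OF \<epsilon> curve g t rR] by (simp_all add: q_def)
      have "r * exp (q * T) \<le> r * exp (\<kappa> * T)" using \<kappa>(1) T r0 by (intro mult_left_mono) auto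
      with em_r have e: "r * exp (q * T) \<le> em" by linarith
      have "speed_bound \<epsilon> (r * exp (q * T)) (r + T * M) \<le> W"
        unfolding W_def speed_bound_def using vm0 e \<epsilon> L0
        by (intro add_mono mult_left_mono divide_right_mono mult_right_mono order_refl) auto
      then have "T * speed_bound \<epsilon> (r * exp (q * T)) (r + T * M) \<le> T * W" using T by simp
      then show ?thesis
        unfolding y_def using c e vm0 TW by (intro in_ball) linarith+
    qed
    define z where "z k = (xs k, es k, vs k)" for k
    note grow = L_step_growth[OF \<epsilon> dt tstep g, folded q_def, folded \<kappa>_def]
    have st: "L_step_upto 0 T E b \<epsilon> dt (real k * dt) (xs k, es k, vs k) (ls k) (xs (Suc k), es (Suc k), vs (Suc k))"
      if "k < N" for k using steps that by (simp add: N_def)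
    have v_le: "\<bar>vs k\<bar> \<le> r + real k * dt * M" if "k \<le> N" for k
      using that
    proof (induction k)
      case (Suc k)
      then have k: "k < N" by simp
      show ?case using grow(1)[OF k k st[OF k]] Suc by (simp add: algebra_simps)
    qed (simp add: ini rR)
    have v_le': "\<bar>vs k\<bar> \<le> r + T * M" if "k \<le> N" for k
      using v_le[OF that] mult_right_mono[OF time[OF that] M0] by linarith
    have e_le: "\<bar>es k\<bar> \<le> r * (1 + dt * \<kappa>) ^ k" if "k \<le> N" for k
      using that
    proof (induction k)
      case (Suc k)
      then have k: "k < N" by simp
      have "\<bar>es (Suc k)\<bar> \<le> \<bar>es k\<bar> * (1 + dt * \<kappa>)" by (rule grow(4)[OF k k st[OF k]])
      also have "\<dots> \<le> r * (1 + dt * \<kappa>) ^ k * (1 + dt * \<kappa>)"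
        using Suc dt \<kappa> by (intro mult_right_mono) auto
      finally show ?case by (simp add: mult_ac)
    qed (simp add: ini rR)
    have e_le': "\<bar>es k\<bar> \<le> r * exp (\<kappa> * T)" if k: "k \<le> N" for k
    proof -
      have "(1 + dt * \<kappa>) ^ k \<le> exp (dt * \<kappa>) ^ k"
        using dt \<kappa> by (intro power_mono exp_ge_add_one_self) simp
      also have "\<dots> = exp (\<kappa> * (real k * dt))" by (simp add: mult_ac flip: exp_of_nat_mult)
      also have "\<dots> \<le> exp (\<kappa> * T)" using mult_left_mono[OF time[OF k] \<kappa>(2)] by simp
      finally have "r * (1 + dt * \<kappa>) ^ k \<le> r * exp (\<kappa> * T)" using r0 by (intro mult_left_mono)
      with e_le[OF k] show ?thesis by linarith
    qed
    have ve: "\<bar>vs k\<bar> + dt * M \<le> vm" "\<bar>es k\<bar> * (1 + T * q)\<^sup>2 \<le> em" if k: "k < N" for k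
    proof -
      have "dt * M \<le> T * M" using dtT[OF k] M0 by (intro mult_right_mono)
      then show "\<bar>vs k\<bar> + dt * M \<le> vm" unfolding vm_def using v_le'[of k] k by linarith
      show "\<bar>es k\<bar> * (1 + T * q)\<^sup>2 \<le> em"
        unfolding em_def using e_le'[of k] k by (intro mult_right_mono) auto
    qed
    have pos: "norm (xs (Suc k) - xs k) \<le> dt * W" "norm (lpos2 (ls k) - xs k) \<le> dt * W" "norm (lpos3 (ls k) - xs k) \<le> dt * W"
      if k: "k < N" for k
      using grow(7)[OF k k st[OF k] ve[OF k]] by (simp_all add: W_def)
    have x_le: "norm (xs k) \<le> r + real k * dt * W" if "k \<le> N" for k
      using that
    proof (induction k)
      case (Suc k)
      then have k: "k < N" by simp
      have "norm (xs (Suc k)) \<le> norm (xs k) + norm (xs (Suc k) - xs k)"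
        using norm_triangle_ineq[of "xs k" "xs (Suc k) - xs k"] by simp
      then show ?case using pos(1)[OF k] Suc by (simp add: algebra_simps)
    qed (simp add: ini rR)
    have x_le': "norm (xs k) \<le> r + T * W" if "k \<le> N" for k
      using x_le[OF that] mult_right_mono[OF time[OF that] W0] by linarith
    have zK: "z k \<in> cball 0 \<rho>" if k: "k \<le> N" for k
      unfolding z_def using x_le'[OF k] e_le'[OF k] v_le'[OF k] vm0 em_r TW by (intro in_ball) linarith+
    have stage: "norm p \<le> r + T * W + T * W" if k: "k < N" and p: "norm (p - xs k) \<le> dt * W" for p k
    proof -
      have "dt * W \<le> T * W" using dtT[OF k] W0 by (intro mult_right_mono)
      then show ?thesis using p norm_triangle_ineq[of "p - xs k" "xs k"] x_le'[of k] k by simp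
    qed
    obtain A u1 u2 u3 where "exact_solution (\<lambda>t z. F (t, z)) parallel_part (cball 0 \<rho>) A y (\<lambda>t. F (t, y t)) u1 u2 u3 T Lc"
      using Lc[OF dy yK] by blast
    then interpret exact_solution "\<lambda>t z. F (t, z)" parallel_part "cball 0 \<rho>" A y "\<lambda>t. F (t, y t)" u1 u2 u3 T Lc .
    have "norm (z n - y (real n * dt)) \<le> C * dt ^ 3"
      unfolding C_def
    proof (rule global_error[OF dt time])
      show "z 0 = y 0" by (simp add: z_def y_def ini)
      show "n \<le> N" using n by (simp add: N_def)
      fix k assume k: "k < N"
      define Z2 Z3 where "Z2 = (lpos2 (ls k), len2 (ls k), vpar3 (ls k))" and "Z3 = (lpos3 (ls k), len3 (ls k), vpar4 (ls k))"
      have "Z2 \<in> cball 0 \<rho>"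
        unfolding Z2_def
        using stage[OF k pos(2)[OF k]] order_trans[OF grow(5)[OF k k st[OF k]] ve(2)[OF k]]
          order_trans[OF grow(2)[OF k k st[OF k]] ve(1)[OF k]] by (rule in_ball)
      moreover have "Z3 \<in> cball 0 \<rho>"
        unfolding Z3_def
        using stage[OF k pos(3)[OF k]] order_trans[OF grow(6)[OF k k st[OF k]] ve(2)[OF k]]
          order_trans[OF grow(3)[OF k k st[OF k]] ve(1)[OF k]] by (rule in_ball)
      moreover note L_step_Runge_Kutta[OF dt st[OF k] g tstep[OF k], folded F_def, folded z_def Z2_def Z3_def]
      ultimately show "\<exists>Z2\<in>cball 0 \<rho>. \<exists>Z3\<in>cball 0 \<rho>. let t = real k * dt in
        Z2 = z k + dt *\<^sub>R (F (t, z k) + \<alpha> *\<^sub>R parallel_part (F (t + dt, Z2) - F (t, z k))) \<and>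
        Z3 = z k + dt *\<^sub>R ((1 / 4) *\<^sub>R (F (t, z k) + F (t + dt, Z2))
          + parallel_part ((\<beta> + \<eta> - 1 / 4) *\<^sub>R F (t, z k) + (\<gamma> - 1 / 4) *\<^sub>R F (t + dt, Z2) + \<alpha> *\<^sub>R F (t + dt / 2, Z3))) \<and>
        z (Suc k) = z k + (dt / 6) *\<^sub>R (F (t, z k) + F (t + dt, Z2) + 4 *\<^sub>R F (t + dt / 2, Z3))"
        unfolding Let_def by blast
    qed (assumption | erule zK)+
    moreover have "norm (fst w) \<le> norm w" "\<bar>fst (snd w)\<bar> \<le> norm w" "\<bar>snd (snd w)\<bar> \<le> norm w" for w :: "vec3 \<times> real \<times> real"
      using norm_fst_le[of "fst w" "snd w"] norm_snd_le[of "snd w" "fst w"]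
        norm_fst_le[of "fst (snd w)" "snd (snd w)"] norm_snd_le[of "snd (snd w)" "fst (snd w)"] by auto
    from this[of "z n - y (real n * dt)"]
    have "norm (xs n - X (real n * dt)) \<le> norm (z n - y (real n * dt))"
      "\<bar>es n - Y (real n * dt)\<bar> \<le> norm (z n - y (real n * dt))"
      "\<bar>vs n - V (real n * dt)\<bar> \<le> norm (z n - y (real n * dt))"
      by (simp_all add: z_def y_def)
    ultimately show "norm (xs n - X (real n * dt)) \<le> C * dt ^ 3 \<and>
           \<bar>es n - Y (real n * dt)\<bar> \<le> C * dt ^ 3 \<and> \<bar>vs n - V (real n * dt)\<bar> \<le> C * dt ^ 3"
      by linarith
  qed
qed

section \<open>Boundedness, consistency and order of the scheme\<close>

theorem proposition3p4:
  fixes T b0 :: real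
    and \<phi> b :: "spacetime \<Rightarrow> real" and E :: "spacetime \<Rightarrow> vec3" and chi :: "real \<times> vec3 \<Rightarrow> real"
    and x0 v0 :: "real \<Rightarrow> vec3" and e0 :: "real \<Rightarrow> real"
    and x v :: "real \<Rightarrow> real \<Rightarrow> nat \<Rightarrow> vec3" and e :: "real \<Rightarrow> real \<Rightarrow> nat \<Rightarrow> real"
    and s :: "real \<Rightarrow> real \<Rightarrow> nat \<Rightarrow> S_stages"
  assumes T: "0 < T"
    and E: "electric_field T \<phi> E"
    and b: "magnetic_intensity T b0 b"
    and chi_adm: "admissible_chi chi"
    and initial_bounded:
      "\<exists>R. \<forall>\<epsilon>>0. norm (x0 \<epsilon>) \<le> R \<and> norm (v0 \<epsilon>) \<le> R \<and> \<bar>e0 \<epsilon>\<bar> \<le> R"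
    and initial: "\<And>dt \<epsilon>. 0 < dt \<Longrightarrow> 0 < \<epsilon> \<Longrightarrow>
      x dt \<epsilon> 0 = x0 \<epsilon> \<and> v dt \<epsilon> 0 = v0 \<epsilon> \<and> e dt \<epsilon> 0 = e0 \<epsilon>"
    and scheme: "\<And>dt \<epsilon> n. 0 < dt \<Longrightarrow> 0 < \<epsilon> \<Longrightarrow> n < N_steps T dt \<Longrightarrow>
      S_step E b chi \<epsilon> dt (real n * dt) (x dt \<epsilon> n, v dt \<epsilon> n, e dt \<epsilon> n) (s dt \<epsilon> n)
        (x dt \<epsilon> (Suc n), v dt \<epsilon> (Suc n), e dt \<epsilon> (Suc n))"
  shows
    "(\<exists>C. \<forall>dt>0. \<forall>\<epsilon>>0. \<forall>n\<le>N_steps T dt.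
        norm (x dt \<epsilon> n) \<le> C \<and> norm (v dt \<epsilon> n) \<le> C \<and> \<bar>e dt \<epsilon> n\<bar> \<le> C)
     \<and>
     ((\<forall>\<epsilon>>0. 0 \<le> e0 \<epsilon>) \<or> (\<forall>y. chi (y, 0) = y) \<longrightarrow>
      (\<forall>dt>0. \<exists>C. \<forall>\<epsilon>>0. \<forall>n. 1 \<le> n \<and> n < N_steps T dt \<longrightarrow>
        L_step_upto (C * \<epsilon>\<^sup>2) T E b \<epsilon> dt (real n * dt)
          (x dt \<epsilon> n, e dt \<epsilon> n, v dt \<epsilon> n $ 3) (L_part (s dt \<epsilon> n))
          (x dt \<epsilon> (Suc n), e dt \<epsilon> (Suc n), v dt \<epsilon> (Suc n) $ 3)))
     \<and>
     (C_k_on 3 (closed_slab T) E \<and> C_k_on 4 (closed_slab T) b \<longrightarrow>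
      (\<forall>\<epsilon>>0. \<forall>R. \<exists>C. \<forall>dt>0. \<forall>xs es vs ls X Y V.
        (\<forall>n<N_steps T dt. L_step_upto 0 T E b \<epsilon> dt (real n * dt)
           (xs n, es n, vs n) (ls n) (xs (Suc n), es (Suc n), vs (Suc n))) \<and>
        characteristic_curve T E b \<epsilon> X Y V \<and>
        xs 0 = X 0 \<and> es 0 = Y 0 \<and> vs 0 = V 0 \<and>
        norm (X 0) \<le> R \<and> \<bar>Y 0\<bar> \<le> R \<and> \<bar>V 0\<bar> \<le> R \<longrightarrow>
        (\<forall>n\<le>N_steps T dt. norm (xs n - X (real n * dt)) \<le> C * dt ^ 3 \<and>
           \<bar>es n - Y (real n * dt)\<bar> \<le> C * dt ^ 3 \<and> \<bar>vs n - V (real n * dt)\<bar> \<le> C * dt ^ 3)))"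
  proof (intro conjI impI)
  obtain M L where "bounded_data T b0 M L E b chi"
    by (rule bounded_data_exists[OF T E b chi_adm]) (rule that)
  then interpret bounded_data T b0 M L E b chi .
  obtain R where R: "\<And>\<epsilon>. 0 < \<epsilon> \<Longrightarrow> norm (x0 \<epsilon>) \<le> R \<and> norm (v0 \<epsilon>) \<le> R \<and> \<bar>e0 \<epsilon>\<bar> \<le> R"
    using initial_bounded by blast
  note g = drift_divergence[OF T E b]
  show "\<exists>C. \<forall>dt>0. \<forall>\<epsilon>>0. \<forall>n\<le>N_steps T dt.
      norm (x dt \<epsilon> n) \<le> C \<and> norm (v dt \<epsilon> n) \<le> C \<and> \<bar>e dt \<epsilon> n\<bar> \<le> C"
    by (rule uniform_bounds[OF R initial scheme])
  show "\<forall>dt>0. \<exists>C. \<forall>\<epsilon>>0. \<forall>n. 1 \<le> n \<and> n < N_steps T dt \<longrightarrow>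
      L_step_upto (C * \<epsilon>\<^sup>2) T E b \<epsilon> dt (real n * dt)
        (x dt \<epsilon> n, e dt \<epsilon> n, v dt \<epsilon> n $ 3) (L_part (s dt \<epsilon> n))
        (x dt \<epsilon> (Suc n), e dt \<epsilon> (Suc n), v dt \<epsilon> (Suc n) $ 3)"
    if "(\<forall>\<epsilon>>0. 0 \<le> e0 \<epsilon>) \<or> (\<forall>y. chi (y, 0) = y)"
    using consistency[OF R initial scheme chi_adm g that] by blast
  assume smooth: "C_k_on 3 (closed_slab T) E \<and> C_k_on 4 (closed_slab T) b"
  have "\<forall>t\<in>{0..T}. \<forall>x. g_field T E b t x = drift_rate E b (t, x)"
    using g by (simp add: drift_rate_def)
  from third_order[OF conjunct1[OF smooth] conjunct2[OF smooth] this]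
  show "\<forall>\<epsilon>>0. \<forall>R. \<exists>C. \<forall>dt>0. \<forall>xs es vs ls X Y V.
      (\<forall>n<N_steps T dt. L_step_upto 0 T E b \<epsilon> dt (real n * dt)
         (xs n, es n, vs n) (ls n) (xs (Suc n), es (Suc n), vs (Suc n))) \<and>
      characteristic_curve T E b \<epsilon> X Y V \<and>
      xs 0 = X 0 \<and> es 0 = Y 0 \<and> vs 0 = V 0 \<and>
      norm (X 0) \<le> R \<and> \<bar>Y 0\<bar> \<le> R \<and> \<bar>V 0\<bar> \<le> R \<longrightarrow>
      (\<forall>n\<le>N_steps T dt. norm (xs n - X (real n * dt)) \<le> C * dt ^ 3 \<and>
         \<bar>es n - Y (real n * dt)\<bar> \<le> C * dt ^ 3 \<and> \<bar>vs n - V (real n * dt)\<bar> \<le> C * dt ^ 3)"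
    by blast
qed

end
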